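(* Suppose that the plant (P) satisfies assumption (A) and that assumption (B) holds (see context). Let $\theta\ge 1$ be any constant and let $l,m\ge 1$ be any integers with $m>(nL+1)(r+\tau)$ such that, with $T=(r+\tau)/m$, $$4|Qp|(L+\theta)T_1\sqrt{|Q|/a}<q,\qquad \theta\ge\max\left(1,\,2|Q|L\sqrt n/q\right),$$ $$\left((nL+1+|k|)\sqrt{\frac{e_n'Pe_n}{2K_1}}+\mu\right)|k|\left(T_2+K\,\frac{((nL+1)T)^{l+1}}{1-(nL+1)T}\right)<\mu .$$ Then there exist constants $\sigma>0$, $\Theta_i>0$ ($i=1,\dots,6$) and a non-decreasing function $M\in C^0(\mathbb R_+;\mathbb R_+)$ such that for every $x_0\in C^0([-r,0];\mathbb R^n)$, $u_0\in L^\infty([-r-\tau,0);\mathbb R)$, $(z_0,w_0)\in\mathbb R^n\times\mathbb R$ and $(\xi,b,d)\in L^\infty_{loc}(\mathbb R_+;\mathbb R\times\mathbb R_+\times\mathbb R^n)$, the solution $(T_r(t)x,\breve T_{r+\tau}(t)u,z(t),w(t))$ of the closed-loop system (P), (O), (F) with initial condition $\breve T_{r+\tau}(0)u=u_0$, $T_r(0)x=x_0$, $(z(0),w(0))=(z_0,w_0)$ and corresponding to the inputs $(\xi,b,d)$ satisfies for all $t\ge 0$: $$\begin{aligned}|z(t)|+|w(t)|+\|T_r(t)x\|_r+\|\breve T_{r+\tau}(t)u\|_{r+\tau}\le{}& e^{-\sigma t}M\Big(\sup_{0\le s\le jT_2+\tau}b(s)\Big)\big(\Theta_1|z_0|+\Theta_2|w_0|+\Theta_3\|x_0\|_r+\Theta_4\|u_0\|_{r+\tau}\big)\\&+M\Big(\sup_{0\le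 s\le jT_2+\tau}b(s)\Big)\Theta_5\sup_{0\le s\le t}\big(e^{-\sigma(t-s)}|\xi(s)|\big)\\&+M\Big(\sup_{0\le s\le jT_2+\tau}b(s)\Big)\Theta_6\sup_{0\le s\le t}\big(e^{-\sigma(t-s)}|d(s)|\big),\end{aligned}$$ where $j=\min\{i\in\mathbb Z^+: iT_2\ge r+T_1\}$.
   Context: Notation. $\mathbb R_+=[0,\infty)$, $\mathbb Z^+=\{0,1,2,\dots\}$; $|\cdot|$ is the Euclidean norm of vectors and the induced norm of matrices; $'$ denotes transpose. $L^\infty(I;U)$ (resp. $L^\infty_{loc}(I;U)$) is the space of measurable and bounded (resp. locally bounded) functions on the interval $I$ with values in $U$; functions differing on null sets are not identified, and suprema are actual suprema (not essential). For a function $x$, $(T_r(t)x)(s)=x(t+s)$ for $s\in[-r,0]$ and $(\breve T_r(t)x)(s)=x(t+s)$ for $s\in[-r,0)$; $\|x\|_r$ denotes $\sup|x(s)|$ over $[-r,0]$ or $[-r,0)$, respectively. For $r=0$, $C^0([-r,0];\mathbb R^n)=\mathbb R^n$. $e_n=(0,\dots,0,1)'\in\mathbb R^n$, $c=(1,0,\dots,0)'\in\mathbb R^n$, $A\in\mathbb R^{n\times n}$ has entries $a_{i,i+1}=1$ for $i=1,\dots,n-1$ and all other entries $0$. Delays: $\tau\ge0$ (input), $r\ge0$ (measurement), $r+\tau>0$. Plant (P): $\dot x_i(t)=f_i(x_1(t),\dots,x_i(t))+x_{i+1}(t)+g_i(x(t),u(t))d_i(t)$ for $i=1,\dots,n-1$,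 and $\dot x_n(t)=f_n(x(t))+g_n(x(t),u(t))d_n(t)+u(t-\tau)$, for $t\geq 0$ a.e., where $x(t)\in\mathbb R^n$, $u(t)\in\mathbb R$, $d(t)\in\mathbb R^n$, $f_i:\mathbb R^i\to\mathbb R$, and $g_i:\mathbb R^n\times\mathbb R\to\mathbb R$ are locally Lipschitz. Put $f(x)=(f_1(x_1),f_2(x_1,x_2),\dots,f_n(x))'$. Assumption (A): there are constants $L\ge0$, $G\ge0$ with $|f_i(x_1,\dots,x_i)-f_i(z_1,\dots,z_i)|\le L|(x_1-z_1,\dots,x_i-z_i)|$ and $|g_i(x,u)|\le G$ for all arguments and all $i=1,\dots,n$; moreover $f_i(0)=0$ for all $i$. Assumption (B): $Q\in\mathbb R^{n\times n}$ is symmetric positive definite with $Q(A+pc')+(A'+cp')Q+2qI\le0$ for a constant $q>0$ and a vector $p=(p_1,\dots,p_n)'\in\mathbb R^n$. $P\in\mathbb R^{n\times n}$ is symmetric positive definite and satisfies, for constants $\mu,\gamma>0$ and a vector $k\in\mathbb R^n$, $x'P(A+e_nk')x+x'Pf(x)+x'P\,\mathrm{diag}(g_1(x,u),\dots,g_n(x,u))d\le-2\mu x'Px+\gamma|d|^2$ for all $(x,d,u)\in\mathbb R^n\times\mathbb R^n\times\mathbb R$. The constants $a,K_1>0$ satisfy $a|x|^2\le x'Qx$ and $K_1|x|^2\le x'Px$ for all $x\in\mathbb R^n$. The upper diameter of the sampling partition $T_1>0$ and the holding period $T_2>0$ satisfy $4|Qp|\left(L+\max(1,2|Q|L\sqrt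 n/q)\right)T_1\sqrt{|Q|/a}<q$ and $\left((nL+1+|k|)\sqrt{e_n'Pe_n/(2K_1)}+\mu\right)|k|T_2<\mu$. Observer (O), with gain parameter $\theta\ge1$, states $(z(t),w(t))\in\mathbb R^n\times\mathbb R$, inputs $b:\mathbb R_+\to\mathbb R_+$ (perturbation of the sampling schedule) and $\xi:\mathbb R_+\to\mathbb R$ (measurement error): sampling times $\tau_0=0$, $\tau_{i+1}=\tau_i+T_1\exp(-b(\tau_i))$; $\dot z_i(t)=f_i(z_1(t),\dots,z_i(t))+z_{i+1}(t)+\theta^ip_i(c'z(t)-w(t))$ for $i=1,\dots,n-1$; $\dot z_n(t)=f_n(z(t))+\theta^np_n(c'z(t)-w(t))+u(t-r-\tau)$; $\dot w(t)=f_1(z_1(t))+z_2(t)$ for $t\in[\tau_i,\tau_{i+1})$; $w(\tau_{i+1})=x_1(\tau_{i+1}-r)+\xi(\tau_{i+1})$. Approximate predictor. For $S>0$ and $v\in L^\infty([0,S);\mathbb R)$ let $P_{S,v}:C^0([0,S];\mathbb R^n)\to C^0([0,S];\mathbb R^n)$, $(P_{S,v}y)(t)=y(0)+\int_0^t\left(f(y(s))+Ay(s)+e_nv(s)\right)ds$. For $x\in\mathbb R^n$ and integer $l\ge1$ let $Q^l_{S,v}x=(P_{S,v}^l\bar x)(S)$, where $\bar x$ is the constant function $x$ and $P^l_{S,v}$ is the $l$-fold composition. For integers $l,m\ge1$, $T=(r+\tau)/m$, $v\in L^\infty([0,r+\tau);\mathbb R)$, put $P^v_{l,m}x=Q^l_{T,v_m}\cdots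 Q^l_{T,v_1}x$ with $v_i(s)=v(s+(i-1)T)$, $s\in[0,T)$. For $u\in L^\infty([-r-\tau,0);\mathbb R)$, put $\Phi_{l,m}(x,u)=P^{v}_{l,m}x$ with $v(s)=u(s-r-\tau)$, $s\in[0,r+\tau)$. Constant $K$: for $m$ with $(nL+1)T<1$, $K=K(m)>0$ is a constant, independent of $l$, such that for all integers $l\ge1$, all $v\in L^\infty([0,r+\tau);\mathbb R)$ and $x\in\mathbb R^n$, $|P^v_{l,m}x-\phi(r+\tau,x;v)|\le K\frac{((nL+1)T)^{l+1}}{1-(nL+1)T}\left(|x|+\sup_{0\le s<r+\tau}|v(s)|\right)$, where $\phi(t,x;v)$ is the solution at time $t$ of $\dot y=f(y)+Ay+e_nv(t)$, $y(0)=x$ (such a $K$ exists). Feedback (F): $u(t)=k'\Phi_{l,m}\left(z(iT_2),\breve T_{r+\tau}(iT_2)u\right)$ for $t\in[iT_2,(i+1)T_2)$, $i\in\mathbb Z^+$. *)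

theory Defs
  imports "HOL-Analysis.Analysis"
begin

section \<open>Finite linear orders as index sets\<close>

text \<open>
  The indices \<open>1, \<dots>, n\<close> are the elements, in increasing order, of an arbitrary finite linearly
  ordered type; \<open>pos i\<close> is the number of the index \<open>i\<close>.
\<close>

type_synonym 'n rvec = "(real, 'n) vec"
type_synonym 'n rmat = "((real, 'n) vec, 'n) vec"

definition pos :: "'n::{finite,linorder} \<Rightarrow> nat"
  where "pos i = card {..i}"

definition fst_idx :: "'n::{finite,linorder}"
  where "fst_idx = Min UNIV"

definition last_idx :: "'n::{finite,linorder}"
  where "last_idx = Max UNIV"

definition cvec :: "'n::{finite,linorder} rvec"
  where "cvec = axis fst_idx 1"

definition evec :: "'n::{finite,linorder} rvec"
  where "evec = axis last_idx 1"

definition shiftA :: "'n::{finite,linorder} rmat"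
  where "shiftA = (\<chi> i j. if pos j = pos i + 1 then 1 else 0)"

text \<open>
  \<open>next_comp y v i\<close> is the component of \<open>y\<close> following \<open>y $ i\<close>, where the scalar \<open>v\<close> stands in
  for the missing component of number \<open>n + 1\<close>.
\<close>

definition next_comp :: "'n::{finite,linorder} rvec \<Rightarrow> real \<Rightarrow> 'n \<Rightarrow> real"
  where "next_comp y v i = (if i = last_idx then v else y $ Min {i<..})"


section \<open>Matrices\<close>

definition outer :: "real ^ 'n \<Rightarrow> real ^ 'm \<Rightarrow> real ^ 'm ^ 'n"
  where "outer x y = (\<chi> i j. x $ i * y $ j)"

definition diag :: "real ^ 'n \<Rightarrow> real ^ 'n ^ 'n"
  where "diag x = (\<chi> i j. if i = j then x $ i else 0)"

definition matnorm :: "real ^ 'n ^ 'm \<Rightarrow> real"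
  where "matnorm M = onorm ((*v) M)"

definition sym_pos_def :: "real ^ 'n ^ 'n \<Rightarrow> bool"
  where "sym_pos_def M \<longleftrightarrow> transpose M = M \<and> (\<forall>x. x \<noteq> 0 \<longrightarrow> x \<bullet> (M *v x) > 0)"

definition neg_semidef :: "real ^ 'n ^ 'n \<Rightarrow> bool"
  where "neg_semidef M \<longleftrightarrow> transpose M = M \<and> (\<forall>x. x \<bullet> (M *v x) \<le> 0)"


section \<open>Function spaces and histories\<close>

text \<open>
  Functions on an interval are represented by total functions whose values outside the interval
  are irrelevant; functions differing on null sets are not identified.
\<close>

definition Linf :: "real set \<Rightarrow> 'a::euclidean_space set \<Rightarrow> (real \<Rightarrow> 'a) \<Rightarrow> bool"
  where "Linf I U v \<longleftrightarrow> v \<in> borel_measurable (lebesgue_on I) \<and> v ` I \<subseteq> U \<and> bounded (v ` I)"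

definition Linf_loc :: "real set \<Rightarrow> 'a::euclidean_space set \<Rightarrow> (real \<Rightarrow> 'a) \<Rightarrow> bool"
  where "Linf_loc I U v \<longleftrightarrow> v \<in> borel_measurable (lebesgue_on I) \<and> v ` I \<subseteq> U
    \<and> (\<forall>C. compact C \<and> C \<subseteq> I \<longrightarrow> bounded (v ` C))"

definition supnorm :: "real set \<Rightarrow> (real \<Rightarrow> 'a::real_normed_vector) \<Rightarrow> real"
  where "supnorm I h = (SUP s\<in>I. norm (h s))"

definition history :: "real \<Rightarrow> (real \<Rightarrow> 'a) \<Rightarrow> real \<Rightarrow> 'a"
  where "history t h = (\<lambda>s. h (t + s))"

definition loc_lipschitz :: "('a::metric_space \<Rightarrow> 'b::metric_space) \<Rightarrow> bool"
  where "loc_lipschitz h \<longleftrightarrow> (\<forall>x. \<exists>e>0. \<exists>C. C-lipschitz_on (cball x e) h)"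


section \<open>Solutions in the sense of Caratheodory\<close>

definition abs_cont_on :: "real set \<Rightarrow> (real \<Rightarrow> 'a::real_normed_vector) \<Rightarrow> bool"
  where "abs_cont_on I x \<longleftrightarrow>
    (\<forall>\<epsilon>>0. \<exists>\<delta>>0. \<forall>D S. D division_of S \<and> S \<subseteq> I \<and> (\<Sum>J\<in>D. measure lborel J) < \<delta>
       \<longrightarrow> (\<Sum>J\<in>D. norm (x (Sup J) - x (Inf J))) < \<epsilon>)"

text \<open>\<open>rhs\<close> is the right-hand side of the equation, evaluated along the trajectory.\<close>

definition ac_solves :: "real set \<Rightarrow> (real \<Rightarrow> 'a::real_normed_vector) \<Rightarrow> (real \<Rightarrow> 'a) \<Rightarrow> bool"
  where "ac_solves I x rhs \<longleftrightarrow>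
    (\<forall>\<alpha> \<beta>. {\<alpha>..\<beta>} \<subseteq> I \<longrightarrow> abs_cont_on {\<alpha>..\<beta>} x)
    \<and> (AE t in lebesgue. t \<in> I \<longrightarrow> (x has_vector_derivative rhs t) (at t within I))"


section \<open>The plant and the standing assumptions\<close>

text \<open>
  A function \<open>f\<^sub>i\<close> of \<open>(x\<^sub>1, \<dots>, x\<^sub>i)\<close> is represented by a function of the whole vector that
  depends only on the components up to \<open>i\<close>.
\<close>

definition plant_functions ::
  "('n::{finite,linorder} \<Rightarrow> 'n rvec \<Rightarrow> real) \<Rightarrow> ('n \<Rightarrow> 'n rvec \<Rightarrow> real \<Rightarrow> real) \<Rightarrow> bool"
  where "plant_functions f g \<longleftrightarrow>
    (\<forall>i x y. (\<forall>j\<le>i. x $ j = y $ j) \<longrightarrow> f i x = f i y)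
    \<and> (\<forall>i. loc_lipschitz (f i))
    \<and> (\<forall>i. loc_lipschitz (\<lambda>(x, u). g i x u))"

definition fvec :: "('n::finite \<Rightarrow> 'n rvec \<Rightarrow> real) \<Rightarrow> 'n rvec \<Rightarrow> 'n rvec"
  where "fvec f x = (\<chi> i. f i x)"

definition assumption_A ::
  "('n::{finite,linorder} \<Rightarrow> 'n rvec \<Rightarrow> real) \<Rightarrow> ('n \<Rightarrow> 'n rvec \<Rightarrow> real \<Rightarrow> real)
    \<Rightarrow> real \<Rightarrow> real \<Rightarrow> bool"
  where "assumption_A f g L G \<longleftrightarrow> L \<ge> 0 \<and> G \<ge> 0
    \<and> (\<forall>i x z. \<bar>f i x - f i z\<bar> \<le> L * sqrt (\<Sum>j\<le>i. (x $ j - z $ j)\<^sup>2))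
    \<and> (\<forall>i x u. \<bar>g i x u\<bar> \<le> G)
    \<and> (\<forall>i. f i 0 = 0)"

definition assumption_B ::
  "('n::{finite,linorder} \<Rightarrow> 'n rvec \<Rightarrow> real) \<Rightarrow> ('n \<Rightarrow> 'n rvec \<Rightarrow> real \<Rightarrow> real) \<Rightarrow> real
    \<Rightarrow> 'n rmat \<Rightarrow> real \<Rightarrow> 'n rvec
    \<Rightarrow> 'n rmat \<Rightarrow> real \<Rightarrow> real \<Rightarrow> 'n rvec
    \<Rightarrow> real \<Rightarrow> real \<Rightarrow> real \<Rightarrow> real \<Rightarrow> bool"
  where "assumption_B f g L Q q p P \<mu> \<gamma> k a K\<^sub>1 T\<^sub>1 T\<^sub>2 \<longleftrightarrow>
    sym_pos_def Q \<and> q > 0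
    \<and> neg_semidef (Q ** (shiftA + outer p cvec) + (transpose shiftA + outer cvec p) ** Q
        + mat (2 * q))
    \<and> sym_pos_def P \<and> \<mu> > 0 \<and> \<gamma> > 0
    \<and> (\<forall>x d u. x \<bullet> (P *v ((shiftA + outer evec k) *v x)) + x \<bullet> (P *v fvec f x)
          + x \<bullet> (P *v (diag (\<chi> i. g i x u) *v d))
        \<le> - 2 * \<mu> * (x \<bullet> (P *v x)) + \<gamma> * (norm d)\<^sup>2)
    \<and> a > 0 \<and> (\<forall>x. a * (norm x)\<^sup>2 \<le> x \<bullet> (Q *v x))
    \<and> K\<^sub>1 > 0 \<and> (\<forall>x. K\<^sub>1 * (norm x)\<^sup>2 \<le> x \<bullet> (P *v x))
    \<and> T\<^sub>1 > 0 \<and> T\<^sub>2 > 0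
    \<and> 4 * norm (Q *v p) * (L + max 1 (2 * matnorm Q * L * sqrt (real CARD('n)) / q)) * T\<^sub>1
        * sqrt (matnorm Q / a) < q
    \<and> ((real CARD('n) * L + 1 + norm k) * sqrt (evec \<bullet> (P *v evec) / (2 * K\<^sub>1)) + \<mu>)
        * norm k * T\<^sub>2 < \<mu>"


section \<open>The approximate predictor\<close>

definition drift ::
  "('n::{finite,linorder} \<Rightarrow> 'n rvec \<Rightarrow> real) \<Rightarrow> 'n rvec \<Rightarrow> real \<Rightarrow> 'n rvec"
  where "drift f y v = fvec f y + shiftA *v y + v *\<^sub>R evec"

definition picard ::
  "('n::{finite,linorder} \<Rightarrow> 'n rvec \<Rightarrow> real) \<Rightarrow> (real \<Rightarrow> real)
    \<Rightarrow> (real \<Rightarrow> 'n rvec) \<Rightarrow> real \<Rightarrow> 'n rvec"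
  where "picard f v y = (\<lambda>t. y 0 + integral {0..t} (\<lambda>s. drift f (y s) (v s)))"

definition Qpred ::
  "('n::{finite,linorder} \<Rightarrow> 'n rvec \<Rightarrow> real) \<Rightarrow> nat \<Rightarrow> real \<Rightarrow> (real \<Rightarrow> real)
    \<Rightarrow> 'n rvec \<Rightarrow> 'n rvec"
  where "Qpred f l S v x = (picard f v ^^ l) (\<lambda>_. x) S"

text \<open>The list \<open>[1..<Suc m]\<close> is traversed from the left, so the step with \<open>i = 1\<close> acts first.\<close>

definition Ppred ::
  "('n::{finite,linorder} \<Rightarrow> 'n rvec \<Rightarrow> real) \<Rightarrow> real \<Rightarrow> real \<Rightarrow> nat \<Rightarrow> nat \<Rightarrow> (real \<Rightarrow> real)
    \<Rightarrow> 'n rvec \<Rightarrow> 'n rvec"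
  where "Ppred f r \<tau> l m v x =
    (let T = (r + \<tau>) / real m
     in fold (\<lambda>i. Qpred f l T (\<lambda>s. v (s + (real i - 1) * T))) [1..<Suc m] x)"

definition Phi ::
  "('n::{finite,linorder} \<Rightarrow> 'n rvec \<Rightarrow> real) \<Rightarrow> real \<Rightarrow> real \<Rightarrow> nat \<Rightarrow> nat
    \<Rightarrow> 'n rvec \<Rightarrow> (real \<Rightarrow> real) \<Rightarrow> 'n rvec"
  where "Phi f r \<tau> l m x u = Ppred f r \<tau> l m (\<lambda>s. u (s - r - \<tau>)) x"

text \<open>
  The error coefficient and the property defining the constant \<open>K = K(m)\<close>. The function \<open>y\<close>
  below is the solution \<open>\<phi>(\<cdot>, x; v)\<close>, which is unique when \<open>f\<close> is Lipschitz.
\<close>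

definition pred_err :: "real \<Rightarrow> real \<Rightarrow> nat \<Rightarrow> real"
  where "pred_err N T l = (N * T) ^ (l + 1) / (1 - N * T)"

definition predictor_constant ::
  "('n::{finite,linorder} \<Rightarrow> 'n rvec \<Rightarrow> real) \<Rightarrow> real \<Rightarrow> real \<Rightarrow> real \<Rightarrow> nat \<Rightarrow> real \<Rightarrow> bool"
  where "predictor_constant f L r \<tau> m K \<longleftrightarrow> K > 0
    \<and> (\<forall>l\<ge>1. \<forall>v x y. Linf {0..<r + \<tau>} UNIV v
          \<and> ac_solves {0..r + \<tau>} y (\<lambda>t. drift f (y t) (v t)) \<and> y 0 = x
        \<longrightarrow> norm (Ppred f r \<tau> l m v x - y (r + \<tau>))
            \<le> K * pred_err (real CARD('n) * L + 1) ((r + \<tau>) / real m) l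
                * (norm x + supnorm {0..<r + \<tau>} v))"


section \<open>The closed-loop system\<close>

primrec sampling_time :: "real \<Rightarrow> (real \<Rightarrow> real) \<Rightarrow> nat \<Rightarrow> real"
  where
    "sampling_time T\<^sub>1 b 0 = 0"
  | "sampling_time T\<^sub>1 b (Suc i) =
       sampling_time T\<^sub>1 b i + T\<^sub>1 * exp (- b (sampling_time T\<^sub>1 b i))"

definition plant ::
  "('n::{finite,linorder} \<Rightarrow> 'n rvec \<Rightarrow> real) \<Rightarrow> ('n \<Rightarrow> 'n rvec \<Rightarrow> real \<Rightarrow> real) \<Rightarrow> real
    \<Rightarrow> (real \<Rightarrow> 'n rvec) \<Rightarrow> (real \<Rightarrow> 'n rvec) \<Rightarrow> (real \<Rightarrow> real) \<Rightarrow> bool"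
  where "plant f g \<tau> d x u \<longleftrightarrow>
    ac_solves {0..} x
      (\<lambda>t. \<chi> i. f i (x t) + next_comp (x t) (u (t - \<tau>)) i + g i (x t) (u t) * d t $ i)"

text \<open>
  For \<open>n \<ge> 2\<close> the term \<open>next_comp (z t) _ fst_idx\<close> in the equation of \<open>w\<close> is \<open>z\<^sub>2(t)\<close>; for
  \<open>n = 1\<close> the delayed input takes its place, as it does in the equation of \<open>z\<^sub>n\<close>.
\<close>

definition observer ::
  "('n::{finite,linorder} \<Rightarrow> 'n rvec \<Rightarrow> real) \<Rightarrow> real \<Rightarrow> real \<Rightarrow> 'n rvec \<Rightarrow> real \<Rightarrow> real
    \<Rightarrow> (real \<Rightarrow> real) \<Rightarrow> (real \<Rightarrow> real)
    \<Rightarrow> (real \<Rightarrow> 'n rvec) \<Rightarrow> (real \<Rightarrow> real) \<Rightarrow> (real \<Rightarrow> 'n rvec) \<Rightarrow> (real \<Rightarrow> real) \<Rightarrow> bool"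
  where "observer f r \<tau> p \<theta> T\<^sub>1 \<xi> b x u z w \<longleftrightarrow>
    ac_solves {0..} z
      (\<lambda>t. \<chi> i. f i (z t) + next_comp (z t) (u (t - r - \<tau>)) i
              + \<theta> ^ pos i * p $ i * (cvec \<bullet> z t - w t))
    \<and> (\<forall>i. let t\<^sub>1 = sampling_time T\<^sub>1 b i; t\<^sub>2 = sampling_time T\<^sub>1 b (Suc i) in
          ac_solves {t\<^sub>1..<t\<^sub>2} w
            (\<lambda>t. f fst_idx (z t) + next_comp (z t) (u (t - r - \<tau>)) fst_idx)
          \<and> w t\<^sub>2 = x (t\<^sub>2 - r) $ fst_idx + \<xi> t\<^sub>2)"

definition feedback ::
  "('n::{finite,linorder} \<Rightarrow> 'n rvec \<Rightarrow> real) \<Rightarrow> real \<Rightarrow> real \<Rightarrow> 'n rvec \<Rightarrow> real \<Rightarrow> nat \<Rightarrow> nat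
    \<Rightarrow> (real \<Rightarrow> real) \<Rightarrow> (real \<Rightarrow> 'n rvec) \<Rightarrow> bool"
  where "feedback f r \<tau> k T\<^sub>2 l m u z \<longleftrightarrow>
    (\<forall>i::nat. \<forall>t\<in>{real i * T\<^sub>2..<real (i + 1) * T\<^sub>2}.
       u t = k \<bullet> Phi f r \<tau> l m (z (real i * T\<^sub>2)) (history (real i * T\<^sub>2) u))"

definition initial_cond ::
  "real \<Rightarrow> real \<Rightarrow> (real \<Rightarrow> 'n::finite rvec) \<Rightarrow> (real \<Rightarrow> real) \<Rightarrow> 'n rvec \<Rightarrow> real
    \<Rightarrow> (real \<Rightarrow> 'n rvec) \<Rightarrow> (real \<Rightarrow> real) \<Rightarrow> (real \<Rightarrow> 'n rvec) \<Rightarrow> (real \<Rightarrow> real) \<Rightarrow> bool"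
  where "initial_cond r \<tau> x\<^sub>0 u\<^sub>0 z\<^sub>0 w\<^sub>0 x u z w \<longleftrightarrow>
    (\<forall>s\<in>{-r..0}. history 0 x s = x\<^sub>0 s)
    \<and> (\<forall>s\<in>{-r - \<tau>..<0}. history 0 u s = u\<^sub>0 s)
    \<and> z 0 = z\<^sub>0 \<and> w 0 = w\<^sub>0"

end

theory Submission
  imports Defs
begin

text \<open>
  The function \<open>M\<close> can be taken constant. Each sample overwrites \<open>w\<close> by a value that is bounded by
  the plant state and the measurement error, so the growth of the closed loop on the initial interval
  does not depend on the number of samples.

  After the first sampling time past \<open>r\<close>, the scaled observer error \<open>\<theta>\<^sup>1\<^sup>-\<^sup>i (z\<^sub>i(t) - x\<^sub>i(t - r))\<close> and the
  intersample error \<open>w(t) - x\<^sub>1(t - r)\<close> form a feedback interconnection whose gain is below one by the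
  condition on \<open>T\<^sub>1\<close>. From time \<open>jT\<^sub>2 + \<tau>\<close> on, the plant is the nominal closed loop perturbed by
  \<open>\<delta>(t) = u(t - \<tau>) - k'x(t)\<close>; the Lyapunov function \<open>x'Px\<close> bounds \<open>x\<close> by \<open>\<delta>\<close>, while the holding
  period and the prediction error bound \<open>\<delta>\<close> by \<open>x\<close>, the observer error and a fraction of \<open>\<delta>\<close>, and
  the condition on \<open>T\<^sub>2\<close> and \<open>K\<close> is the small-gain condition of this second loop. Both loops are closed
  with suprema weighted by \<open>e\<^sup>\<sigma>\<^sup>t\<close> for small \<open>\<sigma>\<close>.

  To avoid that \<open>\<delta>\<close> depends on disturbances later than the time \<open>H\<close> at which the estimate is wanted,
  the plant is continued from \<open>H\<close> to \<open>H + \<tau>\<close> without disturbance; the input needed for this is already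
  determined.
\<close>

section \<open>Absolutely continuous functions and their derivatives\<close>

text \<open>All data enter through one number: on a finite horizon H, a \<open>trajectory\<close>
  has initial data of size at most J and inputs of size at most J e^(-\<sigma> s). Every estimate is
  linear in J with a constant independent of H, J and the trajectory. With H = t and J the initial
  norm plus e^(\<sigma> t) times the fading suprema, a bound C e^(-\<sigma> t) J is the claimed one.
  The finite horizon also makes the weighted suprema finite before any decay is known, which is what
  allows a gain below one to be used on them. The gain conditions offer only strictness, so the
  Lyapunov estimates stay quadratic until the end, where sqrt (X^2 + Y^2) \<le> X + Y turns them
  into linear ones without enlarging the coefficient of the loop variable; strictness alone pays for
  \<sigma> > 0. Solutions have to be constructed as well. The predictor reads z at a holding instant
  and the input before it, so on each holding interval the input is a known constant and the loop is
  open.\<close>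

lemma AE_lebesgue_iff_negligible:
  "(AE t in lebesgue. P t) \<longleftrightarrow> negligible {t. \<not> P t}"
proof
  assume "AE t in lebesgue. P t"
  then obtain N where "{t \<in> space lebesgue. \<not> P t} \<subseteq> N" "N \<in> null_sets lebesgue"
    by (auto elim!: AE_E simp: null_sets_def)
  then show "negligible {t. \<not> P t}"
    by (simp add: negligible_iff_null_sets) (metis (no_types, lifting) negligible_iff_null_sets negligible_subset)
next
  assume "negligible {t. \<not> P t}"
  then have "{t. \<not> P t} \<in> null_sets lebesgue"
    by (simp add: negligible_iff_null_sets)
  then show "AE t in lebesgue. P t"
    by (rule AE_I') auto
qed

lemma abs_cont_onE:
  assumes "abs_cont_on I x" "\<epsilon> > 0"
  obtains \<delta> where "\<delta> > 0" "\<And>D S. \<lbrakk>D division_of S; S \<subseteq> I; (\<Sum>J\<in>D. measure lborel J) < \<delta>\<rbrakk>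
         \<Longrightarrow> (\<Sum>J\<in>D. norm (x (Sup J) - x (Inf J))) < \<epsilon>"
  using assms(1)[unfolded abs_cont_on_def, rule_format, OF assms(2)] by blast

text \<open>The fundamental theorem of calculus for the gauge integral. At points of the null set E
  the gauge is an open set U of measure below \<delta>, so intervals tagged there have small total
  length and absolute continuity controls their increments; at all other points the gauge is the
  radius of differentiability and each interval contributes an error proportional to its
  length.\<close>

lemma abs_cont_has_integral:
  fixes x :: "real \<Rightarrow> 'a::euclidean_space"
  assumes ab: "a \<le> b" and ac: "abs_cont_on {a..b} x" and E: "negligible E"
    and der: "\<And>t. t \<in> {a..b} - E \<Longrightarrow> (x has_vector_derivative g t) (at t within {a..b})"
  shows "(g has_integral (x b - x a)) {a..b}"
proof -
  define G where "G t = (if t \<in> E then 0 else g t)" for t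
  have "(G has_integral (x b - x a)) (cbox a b)"
    unfolding has_integral
  proof (intro allI impI)
    fix e :: real assume e: "e > 0"
    \<comment> \<open>Half of the tolerance is reserved for the intervals tagged outside E; the
      summand 1 covers the case a = b.\<close>
    define e' where "e' = e / (2 * (b - a + 1))"
    have e': "e' > 0" "e' * (b - a) < e / 2"
      using e ab unfolding e'_def by (auto simp: field_simps)
    obtain \<delta> where \<delta>: "\<delta> > 0" and ac\<delta>:
      "\<And>D S. \<lbrakk>D division_of S; S \<subseteq> {a..b}; (\<Sum>J\<in>D. measure lborel J) < \<delta>\<rbrakk>
         \<Longrightarrow> (\<Sum>J\<in>D. norm (x (Sup J) - x (Inf J))) < e / 2"
      using abs_cont_onE[OF ac half_gt_zero[OF e]] by blast
    have "E \<in> sets lebesgue"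
      using E by (simp add: negligible_iff_null_sets null_setsD2)
    then obtain U where U: "open U" "E \<subseteq> U" "U - E \<in> lmeasurable" "emeasure lebesgue (U - E) < ennreal \<delta>"
      using sets_lebesgue_outer_open[OF _ \<delta>] by metis
    have Umeas: "U \<in> lmeasurable" "measure lebesgue U < \<delta>"
    proof -
      have eq: "U = (U - E) \<union> E" using U by auto
      show "U \<in> lmeasurable"
        using U(3) E by (subst eq, intro fmeasurable.Un) (auto simp: negligible_iff_measure)
      have "measure lebesgue U \<le> measure lebesgue (U - E) + measure lebesgue E"
        by (subst eq, rule measure_Un_le)
           (use U(3) \<open>E \<in> sets lebesgue\<close> in \<open>auto simp: fmeasurableD\<close>)
      also have "\<dots> = measure lebesgue (U - E)"
        using E by (simp add: negligible_iff_measure)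
      also have "\<dots> < \<delta>"
        using U(3,4) \<delta> by (simp add: emeasure_eq_measure2 ennreal_less_iff)
      finally show "measure lebesgue U < \<delta>" .
    qed
    have "\<forall>t. \<exists>s>0. t \<in> {a..b} - E \<longrightarrow> (\<forall>y\<in>{a..b}. \<bar>y - t\<bar> < s \<longrightarrow>
              norm (x y - x t - (y - t) *\<^sub>R g t) \<le> e' * \<bar>y - t\<bar>)"
    proof
      fix t
      show "\<exists>s>0. t \<in> {a..b} - E \<longrightarrow> (\<forall>y\<in>{a..b}. \<bar>y - t\<bar> < s \<longrightarrow>
              norm (x y - x t - (y - t) *\<^sub>R g t) \<le> e' * \<bar>y - t\<bar>)"
      proof (cases "t \<in> {a..b} - E")
        case True
        from der[OF this] e'(1) show ?thesis
          unfolding has_vector_derivative_def has_derivative_within_alt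
          by (metis real_norm_def)
      qed (auto intro: exI[of _ 1])
    qed
    then obtain s where s: "\<And>t. s t > 0" and sd:
      "\<And>t y. \<lbrakk>t \<in> {a..b} - E; y \<in> {a..b}; \<bar>y - t\<bar> < s t\<rbrakk> \<Longrightarrow>
              norm (x y - x t - (y - t) *\<^sub>R g t) \<le> e' * \<bar>y - t\<bar>"
      by metis
    define \<gamma> where "\<gamma> t = (if t \<in> E then U else ball t (s t))" for t
    have "gauge \<gamma>"
      using U s by (auto simp: gauge_def \<gamma>_def)
    moreover
    have "norm ((\<Sum>(t,k)\<in>p. measure lborel k *\<^sub>R G t) - (x b - x a)) < e"
      if p: "p tagged_division_of cbox a b" and fine: "\<gamma> fine p" for p
    proof -
      \<comment> \<open>The value 0 on the empty set makes \<Delta> vanish on every interval without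
        interior. This is what the passage from a sum over tagged intervals to a sum over the
        intervals themselves requires.\<close>
      define \<Delta> where "\<Delta> k = (if k = {} then 0 else x (Sup k) - x (Inf k))" for k
      have "x b - x a = (\<Sum>(t,k)\<in>p. x (Sup k) - x (Inf k))"
        using additive_tagged_division_1[OF ab, of p x] p by simp
      also have "\<dots> = (\<Sum>(t,k)\<in>p. \<Delta> k)"
        using tagged_division_ofD(2)[OF p] by (intro sum.cong) (fastforce simp: \<Delta>_def)+
      finally have tel: "x b - x a = (\<Sum>(t,k)\<in>p. \<Delta> k)" .
      have finp: "finite p" using p by auto
      define p1 where "p1 = {(t,k). (t,k) \<in> p \<and> t \<in> E}"
      define p2 where "p2 = {(t,k). (t,k) \<in> p \<and> t \<notin> E}"
      have p12: "p = p1 \<union> p2" "p1 \<inter> p2 = {}" "finite p1" "finite p2"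
        using finp unfolding p1_def p2_def by (auto intro: finite_subset)
      have "norm ((\<Sum>(t,k)\<in>p. measure lborel k *\<^sub>R G t) - (x b - x a))
          = norm (\<Sum>(t,k)\<in>p. measure lborel k *\<^sub>R G t - \<Delta> k)"
        unfolding tel by (simp add: sum_subtractf case_prod_unfold)
      also have "\<dots> \<le> (\<Sum>(t,k)\<in>p. norm (measure lborel k *\<^sub>R G t - \<Delta> k))"
        by (simp add: case_prod_unfold norm_sum)
      also have "\<dots> = (\<Sum>(t,k)\<in>p1. norm (measure lborel k *\<^sub>R G t - \<Delta> k)) + (\<Sum>(t,k)\<in>p2. norm (measure lborel k *\<^sub>R G t - \<Delta> k))"
        using p12 by (metis (no_types, lifting) sum.union_disjoint)
      also have "(\<Sum>(t,k)\<in>p1. norm (measure lborel k *\<^sub>R G t - \<Delta> k)) = (\<Sum>(t,k)\<in>p1. norm (\<Delta> k))"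
        by (rule sum.cong) (auto simp: p1_def G_def)
      also have "\<dots> < e / 2"
      proof -
        have tp: "p1 tagged_partial_division_of cbox a b"
          using p p12(1) unfolding tagged_division_of_def by (metis sup_ge1 tagged_partial_division_subset)
        have tp': "p1 tagged_division_of \<Union>(snd ` p1)"
          using tagged_partial_division_of_Union_self[OF tp] .
        have dv: "snd ` p1 division_of \<Union>(snd ` p1)"
          using division_of_tagged_division[OF tp'] .
        have "(\<Sum>(t,k)\<in>p1. norm (\<Delta> k)) = (\<Sum>k\<in>snd ` p1. norm (\<Delta> k))"
          by (rule sum.over_tagged_division_lemma[OF tp'])
             (force simp: \<Delta>_def box_real cbox_interval)
        also have "\<dots> = (\<Sum>k\<in>snd ` p1. norm (x (Sup k) - x (Inf k)))"
          using division_ofD(3)[OF dv] by (intro sum.cong) (auto simp: \<Delta>_def)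
        also have "\<dots> < e / 2"
          unfolding \<Delta>_def
        proof (rule ac\<delta>[OF dv])
          show "\<Union>(snd ` p1) \<subseteq> {a..b}"
            using tagged_partial_division_ofD(3)[OF tp] by (force simp: p1_def)
          have sub: "\<Union>(snd ` p1) \<subseteq> U"
            using fine unfolding fine_def p1_def \<gamma>_def by fastforce
          have "(\<Sum>J\<in>snd ` p1. measure lborel J) = measure lebesgue (\<Union>(snd ` p1))"
            using content_division[OF dv] elementary_interval[of _ "_::real"] division_ofD(4)[OF dv]
            by (metis (no_types, lifting) measure_completion sum.cong lborelD borel_closed closed_cbox sets_lborel)
          also have "\<dots> \<le> measure lebesgue U"
            using sub Umeas lmeasurable_division[OF dv] by (intro measure_mono_fmeasurable) (auto simp: fmeasurableD)
          finally show "(\<Sum>J\<in>snd ` p1. measure lborel J) < \<delta>"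
            using Umeas by simp
        qed
        finally show ?thesis .
      qed
      also have "(\<Sum>(t,k)\<in>p2. norm (measure lborel k *\<^sub>R G t - \<Delta> k)) \<le> (\<Sum>(t,k)\<in>p2. e' * measure lborel k)"
      proof (rule sum_mono, clarify)
        fix t k assume tk: "(t,k) \<in> p2"
        then have tkp: "(t,k) \<in> p" and tE: "t \<notin> E" by (auto simp: p2_def)
        obtain u v where k: "k = {u..v}" "t \<in> {u..v}" "{u..v} \<subseteq> {a..b}" 
          using tagged_division_ofD(2-4)[OF p tkp] by (metis cbox_interval)
        have "{u..v} \<subseteq> ball t (s t)"
          using fine tkp tE k unfolding fine_def \<gamma>_def by fastforce
        then have near: "\<bar>u - t\<bar> < s t" "\<bar>v - t\<bar> < s t"
        proof -
          have "u \<in> {u..v}" "v \<in> {u..v}" using k(2) by auto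
          then have "u \<in> ball t (s t)" "v \<in> ball t (s t)" using \<open>{u..v} \<subseteq> ball t (s t)\<close> by blast+
          then show "\<bar>u - t\<bar> < s t" "\<bar>v - t\<bar> < s t" by (auto simp: dist_real_def)
        qed
        have uv: "u \<le> t" "t \<le> v" "u \<in> {a..b}" "v \<in> {a..b}" "t \<in> {a..b} - E"
          using k tE by auto
        have 1: "norm (x v - x t - (v - t) *\<^sub>R g t) \<le> e' * \<bar>v - t\<bar>"
          and 2: "norm (x u - x t - (u - t) *\<^sub>R g t) \<le> e' * \<bar>u - t\<bar>"
          using sd uv near by blast+
        \<comment> \<open>The increment is split at the tag t, so that differentiability at t
          applies to both halves.\<close>
        have "measure lborel k *\<^sub>R G t - \<Delta> k =
            (x u - x t - (u - t) *\<^sub>R g t) - (x v - x t - (v - t) *\<^sub>R g t)"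
          using k uv tE by (simp add: \<Delta>_def G_def algebra_simps)
        also have "norm \<dots> \<le> e' * \<bar>u - t\<bar> + e' * \<bar>v - t\<bar>"
          using norm_triangle_le_diff 1 2 by (smt (verit) norm_triangle_ineq4)
        also have "\<dots> = e' * measure lborel k"
          using k uv by (simp add: algebra_simps)
        finally show "norm (measure lborel k *\<^sub>R G t - \<Delta> k) \<le> e' * measure lborel k" .
      qed
      also have "\<dots> \<le> (\<Sum>(t,k)\<in>p. e' * measure lborel k)"
        using p12 e' finp by (intro sum_mono2) auto
      also have "\<dots> = e' * (b - a)"
        using additive_content_tagged_division[OF p] ab
        by (simp add: case_prod_unfold flip: sum_distrib_left)
      also have "\<dots> < e / 2" by (fact e'(2))
      finally show ?thesis by simp
    qed
    ultimately show "\<exists>\<gamma>. gauge \<gamma> \<and> (\<forall>p. p tagged_division_of cbox a b \<and> \<gamma> fine p \<longrightarrow>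
         norm ((\<Sum>(x,k)\<in>p. measure lborel k *\<^sub>R G x) - (x b - x a)) < e)"
      by (intro exI[of _ \<gamma>]) simp
  qed
  then show ?thesis
    using has_integral_spike[OF E, of "cbox a b" g G] by (simp add: G_def cbox_interval)
qed

lemma ac_solves_has_integral:
  fixes x :: "real \<Rightarrow> 'a::euclidean_space"
  assumes "ac_solves I x F" "{a..b} \<subseteq> I" "a \<le> b"
  shows "(F has_integral (x b - x a)) {a..b}"
proof (rule abs_cont_has_integral)
  show "abs_cont_on {a..b} x" using assms by (auto simp: ac_solves_def)
  show "negligible {t. \<not> (t \<in> I \<longrightarrow> (x has_vector_derivative F t) (at t within I))}"
    using assms by (simp only: ac_solves_def AE_lebesgue_iff_negligible)
  show "(x has_vector_derivative F t) (at t within {a..b})"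
    if "t \<in> {a..b} - {t. \<not> (t \<in> I \<longrightarrow> (x has_vector_derivative F t) (at t within I))}" for t
    using that assms(2) by (auto intro: has_vector_derivative_within_subset)
qed (use assms in auto)

lemma abs_cont_on_subset: "abs_cont_on I x \<Longrightarrow> J \<subseteq> I \<Longrightarrow> abs_cont_on J x"
  unfolding abs_cont_on_def by (meson order_trans)

lemma ac_solves_subset:
  assumes "ac_solves I x F" "J \<subseteq> I"
  shows "ac_solves J x F"
proof -
  have "AE t in lebesgue. t \<in> I \<longrightarrow> (x has_vector_derivative F t) (at t within I)"
    using assms by (simp add: ac_solves_def)
  then have "AE t in lebesgue. t \<in> J \<longrightarrow> (x has_vector_derivative F t) (at t within J)"
    by (rule AE_mp) (use assms(2) in \<open>auto intro!: AE_I2 intro: has_vector_derivative_within_subset\<close>)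
  then show ?thesis
    using assms unfolding ac_solves_def by (meson order_trans)
qed

text \<open>Absolute continuity sees only the endpoints of the intervals of a division, and these
  lie in I because the intervals are nonempty and closed.\<close>

lemma ac_solves_cong:
  assumes "ac_solves I x F" "\<And>t. t \<in> I \<Longrightarrow> x t = y t" "\<And>t. t \<in> I \<Longrightarrow> F t = G t"
  shows "ac_solves I y G"
proof -
  have "abs_cont_on {\<alpha>..\<beta>} y" if "{\<alpha>..\<beta>} \<subseteq> I" for \<alpha> \<beta>
    unfolding abs_cont_on_def
  proof (intro allI impI)
    fix \<epsilon> :: real assume "\<epsilon> > 0"
    moreover have "abs_cont_on {\<alpha>..\<beta>} x" using assms(1) that by (simp add: ac_solves_def)
    ultimately obtain \<delta> where \<delta>: "\<delta> > 0"
      "\<And>D S. \<lbrakk>D division_of S; S \<subseteq> {\<alpha>..\<beta>}; (\<Sum>J\<in>D. measure lborel J) < \<delta>\<rbrakk>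
         \<Longrightarrow> (\<Sum>J\<in>D. norm (x (Sup J) - x (Inf J))) < \<epsilon>"
      using abs_cont_onE by blast
    have "(\<Sum>J\<in>D. norm (y (Sup J) - y (Inf J))) < \<epsilon>"
      if D: "D division_of S" "S \<subseteq> {\<alpha>..\<beta>}" "(\<Sum>J\<in>D. measure lborel J) < \<delta>" for D S
    proof -
      have "Sup J \<in> I \<and> Inf J \<in> I" if "J \<in> D" for J
      proof -
        obtain u v where J: "J = {u..v}" "J \<noteq> {}" "J \<subseteq> S"
          using division_ofD[OF D(1)] \<open>J \<in> D\<close> by (metis cbox_interval)
        then show ?thesis
          using D(2) \<open>{\<alpha>..\<beta>} \<subseteq> I\<close> by fastforce
      qed
      then have "(\<Sum>J\<in>D. norm (y (Sup J) - y (Inf J))) = (\<Sum>J\<in>D. norm (x (Sup J) - x (Inf J)))"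
        using assms(2) by (intro sum.cong) auto
      then show ?thesis using \<delta>(2)[OF D] by simp
    qed
    with \<delta>(1) show "\<exists>\<delta>>0. \<forall>D S. D division_of S \<and> S \<subseteq> {\<alpha>..\<beta>} \<and> (\<Sum>J\<in>D. measure lborel J) < \<delta>
       \<longrightarrow> (\<Sum>J\<in>D. norm (y (Sup J) - y (Inf J))) < \<epsilon>" by blast
  qed
  moreover have "AE t in lebesgue. t \<in> I \<longrightarrow> (x has_vector_derivative F t) (at t within I)"
    using assms by (simp add: ac_solves_def)
  then have "AE t in lebesgue. t \<in> I \<longrightarrow> (y has_vector_derivative G t) (at t within I)"
  proof (rule AE_mp, intro AE_I2 impI)
    fix t assume *: "t \<in> I \<longrightarrow> (x has_vector_derivative F t) (at t within I)" "t \<in> I"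
    show "(y has_vector_derivative G t) (at t within I)"
      using * assms(2,3) by (metis has_vector_derivative_transform)
  qed
  ultimately show ?thesis by (simp add: ac_solves_def)
qed

lemma lipschitz_imp_abs_cont_on:
  assumes "\<And>s t. \<lbrakk>s \<in> {a..b}; t \<in> {a..b}; s \<le> t\<rbrakk> \<Longrightarrow> norm (x t - x s) \<le> B * (t - s)"
  shows "abs_cont_on {a..b::real} x"
  unfolding abs_cont_on_def
proof (intro allI impI)
  fix \<epsilon> :: real assume \<epsilon>: "\<epsilon> > 0"
  define B' where "B' = \<bar>B\<bar> + 1"
  have B': "B' > 0" "B \<le> B'" by (auto simp: B'_def)
  have "(\<Sum>J\<in>D. norm (x (Sup J) - x (Inf J))) < \<epsilon>"
    if D: "D division_of S" "S \<subseteq> {a..b}" "(\<Sum>J\<in>D. measure lborel J) < \<epsilon> / B'" for D S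
  proof -
    have "(\<Sum>J\<in>D. norm (x (Sup J) - x (Inf J))) \<le> (\<Sum>J\<in>D. B' * measure lborel J)"
    proof (rule sum_mono)
      fix J assume "J \<in> D"
      then obtain u v where J: "J = {u..v}" "J \<noteq> {}" "J \<subseteq> S"
        using division_ofD[OF D(1)] by (metis cbox_interval)
      then have "norm (x v - x u) \<le> B * (v - u)"
        using D(2) by (intro assms) fastforce+
      also have "\<dots> \<le> B' * (v - u)"
        using J B' by (intro mult_right_mono) auto
      finally show "norm (x (Sup J) - x (Inf J)) \<le> B' * measure lborel J"
        using J by auto
    qed
    also have "\<dots> < \<epsilon>"
      using D(3) B' by (simp add: field_simps flip: sum_distrib_left)
    finally show ?thesis .
  qed
  moreover have "\<epsilon> / B' > 0" using \<epsilon> B' by simp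
  ultimately show "\<exists>\<delta>>0. \<forall>D S. D division_of S \<and> S \<subseteq> {a..b} \<and> (\<Sum>J\<in>D. measure lborel J) < \<delta>
       \<longrightarrow> (\<Sum>J\<in>D. norm (x (Sup J) - x (Inf J))) < \<epsilon>" by blast
qed

text \<open>Lebesgue differentiation controls averages over intervals to the right of t. Applied to
  the reflection \<open>F'\<close> as well, it controls those to the left, so the derivative is
  two-sided. The null set depends on F alone, not on the base point or the primitive.\<close>

lemma indefinite_integral_derivative_ae:
  fixes F :: "real \<Rightarrow> 'a::euclidean_space"
  assumes int: "\<And>a b. F integrable_on {a..b}"
  obtains N where "negligible N"
    "\<And>t a y. \<lbrakk>t \<notin> N; a < t; \<And>s. a < s \<Longrightarrow> (F has_integral (y s - y a)) {a..s}\<rbrakk>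
        \<Longrightarrow> (y has_vector_derivative F t) (at t)"
proof -
  define F' where "F' t = F (- t)" for t
  have int': "F' integrable_on {a..b}" for a b
    using int[of "-b" "-a"] Henstock_Kurzweil_Integration.integrable_reflect_real[of F "-a" "-b"]
    unfolding F'_def by simp
  obtain N1 where N1: "negligible N1" "\<And>x e. \<lbrakk>x \<notin> N1; 0 < e\<rbrakk> \<Longrightarrow>
       \<exists>d>0. \<forall>h. 0 < h \<and> h < d \<longrightarrow> norm (integral {x..x + h} F /\<^sub>R h - F x) < e"
    using integrable_ccontinuous_explicit[of F] int by (auto simp: cbox_interval)
  obtain N2 where N2: "negligible N2" "\<And>x e. \<lbrakk>x \<notin> N2; 0 < e\<rbrakk> \<Longrightarrow>
       \<exists>d>0. \<forall>h. 0 < h \<and> h < d \<longrightarrow> norm (integral {x..x + h} F' /\<^sub>R h - F' x) < e"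
    using integrable_ccontinuous_explicit[of F'] int' by (auto simp: cbox_interval)
  show thesis
  proof
    show "negligible (N1 \<union> uminus ` N2)"
      using N1 N2 by (intro negligible_Un negligible_differentiable_image_negligible)
        (auto simp: differentiable_on_def)
    fix t a y assume t: "t \<notin> N1 \<union> uminus ` N2" "a < t"
      and y: "\<And>s. a < s \<Longrightarrow> (F has_integral (y s - y a)) {a..s}"
    have diff: "(F has_integral (y v - y u)) {u..v}" if "a < u" "u \<le> v" for u v
    proof -
      have "integral {a..u} F + integral {u..v} F = integral {a..v} F"
        using that int by (intro Henstock_Kurzweil_Integration.integral_combine) auto
      then have "integral {u..v} F = y v - y u"
        using y[of u] y[of v] that by (simp add: integral_unique algebra_simps)
      then show ?thesis
        using int by (metis integrable_integral)
    qed
    show "(y has_vector_derivative F t) (at t)"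
      unfolding has_vector_derivative_def has_derivative_at_alt
    proof (intro conjI allI impI)
      show "bounded_linear (\<lambda>x. x *\<^sub>R F t)" by (rule bounded_linear_scaleR_left)
      fix e :: real assume e: "e > 0"
      obtain d1 where d1: "d1 > 0" "\<And>h. \<lbrakk>0 < h; h < d1\<rbrakk> \<Longrightarrow> norm (integral {t..t + h} F /\<^sub>R h - F t) < e"
        using N1(2)[of t e] t e by auto
      obtain d2 where d2: "d2 > 0" "\<And>h. \<lbrakk>0 < h; h < d2\<rbrakk> \<Longrightarrow> norm (integral {-t..-t + h} F' /\<^sub>R h - F' (-t)) < e"
        using N2(2)[of "-t" e] t e by force
      have "norm (y s - y t - (s - t) *\<^sub>R F t) \<le> e * norm (s - t)"
        if s: "norm (s - t) < Min {d1, d2, t - a}" for s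
      proof -
        consider "s = t" | "t < s" | "s < t" by linarith
        then show ?thesis
        proof cases
          case 2
          define h where "h = s - t"
          have h: "0 < h" "h < d1" "s = t + h" using s 2 by (auto simp: h_def)
          have "y s - y t = integral {t..t+h} F"
            using diff[of t s] t(2) h by (simp add: integral_unique)
          then have "y s - y t - (s - t) *\<^sub>R F t = h *\<^sub>R (integral {t..t + h} F /\<^sub>R h - F t)"
            using h by (simp add: algebra_simps)
          also have "norm \<dots> \<le> h * e"
            using d1(2)[OF h(1,2)] h by (simp add: less_imp_le)
          finally show ?thesis using h by (simp add: mult.commute)
        next
          case 3
          define h where "h = t - s"
          have h: "0 < h" "h < d2" "s = t - h" "a < s" using s 3 by (auto simp: h_def)
          have "y t - y s = integral {t-h..t} F"
            using diff[of s t] h by (simp add: integral_unique)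
          also have "\<dots> = integral {-t..-t+h} F'"
            using Henstock_Kurzweil_Integration.integral_reflect_real[of t "t-h" F] unfolding F'_def by simp
          finally have eq: "y s = y t - integral {-t..-t+h} F'" by (simp add: algebra_simps)
          have "y s - y t - (s - t) *\<^sub>R F t = (-h) *\<^sub>R (integral {-t..-t + h} F' /\<^sub>R h - F' (-t))"
            unfolding eq using h(1) unfolding h(3) by (simp add: algebra_simps F'_def)
          also have "norm \<dots> \<le> h * e"
            using d2(2)[OF h(1,2)] h by (simp add: less_imp_le)
          finally show ?thesis using h by (simp add: mult.commute)
        qed simp
      qed
      moreover have "Min {d1, d2, t - a} > 0" using d1 d2 t by auto
      ultimately show "\<exists>d>0. \<forall>s. norm (s - t) < d \<longrightarrow> norm (y s - y t - (s - t) *\<^sub>R F t) \<le> e * norm (s - t)"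
        by blast
    qed
  qed
qed

text \<open>Converse of \<open>ac_solves_has_integral\<close>, for bounded right-hand sides: these
  make y Lipschitz, hence absolutely continuous, on compact subintervals. The extension
  \<open>F0\<close> of F by zero is integrable over every compact interval, so differentiation of
  its primitive applies off a null set.\<close>

lemma ac_solvesI_integral:
  fixes y :: "real \<Rightarrow> 'a::euclidean_space"
  assumes I: "I = {a..} \<or> I = {a..b} \<or> I = {a..<b}"
    and meas: "F \<in> borel_measurable (lebesgue_on I)"
    and bnd: "\<And>c. c \<in> I \<Longrightarrow> \<exists>B. \<forall>t\<in>{a..c}. norm (F t) \<le> B"
    and bnd': "I \<noteq> {a..} \<Longrightarrow> \<exists>B. \<forall>t\<in>I. norm (F t) \<le> B"
    and y: "\<And>t. t \<in> I \<Longrightarrow> y t = y a + integral {a..t} F"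
  shows "ac_solves I y F"
proof -
  define F0 where "F0 t = (if t \<in> I then F t else 0)" for t
  have Iiv: "is_interval I" "I \<in> sets lebesgue" "\<And>t. t \<in> I \<Longrightarrow> {a..t} \<subseteq> I"
    using I by (auto simp: is_interval_1)
  have measF0: "F0 \<in> borel_measurable lebesgue"
    using meas Iiv(2) unfolding F0_def by (simp add: borel_measurable_if)
  have F0b: "\<exists>B. \<forall>t\<in>{c..d}. norm (F0 t) \<le> B" for c d
  proof (cases "I = {a..}")
    case True
    obtain B where B: "\<forall>t\<in>{a..max a d}. norm (F t) \<le> B"
      using bnd[of "max a d"] True by auto
    have "norm (F0 t) \<le> max B 0" if "t \<in> {c..d}" for t
      using B that True by (auto simp: F0_def le_max_iff_disj)
    then show ?thesis by blast
  next
    case False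
    obtain B where B: "\<forall>t\<in>I. norm (F t) \<le> B" using bnd'[OF False] by blast
    have "norm (F0 t) \<le> max B 0" for t
      using B by (auto simp: F0_def le_max_iff_disj)
    then show ?thesis by blast
  qed
  have F0int: "F0 integrable_on {c..d}" for c d
  proof -
    obtain B where B: "\<forall>t\<in>{c..d}. norm (F0 t) \<le> B" using F0b by blast
    show ?thesis
    proof (rule measurable_bounded_by_integrable_imp_integrable)
      show "F0 \<in> borel_measurable (lebesgue_on {c..d})"
        using measF0 by (rule measurable_restrict_space1)
      show "(\<lambda>_. B) integrable_on {c..d}" by (rule integrable_const_ivl)
      show "norm (F0 x) \<le> B" if "x \<in> {c..d}" for x using B that by blast
    qed simp
  qed
  have hi0: "(F0 has_integral (y t - y a)) {a..t}" if "t \<in> I" for t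
  proof -
    have "integral {a..t} F0 = integral {a..t} F"
      using Iiv(3)[OF that] by (intro integral_cong) (auto simp: F0_def)
    then show ?thesis
      using y[OF that] integrable_integral[OF F0int[of a t]] by simp
  qed
  have hi: "(F0 has_integral (y t - y s)) {s..t}" if "s \<in> I" "t \<in> I" "s \<le> t" for s t
  proof -
    have "a \<le> s" using that I by auto
    then have "integral {a..s} F0 + integral {s..t} F0 = integral {a..t} F0"
      using that F0int by (intro Henstock_Kurzweil_Integration.integral_combine) auto
    then have "integral {s..t} F0 = y t - y s"
      using hi0[OF that(1)] hi0[OF that(2)] by (simp add: integral_unique algebra_simps)
    then show ?thesis using F0int by (metis integrable_integral)
  qed
  have "abs_cont_on {\<alpha>..\<beta>} y" if ab: "{\<alpha>..\<beta>} \<subseteq> I" for \<alpha> \<beta>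
  proof -
    obtain B where B: "\<forall>t\<in>{\<alpha>..\<beta>}. norm (F0 t) \<le> B" using F0b by blast
    show ?thesis
    proof (rule lipschitz_imp_abs_cont_on)
      fix s t assume st: "s \<in> {\<alpha>..\<beta>}" "t \<in> {\<alpha>..\<beta>}" "s \<le> t"
      then have "B \<ge> 0" using B by (metis norm_ge_zero order_trans)
      have "(F0 has_integral (y t - y s)) {s..t}" using st ab by (intro hi) auto
      then show "norm (y t - y s) \<le> B * (t - s)"
        using has_integral_bound_real[OF \<open>B \<ge> 0\<close>, of "{}" F0 "y t - y s" s t] st B by auto
    qed
  qed
  moreover have "AE t in lebesgue. t \<in> I \<longrightarrow> (y has_vector_derivative F t) (at t within I)"
  proof -
    define J where "J = I \<inter> {..a} \<union> {b}"
    obtain N where N: "negligible N"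
      "\<And>t a y. \<lbrakk>t \<notin> N; a < t; \<And>s. a < s \<Longrightarrow> (F0 has_integral (y s - y a)) {a..s}\<rbrakk>
        \<Longrightarrow> (y has_vector_derivative F0 t) (at t)"
      using indefinite_integral_derivative_ae[OF F0int] by metis
    have "(y has_vector_derivative F t) (at t within I)" if t: "t \<in> I" "t \<notin> N" "t \<noteq> a" "t \<noteq> b" for t
    proof -
      define Y where "Y s = integral {a..s} F0" for s
      have "a < t" using t I by auto
      have "(Y has_vector_derivative F0 t) (at t)"
        using \<open>a < t\<close> t(2) F0int by (intro N(2)) (auto simp: Y_def integrable_integral)
      then have "((\<lambda>s. y a + Y s) has_vector_derivative F t) (at t within I)"
        using t(1) by (subst add.commute, subst has_vector_derivative_add_const)
          (simp add: F0_def has_vector_derivative_at_within)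
      moreover have "y a + Y s = y s" if "s \<in> I" for s
        using hi0[OF that] by (simp add: Y_def integral_unique)
      ultimately show ?thesis
        using t(1) by (metis has_vector_derivative_transform)
    qed
    then have "{t. \<not> (t \<in> I \<longrightarrow> (y has_vector_derivative F t) (at t within I))} \<subseteq> N \<union> {a, b}"
      by blast
    then show ?thesis
      unfolding AE_lebesgue_iff_negligible
      using negligible_subset[of "N \<union> {a, b}"] negligible_Un[OF N(1), of "{a, b}"] by auto
  qed
  ultimately show ?thesis by (simp add: ac_solves_def)
qed

lemma abs_cont_on_imp_continuous_on:
  fixes x :: "real \<Rightarrow> 'a::real_normed_vector"
  assumes "abs_cont_on {a..b} x"
  shows "continuous_on {a..b} x"
  unfolding continuous_on_iff
proof (intro ballI allI impI)
  fix t \<epsilon> :: real assume t: "t \<in> {a..b}" and "\<epsilon> > 0"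
  then obtain \<delta> where \<delta>: "\<delta> > 0" "\<And>D S. \<lbrakk>D division_of S; S \<subseteq> {a..b}; (\<Sum>J\<in>D. measure lborel J) < \<delta>\<rbrakk>
         \<Longrightarrow> (\<Sum>J\<in>D. norm (x (Sup J) - x (Inf J))) < \<epsilon>"
    using abs_cont_onE[OF assms] by blast
  have key: "norm (x v - x u) < \<epsilon>" if "u \<in> {a..b}" "v \<in> {a..b}" "u \<le> v" "v - u < \<delta>" for u v
  proof -
    have "{{u..v}} division_of {u..v}"
      using that division_of_self[of u v] by (simp add: cbox_interval)
    then show ?thesis using \<delta>(2)[of "{{u..v}}" "{u..v}"] that by auto
  qed
  have "dist (x s) (x t) < \<epsilon>" if "s \<in> {a..b}" "dist s t < \<delta>" for s
    using key[of s t] key[of t s] that t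
    by (cases "s \<le> t") (auto simp: dist_norm norm_minus_commute abs_if split: if_splits)
  then show "\<exists>d>0. \<forall>s\<in>{a..b}. dist s t < d \<longrightarrow> dist (x s) (x t) < \<epsilon>"
    using \<delta>(1) by blast
qed

text \<open>Sums, bilinear products and linear images all satisfy the hypothesis that increments are
  dominated by those of x and y, so one argument with divisions serves for all of them.\<close>

lemma abs_cont_on_combine:
  fixes x :: "real \<Rightarrow> 'a::real_normed_vector" and y :: "real \<Rightarrow> 'b::real_normed_vector"
  assumes x: "abs_cont_on I x" and y: "abs_cont_on I y"
    and v: "\<And>s t. \<lbrakk>s \<in> I; t \<in> I\<rbrakk> \<Longrightarrow> norm (v t - v s) \<le> C * (norm (x t - x s) + norm (y t - y s))"
  shows "abs_cont_on I v"
  unfolding abs_cont_on_def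
proof (intro allI impI)
  fix \<epsilon> :: real assume "\<epsilon> > 0"
  define C' where "C' = \<bar>C\<bar> + 1"
  have C': "C' > 0" "C \<le> C'" by (auto simp: C'_def)
  with \<open>\<epsilon> > 0\<close> have e: "\<epsilon> / (2 * C') > 0" by simp
  obtain \<delta>1 where \<delta>1: "\<delta>1 > 0" "\<And>D S. \<lbrakk>D division_of S; S \<subseteq> I; (\<Sum>J\<in>D. measure lborel J) < \<delta>1\<rbrakk>
         \<Longrightarrow> (\<Sum>J\<in>D. norm (x (Sup J) - x (Inf J))) < \<epsilon> / (2 * C')"
    using abs_cont_onE[OF x e] by blast
  obtain \<delta>2 where \<delta>2: "\<delta>2 > 0" "\<And>D S. \<lbrakk>D division_of S; S \<subseteq> I; (\<Sum>J\<in>D. measure lborel J) < \<delta>2\<rbrakk>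
         \<Longrightarrow> (\<Sum>J\<in>D. norm (y (Sup J) - y (Inf J))) < \<epsilon> / (2 * C')"
    using abs_cont_onE[OF y e] by blast
  have "(\<Sum>J\<in>D. norm (v (Sup J) - v (Inf J))) < \<epsilon>"
    if D: "D division_of S" "S \<subseteq> I" "(\<Sum>J\<in>D. measure lborel J) < min \<delta>1 \<delta>2" for D S
  proof -
    have "(\<Sum>J\<in>D. norm (v (Sup J) - v (Inf J)))
        \<le> (\<Sum>J\<in>D. C' * (norm (x (Sup J) - x (Inf J)) + norm (y (Sup J) - y (Inf J))))"
    proof (rule sum_mono)
      fix J assume "J \<in> D"
      then obtain u w where J: "J = {u..w}" "J \<noteq> {}" "J \<subseteq> S"
        using division_ofD[OF D(1)] by (metis cbox_interval)
      then have "Sup J \<in> I" "Inf J \<in> I" using D(2) by fastforce+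
      then have "norm (v (Sup J) - v (Inf J)) \<le> C * (norm (x (Sup J) - x (Inf J)) + norm (y (Sup J) - y (Inf J)))"
        by (rule v[rotated])
      also have "\<dots> \<le> C' * (norm (x (Sup J) - x (Inf J)) + norm (y (Sup J) - y (Inf J)))"
        using C' by (intro mult_right_mono) auto
      finally show "norm (v (Sup J) - v (Inf J)) \<le> C' * (norm (x (Sup J) - x (Inf J)) + norm (y (Sup J) - y (Inf J)))" .
    qed
    also have "\<dots> = C' * ((\<Sum>J\<in>D. norm (x (Sup J) - x (Inf J))) + (\<Sum>J\<in>D. norm (y (Sup J) - y (Inf J))))"
      by (simp add: distrib_left sum.distrib flip: sum_distrib_left)
    also have "\<dots> < C' * (\<epsilon> / (2 * C') + \<epsilon> / (2 * C'))"
      using \<delta>1(2)[OF D(1,2)] \<delta>2(2)[OF D(1,2)] D(3) C' by (intro mult_strict_left_mono add_strict_mono) auto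
    also have "\<dots> = \<epsilon>" using C' by (simp add: field_simps)
    finally show ?thesis .
  qed
  moreover have "min \<delta>1 \<delta>2 > 0" using \<delta>1 \<delta>2 by simp
  ultimately show "\<exists>\<delta>>0. \<forall>D S. D division_of S \<and> S \<subseteq> I \<and> (\<Sum>J\<in>D. measure lborel J) < \<delta>
       \<longrightarrow> (\<Sum>J\<in>D. norm (v (Sup J) - v (Inf J))) < \<epsilon>" by blast
qed

section \<open>Products, linear images, sums and restrictions of solutions\<close>

lemma ac_solvesI2:
  assumes "abs_cont_on {a..b} x"
    and "AE t in lebesgue. t \<in> {a..b} \<longrightarrow> (x has_vector_derivative F t) (at t within {a..b})"
  shows "ac_solves {a..b} x F"
  using assms abs_cont_on_subset unfolding ac_solves_def by blast

lemma ac_solvesD: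
  assumes "ac_solves {a..b} x F"
  shows "abs_cont_on {a..b} x"
    and "AE t in lebesgue. t \<in> {a..b} \<longrightarrow> (x has_vector_derivative F t) (at t within {a..b})"
  using assms by (auto simp: ac_solves_def)

lemma ac_solves_continuous_on:
  fixes x :: "real \<Rightarrow> 'a::real_normed_vector"
  shows "ac_solves {a..b} x F \<Longrightarrow> continuous_on {a..b} x"
  by (intro abs_cont_on_imp_continuous_on ac_solvesD(1))

text \<open>The product rule, used for quadratic Lyapunov functions and for integrating factors.
  Both factors are bounded on the compact interval, which is why the increments of the product are
  dominated by those of the factors.\<close>

lemma ac_solves_bilinear:
  fixes x :: "real \<Rightarrow> 'a::real_normed_vector" and y :: "real \<Rightarrow> 'b::real_normed_vector"
  assumes B: "bounded_bilinear pr" and x: "ac_solves {a..b} x F" and y: "ac_solves {a..b} y G"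
  shows "ac_solves {a..b} (\<lambda>t. pr (x t) (y t)) (\<lambda>t. pr (x t) (G t) + pr (F t) (y t))"
proof (rule ac_solvesI2)
  interpret bounded_bilinear pr by fact
  have "bounded (x ` {a..b})" "bounded (y ` {a..b})"
    using x y by (auto intro!: compact_imp_bounded compact_continuous_image ac_solves_continuous_on)
  then obtain M1 M2 where M: "M1 > 0" "M2 > 0" "\<And>t. t \<in> {a..b} \<Longrightarrow> norm (x t) \<le> M1" "\<And>t. t \<in> {a..b} \<Longrightarrow> norm (y t) \<le> M2"
    unfolding bounded_pos by blast
  obtain K where K: "K \<ge> 0" "\<And>u v. norm (pr u v) \<le> norm u * norm v * K"
    using nonneg_bounded by blast
  show "abs_cont_on {a..b} (\<lambda>t. pr (x t) (y t))"
  proof (rule abs_cont_on_combine[OF ac_solvesD(1)[OF x] ac_solvesD(1)[OF y]])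
    fix s t assume st: "s \<in> {a..b}" "t \<in> {a..b}"
    have "pr (x t) (y t) - pr (x s) (y s) = pr (x t - x s) (y t) + pr (x s) (y t - y s)"
      by (simp add: diff_left diff_right)
    also have "norm \<dots> \<le> norm (x t - x s) * norm (y t) * K + norm (x s) * norm (y t - y s) * K"
      using K(2) by (intro norm_triangle_le add_mono)
    also have "\<dots> \<le> norm (x t - x s) * (M1 + M2) * K + (M1 + M2) * norm (y t - y s) * K"
      using K M(1,2) M(3)[OF st(1)] M(4)[OF st(2)] by (intro add_mono mult_mono mult_right_mono) auto
    finally show "norm (pr (x t) (y t) - pr (x s) (y s)) \<le> (K * (M1 + M2)) * (norm (x t - x s) + norm (y t - y s))"
      by (simp add: algebra_simps)
  qed
  show "AE t in lebesgue. t \<in> {a..b} \<longrightarrow>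
     ((\<lambda>t. pr (x t) (y t)) has_vector_derivative pr (x t) (G t) + pr (F t) (y t)) (at t within {a..b})"
    using ac_solvesD(2)[OF x] ac_solvesD(2)[OF y]
    by eventually_elim (auto intro: has_vector_derivative)
qed

lemma ac_solves_linear:
  fixes x :: "real \<Rightarrow> 'a::real_normed_vector"
  assumes h: "bounded_linear h" and x: "ac_solves {a..b} x F"
  shows "ac_solves {a..b} (\<lambda>t. h (x t)) (\<lambda>t. h (F t))"
proof (rule ac_solvesI2)
  interpret bounded_linear h by fact
  obtain K where K: "K \<ge> 0" "\<And>u. norm (h u) \<le> norm u * K"
    using nonneg_bounded by blast
  show "abs_cont_on {a..b} (\<lambda>t. h (x t))"
  proof (rule abs_cont_on_combine[OF ac_solvesD(1)[OF x] ac_solvesD(1)[OF x]])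
    fix s t
    have "norm (h (x t) - h (x s)) \<le> norm (x t - x s) * K" using K(2)[of "x t - x s"] by (simp add: diff)
    also have "\<dots> \<le> K * (norm (x t - x s) + norm (x t - x s))" using K(1) by (simp add: algebra_simps)
    finally show "norm (h (x t) - h (x s)) \<le> K * (norm (x t - x s) + norm (x t - x s))" .
  qed
  show "AE t in lebesgue. t \<in> {a..b} \<longrightarrow> ((\<lambda>t. h (x t)) has_vector_derivative h (F t)) (at t within {a..b})"
    using ac_solvesD(2)[OF x] by eventually_elim (auto intro: has_vector_derivative)
qed

lemma ac_solves_add:
  fixes x :: "real \<Rightarrow> 'a::real_normed_vector"
  assumes x: "ac_solves {a..b} x F" and y: "ac_solves {a..b} y G"
  shows "ac_solves {a..b} (\<lambda>t. x t + y t) (\<lambda>t. F t + G t)"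
proof (rule ac_solvesI2)
  show "abs_cont_on {a..b} (\<lambda>t. x t + y t)"
    by (rule abs_cont_on_combine[OF ac_solvesD(1)[OF x] ac_solvesD(1)[OF y], where C = 1])
       (simp add: add_diff_add norm_triangle_ineq)
  show "AE t in lebesgue. t \<in> {a..b} \<longrightarrow> ((\<lambda>t. x t + y t) has_vector_derivative F t + G t) (at t within {a..b})"
    using ac_solvesD(2)[OF x] ac_solvesD(2)[OF y]
    by eventually_elim (auto intro: has_vector_derivative_add)
qed

lemma ac_solves_diff:
  fixes x :: "real \<Rightarrow> 'a::real_normed_vector"
  assumes x: "ac_solves {a..b} x F" and y: "ac_solves {a..b} y G"
  shows "ac_solves {a..b} (\<lambda>t. x t - y t) (\<lambda>t. F t - G t)"
  using ac_solves_add[OF x ac_solves_linear[OF bounded_linear_minus[OF bounded_linear_ident] y]] by simp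

lemma ac_solves_spike:
  assumes "ac_solves I x F" "negligible {t \<in> I. F t \<noteq> F' t}"
  shows "ac_solves I x F'"
proof -
  have "AE t in lebesgue. t \<in> I \<longrightarrow> F t = F' t"
    unfolding AE_lebesgue_iff_negligible using assms(2) by (simp add: conj_commute)
  moreover have "AE t in lebesgue. t \<in> I \<longrightarrow> (x has_vector_derivative F t) (at t within I)"
    using assms(1) by (simp add: ac_solves_def)
  ultimately have "AE t in lebesgue. t \<in> I \<longrightarrow> (x has_vector_derivative F' t) (at t within I)"
    by eventually_elim auto
  then show ?thesis using assms(1) by (simp add: ac_solves_def)
qed

text \<open>The bound on F is asked for on \<open>{a..<b}\<close> only, since the input is often
  known only before the current time. The endpoint is a null set and both functions are set to 0
  there.\<close>

lemma ac_solves_norm_bound: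
  fixes x :: "real \<Rightarrow> 'a::euclidean_space"
  assumes "ac_solves {a..b} x F" "a \<le> b" "\<And>s. s \<in> {a..<b} \<Longrightarrow> norm (F s) \<le> h s" "(h has_integral i) {a..b}"
  shows "norm (x b - x a) \<le> i"
proof -
  have "(F has_integral (x b - x a)) {a..b}"
    using ac_solves_has_integral[OF assms(1) order_refl assms(2)] .
  then have 1: "((\<lambda>s. if s = b then 0 else F s) has_integral (x b - x a)) {a..b}"
    by (rule has_integral_spike_finite[of "{b}", rotated 2]) auto
  have 2: "((\<lambda>s. if s = b then 0 else h s) has_integral i) {a..b}"
    using assms(4) by (rule has_integral_spike_finite[of "{b}", rotated 2]) auto
  have "norm (integral {a..b} (\<lambda>s. if s = b then 0 else F s)) \<le> integral {a..b} (\<lambda>s. if s = b then 0 else h s)"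
    by (rule Henstock_Kurzweil_Integration.integral_norm_bound_integral) (use 1 2 assms(3) in auto)
  then show ?thesis
    using 1 2 by (simp add: integral_unique)
qed

lemma ac_solves_const_bound:
  fixes x :: "real \<Rightarrow> 'a::euclidean_space"
  assumes "ac_solves {a..b} x F" "a \<le> b" "\<And>s. s \<in> {a..<b} \<Longrightarrow> norm (F s) \<le> B"
  shows "norm (x b - x a) \<le> B * (b - a)"
  by (rule ac_solves_norm_bound[OF assms(1-3)])
     (use has_integral_const_real[of B a b] assms(2) in \<open>auto simp: mult.commute\<close>)

lemma ac_solves_le:
  fixes x :: "real \<Rightarrow> real"
  assumes "ac_solves {a..b} x F" "a \<le> b" "\<And>s. s \<in> {a..<b} \<Longrightarrow> F s \<le> h s" "(h has_integral i) {a..b}"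
  shows "x b - x a \<le> i"
proof -
  have "(F has_integral (x b - x a)) {a..b}"
    using ac_solves_has_integral[OF assms(1) order_refl assms(2)] .
  then have 1: "((\<lambda>s. if s = b then 0 else F s) has_integral (x b - x a)) {a..b}"
    by (rule has_integral_spike_finite[of "{b}", rotated 2]) auto
  have 2: "((\<lambda>s. if s = b then 0 else h s) has_integral i) {a..b}"
    using assms(4) by (rule has_integral_spike_finite[of "{b}", rotated 2]) auto
  show ?thesis
    by (rule has_integral_le[OF 1 2]) (use assms(3) in auto)
qed

lemma has_integral_exp:
  fixes c :: real
  assumes "c \<noteq> 0" "a \<le> b"
  shows "((\<lambda>s. exp (c * s)) has_integral (exp (c * b) - exp (c * a)) / c) {a..b}"
proof -
  have "((\<lambda>s. exp (c * s) / c) has_vector_derivative exp (c * x)) (at x within {a..b})" for x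
    unfolding has_real_derivative_iff_has_vector_derivative[symmetric]
    using assms by (auto intro!: derivative_eq_intros)
  then show ?thesis
    using fundamental_theorem_of_calculus[of a b "\<lambda>s. exp (c * s) / c" "\<lambda>s. exp (c * s)"] assms
    by (simp add: diff_divide_distrib)
qed

lemma ac_solves_exp: "ac_solves {a..b} (\<lambda>s. exp (c * s :: real)) (\<lambda>s. c * exp (c * s))"
proof (rule ac_solvesI2)
  have d: "((\<lambda>s. exp (c * s)) has_vector_derivative c * exp (c * s)) (at s within {a..b})" for s
    by (auto intro!: derivative_eq_intros simp flip: has_real_derivative_iff_has_vector_derivative)
  then show "AE t in lebesgue. t \<in> {a..b} \<longrightarrow> ((\<lambda>s. exp (c * s)) has_vector_derivative c * exp (c * t)) (at t within {a..b})"
    by simp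
  define B where "B = \<bar>c\<bar> * exp (\<bar>c\<bar> * max \<bar>a\<bar> \<bar>b\<bar>)"
  show "abs_cont_on {a..b} (\<lambda>s. exp (c * s))"
  proof (rule lipschitz_imp_abs_cont_on[where B = B])
    fix s t assume st: "s \<in> {a..b}" "t \<in> {a..b}" "s \<le> t"
    have "norm (exp (c * t) - exp (c * s)) \<le> B * norm (t - s)"
    proof (rule field_differentiable_bound[of "{a..b}" _ "\<lambda>s. c * exp (c * s)"])
      show "((\<lambda>s. exp (c * s)) has_field_derivative c * exp (c * u)) (at u within {a..b})" if "u \<in> {a..b}" for u
        using d by (simp add: has_real_derivative_iff_has_vector_derivative)
      show "norm (c * exp (c * u)) \<le> B" if "u \<in> {a..b}" for u
      proof -
        have "c * u \<le> \<bar>c\<bar> * \<bar>u\<bar>" by (metis abs_ge_self abs_mult)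
        also have "\<dots> \<le> \<bar>c\<bar> * max \<bar>a\<bar> \<bar>b\<bar>" using that by (intro mult_left_mono) auto
        finally show ?thesis by (auto simp: B_def abs_mult intro!: mult_left_mono)
      qed
    qed (use st in auto)
    then show "norm (exp (c * t) - exp (c * s)) \<le> B * (t - s)" using st by simp
  qed
qed

text \<open>Gives the equation of the delayed state x(t - r). Translation maps divisions to
  divisions of the same total length and null sets to null sets.\<close>

lemma ac_solves_shift:
  fixes x :: "real \<Rightarrow> 'a::euclidean_space"
  assumes x: "ac_solves {a..b} x F"
  shows "ac_solves {a + c..b + c} (\<lambda>t. x (t - c)) (\<lambda>t. F (t - c))"
proof (rule ac_solvesI2)
  define N where "N = {t. \<not> (t \<in> {a..b} \<longrightarrow> (x has_vector_derivative F t) (at t within {a..b}))}"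
  have N: "negligible N" using ac_solvesD(2)[OF x] by (simp add: AE_lebesgue_iff_negligible N_def)
  have "((\<lambda>t. x (t - c)) has_vector_derivative F (t - c)) (at t within {a + c..b + c})"
    if "t \<in> {a + c..b + c}" "t - c \<notin> N" for t
  proof -
    have "(x has_vector_derivative F (t - c)) (at (t - c) within (\<lambda>t. t - c) ` {a + c..b + c})"
      using that by (auto simp: N_def image_diff_atLeastAtMost)
    then have "(x \<circ> (\<lambda>t. t - c) has_vector_derivative 1 *\<^sub>R F (t - c)) (at t within {a + c..b + c})"
      by (intro vector_diff_chain_within) (auto intro!: derivative_eq_intros)
    then show ?thesis by (simp add: o_def)
  qed
  then have "{t. \<not> (t \<in> {a + c..b + c} \<longrightarrow> ((\<lambda>t. x (t - c)) has_vector_derivative F (t - c)) (at t within {a + c..b + c}))}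
     \<subseteq> (+) c ` N"
    by (auto simp: image_iff) (metis add.commute diff_add_cancel)
  then show "AE t in lebesgue. t \<in> {a + c..b + c} \<longrightarrow> ((\<lambda>t. x (t - c)) has_vector_derivative F (t - c)) (at t within {a + c..b + c})"
    unfolding AE_lebesgue_iff_negligible
    using negligible_subset negligible_translation[OF N] by blast
  show "abs_cont_on {a + c..b + c} (\<lambda>t. x (t - c))"
    unfolding abs_cont_on_def
  proof (intro allI impI)
    fix \<epsilon> :: real assume "\<epsilon> > 0"
    then obtain \<delta> where \<delta>: "\<delta> > 0" "\<And>D S. \<lbrakk>D division_of S; S \<subseteq> {a..b}; (\<Sum>J\<in>D. measure lborel J) < \<delta>\<rbrakk>
         \<Longrightarrow> (\<Sum>J\<in>D. norm (x (Sup J) - x (Inf J))) < \<epsilon>"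
      using abs_cont_onE[OF ac_solvesD(1)[OF x]] by blast
    have "(\<Sum>J\<in>D. norm (x (Sup J - c) - x (Inf J - c))) < \<epsilon>"
      if D: "D division_of S" "S \<subseteq> {a + c..b + c}" "(\<Sum>J\<in>D. measure lborel J) < \<delta>" for D S
    proof -
      have inj: "inj_on ((`) ((+) (-c))) D"
        by (rule inj_on_subset[of _ UNIV]) (auto simp: inj_image_eq_iff intro!: injI)
      have J: "\<exists>u v. J = {u..v} \<and> u \<le> v" if "J \<in> D" for J
        using division_ofD(3,4)[OF D(1) that] by (metis atLeastatMost_empty_iff cbox_interval)
      have "(\<lambda>J. (+) (-c) ` J) ` D division_of (+) (-c) ` S"
      proof (rule division_ofI)
        show "finite ((\<lambda>J. (+) (-c) ` J) ` D)" using division_ofD(1)[OF D(1)] by simp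
        show "\<Union>((\<lambda>J. (+) (-c) ` J) ` D) = (+) (-c) ` S" using division_ofD(6)[OF D(1)] by auto
        fix K assume "K \<in> (\<lambda>J. (+) (-c) ` J) ` D"
        then obtain J where J': "J \<in> D" "K = (+) (-c) ` J" by auto
        show "K \<subseteq> (+) (-c) ` S" "K \<noteq> {}" using J' division_ofD(2,3)[OF D(1)] by auto
        show "\<exists>a b. K = cbox a b"
          using J' J[OF J'(1)] by (metis cbox_interval image_add_atLeastAtMost)
        fix K' assume "K' \<in> (\<lambda>J. (+) (-c) ` J) ` D" "K \<noteq> K'"
        then obtain J'' where J'': "J'' \<in> D" "K' = (+) (-c) ` J''" "J \<noteq> J''" using J' by auto
        have "interior J \<inter> interior J'' = {}" using J' J'' division_ofD(5)[OF D(1)] by blast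
        then show "interior K \<inter> interior K' = {}"
          unfolding J'(2) J''(2) interior_translation by auto
      qed
      moreover have "(+) (-c) ` S \<subseteq> {a..b}" using D(2) by fastforce
      moreover have "(\<Sum>J\<in>(\<lambda>J. (+) (-c) ` J) ` D. measure lborel J) = (\<Sum>J\<in>D. measure lborel J)"
        by (subst sum.reindex[OF inj], rule sum.cong) (use J in fastforce)+
      ultimately have "(\<Sum>J\<in>(\<lambda>J. (+) (-c) ` J) ` D. norm (x (Sup J) - x (Inf J))) < \<epsilon>"
        using \<delta>(2) D(3) by simp
      moreover have "(\<Sum>J\<in>(\<lambda>J. (+) (-c) ` J) ` D. norm (x (Sup J) - x (Inf J))) = (\<Sum>J\<in>D. norm (x (Sup J - c) - x (Inf J - c)))"
        by (subst sum.reindex[OF inj], rule sum.cong) (use J in fastforce)+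
      ultimately show ?thesis by simp
    qed
    with \<delta>(1) show "\<exists>\<delta>>0. \<forall>D S. D division_of S \<and> S \<subseteq> {a + c..b + c} \<and> (\<Sum>J\<in>D. measure lborel J) < \<delta>
       \<longrightarrow> (\<Sum>J\<in>D. norm (x (Sup J - c) - x (Inf J - c))) < \<epsilon>" by blast
  qed
qed

text \<open>Both right-hand sides are bounded by B, so both pieces and hence the glued function are
  B-Lipschitz, which settles absolute continuity. The derivative is local except at the junction b,
  a null set.\<close>

lemma ac_solves_concat:
  fixes x :: "real \<Rightarrow> 'a::euclidean_space"
  assumes x: "ac_solves {a..b} x F" and y: "ac_solves {b..c} y G" and ab: "a \<le> b" "b \<le> c" "x b = y b"
    and bnd: "\<And>t. t \<in> {a..b} \<Longrightarrow> norm (F t) \<le> B" "\<And>t. t \<in> {b..c} \<Longrightarrow> norm (G t) \<le> B"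
  shows "ac_solves {a..c} (\<lambda>t. if t \<le> b then x t else y t) (\<lambda>t. if t \<le> b then F t else G t)"
    (is "ac_solves _ ?z ?H")
proof (rule ac_solvesI2)
  show "abs_cont_on {a..c} ?z"
  proof (rule lipschitz_imp_abs_cont_on[where B = B])
    have lx: "norm (x t - x s) \<le> B * (t - s)" if "s \<in> {a..b}" "t \<in> {a..b}" "s \<le> t" for s t
      using that bnd by (intro ac_solves_const_bound[OF ac_solves_subset[OF x]]) auto
    have ly: "norm (y t - y s) \<le> B * (t - s)" if "s \<in> {b..c}" "t \<in> {b..c}" "s \<le> t" for s t
      using that bnd by (intro ac_solves_const_bound[OF ac_solves_subset[OF y]]) auto
    fix s t assume st: "s \<in> {a..c}" "t \<in> {a..c}" "s \<le> t"
    consider "t \<le> b" | "b < s" | "s \<le> b" "b < t" using st by linarith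
    then show "norm (?z t - ?z s) \<le> B * (t - s)"
    proof cases
      case 3
      have "norm (y t - x s) \<le> norm (y t - y b) + norm (x b - x s)"
        using ab(3) norm_triangle_ineq[of "y t - y b" "x b - x s"] by simp
      also have "\<dots> \<le> B * (t - b) + B * (b - s)"
        using 3 st ab by (intro add_mono lx ly) auto
      finally show ?thesis using 3 by (simp add: algebra_simps)
    qed (use lx ly st in auto)
  qed
  have "AE t in lebesgue. t \<noteq> b"
    by (simp add: AE_lebesgue_iff_negligible)
  with ac_solvesD(2)[OF x] ac_solvesD(2)[OF y]
  show "AE t in lebesgue. t \<in> {a..c} \<longrightarrow> (?z has_vector_derivative ?H t) (at t within {a..c})"
  proof eventually_elim
    fix t
    assume 1: "t \<in> {a..b} \<longrightarrow> (x has_vector_derivative F t) (at t within {a..b})"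
      and 2: "t \<in> {b..c} \<longrightarrow> (y has_vector_derivative G t) (at t within {b..c})" and 3: "t \<noteq> b"
    show "t \<in> {a..c} \<longrightarrow> (?z has_vector_derivative ?H t) (at t within {a..c})"
    proof
      assume t: "t \<in> {a..c}"
      show "(?z has_vector_derivative ?H t) (at t within {a..c})"
      proof (cases "t < b")
        case True
        then have "(x has_vector_derivative ?H t) (at t within {a..b})" using 1 t by auto
        then have "(?z has_vector_derivative ?H t) (at t within {a..b})"
          by (rule has_vector_derivative_transform[rotated 2]) (use True t in auto)
        moreover have "at t within {a..b} = at t within {a..c}"
          by (rule at_within_nhd[of _ "{..<b}"]) (use True ab t in auto)
        ultimately show ?thesis by simp
      next
        case False
        then have tb: "b < t" using 3 by simp
        then have "(y has_vector_derivative ?H t) (at t within {b..c})" using 2 t by auto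
        then have "(?z has_vector_derivative ?H t) (at t within {b..c})"
          by (rule has_vector_derivative_transform[rotated 2]) (use tb t ab(3) in auto)
        moreover have "at t within {b..c} = at t within {a..c}"
          by (rule at_within_nhd[of _ "{b<..}"]) (use tb ab t in auto)
        ultimately show ?thesis by simp
      qed
    qed
  qed
qed

text \<open>The hypothesis on \<open>F\<close> allows the right-hand side to depend on the past of the solution.\<close>

lemma gronwall_memory:
  fixes y :: "real \<Rightarrow> 'a::euclidean_space"
  assumes y: "ac_solves {a..b} y F" and ab: "a \<le> b" and c: "c > 0" and B: "B \<ge> 0"
    and F: "\<And>s M. \<lbrakk>s \<in> {a..<b}; \<And>\<sigma>. \<sigma> \<in> {a..s} \<Longrightarrow> norm (y \<sigma>) \<le> M\<rbrakk> \<Longrightarrow> norm (F s) \<le> c * M + B"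
    and t: "t \<in> {a..b}"
  shows "norm (y t) \<le> 2 * exp (2 * c * (b - a)) * (norm (y a) + B * (b - a))"
proof -
  \<comment> \<open>The rate \<open>2 * c\<close> is twice the growth constant. Where \<phi> attains
    its maximum, the integral of the memory term is then at most half of that maximum and can be
    absorbed, which is the origin of the factor 2 in the bound.\<close>
  define \<phi> where "\<phi> s = exp (- (2 * c) * (s - a)) * norm (y s)" for s
  have "continuous_on {a..b} \<phi>"
    unfolding \<phi>_def by (intro continuous_intros ac_solves_continuous_on[OF y])
  then obtain s' where s': "s' \<in> {a..b}" "\<And>s. s \<in> {a..b} \<Longrightarrow> \<phi> s \<le> \<phi> s'"
    using continuous_attains_sup[of "{a..b}" \<phi>] ab by auto
  define m where "m = \<phi> s'"
  have m0: "m \<ge> 0" by (simp add: m_def \<phi>_def)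
  have ym: "norm (y s) \<le> m * exp (2 * c * (s - a))" if "s \<in> {a..b}" for s
  proof -
    have "norm (y s) = \<phi> s * exp (2 * c * (s - a))"
      by (simp add: \<phi>_def algebra_simps flip: exp_add)
    also have "\<dots> \<le> m * exp (2 * c * (s - a))"
      using s'(2)[OF that] by (simp add: m_def)
    finally show ?thesis .
  qed
  have hi: "((\<lambda>s. c * m * exp (- (2 * c * a)) * exp (2 * c * s) + B) has_integral
      c * m * exp (- (2 * c * a)) * ((exp (2 * c * s') - exp (2 * c * a)) / (2 * c)) + B * (s' - a)) {a..s'}"
    using s' c has_integral_const_real[of B a s'] has_integral_exp[of "2 * c" a s']
    by (intro has_integral_add has_integral_mult_right) (auto simp: mult.commute)
  have "norm (y s' - y a) \<le> c * m * exp (- (2 * c * a)) * ((exp (2 * c * s') - exp (2 * c * a)) / (2 * c)) + B * (s' - a)"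
  proof (rule ac_solves_norm_bound[OF _ _ _ hi])
    show "ac_solves {a..s'} y F" using s' by (intro ac_solves_subset[OF y]) auto
    fix s assume s: "s \<in> {a..<s'}"
    have "norm (F s) \<le> c * (m * exp (2 * c * (s - a))) + B"
    proof (rule F)
      fix \<sigma> assume "\<sigma> \<in> {a..s}"
      then have "norm (y \<sigma>) \<le> m * exp (2 * c * (\<sigma> - a))" using s s' by (intro ym) auto
      also have "\<dots> \<le> m * exp (2 * c * (s - a))"
        using \<open>\<sigma> \<in> {a..s}\<close> c m0 by (intro mult_left_mono) auto
      finally show "norm (y \<sigma>) \<le> m * exp (2 * c * (s - a))" .
    qed (use s s' in auto)
    then show "norm (F s) \<le> c * m * exp (- (2 * c * a)) * exp (2 * c * s) + B"
      by (simp add: algebra_simps flip: exp_add)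
  qed (use s' in auto)
  also have "\<dots> = m / 2 * (exp (2 * c * (s' - a)) - 1) + B * (s' - a)"
    using c by (simp add: field_simps flip: exp_add)
  also have "\<dots> \<le> m / 2 * exp (2 * c * (s' - a)) + B * (b - a)"
    using s' B m0 by (intro add_mono mult_left_mono) auto
  finally have *: "norm (y s') \<le> norm (y a) + B * (b - a) + m / 2 * exp (2 * c * (s' - a))"
    using norm_triangle_sub[of "y s'" "y a"] by linarith
  have e1: "exp (- (2 * c) * (s' - a)) \<le> 1" using s' c by (simp add: mult_nonneg_nonneg)
  have "m \<le> exp (- (2 * c) * (s' - a)) * (norm (y a) + B * (b - a) + m / 2 * exp (2 * c * (s' - a)))"
    unfolding m_def \<phi>_def using * by (intro mult_left_mono) (auto simp: m_def \<phi>_def)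
  also have "\<dots> = exp (- (2 * c) * (s' - a)) * (norm (y a) + B * (b - a)) + m / 2"
    by (simp add: algebra_simps flip: exp_add)
  also have "\<dots> \<le> 1 * (norm (y a) + B * (b - a)) + m / 2"
    using e1 B ab by (intro add_right_mono mult_right_mono) auto
  finally have "m \<le> 2 * (norm (y a) + B * (b - a))" by simp
  moreover have "exp (2 * c * (t - a)) \<le> exp (2 * c * (b - a))" using t c by simp
  ultimately have "m * exp (2 * c * (t - a)) \<le> 2 * (norm (y a) + B * (b - a)) * exp (2 * c * (b - a))"
    using m0 by (intro mult_mono) auto
  with ym[OF t] have "norm (y t) \<le> 2 * (norm (y a) + B * (b - a)) * exp (2 * c * (b - a))"
    by (rule order_trans)
  then show ?thesis by (simp only: mult.commute mult.left_commute mult.assoc)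
qed

text \<open>Integrating factor e^(2 \<omega> s). As \<sigma> < \<omega>, the forcing decays more
  slowly than the homogeneous solution and dictates the rate. All rates carry a factor 2 because v
  will be a quadratic form in a quantity that decays at rate \<sigma>.\<close>

lemma exponential_comparison:
  fixes v :: "real \<Rightarrow> real"
  assumes v: "ac_solves {a..b} v F" and ab: "a \<le> b" and va: "v a \<ge> 0" and c: "c \<ge> 0"
    and \<sigma>: "\<sigma> < \<omega>"
    and F: "\<And>s. s \<in> {a..<b} \<Longrightarrow> F s \<le> - 2 * \<omega> * v s + c * exp (- 2 * \<sigma> * s)"
  shows "v b \<le> exp (- 2 * \<sigma> * b) * (exp (2 * \<sigma> * a) * v a + c / (2 * \<omega> - 2 * \<sigma>))"
proof -
  define w where "w s = exp (2 * \<omega> * s) * v s" for s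
  define W where "W s = exp (2 * \<omega> * s) * F s + 2 * \<omega> * exp (2 * \<omega> * s) * v s" for s
  have w: "ac_solves {a..b} w W"
    using ac_solves_bilinear[OF bounded_bilinear_mult ac_solves_exp v] unfolding w_def W_def .
  have hi: "((\<lambda>s. c * exp ((2 * \<omega> - 2 * \<sigma>) * s)) has_integral
      c * ((exp ((2 * \<omega> - 2 * \<sigma>) * b) - exp ((2 * \<omega> - 2 * \<sigma>) * a)) / (2 * \<omega> - 2 * \<sigma>))) {a..b}"
    using \<sigma> ab by (intro has_integral_mult_right has_integral_exp) auto
  have "w b - w a \<le> c * ((exp ((2 * \<omega> - 2 * \<sigma>) * b) - exp ((2 * \<omega> - 2 * \<sigma>) * a)) / (2 * \<omega> - 2 * \<sigma>))"
  proof (rule ac_solves_le[OF w ab _ hi])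
    fix s assume "s \<in> {a..<b}"
    have "W s = exp (2 * \<omega> * s) * (F s + 2 * \<omega> * v s)" by (simp add: W_def algebra_simps)
    also have "\<dots> \<le> exp (2 * \<omega> * s) * (c * exp (- 2 * \<sigma> * s))"
      using F[OF \<open>s \<in> {a..<b}\<close>] by (intro mult_left_mono) auto
    also have "\<dots> = c * exp ((2 * \<omega> - 2 * \<sigma>) * s)"
      by (simp add: algebra_simps flip: exp_add)
    finally show "W s \<le> c * exp ((2 * \<omega> - 2 * \<sigma>) * s)" .
  qed
  also have "\<dots> \<le> c * (exp ((2 * \<omega> - 2 * \<sigma>) * b) / (2 * \<omega> - 2 * \<sigma>))"
    using c \<sigma> by (intro mult_left_mono divide_right_mono) auto
  finally have "w b \<le> w a + c / (2 * \<omega> - 2 * \<sigma>) * exp ((2 * \<omega> - 2 * \<sigma>) * b)" by simp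
  then have "exp (- 2 * \<omega> * b) * w b \<le> exp (- 2 * \<omega> * b) * (w a + c / (2 * \<omega> - 2 * \<sigma>) * exp ((2 * \<omega> - 2 * \<sigma>) * b))"
    by (intro mult_left_mono) auto
  then have "v b \<le> exp (- 2 * \<omega> * (b - a)) * v a + c / (2 * \<omega> - 2 * \<sigma>) * exp (- 2 * \<sigma> * b)"
    by (simp add: w_def algebra_simps flip: exp_add)
  also have "exp (- 2 * \<omega> * (b - a)) * v a \<le> exp (- 2 * \<sigma> * (b - a)) * v a"
    using \<sigma> ab va by (intro mult_right_mono) (auto intro: mult_right_mono)
  finally show ?thesis by (simp add: algebra_simps flip: exp_add)
qed

section \<open>Volterra equations\<close>

lemma bounded_measurable_integrable:
  fixes F :: "real \<Rightarrow> 'a::euclidean_space"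
  assumes "F \<in> borel_measurable (lebesgue_on {a..b})" "\<And>t. t \<in> {a..b} \<Longrightarrow> norm (F t) \<le> B" "{c..d} \<subseteq> {a..b}"
  shows "F integrable_on {c..d}"
proof (rule measurable_bounded_by_integrable_imp_integrable)
  show "F \<in> borel_measurable (lebesgue_on {c..d})"
    using measurable_restrict_mono[OF assms(1,3)] .
  show "(\<lambda>_. B) integrable_on {c..d}" by (rule integrable_const_ivl)
  show "norm (F x) \<le> B" if "x \<in> {c..d}" for x using assms that by blast
qed simp

text \<open>\<Psi> may depend on the whole past of y, and the Lipschitz condition \<open>lip\<close>
  is causal: it compares \<Psi> at time s with the running distance up to s. Weighting by e^(2 c (s
  - a)) makes the Picard map a contraction with factor 1/2 on the whole interval, so no patching of
  short intervals occurs.\<close>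

lemma volterra_exists:
  fixes \<Psi> :: "(real \<Rightarrow> 'a::euclidean_space) \<Rightarrow> real \<Rightarrow> 'a"
  assumes ab: "a \<le> b" and c: "c > 0"
    and meas: "\<And>y. continuous_on {a..b} y \<Longrightarrow> \<Psi> y \<in> borel_measurable (lebesgue_on {a..b})"
    and lip: "\<And>y y' s M. \<lbrakk>continuous_on {a..b} y; continuous_on {a..b} y'; s \<in> {a..b}; \<And>\<sigma>. \<sigma> \<in> {a..s} \<Longrightarrow> norm (y \<sigma> - y' \<sigma>) \<le> M\<rbrakk>
        \<Longrightarrow> norm (\<Psi> y s - \<Psi> y' s) \<le> c * M"
    and bnd: "\<And>s. s \<in> {a..b} \<Longrightarrow> norm (\<Psi> (\<lambda>_. x0) s) \<le> B"
  obtains y where "ac_solves {a..b} y (\<Psi> y)" "y a = x0"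
proof -
  have bndy: "\<exists>B'. \<forall>s\<in>{a..b}. norm (\<Psi> y s) \<le> B'" if y: "continuous_on {a..b} y" for y
  proof -
    have "bounded ((\<lambda>s. y s - x0) ` {a..b})"
      using y by (intro compact_imp_bounded compact_continuous_image continuous_intros) auto
    then obtain M where M: "\<And>s. s \<in> {a..b} \<Longrightarrow> norm (y s - x0) \<le> M" unfolding bounded_iff by blast
    have "norm (\<Psi> y s) \<le> c * M + B" if s: "s \<in> {a..b}" for s
    proof -
      have "norm (\<Psi> y s - \<Psi> (\<lambda>_. x0) s) \<le> c * M" using s M y by (intro lip) auto
      then show ?thesis using bnd[OF s] norm_triangle_sub[of "\<Psi> y s" "\<Psi> (\<lambda>_. x0) s"] by linarith
    qed
    then show ?thesis by blast
  qed
  have int: "\<Psi> y integrable_on {a..t}" if y: "continuous_on {a..b} y" and t: "t \<in> {a..b}" for y t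
    using bndy[OF y] bounded_measurable_integrable[OF meas[OF y]] t by (metis atLeastatMost_subset_iff atLeastAtMost_iff order_refl)
  \<comment> \<open>The fixed point is sought in weighted form: w is a bounded continuous function,
    \<open>g w\<close> the candidate solution, and \<open>h w\<close> the weighted Picard image of
    \<open>g w\<close>.\<close>
  define g where "g w s = exp (2 * c * (s - a)) *\<^sub>R apply_bcontfun w s" for w :: "real \<Rightarrow>\<^sub>C 'a" and s
  have gc: "continuous_on {a..b} (g w)" for w
    unfolding g_def by (intro continuous_intros continuous_on_apply_bcontfun)
  define h where "h w t = exp (- (2 * c * (t - a))) *\<^sub>R (x0 + integral {a..t} (\<Psi> (g w)))" for w t
  have hc: "continuous_on (cbox a b) (h w)" for w
    unfolding h_def cbox_interval using int[OF gc, of b] ab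
    by (intro continuous_intros indefinite_integral_continuous_1) auto
  \<comment> \<open>Bounded continuous functions live on the whole line, so the image is extended
    constantly beyond both ends of the interval by \<open>clamp\<close>.\<close>
  have "\<forall>w. \<exists>w'. \<forall>t. apply_bcontfun w' t = h w (clamp a b t)"
    using continuous_on_cbox_bcontfunE[OF hc] by metis
  then obtain Tm where Tm_clamp: "\<And>w t. apply_bcontfun (Tm w) t = h w (clamp a b t)" by metis
  have Tm: "apply_bcontfun (Tm w) t = h w t" if "t \<in> {a..b}" for w t
    using that by (simp add: Tm_clamp cbox_interval)
  have contr: "dist (Tm w) (Tm v) \<le> (1/2) * dist w v" for w v
  proof (rule dist_bound)
    fix t
    define t' where "t' = clamp a b t"
    have t': "t' \<in> {a..b}" using clamp_in_interval[of a b t] ab by (simp add: t'_def cbox_interval)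
    define d where "d = dist w v"
    have d: "d \<ge> 0" by (simp add: d_def)
    have i1: "\<Psi> (g w) integrable_on {a..t'}" "\<Psi> (g v) integrable_on {a..t'}" using int gc t' by blast+
    have hi: "((\<lambda>s. c * d * exp (- (2 * c * a)) * exp (2 * c * s)) has_integral
        c * d * exp (- (2 * c * a)) * ((exp (2 * c * t') - exp (2 * c * a)) / (2 * c))) {a..t'}"
      using t' c by (intro has_integral_mult_right has_integral_exp) auto
    have "norm (integral {a..t'} (\<Psi> (g w)) - integral {a..t'} (\<Psi> (g v)))
        = norm (integral {a..t'} (\<lambda>s. \<Psi> (g w) s - \<Psi> (g v) s))"
      using i1 by (simp add: Henstock_Kurzweil_Integration.integral_diff)
    also have "\<dots> \<le> integral {a..t'} (\<lambda>s. c * d * exp (- (2 * c * a)) * exp (2 * c * s))"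
    proof (rule Henstock_Kurzweil_Integration.integral_norm_bound_integral)
      show "(\<lambda>s. \<Psi> (g w) s - \<Psi> (g v) s) integrable_on {a..t'}" using i1 by (intro integrable_diff)
      show "(\<lambda>s. c * d * exp (- (2 * c * a)) * exp (2 * c * s)) integrable_on {a..t'}" using hi by blast
      fix s assume s: "s \<in> {a..t'}"
      have "norm (\<Psi> (g w) s - \<Psi> (g v) s) \<le> c * (d * exp (2 * c * (s - a)))"
      proof (rule lip)
        fix \<sigma> assume \<sigma>: "\<sigma> \<in> {a..s}"
        have "norm (g w \<sigma> - g v \<sigma>) = exp (2 * c * (\<sigma> - a)) * dist (apply_bcontfun w \<sigma>) (apply_bcontfun v \<sigma>)"
          by (simp add: g_def dist_norm flip: scaleR_diff_right)
        also have "\<dots> \<le> exp (2 * c * (s - a)) * d"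
          using \<sigma> c d dist_bounded[of w \<sigma> v] by (intro mult_mono) (auto simp: d_def)
        finally show "norm (g w \<sigma> - g v \<sigma>) \<le> d * exp (2 * c * (s - a))" by (simp add: mult.commute)
      qed (use s t' gc in auto)
      then show "norm (\<Psi> (g w) s - \<Psi> (g v) s) \<le> c * d * exp (- (2 * c * a)) * exp (2 * c * s)"
        by (simp add: algebra_simps flip: exp_add)
    qed
    also have "\<dots> = d / 2 * (exp (2 * c * (t' - a)) - 1)"
      unfolding integral_unique[OF hi] using c by (simp add: field_simps flip: exp_add)
    also have "\<dots> \<le> d / 2 * exp (2 * c * (t' - a))"
      using d by (intro mult_left_mono) auto
    finally have "norm (integral {a..t'} (\<Psi> (g w)) - integral {a..t'} (\<Psi> (g v))) \<le> d / 2 * exp (2 * c * (t' - a))" .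
    then have "exp (- (2 * c * (t' - a))) * norm (integral {a..t'} (\<Psi> (g w)) - integral {a..t'} (\<Psi> (g v)))
        \<le> exp (- (2 * c * (t' - a))) * (d / 2 * exp (2 * c * (t' - a)))"
      by (intro mult_left_mono) auto
    also have "\<dots> = d / 2" by (simp add: algebra_simps flip: exp_add)
    finally show "dist (apply_bcontfun (Tm w) t) (apply_bcontfun (Tm v) t) \<le> (1/2) * dist w v"
      unfolding Tm_clamp by (simp add: h_def dist_norm d_def flip: t'_def scaleR_diff_right)
  qed
  obtain w where w: "Tm w = w"
    using banach_fix_type[of "1/2" Tm] contr by auto
  define y where "y = g w"
  have yc: "continuous_on {a..b} y" unfolding y_def by (rule gc)
  have eq: "y t = x0 + integral {a..t} (\<Psi> y)" if "t \<in> {a..b}" for t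
  proof -
    have "y t = exp (2 * c * (t - a)) *\<^sub>R h w t"
      using Tm[OF that, of w] by (simp add: y_def g_def w)
    also have "\<dots> = x0 + integral {a..t} (\<Psi> y)" by (simp add: h_def y_def flip: exp_add)
    finally show ?thesis .
  qed
  have ya: "y a = x0" using eq[of a] ab by simp
  have "ac_solves {a..b} y (\<Psi> y)"
  proof (rule ac_solvesI_integral[where a = a and b = b])
    show "\<exists>B. \<forall>t\<in>{a..d}. norm (\<Psi> y t) \<le> B" if "d \<in> {a..b}" for d
      using bndy[OF yc] that by (meson atLeastAtMost_iff order_trans)
    show "y t = y a + integral {a..t} (\<Psi> y)" if "t \<in> {a..b}" for t
      using eq[OF that] ya by simp
  qed (use meas[OF yc] bndy[OF yc] in auto)
  with ya show thesis by (rule that[rotated])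
qed

text \<open>The difference of the solutions satisfies \<open>gronwall_memory\<close> with zero
  initial value and B = 0. The Lipschitz estimate is needed along these two solutions only, which
  later suffices for a locally Lipschitz g.\<close>

lemma volterra_unique:
  fixes y y' :: "real \<Rightarrow> 'a::euclidean_space"
  assumes y: "ac_solves {a..b} y F" and y': "ac_solves {a..b} y' F'" and ab: "a \<le> b" and c: "c > 0"
    and eq: "y a = y' a"
    and lip: "\<And>s M. \<lbrakk>s \<in> {a..<b}; \<And>\<sigma>. \<sigma> \<in> {a..s} \<Longrightarrow> norm (y \<sigma> - y' \<sigma>) \<le> M\<rbrakk>
        \<Longrightarrow> norm (F s - F' s) \<le> c * M"
    and t: "t \<in> {a..b}"
  shows "y t = y' t"
  using gronwall_memory[OF ac_solves_diff[OF y y'] ab c order_refl _ t] eq lip by simp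

text \<open>Countably many exceptional null sets, one per horizon, have a null union; off it, each t
  lies in the relative interior of some horizon, where the two kinds of one-sided derivative
  agree.\<close>

lemma ac_solves_atLeast:
  assumes "\<And>n::nat. ac_solves {a..a + real n} y F"
  shows "ac_solves {a..} y F"
proof -
  have "abs_cont_on {\<alpha>..\<beta>} y" if "{\<alpha>..\<beta>} \<subseteq> {a..}" for \<alpha> \<beta>
  proof -
    obtain n :: nat where "\<beta> - a \<le> real n" using real_arch_simple by blast
    then have "{\<alpha>..\<beta>} \<subseteq> {a..a + real n}" using that by auto
    then show ?thesis using ac_solvesD(1)[OF assms] abs_cont_on_subset by blast
  qed
  moreover have "AE t in lebesgue. \<forall>n::nat. t \<in> {a..a + real n} \<longrightarrow> (y has_vector_derivative F t) (at t within {a..a + real n})"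
    unfolding AE_all_countable using ac_solvesD(2)[OF assms] by blast
  then have "AE t in lebesgue. t \<in> {a..} \<longrightarrow> (y has_vector_derivative F t) (at t within {a..})"
  proof eventually_elim
    fix t
    assume *: "\<forall>n::nat. t \<in> {a..a + real n} \<longrightarrow> (y has_vector_derivative F t) (at t within {a..a + real n})"
    show "t \<in> {a..} \<longrightarrow> (y has_vector_derivative F t) (at t within {a..})"
    proof
      assume t: "t \<in> {a..}"
      obtain n :: nat where n: "t - a < real n" using reals_Archimedean2 by blast
      have "at t within {a..a + real n} = at t within {a..}"
        by (rule at_within_nhd[of _ "{..<a + real n}"]) (use n in auto)
      moreover have "t \<in> {a..a + real n}" using t n by simp
      ultimately show "(y has_vector_derivative F t) (at t within {a..})" using * by metis
    qed
  qed
  ultimately show ?thesis by (simp add: ac_solves_def)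
qed

section \<open>The drift of the plant and high-gain scaling\<close>

lemma pos_strict_mono: "i < j \<Longrightarrow> pos i < pos (j :: 'n::{finite,linorder})"
  unfolding pos_def by (intro psubset_card_mono) (auto simp: psubset_eq)

lemma pos_inj: "pos i = pos j \<longleftrightarrow> i = (j :: 'n::{finite,linorder})"
  by (metis linorder_cases pos_strict_mono less_irrefl)

lemma pos_mono: "i \<le> j \<Longrightarrow> pos i \<le> pos (j :: 'n::{finite,linorder})"
  using pos_strict_mono[of i j] by (auto simp: le_less)

lemma pos_ge_1: "pos (i :: 'n::{finite,linorder}) \<ge> 1"
  unfolding pos_def using card_gt_0_iff[of "{..i}"] by force

lemma pos_le_card: "pos (i :: 'n::{finite,linorder}) \<le> CARD('n)"
  unfolding pos_def by (intro card_mono) auto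

lemma fst_idx_le: "fst_idx \<le> (i :: 'n::{finite,linorder})"
  by (simp add: fst_idx_def)

lemma last_idx_ge: "(i :: 'n::{finite,linorder}) \<le> last_idx"
  by (simp add: last_idx_def)

lemma pos_fst_idx: "pos (fst_idx :: 'n::{finite,linorder}) = 1"
proof -
  have "{..fst_idx} = {fst_idx :: 'n}" using fst_idx_le antisym by auto
  then show ?thesis by (simp add: pos_def)
qed

text \<open>Translates the numbering \<open>pos\<close> used in \<open>shiftA\<close> into the
  order-theoretic successor used in \<open>next_comp\<close>. The last index has no successor and is
  excluded.\<close>

lemma pos_Suc_iff:
  fixes i j :: "'n::{finite,linorder}"
  assumes "i \<noteq> last_idx"
  shows "pos j = pos i + 1 \<longleftrightarrow> j = Min {i<..}"
proof -
  have "i < last_idx" using assms last_idx_ge[of i] by simp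
  then have ne: "{i<..} \<noteq> {}" by auto
  have m: "i < Min {i<..}" using Min_in[OF _ ne] by simp
  have "{..Min {i<..}} = insert (Min {i<..}) {..i}"
    using m by (auto simp: not_le) (metis Min_le finite greaterThan_iff leD le_less_linear order_antisym_conv)
  then have "pos (Min {i<..}) = pos i + 1" using m by (simp add: pos_def)
  then show ?thesis using pos_inj by metis
qed

lemma pos_last_not_Suc: "pos (j :: 'n::{finite,linorder}) \<noteq> pos (last_idx :: 'n) + 1"
  using pos_mono[OF last_idx_ge, of j] by simp

lemma shiftA_mult: "(shiftA *v y) $ i = (if i = last_idx then 0 else y $ Min {i<..})"
  for y :: "'n::{finite,linorder} rvec"
proof -
  have "(shiftA *v y) $ i = (\<Sum>j\<in>UNIV. if pos j = pos i + 1 then y $ j else 0)"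
    by (auto simp: shiftA_def matrix_vector_mult_def intro!: sum.cong)
  also have "\<dots> = (if i = last_idx then 0 else y $ Min {i<..})"
  proof (cases "i = last_idx")
    case True
    then show ?thesis using pos_last_not_Suc[where 'n = 'n] by (simp del: One_nat_def add_Suc_right)
  next
    case False
    then show ?thesis by (simp only: pos_Suc_iff[OF False]) simp
  qed
  finally show ?thesis .
qed

lemma evec_nth: "(evec :: 'n::{finite,linorder} rvec) $ i = (if i = last_idx then 1 else 0)"
  by (simp add: evec_def axis_def)

lemma next_comp_eq: "next_comp y v i = (shiftA *v y) $ i + v * evec $ i"
  by (simp add: next_comp_def shiftA_mult evec_nth)

lemma norm_evec: "norm (evec :: 'n::{finite,linorder} rvec) = 1"
  by (simp add: evec_def norm_axis_1)

lemma inner_cvec: "cvec \<bullet> y = y $ fst_idx"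
  by (simp add: cvec_def inner_axis' )

lemma drift_eq: "drift f y v = (\<chi> i. f i y + next_comp y v i)"
  by (simp add: drift_def fvec_def vec_eq_iff next_comp_eq)

lemma diag_mult: "(diag x *v d) $ i = x $ i * d $ i"
  by (simp add: diag_def matrix_vector_mult_def if_distrib[of "\<lambda>x. x * _"] cong: if_cong)

lemma plant_rhs_eq:
  "(\<chi> i. f i x + next_comp x v i + g i x u * d $ i) = drift f x v + diag (\<chi> i. g i x u) *v d"
  by (simp add: drift_eq vec_eq_iff diag_mult)

lemma observer_rhs_eq:
  "(\<chi> i. f i z + next_comp z v i + \<theta> ^ pos i * p $ i * e) = drift f z v + e *\<^sub>R (\<chi> i. \<theta> ^ pos i * p $ i)"
  by (simp add: drift_eq vec_eq_iff)

lemma norm_sq_sum: "(norm v)\<^sup>2 = (\<Sum>i\<in>UNIV. (v $ i)\<^sup>2)" for v :: "'n::finite rvec"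
  by (simp add: norm_vec_def L2_set_def sum_nonneg)

lemma norm_vec_le_sqrt:
  fixes v :: "'n::finite rvec"
  assumes "\<And>i. \<bar>v $ i\<bar> \<le> c" "c \<ge> 0"
  shows "norm v \<le> sqrt (real CARD('n)) * c"
proof -
  have "(norm v)\<^sup>2 = (\<Sum>i\<in>UNIV. (v $ i)\<^sup>2)"
    by (rule norm_sq_sum)
  also have "\<dots> \<le> (\<Sum>i\<in>(UNIV :: 'n set). c\<^sup>2)"
    using assms by (intro sum_mono) (metis abs_le_square_iff abs_of_nonneg)
  also have "\<dots> = (sqrt (real CARD('n)) * c)\<^sup>2" by (simp add: power_mult_distrib)
  finally show ?thesis using assms by (intro power2_le_imp_le[of "norm v"]) auto
qed

lemma norm_vec_le_comp:
  fixes v w :: "'n::finite rvec"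
  assumes "\<And>i. \<bar>v $ i\<bar> \<le> c * \<bar>w $ i\<bar>" "c \<ge> 0"
  shows "norm v \<le> c * norm w"
proof -
  have "norm v \<le> norm (c *\<^sub>R w)"
    using assms by (intro norm_le_componentwise_cart) (simp add: abs_mult)
  then show ?thesis using assms by simp
qed

text \<open>The nonzero components of the product are components of y with distinct indices, because
  taking successors is injective.\<close>

lemma norm_shiftA_mult: "norm (shiftA *v y) \<le> norm y" for y :: "'n::{finite,linorder} rvec"
proof -
  let ?I = "UNIV - {last_idx :: 'n}" and ?s = "\<lambda>i :: 'n. Min {i<..}"
  have inj: "inj_on ?s ?I"
  proof (rule inj_onI)
    fix i j :: 'n assume "i \<in> ?I" "j \<in> ?I" "?s i = ?s j"
    then have "pos i + 1 = pos j + 1" by (metis DiffD2 insertI1 pos_Suc_iff)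
    then show "i = j" by (simp add: pos_inj)
  qed
  have "(norm (shiftA *v y))\<^sup>2 = (\<Sum>i\<in>UNIV. ((shiftA *v y) $ i)\<^sup>2)"
    by (rule norm_sq_sum)
  also have "\<dots> = (\<Sum>i\<in>?I. (y $ ?s i)\<^sup>2)"
    by (rule sum.mono_neutral_cong_right) (auto simp: shiftA_mult)
  also have "\<dots> = (\<Sum>i\<in>?s ` ?I. (y $ i)\<^sup>2)"
    by (simp add: sum.reindex[OF inj])
  also have "\<dots> \<le> (\<Sum>i\<in>UNIV. (y $ i)\<^sup>2)"
    by (intro sum_mono2) auto
  also have "\<dots> = (norm y)\<^sup>2"
    by (rule norm_sq_sum[symmetric])
  finally show ?thesis by (rule power2_le_imp_le) simp
qed

lemma sqrt_partial_le_norm: "sqrt (\<Sum>j\<le>i. (v $ j)\<^sup>2) \<le> norm v" for v :: "'n::{finite,linorder} rvec"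
proof -
  have "(\<Sum>j\<le>i. (v $ j)\<^sup>2) \<le> (\<Sum>j\<in>UNIV. (v $ j)\<^sup>2)" by (intro sum_mono2) auto
  also have "\<dots> = (norm v)\<^sup>2"
    by (rule norm_sq_sum[symmetric])
  finally show ?thesis by (simp add: real_le_lsqrt)
qed

section \<open>Lipschitz bounds for the nonlinearity and the drift\<close>

context
  fixes f :: "'n::{finite,linorder} \<Rightarrow> 'n rvec \<Rightarrow> real" and g and L G :: real
  assumes A: "assumption_A f g L G"
begin

lemma L_nonneg: "L \<ge> 0" and G_nonneg: "G \<ge> 0"
  using A by (auto simp: assumption_A_def)

lemma f_lipschitz: "\<bar>f i x - f i z\<bar> \<le> L * sqrt (\<Sum>j\<le>i. ((x - z) $ j)\<^sup>2)"
  using A by (auto simp: assumption_A_def)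

text \<open>Bounding the Euclidean norm by the sum of the absolute values of the components gives
  the constant nL. Together with the norm 1 of the shift matrix it becomes the nL + 1 of the
  hypotheses.\<close>

lemma fvec_lipschitz: "norm (fvec f x - fvec f z) \<le> real CARD('n) * L * norm (x - z)"
proof -
  have "norm (fvec f x - fvec f z) \<le> (\<Sum>i\<in>(UNIV :: 'n set). \<bar>(fvec f x - fvec f z) $ i\<bar>)"
    by (rule norm_le_l1_cart)
  also have "\<dots> \<le> (\<Sum>i\<in>(UNIV :: 'n set). L * norm (x - z))"
  proof (rule sum_mono)
    fix i
    have "\<bar>(fvec f x - fvec f z) $ i\<bar> \<le> L * sqrt (\<Sum>j\<le>i. ((x - z) $ j)\<^sup>2)"
      using f_lipschitz[of i x z] by (simp add: fvec_def)
    also have "\<dots> \<le> L * norm (x - z)"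
      by (intro mult_left_mono sqrt_partial_le_norm L_nonneg)
    finally show "\<bar>(fvec f x - fvec f z) $ i\<bar> \<le> L * norm (x - z)" .
  qed
  finally show ?thesis by simp
qed

lemma fvec_0: "fvec f 0 = 0"
  using A by (simp add: assumption_A_def fvec_def vec_eq_iff)

lemma drift_lipschitz:
  "norm (drift f y v - drift f y' v) \<le> (real CARD('n) * L + 1) * norm (y - y')"
proof -
  have "drift f y v - drift f y' v = (fvec f y - fvec f y') + shiftA *v (y - y')"
    by (simp add: drift_def matrix_vector_mult_diff_distrib)
  also have "norm \<dots> \<le> real CARD('n) * L * norm (y - y') + norm (y - y')"
    by (intro norm_triangle_le add_mono fvec_lipschitz norm_shiftA_mult)
  finally show ?thesis by (simp add: algebra_simps)
qed

lemma drift_bound: "norm (drift f y v) \<le> (real CARD('n) * L + 1) * norm y + \<bar>v\<bar>"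
proof -
  have "drift f y v = (drift f y v - drift f 0 v) + v *\<^sub>R evec"
    by (simp add: drift_def fvec_0)
  also have "norm \<dots> \<le> (real CARD('n) * L + 1) * norm (y - 0) + \<bar>v\<bar>"
    by (intro norm_triangle_le add_mono drift_lipschitz) (simp add: norm_evec)
  finally show ?thesis by simp
qed

lemma diag_bound: "norm (diag (\<chi> i. g i x u) *v d) \<le> G * norm d"
  using A by (intro norm_vec_le_comp)
    (auto simp: assumption_A_def diag_mult abs_mult intro: mult_right_mono)

end

section \<open>High-gain scaling of the observer error\<close>

definition hgw :: "real \<Rightarrow> 'n::{finite,linorder} \<Rightarrow> real"
  where "hgw \<theta> i = \<theta> / \<theta> ^ pos i"

text \<open>The weights \<open>hgw\<close> are \<theta>^(1-i), written as quotients because the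
  exponents are natural numbers. They are normalised to leave the first component, the measured one,
  unchanged.\<close>

definition hgscale :: "real \<Rightarrow> 'n::{finite,linorder} rvec \<Rightarrow> 'n rvec"
  where "hgscale \<theta> v = (\<chi> i. hgw \<theta> i * v $ i)"

lemma bounded_linear_hgscale: "bounded_linear (hgscale \<theta>)"
  by (rule linear_conv_bounded_linear[THEN iffD1])
     (auto intro!: linearI simp: hgscale_def vec_eq_iff algebra_simps)

context
  fixes \<theta> :: real
  assumes \<theta>: "\<theta> \<ge> 1"
begin

lemma hgweight_bounds:
  fixes i :: "'n::{finite,linorder}"
  shows "0 < hgw \<theta> i" "hgw \<theta> i \<le> 1" "1 \<le> \<theta> ^ CARD('n) * hgw \<theta> i"
proof -
  show "0 < hgw \<theta> i" using \<theta> by (simp add: hgw_def)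
  have "\<theta> ^ 1 \<le> \<theta> ^ pos i" using \<theta> pos_ge_1 by (intro power_increasing)
  then show "hgw \<theta> i \<le> 1" using \<theta> by (simp add: hgw_def)
  have "\<theta> ^ pos i \<le> \<theta> ^ CARD('n)" using \<theta> pos_le_card by (intro power_increasing)
  also have "\<dots> \<le> \<theta> ^ CARD('n) * \<theta>" using \<theta> by simp
  finally show "1 \<le> \<theta> ^ CARD('n) * hgw \<theta> i" using \<theta> by (simp add: hgw_def)
qed

lemma hgweight_antimono:
  fixes i j :: "'n::{finite,linorder}"
  assumes "j \<le> i"
  shows "hgw \<theta> i \<le> hgw \<theta> j"
  using pos_mono[OF assms] \<theta> unfolding hgw_def by (intro divide_left_mono power_increasing) auto

lemma norm_hgscale_le: "norm (hgscale \<theta> v) \<le> norm v"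
proof -
  have "\<bar>hgscale \<theta> v $ i\<bar> \<le> 1 * \<bar>v $ i\<bar>" for i
    using mult_right_mono[OF hgweight_bounds(2)[of i], of "\<bar>v $ i\<bar>"] hgweight_bounds(1)[of i]
    by (simp add: hgscale_def abs_mult)
  then show ?thesis using norm_vec_le_comp[of "hgscale \<theta> v" 1 v] by simp
qed

lemma norm_le_hgscale: "norm v \<le> \<theta> ^ CARD('n) * norm (hgscale \<theta> v)" for v :: "'n::{finite,linorder} rvec"
proof (rule norm_vec_le_comp)
  show "\<bar>v $ i\<bar> \<le> \<theta> ^ CARD('n) * \<bar>hgscale \<theta> v $ i\<bar>" for i
    using mult_right_mono[OF hgweight_bounds(3)[of i], of "\<bar>v $ i\<bar>"] hgweight_bounds(1)[of i]
    by (simp add: hgscale_def abs_mult mult.assoc)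
qed (use \<theta> in simp)

lemma hgscale_fst: "hgscale \<theta> v $ fst_idx = v $ fst_idx"
  using \<theta> by (simp add: hgscale_def hgw_def pos_fst_idx)

text \<open>The weight of the successor of i is the weight of i divided by \<theta>. With
  \<open>hgscale_gain\<close> this turns the linear part of the error equation into \<theta> (A + p
  c'), so the decay rate is proportional to \<theta>.\<close>

lemma hgscale_shiftA: "hgscale \<theta> (shiftA *v v) = \<theta> *\<^sub>R (shiftA *v hgscale \<theta> v)"
proof -
  have "hgw \<theta> i * v $ Min {i<..} = \<theta> * (hgw \<theta> (Min {i<..}) * v $ Min {i<..})"
    if "i \<noteq> last_idx" for i
    using \<theta> pos_Suc_iff[OF that, of "Min {i<..}"] by (simp add: hgw_def)
  then show ?thesis by (simp add: hgscale_def vec_eq_iff shiftA_mult)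
qed

lemma hgscale_gain: "hgscale \<theta> (\<chi> i. \<theta> ^ pos i * p $ i) = \<theta> *\<^sub>R p"
  using \<theta> by (simp add: hgscale_def hgw_def vec_eq_iff)

text \<open>The constant does not grow with \<theta>, and this is where the triangular structure
  enters: the component i of f depends on components j \<le> i only, whose weights are at least that
  of i. Hence a large \<theta> lets the linear part dominate.\<close>

lemma hgscale_fvec:
  fixes f :: "'n::{finite,linorder} \<Rightarrow> 'n rvec \<Rightarrow> real"
  assumes A: "assumption_A f g L G"
  shows "norm (hgscale \<theta> (fvec f z - fvec f y)) \<le> L * sqrt (real CARD('n)) * norm (hgscale \<theta> (z - y))"
proof -
  have "\<bar>hgscale \<theta> (fvec f z - fvec f y) $ i\<bar> \<le> L * norm (hgscale \<theta> (z - y))" for i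
  proof -
    let ?w = "hgw \<theta> :: 'n \<Rightarrow> real"
    have "\<bar>hgscale \<theta> (fvec f z - fvec f y) $ i\<bar> \<le> ?w i * (L * sqrt (\<Sum>j\<le>i. ((z - y) $ j)\<^sup>2))"
      using f_lipschitz[OF A, of i z y] hgweight_bounds(1)[of i] by (simp add: hgscale_def fvec_def abs_mult mult_left_mono less_imp_le)
    also have "\<dots> = L * sqrt (\<Sum>j\<le>i. (?w i * (z - y) $ j)\<^sup>2)"
      using hgweight_bounds(1)[of i] by (simp add: power_mult_distrib real_sqrt_mult flip: sum_distrib_left)
    also have "\<dots> \<le> L * sqrt (\<Sum>j\<le>i. (hgscale \<theta> (z - y) $ j)\<^sup>2)"
    proof (intro mult_left_mono real_sqrt_le_mono sum_mono L_nonneg[OF A])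
      fix j assume "j \<in> {..i}"
      then have "\<bar>?w i * (z - y) $ j\<bar> \<le> \<bar>?w j * (z - y) $ j\<bar>"
        using hgweight_antimono[of j i] hgweight_bounds(1)[of i] hgweight_bounds(1)[of j]
        unfolding abs_mult by (intro mult_right_mono) auto
      then show "(?w i * (z - y) $ j)\<^sup>2 \<le> (hgscale \<theta> (z - y) $ j)\<^sup>2"
        by (simp add: hgscale_def abs_le_square_iff)
    qed
    also have "\<dots> \<le> L * norm (hgscale \<theta> (z - y))"
      by (intro mult_left_mono sqrt_partial_le_norm L_nonneg[OF A])
    finally show ?thesis .
  qed
  then show ?thesis
    using norm_vec_le_sqrt[of "hgscale \<theta> (fvec f z - fvec f y)" "L * norm (hgscale \<theta> (z - y))"] L_nonneg[OF A]
    by (simp add: mult_ac)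
qed

end

section \<open>Closed-loop trajectories and crude bounds\<close>

locale predictor_feedback =
  fixes f :: "'n::{finite,linorder} \<Rightarrow> 'n rvec \<Rightarrow> real"
    and g :: "'n \<Rightarrow> 'n rvec \<Rightarrow> real \<Rightarrow> real"
    and P Q :: "'n rmat" and p k :: "'n rvec"
    and r \<tau> L G q \<mu> \<gamma> a K\<^sub>1 T\<^sub>1 T\<^sub>2 \<theta> T K :: real and l m :: nat
  assumes delays: "\<tau> \<ge> 0" "r \<ge> 0" "r + \<tau> > 0"
    and plant_fg: "plant_functions f g"
    and A: "assumption_A f g L G"
    and B: "assumption_B f g L Q q p P \<mu> \<gamma> k a K\<^sub>1 T\<^sub>1 T\<^sub>2"
    and theta: "\<theta> \<ge> 1"
    and lm: "l \<ge> 1" "m \<ge> 1" "real m > (real CARD('n) * L + 1) * (r + \<tau>)"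
    and T: "T = (r + \<tau>) / real m"
    and K: "predictor_constant f L r \<tau> m K"
    and sampling: "4 * norm (Q *v p) * (L + \<theta>) * T\<^sub>1 * sqrt (matnorm Q / a) < q"
    and gain: "\<theta> \<ge> max 1 (2 * matnorm Q * L * sqrt (real CARD('n)) / q)"
    and holding: "((real CARD('n) * L + 1 + norm k) * sqrt (evec \<bullet> (P *v evec) / (2 * K\<^sub>1)) + \<mu>)
        * norm k * (T\<^sub>2 + K * pred_err (real CARD('n) * L + 1) T l) < \<mu>"
begin

section \<open>Flow of the undisturbed plant and accuracy of the predictor\<close>

definition N :: real where "N = real CARD('n) * L + 1"

abbreviation R :: real where "R \<equiv> r + \<tau>"

text \<open>Relative error of the predictor: it multiplies |x| + sup |v| in the property defining
  K.\<close>

definition pe :: real where "pe = K * pred_err N T l"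

lemma N_ge_1: "N \<ge> 1"
  using L_nonneg[OF A] by (simp add: N_def)

lemma pos_consts: "\<mu> > 0" "\<gamma> > 0" "q > 0" "a > 0" "K\<^sub>1 > 0" "T\<^sub>1 > 0" "T\<^sub>2 > 0" "K > 0"
  using B K by (auto simp: assumption_B_def predictor_constant_def)

lemma pe_nonneg: "pe \<ge> 0"
proof -
  have "N * T < 1" "T > 0"
    using lm delays by (simp_all add: T N_def field_simps)
  then show ?thesis
    using pos_consts N_ge_1 by (simp add: pe_def pred_err_def)
qed

lemma norm_drift: "norm (drift f y v) \<le> N * norm y + \<bar>v\<bar>"
  using drift_bound[OF A] by (simp add: N_def)

lemma norm_drift_diff: "norm (drift f y v - drift f y' v) \<le> N * norm (y - y')"
  using drift_lipschitz[OF A] by (simp add: N_def)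

lemma continuous_on_drift: "continuous_on S (\<lambda>y. drift f y v)"
  by (rule lipschitz_on_continuous_on[of N])
     (use norm_drift_diff N_ge_1 in \<open>auto simp: lipschitz_on_def dist_norm\<close>)

lemma drift_measurable:
  fixes \<alpha> \<beta> :: real
  assumes y: "continuous_on {\<alpha>..\<beta>} y" and v: "v \<in> borel_measurable (lebesgue_on {\<alpha>..\<beta>})"
  shows "(\<lambda>s. drift f (y s) (v s)) \<in> borel_measurable (lebesgue_on {\<alpha>..\<beta>})"
proof -
  have "continuous_on {\<alpha>..\<beta>} (\<lambda>s. drift f (y s) 0)"
    using continuous_on_compose2[OF continuous_on_drift y] by blast
  then have "(\<lambda>s. drift f (y s) 0) \<in> borel_measurable (lebesgue_on {\<alpha>..\<beta>})"
    by (rule continuous_imp_measurable_on_sets_lebesgue) simp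
  then have "(\<lambda>s. drift f (y s) 0 + v s *\<^sub>R evec) \<in> borel_measurable (lebesgue_on {\<alpha>..\<beta>})"
    using v by (intro borel_measurable_add borel_measurable_scaleR) auto
  then show ?thesis by (simp add: drift_def)
qed

lemma extend_measurable:
  fixes v :: "real \<Rightarrow> 'b::euclidean_space"
  assumes "v \<in> borel_measurable (lebesgue_on {\<alpha>..<\<beta>})"
  shows "(\<lambda>s. if s \<in> {\<alpha>..<\<beta>} then v s else 0) \<in> borel_measurable (lebesgue_on S)"
  using assms by (intro measurable_restrict_space1) (simp add: borel_measurable_if del: atLeastLessThan_iff)

text \<open>The input is given on the half-open interval only. Its zero extension \<open>v'\<close>
  changes the right-hand side at most at \<beta>, a null set.\<close>

lemma flow_exists:
  assumes ab: "\<alpha> \<le> \<beta>" and v: "v \<in> borel_measurable (lebesgue_on {\<alpha>..<\<beta>})"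
    and V: "\<And>s. s \<in> {\<alpha>..<\<beta>} \<Longrightarrow> \<bar>v s\<bar> \<le> V"
  obtains y where "ac_solves {\<alpha>..\<beta>} y (\<lambda>t. drift f (y t) (v t))" "y \<alpha> = x0"
proof -
  define v' where "v' s = (if s \<in> {\<alpha>..<\<beta>} then v s else 0)" for s
  have v'm: "v' \<in> borel_measurable (lebesgue_on {\<alpha>..\<beta>})"
    unfolding v'_def by (rule extend_measurable[OF v])
  obtain y where y: "ac_solves {\<alpha>..\<beta>} y (\<lambda>t. drift f (y t) (v' t))" "y \<alpha> = x0"
  proof (rule volterra_exists[of \<alpha> \<beta> N "\<lambda>y t. drift f (y t) (v' t)" x0 "N * norm x0 + max V 0"])
    show "norm (drift f (y s) (v' s) - drift f (y' s) (v' s)) \<le> N * M"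
      if "s \<in> {\<alpha>..\<beta>}" "\<And>\<sigma>. \<sigma> \<in> {\<alpha>..s} \<Longrightarrow> norm (y \<sigma> - y' \<sigma>) \<le> M" for y y' s M
    proof -
      have "N * norm (y s - y' s) \<le> N * M" using that N_ge_1 by (intro mult_left_mono) auto
      then show ?thesis using norm_drift_diff order_trans by blast
    qed
    show "norm (drift f x0 (v' s)) \<le> N * norm x0 + max V 0" if "s \<in> {\<alpha>..\<beta>}" for s
      using norm_drift[of x0 "v' s"] V[of s] by (auto simp: v'_def split: if_splits)
  qed (use ab N_ge_1 drift_measurable[OF _ v'm] in auto)
  have "ac_solves {\<alpha>..\<beta>} y (\<lambda>t. drift f (y t) (v t))"
    using y(1) by (rule ac_solves_spike)
      (rule negligible_subset[of "{\<beta>}"], auto simp: v'_def split: if_splits)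
  then show thesis using y(2) by (rule that)
qed

lemma flow_bound:
  assumes x: "ac_solves {\<alpha>..\<beta>} x (\<lambda>t. drift f (x t) (v t) + D t)" and ab: "\<alpha> \<le> \<beta>"
    and U: "\<And>s. s \<in> {\<alpha>..<\<beta>} \<Longrightarrow> \<bar>v s\<bar> \<le> U" "\<And>s. s \<in> {\<alpha>..<\<beta>} \<Longrightarrow> norm (D s) \<le> W" "U \<ge> 0" "W \<ge> 0"
    and t: "t \<in> {\<alpha>..\<beta>}"
  shows "norm (x t) \<le> 2 * exp (2 * N * (\<beta> - \<alpha>)) * (norm (x \<alpha>) + (U + W) * (\<beta> - \<alpha>))"
proof (rule gronwall_memory[OF x ab _ _ _ t])
  fix s M assume s: "s \<in> {\<alpha>..<\<beta>}" and M: "\<And>\<sigma>. \<sigma> \<in> {\<alpha>..s} \<Longrightarrow> norm (x \<sigma>) \<le> M"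
  have "N * norm (x s) \<le> N * M" using s M N_ge_1 by (intro mult_left_mono) auto
  then show "norm (drift f (x s) (v s) + D s) \<le> N * M + (U + W)"
    using norm_drift[of "x s" "v s"] norm_triangle_ineq[of "drift f (x s) (v s)" "D s"] U(1)[OF s] U(2)[OF s]
    by linarith
qed (use N_ge_1 U in auto)

lemma flow_diff_bound:
  assumes x: "ac_solves {\<alpha>..\<beta>} x (\<lambda>t. drift f (x t) (v t) + D t)"
    and y: "ac_solves {\<alpha>..\<beta>} y (\<lambda>t. drift f (y t) (v t))" and ab: "\<alpha> \<le> \<beta>"
    and W: "\<And>s. s \<in> {\<alpha>..<\<beta>} \<Longrightarrow> norm (D s) \<le> W" "W \<ge> 0"
    and t: "t \<in> {\<alpha>..\<beta>}"
  shows "norm (y t - x t) \<le> 2 * exp (2 * N * (\<beta> - \<alpha>)) * (norm (y \<alpha> - x \<alpha>) + W * (\<beta> - \<alpha>))"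
proof (rule gronwall_memory[OF ac_solves_diff[OF y x] ab _ _ _ t])
  fix s M assume s: "s \<in> {\<alpha>..<\<beta>}" and M: "\<And>\<sigma>. \<sigma> \<in> {\<alpha>..s} \<Longrightarrow> norm (y \<sigma> - x \<sigma>) \<le> M"
  have "N * norm (y s - x s) \<le> N * M" using s M N_ge_1 by (intro mult_left_mono) auto
  have eq: "drift f (y s) (v s) - (drift f (x s) (v s) + D s) = (drift f (y s) (v s) - drift f (x s) (v s)) - D s"
    by simp
  show "norm (drift f (y s) (v s) - (drift f (x s) (v s) + D s)) \<le> N * M + W"
    unfolding eq using \<open>N * norm (y s - x s) \<le> N * M\<close> norm_drift_diff[of "y s" "v s" "x s"] W(1)[OF s] norm_triangle_ineq4[of "drift f (y s) (v s) - drift f (x s) (v s)" "D s"]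
    by linarith
qed (use N_ge_1 W in auto)

text \<open>Two comparisons are chained through the undisturbed flow y started at \<open>x0\<close>:
  the predictor against y, with relative error \<open>pe\<close>, and y against the disturbed motion
  X, by Gronwall. Thus \<open>x0\<close> may be an estimate of \<open>X 0\<close>, and D may be an
  actual disturbance.\<close>

lemma predictor_error:
  assumes v: "Linf {0..<R} UNIV v" and V: "\<And>s. s \<in> {0..<R} \<Longrightarrow> \<bar>v s\<bar> \<le> V"
    and X: "ac_solves {0..R} X (\<lambda>t. drift f (X t) (v t) + D t)"
    and W: "\<And>s. s \<in> {0..<R} \<Longrightarrow> norm (D s) \<le> W" "W \<ge> 0"
  shows "norm (Ppred f r \<tau> l m v x0 - X R)
     \<le> pe * (norm x0 + V) + 2 * exp (2 * N * R) * (norm (x0 - X 0) + W * R)"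
proof -
  have vm: "v \<in> borel_measurable (lebesgue_on {0..<R})" using v by (simp add: Linf_def)
  obtain y where y: "ac_solves {0..R} y (\<lambda>t. drift f (y t) (v t))" "y 0 = x0"
    using flow_exists[of 0 R v V] delays vm V by auto
  have "norm (Ppred f r \<tau> l m v x0 - y R) \<le> pe * (norm x0 + supnorm {0..<R} v)"
    using K[unfolded predictor_constant_def, THEN conjunct2, rule_format, OF lm(1), of v y x0] v y
    by (simp add: pe_def N_def flip: T)
  also have "\<dots> \<le> pe * (norm x0 + V)"
    unfolding supnorm_def using pe_nonneg delays V
    by (intro mult_left_mono add_left_mono cSUP_least) auto
  finally have 1: "norm (Ppred f r \<tau> l m v x0 - y R) \<le> pe * (norm x0 + V)" .
  have 2: "norm (y R - X R) \<le> 2 * exp (2 * N * R) * (norm (x0 - X 0) + W * R)"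
    using flow_diff_bound[OF X y(1) _ W, of R] y(2) delays by simp
  show ?thesis
    using 1 2 norm_triangle_ineq[of "Ppred f r \<tau> l m v x0 - y R" "y R - X R"] by simp
qed

text \<open>Here the motion compared with is the undisturbed flow from \<open>x0\<close> itself, so
  only the predictor error and the growth of that flow remain.\<close>

lemma predictor_bound:
  assumes v: "Linf {0..<R} UNIV v" and V: "\<And>s. s \<in> {0..<R} \<Longrightarrow> \<bar>v s\<bar> \<le> V"
  shows "norm (Ppred f r \<tau> l m v x0) \<le> (pe + 2 * exp (2 * N * R) * (1 + R)) * (norm x0 + V)"
proof -
  have "V \<ge> 0" using V[of 0] delays by simp
  have vm: "v \<in> borel_measurable (lebesgue_on {0..<R})" using v by (simp add: Linf_def)
  obtain y where y: "ac_solves {0..R} y (\<lambda>t. drift f (y t) (v t) + 0)" "y 0 = x0"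
    using flow_exists[of 0 R v V] delays vm V by auto
  have "norm (Ppred f r \<tau> l m v x0 - y R) \<le> pe * (norm x0 + V)"
    using predictor_error[OF v V y(1), of 0 x0] y(2) by simp
  moreover have "norm (y R) \<le> 2 * exp (2 * N * R) * (norm x0 + (V + 0) * R)"
    using flow_bound[OF y(1) _ V, of 0 R] \<open>V \<ge> 0\<close> y(2) delays by simp
  moreover have "\<dots> \<le> 2 * exp (2 * N * R) * ((1 + R) * (norm x0 + V))"
    using \<open>V \<ge> 0\<close> delays by (intro mult_left_mono) (auto simp: algebra_simps)
  ultimately show ?thesis
    using norm_triangle_sub[of "Ppred f r \<tau> l m v x0" "y R"] by (simp add: algebra_simps)
qed

section \<open>Trajectories on a finite horizon and their growth\<close>

definition inj_gain :: "'n rvec" where "inj_gain = (\<chi> i. \<theta> ^ pos i * p $ i)"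

text \<open>
  \<open>x\<close> is the plant state up to time \<open>H\<close>, continued up to time \<open>H + \<tau>\<close> without disturbance. This makes
  the state that is predicted at time \<open>H\<close> independent of future disturbances.
\<close>

definition trajectory ::
  "real \<Rightarrow> real \<Rightarrow> real \<Rightarrow> (real \<Rightarrow> 'n rvec) \<Rightarrow> (real \<Rightarrow> real) \<Rightarrow> (real \<Rightarrow> 'n rvec) \<Rightarrow> (real \<Rightarrow> real)
    \<Rightarrow> (real \<Rightarrow> real) \<Rightarrow> (real \<Rightarrow> 'n rvec) \<Rightarrow> (real \<Rightarrow> 'n rvec) \<Rightarrow> (nat \<Rightarrow> real) \<Rightarrow> bool"
  where "trajectory H J \<sigma> x u z w \<xi> d D ts \<longleftrightarrow> 0 \<le> H \<and> 0 \<le> J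
    \<and> ac_solves {0..H + \<tau>} x (\<lambda>t. drift f (x t) (u (t - \<tau>)) + D t)
    \<and> (\<forall>t\<in>{0..H + \<tau>}. norm (D t) \<le> G * norm (d t))
    \<and> (\<forall>t\<in>{0..H + \<tau>}. x t \<bullet> (P *v (drift f (x t) (k \<bullet> x t) + D t))
          \<le> - 2 * \<mu> * (x t \<bullet> (P *v x t)) + \<gamma> * (norm (d t))\<^sup>2)
    \<and> (\<forall>t\<in>{0..H + \<tau>}. norm (d t) \<le> exp (- \<sigma> * t) * J)
    \<and> ac_solves {0..H} z (\<lambda>t. drift f (z t) (u (t - r - \<tau>)) + (z t $ fst_idx - w t) *\<^sub>R inj_gain)
    \<and> ts 0 = 0 \<and> (\<forall>i. ts i < ts (Suc i) \<and> ts (Suc i) \<le> ts i + T\<^sub>1) \<and> (\<forall>t. \<exists>i. t < ts i)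
    \<and> (\<forall>i. ac_solves {ts i..<ts (Suc i)} w (\<lambda>t. drift f (z t) (u (t - r - \<tau>)) $ fst_idx))
    \<and> (\<forall>i. ts (Suc i) \<le> H \<longrightarrow> w (ts (Suc i)) = x (ts (Suc i) - r) $ fst_idx + \<xi> (ts (Suc i)))
    \<and> (\<forall>t\<in>{0..H}. \<bar>\<xi> t\<bar> \<le> exp (- \<sigma> * t) * J)
    \<and> feedback f r \<tau> k T\<^sub>2 l m u z
    \<and> (\<forall>t\<in>{-r..0}. norm (x t) \<le> J) \<and> (\<forall>t\<in>{-r-\<tau>..<0}. \<bar>u t\<bar> \<le> J)
    \<and> norm (z 0) \<le> J \<and> \<bar>w 0\<bar> \<le> J
    \<and> (\<forall>i::nat. Linf {0..<R} UNIV (\<lambda>s. u (real i * T\<^sub>2 + (s - r - \<tau>))))"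

lemma trajectoryD:
  assumes "trajectory H J \<sigma> x u z w \<xi> d D ts"
  shows "0 \<le> H" "0 \<le> J"
    and "ac_solves {0..H + \<tau>} x (\<lambda>t. drift f (x t) (u (t - \<tau>)) + D t)"
    and "\<And>t. t \<in> {0..H + \<tau>} \<Longrightarrow> norm (D t) \<le> G * norm (d t)"
    and "\<And>t. t \<in> {0..H + \<tau>} \<Longrightarrow> x t \<bullet> (P *v (drift f (x t) (k \<bullet> x t) + D t))
          \<le> - 2 * \<mu> * (x t \<bullet> (P *v x t)) + \<gamma> * (norm (d t))\<^sup>2"
    and "\<And>t. t \<in> {0..H + \<tau>} \<Longrightarrow> norm (d t) \<le> exp (- \<sigma> * t) * J"
    and "ac_solves {0..H} z (\<lambda>t. drift f (z t) (u (t - r - \<tau>)) + (z t $ fst_idx - w t) *\<^sub>R inj_gain)"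
    and "ts 0 = 0" "\<And>i. ts i < ts (Suc i)" "\<And>i. ts (Suc i) \<le> ts i + T\<^sub>1" "\<And>t. \<exists>i. t < ts i"
    and "\<And>i. ac_solves {ts i..<ts (Suc i)} w (\<lambda>t. drift f (z t) (u (t - r - \<tau>)) $ fst_idx)"
    and "\<And>i. ts (Suc i) \<le> H \<Longrightarrow> w (ts (Suc i)) = x (ts (Suc i) - r) $ fst_idx + \<xi> (ts (Suc i))"
    and "\<And>t. t \<in> {0..H} \<Longrightarrow> \<bar>\<xi> t\<bar> \<le> exp (- \<sigma> * t) * J"
    and "feedback f r \<tau> k T\<^sub>2 l m u z"
    and "\<And>t. t \<in> {-r..0} \<Longrightarrow> norm (x t) \<le> J" "\<And>t. t \<in> {-r-\<tau>..<0} \<Longrightarrow> \<bar>u t\<bar> \<le> J"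
    and "norm (z 0) \<le> J" "\<bar>w 0\<bar> \<le> J"
    and "\<And>i::nat. Linf {0..<R} UNIV (\<lambda>s. u (real i * T\<^sub>2 + (s - r - \<tau>)))"
  using assms unfolding trajectory_def by blast+

lemma sampling_interval:
  fixes ts :: "nat \<Rightarrow> real"
  assumes "ts 0 \<le> t" "\<exists>i. t < ts i"
  obtains i where "ts i \<le> t" "t < ts (Suc i)"
proof -
  define i where "i = (LEAST i. t < ts i)"
  have i: "t < ts i" using assms(2) unfolding i_def by (rule LeastI_ex)
  have "i \<noteq> 0" using i assms(1) by (metis not_le)
  then obtain j where j: "i = Suc j" using not0_implies_Suc by blast
  have "\<not> t < ts j" using not_less_Least[of j "\<lambda>i. t < ts i"] j by (simp add: i_def)
  then show thesis using that[of j] i j by simp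
qed

lemma norm_nth_le: "\<bar>x $ i\<bar> \<le> norm x" for x :: "'n rvec"
  using component_le_norm_cart .

lemma ts_mono:
  assumes "trajectory H J \<sigma> x u z w \<xi> d D ts"
  shows "i \<le> j \<Longrightarrow> ts i \<le> ts j" "0 \<le> ts i"
proof -
  show 1: "i \<le> j \<Longrightarrow> ts i \<le> ts j" for i j
    using lift_Suc_mono_le[of ts] trajectoryD(9)[OF assms] less_imp_le by blast
  show "0 \<le> ts i" using 1[of 0 i] trajectoryD(8)[OF assms] by simp
qed

lemma decaying_le:
  assumes "\<sigma> \<ge> 0" "0 \<le> t" "J \<ge> 0"
  shows "exp (- \<sigma> * t) * J \<le> (J :: real)"
  using assms by (simp add: mult_left_le_one_le)

lemma inter_sample_bound:
  assumes tr: "trajectory H J \<sigma> x u z w \<xi> d D ts" and i: "ts i \<le> s" "s < ts (Suc i)"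
    and M: "\<And>\<rho>. \<rho> \<in> {0..s} \<Longrightarrow> norm (z \<rho>) \<le> M" and U: "\<And>\<rho>. \<rho> \<in> {0..<s} \<Longrightarrow> \<bar>u (\<rho> - r - \<tau>)\<bar> \<le> U"
    and U0: "U \<ge> 0"
  shows "\<bar>w s\<bar> \<le> \<bar>w (ts i)\<bar> + (N * M + U) * s"
proof -
  have i0: "0 \<le> ts i" using ts_mono(2)[OF tr] .
  have "0 \<le> M" using M[of s] i i0 norm_ge_zero order_trans by (metis atLeastAtMost_iff order_refl)
  have "norm (w s - w (ts i)) \<le> (N * M + U) * (s - ts i)"
  proof (rule ac_solves_const_bound)
    show "ac_solves {ts i..s} w (\<lambda>t. drift f (z t) (u (t - r - \<tau>)) $ fst_idx)"
      using trajectoryD(12)[OF tr, of i] by (rule ac_solves_subset) (use i in auto)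
    fix \<rho> assume \<rho>: "\<rho> \<in> {ts i..<s}"
    have "norm (drift f (z \<rho>) (u (\<rho> - r - \<tau>)) $ fst_idx) \<le> norm (drift f (z \<rho>) (u (\<rho> - r - \<tau>)))"
      using norm_nth_le by simp
    also have "\<dots> \<le> N * norm (z \<rho>) + \<bar>u (\<rho> - r - \<tau>)\<bar>" by (rule norm_drift)
    also have "\<dots> \<le> N * M + U"
      using \<rho> i0 M U N_ge_1 by (intro add_mono mult_left_mono) auto
    finally show "norm (drift f (z \<rho>) (u (\<rho> - r - \<tau>)) $ fst_idx) \<le> N * M + U" .
  qed (use i in auto)
  also have "\<dots> \<le> (N * M + U) * s"
    using i0 U0 \<open>0 \<le> M\<close> N_ge_1 by (intro mult_left_mono) auto
  finally show ?thesis by auto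
qed

text \<open>At index 0 the value is the initial datum \<open>w 0\<close>; at every later sample it
  is a delayed output plus a measurement error.\<close>

lemma sampled_value_bound:
  assumes tr: "trajectory H J \<sigma> x u z w \<xi> d D ts" and \<sigma>: "\<sigma> \<ge> 0" and i: "ts i \<le> H"
    and X: "\<And>t. t \<in> {-r..ts i - r} \<Longrightarrow> norm (x t) \<le> X" "X \<ge> 0"
  shows "\<bar>w (ts i)\<bar> \<le> X + J"
proof (cases i)
  case 0
  then show ?thesis using trajectoryD(8,19)[OF tr] X by simp
next
  case (Suc j)
  have "\<bar>\<xi> (ts i)\<bar> \<le> J"
    using trajectoryD(14)[OF tr, of "ts i"] i ts_mono(2)[OF tr, of i] decaying_le[OF \<sigma> _ trajectoryD(2)[OF tr], of "ts i"]
    by simp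
  moreover have "\<bar>x (ts i - r) $ fst_idx\<bar> \<le> X"
    using norm_nth_le X(1)[of "ts i - r"] ts_mono(2)[OF tr, of i] order_trans by fastforce
  ultimately show ?thesis using trajectoryD(13)[OF tr, of j] i Suc by simp
qed

text \<open>Since the last sample, w has integrated the drift along z, so |w(s)| is bounded by data
  and by the running maximum of |z| up to s. The equation of z is then of the form treated by
  \<open>gronwall_memory\<close>, and C depends on \<open>b0\<close> but not on the sampling
  times.\<close>

lemma crude_observer_bound:
  assumes b0: "b0 \<ge> 0" and c1: "c1 \<ge> 0" and \<sigma>: "\<sigma> \<ge> 0"
  shows "\<exists>C\<ge>0. \<forall>H J x u z w \<xi> d D ts b. trajectory H J \<sigma> x u z w \<xi> d D ts \<longrightarrow> 0 \<le> b \<longrightarrow> b \<le> b0 \<longrightarrow> b \<le> H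
    \<longrightarrow> (\<forall>s\<in>{0..<b}. \<bar>u (s - r - \<tau>)\<bar> \<le> c1 * J) \<longrightarrow> (\<forall>s\<in>{-r..b-r}. norm (x s) \<le> c1 * J)
    \<longrightarrow> (\<forall>t\<in>{0..b}. norm (z t) \<le> C * J \<and> \<bar>w t\<bar> \<le> C * J)"
proof -
  define h where "h = norm inj_gain"
  have h0: "h \<ge> 0" by (simp add: h_def)
  \<comment> \<open>Coefficient of the running maximum of |z|: N from the drift, h from the first
    component of z in the injection, and \<open>h * N * b0\<close> from w, which integrates the
    drift for a time of at most \<open>b0\<close>. In the same way \<open>B1\<close> collects the
    coefficients of J.\<close>
  define c where "c = N + h + h * N * b0"
  define B1 where "B1 = c1 + h * ((c1 + 1) + c1 * b0)"
  define Cz where "Cz = 2 * exp (2 * c * b0) * (1 + B1 * b0)"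
  define Cw where "Cw = (c1 + 1) + (N * Cz + c1) * b0"
  have N0: "N \<ge> 0" using N_ge_1 by simp
  have c0: "c > 0" using N_ge_1 h0 b0 by (simp add: c_def add_pos_nonneg)
  have B10: "B1 \<ge> 0" using c1 h0 b0 by (simp add: B1_def)
  have Cz0: "Cz \<ge> 0" using B10 b0 by (simp add: Cz_def)
  have Cw0: "Cw \<ge> 0" using Cz0 b0 c1 N0 by (simp add: Cw_def)
  have main: "norm (z t) \<le> Cz * J \<and> \<bar>w t\<bar> \<le> Cw * J"
    if tr: "trajectory H J \<sigma> x u z w \<xi> d D ts" and b: "0 \<le> b" "b \<le> b0" "b \<le> H"
      and u: "\<forall>s\<in>{0..<b}. \<bar>u (s - r - \<tau>)\<bar> \<le> c1 * J" and x: "\<forall>s\<in>{-r..b-r}. norm (x s) \<le> c1 * J"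
      and t: "t \<in> {0..b}" for H J x u z w \<xi> d D ts b t
  proof -
    have J0: "J \<ge> 0" using trajectoryD(2)[OF tr] .
    have cJ: "c1 * J \<ge> 0" using c1 J0 by simp
    have wb: "\<bar>w s\<bar> \<le> (c1 + 1) * J + (N * M + c1 * J) * b0"
      if s: "s \<in> {0..b}" and M: "\<And>\<rho>. \<rho> \<in> {0..s} \<Longrightarrow> norm (z \<rho>) \<le> M" for s M
    proof -
      obtain i where i: "ts i \<le> s" "s < ts (Suc i)"
        using sampling_interval[of ts s] trajectoryD(8,11)[OF tr] s by auto
      have "0 \<le> M" using M[of s] s norm_ge_zero order_trans by (metis atLeastAtMost_iff order_refl)
      have "\<bar>w s\<bar> \<le> \<bar>w (ts i)\<bar> + (N * M + c1 * J) * s"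
        using s u cJ by (intro inter_sample_bound[OF tr i M]) auto
      also have "\<bar>w (ts i)\<bar> \<le> c1 * J + J"
        using i s b x cJ by (intro sampled_value_bound[OF tr \<sigma>]) auto
      also have "(N * M + c1 * J) * s \<le> (N * M + c1 * J) * b0"
        using s b cJ \<open>0 \<le> M\<close> N0 by (intro mult_left_mono) auto
      finally show ?thesis by (simp add: algebra_simps)
    qed
    have zac: "ac_solves {0..b} z (\<lambda>t. drift f (z t) (u (t - r - \<tau>)) + (z t $ fst_idx - w t) *\<^sub>R inj_gain)"
      using trajectoryD(7)[OF tr] by (rule ac_solves_subset) (use b in auto)
    have zb: "norm (z t) \<le> Cz * J" if t: "t \<in> {0..b}" for t
    proof -
      have "norm (z t) \<le> 2 * exp (2 * c * (b - 0)) * (norm (z 0) + (B1 * J) * (b - 0))"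
      proof (rule gronwall_memory[OF zac b(1) c0 _ _ t])
        fix s M assume s: "s \<in> {0..<b}" and M: "\<And>\<rho>. \<rho> \<in> {0..s} \<Longrightarrow> norm (z \<rho>) \<le> M"
        have zM: "norm (z s) \<le> M" using s M by auto
        have "norm (drift f (z s) (u (s - r - \<tau>))) \<le> N * M + c1 * J"
          using norm_drift[of "z s" "u (s - r - \<tau>)"] mult_left_mono[OF zM N0] u s by fastforce
        moreover have "norm ((z s $ fst_idx - w s) *\<^sub>R inj_gain) \<le> (M + ((c1 + 1) * J + (N * M + c1 * J) * b0)) * h"
        proof -
          have "\<bar>z s $ fst_idx - w s\<bar> \<le> M + ((c1 + 1) * J + (N * M + c1 * J) * b0)"
            using wb[OF _ M] s zM norm_nth_le[of "z s" fst_idx] by fastforce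
          then show ?thesis by (simp add: h_def mult_right_mono)
        qed
        ultimately have "norm (drift f (z s) (u (s - r - \<tau>)) + (z s $ fst_idx - w s) *\<^sub>R inj_gain)
           \<le> (N * M + c1 * J) + (M + ((c1 + 1) * J + (N * M + c1 * J) * b0)) * h"
          by (intro norm_triangle_le) linarith
        also have "\<dots> = c * M + B1 * J" by (simp add: c_def B1_def algebra_simps)
        finally show "norm (drift f (z s) (u (s - r - \<tau>)) + (z s $ fst_idx - w s) *\<^sub>R inj_gain) \<le> c * M + B1 * J" .
      qed (use B10 J0 in simp)
      also have "\<dots> \<le> 2 * exp (2 * c * b0) * (J + (B1 * J) * b0)"
        using b c0 trajectoryD(18)[OF tr] B10 J0 by (intro mult_mono add_mono mult_left_mono) auto
      also have "\<dots> = Cz * J" by (simp add: Cz_def algebra_simps)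
      finally show ?thesis .
    qed
    have "\<bar>w t\<bar> \<le> (c1 + 1) * J + (N * (Cz * J) + c1 * J) * b0"
      using t zb by (intro wb) auto
    also have "\<dots> = Cw * J" by (simp add: Cw_def algebra_simps)
    finally show ?thesis using zb[OF t] by simp
  qed
  have le: "Cz * J \<le> max Cz Cw * J" "Cw * J \<le> max Cz Cw * J" if "J \<ge> 0" for J
    using that by (auto intro: mult_right_mono)
  show ?thesis
  proof (intro exI[of _ "max Cz Cw"] conjI allI impI ballI)
    fix H J x u z w \<xi> d D ts b t
    assume tr: "trajectory H J \<sigma> x u z w \<xi> d D ts" and b: "0 \<le> b" "b \<le> b0" "b \<le> H"
      and u: "\<forall>s\<in>{0..<b}. \<bar>u (s - r - \<tau>)\<bar> \<le> c1 * J" and x: "\<forall>s\<in>{-r..b-r}. norm (x s) \<le> c1 * J"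
      and t: "t \<in> {0..b}"
    note m = main[OF tr b u x t]
    show "norm (z t) \<le> max Cz Cw * J" "\<bar>w t\<bar> \<le> max Cz Cw * J"
      using m le[OF trajectoryD(2)[OF tr]] by linarith+
  qed (use Cz0 in auto)
qed

lemma feedback_value:
  assumes "feedback f r \<tau> k T\<^sub>2 l m u z" "real i * T\<^sub>2 \<le> t" "t < real (Suc i) * T\<^sub>2"
  shows "u t = k \<bullet> Ppred f r \<tau> l m (\<lambda>s. u (real i * T\<^sub>2 + (s - r - \<tau>))) (z (real i * T\<^sub>2))"
  using assms unfolding feedback_def Phi_def history_def by (simp add: mult.commute)

lemma crude_plant_bound:
  assumes tr: "trajectory H J \<sigma> x u z w \<xi> d D ts" and \<sigma>: "\<sigma> \<ge> 0" and b: "0 \<le> b" "b \<le> b0" "b \<le> H + \<tau>"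
    and u: "\<And>s. s \<in> {0..<b} \<Longrightarrow> \<bar>u (s - \<tau>)\<bar> \<le> c1 * J" and c1: "c1 \<ge> 0" and t: "t \<in> {0..b}"
  shows "norm (x t) \<le> 2 * exp (2 * N * b0) * (1 + (c1 + G) * b0) * J"
proof -
  have J0: "J \<ge> 0" using trajectoryD(2)[OF tr] .
  have G0: "G \<ge> 0" using G_nonneg[OF A] .
  have "norm (x t) \<le> 2 * exp (2 * N * (b - 0)) * (norm (x 0) + (c1 * J + G * J) * (b - 0))"
  proof (rule flow_bound[OF _ b(1)])
    show "ac_solves {0..b} x (\<lambda>t. drift f (x t) (u (t - \<tau>)) + D t)"
      using trajectoryD(3)[OF tr] by (rule ac_solves_subset) (use b in auto)
    fix s assume s: "s \<in> {0..<b}"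
    have "norm (D s) \<le> G * norm (d s)" using trajectoryD(4)[OF tr, of s] s b by auto
    also have "\<dots> \<le> G * (exp (- \<sigma> * s) * J)"
      using trajectoryD(6)[OF tr, of s] s b G0 by (intro mult_left_mono) auto
    also have "\<dots> \<le> G * J"
      using decaying_le[OF \<sigma> _ J0, of s] s G0 by (intro mult_left_mono) auto
    finally show "norm (D s) \<le> G * J" .
  qed (use u t c1 J0 G0 in auto)
  also have "\<dots> \<le> 2 * exp (2 * N * b0) * (J + (c1 * J + G * J) * b0)"
    using b N_ge_1 trajectoryD(16)[OF tr, of 0] delays c1 J0 G0 by (intro mult_mono add_mono) auto
  finally show ?thesis by (simp add: algebra_simps)
qed

text \<open>Induction over the holding intervals. The input on the interval number i is computed
  from z at its left end and from earlier input, both already bounded; this bounds the plant up to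
  the next holding instant, and then the observer. C depends on i and \<sigma> but not on J, H or
  the trajectory.\<close>

lemma crude_bound:
  assumes \<sigma>: "\<sigma> \<ge> 0"
  shows "\<exists>C\<ge>0. \<forall>H J x u z w \<xi> d D ts. trajectory H J \<sigma> x u z w \<xi> d D ts \<longrightarrow>
     (\<forall>t\<in>{0..H}. t \<le> real i * T\<^sub>2 \<longrightarrow> norm (z t) \<le> C * J \<and> \<bar>w t\<bar> \<le> C * J \<and> norm (x t) \<le> C * J)
     \<and> (\<forall>s\<in>{-r-\<tau>..H}. s < real i * T\<^sub>2 \<longrightarrow> \<bar>u s\<bar> \<le> C * J)"
proof (induction i)
  case 0
  show ?case
  proof (intro exI[of _ 1] conjI allI impI ballI)
    fix H J x u z w \<xi> d D ts t
    assume tr: "trajectory H J \<sigma> x u z w \<xi> d D ts"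
    show "norm (z t) \<le> 1 * J" "\<bar>w t\<bar> \<le> 1 * J" "norm (x t) \<le> 1 * J" if "t \<in> {0..H}" "t \<le> real 0 * T\<^sub>2"
      using that trajectoryD(18,19)[OF tr] trajectoryD(16)[OF tr, of 0] delays by auto
    show "\<bar>u t\<bar> \<le> 1 * J" if "t \<in> {-r-\<tau>..H}" "t < real 0 * T\<^sub>2"
      using that trajectoryD(17)[OF tr, of t] by auto
  qed auto
next
  case (Suc i)
  then obtain C where C0: "C \<ge> 0" and C: "\<And>H J x u z w \<xi> d D ts. trajectory H J \<sigma> x u z w \<xi> d D ts \<Longrightarrow>
     (\<forall>t\<in>{0..H}. t \<le> real i * T\<^sub>2 \<longrightarrow> norm (z t) \<le> C * J \<and> \<bar>w t\<bar> \<le> C * J \<and> norm (x t) \<le> C * J)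
     \<and> (\<forall>s\<in>{-r-\<tau>..H}. s < real i * T\<^sub>2 \<longrightarrow> \<bar>u s\<bar> \<le> C * J)" by blast
  define b0 where "b0 = real (Suc i) * T\<^sub>2"
  have b00: "b0 \<ge> 0" using pos_consts by (simp add: b0_def)
  have G0: "G \<ge> 0" using G_nonneg[OF A] .
  define Cp where "Cp = pe + 2 * exp (2 * N * R) * (1 + R)"
  have Cp0: "Cp \<ge> 0" using pe_nonneg delays by (simp add: Cp_def)
  \<comment> \<open>The factor \<open>2 * C\<close> stems from the two arguments of the predictor,
    the state estimate and the past input, each bounded by \<open>C * J\<close>.\<close>
  define Cu where "Cu = max C (norm k * (Cp * (2 * C)))"
  have Cu0: "Cu \<ge> 0" using C0 by (simp add: Cu_def)
  define Cx where "Cx = 2 * exp (2 * N * b0) * (1 + (Cu + G) * b0)"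
  have Cx0: "Cx \<ge> 0" using b00 Cu0 G0 by (simp add: Cx_def)
  define c1 where "c1 = Cu + Cx + 1"
  have c10: "c1 \<ge> 0" using Cu0 Cx0 by (simp add: c1_def)
  obtain Cz where Cz0: "Cz \<ge> 0" and Cz: "\<And>H J x u z w \<xi> d D ts b t. \<lbrakk>trajectory H J \<sigma> x u z w \<xi> d D ts; 0 \<le> b; b \<le> b0; b \<le> H;
     \<forall>s\<in>{0..<b}. \<bar>u (s - r - \<tau>)\<bar> \<le> c1 * J; \<forall>s\<in>{-r..b-r}. norm (x s) \<le> c1 * J; t \<in> {0..b}\<rbrakk>
     \<Longrightarrow> norm (z t) \<le> Cz * J \<and> \<bar>w t\<bar> \<le> Cz * J"
    using crude_observer_bound[OF b00 c10 \<sigma>] by metis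
  define C' where "C' = c1 + Cz"
  show ?case
  proof (intro exI[of _ C'] conjI allI impI)
    show "C' \<ge> 0" using c10 Cz0 by (simp add: C'_def)
    fix H J x u z w \<xi> d D ts
    assume tr: "trajectory H J \<sigma> x u z w \<xi> d D ts"
    have J0: "J \<ge> 0" using trajectoryD(2)[OF tr] .
    have le: "Cu * J \<le> c1 * J" "Cx * J \<le> c1 * J" "J \<le> c1 * J" "c1 * J \<le> C' * J" "Cz * J \<le> C' * J" "C * J \<le> Cu * J"
    proof -
      show "J \<le> c1 * J" using mult_right_mono[OF _ J0, of 1 c1] Cu0 Cx0 by (simp add: c1_def)
    qed (use Cu0 Cx0 c10 Cz0 J0 in \<open>auto simp: c1_def C'_def Cu_def intro!: mult_right_mono\<close>)
    have ub: "\<bar>u s\<bar> \<le> Cu * J" if s: "s \<in> {-r-\<tau>..H}" "s < b0" for s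
    proof (cases "s < real i * T\<^sub>2")
      case True
      then show ?thesis using C[OF tr] s le(6) by force
    next
      case False
      have iH: "real i * T\<^sub>2 \<le> H" "real i * T\<^sub>2 \<ge> 0" using False s pos_consts by auto
      have "\<bar>u s\<bar> = \<bar>k \<bullet> Ppred f r \<tau> l m (\<lambda>s. u (real i * T\<^sub>2 + (s - r - \<tau>))) (z (real i * T\<^sub>2))\<bar>"
        using False s by (subst feedback_value[OF trajectoryD(15)[OF tr], of i]) (auto simp: b0_def)
      also have "\<dots> \<le> norm k * norm (Ppred f r \<tau> l m (\<lambda>s. u (real i * T\<^sub>2 + (s - r - \<tau>))) (z (real i * T\<^sub>2)))"
        by (rule Cauchy_Schwarz_ineq2)
      also have "\<dots> \<le> norm k * (Cp * (norm (z (real i * T\<^sub>2)) + C * J))"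
        unfolding Cp_def
      proof (intro mult_left_mono predictor_bound)
        show "Linf {0..<R} UNIV (\<lambda>s. u (real i * T\<^sub>2 + (s - r - \<tau>)))" using trajectoryD(20)[OF tr] .
        show "\<bar>u (real i * T\<^sub>2 + (s - r - \<tau>))\<bar> \<le> C * J" if "s \<in> {0..<R}" for s
          using C[OF tr] that iH by auto
      qed simp
      also have "\<dots> \<le> norm k * (Cp * (C * J + C * J))"
        using C[OF tr] iH Cp0 C0 J0 by (intro mult_left_mono add_mono) auto
      also have "\<dots> = norm k * (Cp * (2 * C)) * J" by simp
      also have "\<dots> \<le> Cu * J" using J0 by (intro mult_right_mono) (auto simp: Cu_def)
      finally show ?thesis .
    qed
    define b where "b = min b0 H"
    have b: "0 \<le> b" "b \<le> b0" "b \<le> H" using b00 trajectoryD(1)[OF tr] by (auto simp: b_def)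
    have xb: "norm (x t) \<le> Cx * J" if "t \<in> {0..b}" for t
      unfolding Cx_def
      by (rule crude_plant_bound[OF tr \<sigma> b(1,2) _ _ Cu0 that]) (use b delays ub in auto)
    have xb': "norm (x t) \<le> c1 * J" if "t \<in> {-r..b}" for t
      using xb[of t] trajectoryD(16)[OF tr, of t] that le by (cases "t < 0") force+
    have ub': "\<bar>u (s - r - \<tau>)\<bar> \<le> c1 * J" if "s \<in> {0..<b}" for s
      using ub[of "s - r - \<tau>"] that le(1) b delays by force
    have zb: "norm (z t) \<le> Cz * J \<and> \<bar>w t\<bar> \<le> Cz * J" if "t \<in> {0..b}" for t
      using Cz[OF tr b _ _ that] ub' xb' delays by auto
    show "\<forall>t\<in>{0..H}. t \<le> real (Suc i) * T\<^sub>2 \<longrightarrow> norm (z t) \<le> C' * J \<and> \<bar>w t\<bar> \<le> C' * J \<and> norm (x t) \<le> C' * J"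
    proof (intro ballI impI)
      fix t assume "t \<in> {0..H}" "t \<le> real (Suc i) * T\<^sub>2"
      then have t: "t \<in> {0..b}" by (auto simp: b_def b0_def)
      then show "norm (z t) \<le> C' * J \<and> \<bar>w t\<bar> \<le> C' * J \<and> norm (x t) \<le> C' * J"
        using zb[OF t] xb[OF t] le by linarith
    qed
    show "\<forall>s\<in>{-r-\<tau>..H}. s < real (Suc i) * T\<^sub>2 \<longrightarrow> \<bar>u s\<bar> \<le> C' * J"
      using ub le unfolding b0_def by (meson order_trans)
  qed
qed

end

section \<open>Convergence of the observer\<close>

text \<open>Used to convert a strict gain condition at \<sigma> = 0 into one that tolerates the
  weights e^(\<sigma> c) created by delays, sampling and holding.\<close>

lemma exp_slack:
  fixes \<kappa> c :: real
  assumes "\<kappa> < 1" "c \<ge> 0"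
  shows "\<exists>s>0. \<forall>\<sigma>\<le>s. exp (\<sigma> * c) * \<kappa> < 1"
proof (cases "\<kappa> > 0")
  case True
  \<comment> \<open>Chosen so that \<open>s * (c + 1)\<close> equals \<open>- ln \<kappa>\<close>;
    the summand 1 makes the inequality strict and covers c = 0.\<close>
  define s where "s = - ln \<kappa> / (c + 1)"
  have ln: "ln \<kappa> < 0" using True assms by simp
  have s: "s > 0" unfolding s_def using ln assms by (intro divide_pos_pos) auto
  have "exp (\<sigma> * c) * \<kappa> < 1" if "\<sigma> \<le> s" for \<sigma>
  proof -
    have "\<sigma> * c \<le> s * c" using that assms by (intro mult_right_mono)
    also have "\<dots> < s * (c + 1)" using s by simp
    also have "\<dots> = - ln \<kappa>" using assms by (simp add: s_def)
    finally have "exp (\<sigma> * c) < exp (- ln \<kappa>)" by simp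
    also have "\<dots> = 1 / \<kappa>" using True by (simp add: exp_minus divide_inverse)
    finally show ?thesis using True by (simp add: field_simps)
  qed
  then show ?thesis using s by blast
next
  case False
  have "exp (\<sigma> * c) * \<kappa> \<le> 0" for \<sigma> using False by (simp add: mult_nonneg_nonpos)
  then have "exp (\<sigma> * c) * \<kappa> < 1" for \<sigma> using less_le_trans by (metis le_less_trans zero_less_one)
  then show ?thesis by (intro exI[of _ 1]) auto
qed

lemma young:
  fixes X Y c :: real
  assumes "c > 0"
  shows "2 * X * Y \<le> c * X\<^sup>2 + Y\<^sup>2 / c"
proof -
  have "0 \<le> c * (X - Y / c)\<^sup>2" using assms by simp
  also have "\<dots> = c * X\<^sup>2 + Y\<^sup>2 / c - 2 * X * Y"
    using assms by (simp add: power2_eq_square field_simps)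
  finally show ?thesis by simp
qed

lemma young_gain:
  fixes n Z h X \<theta> q :: real
  assumes \<theta>: "\<theta> > 0" and q: "q > 0" and X: "\<bar>X\<bar> \<le> n * Z"
  shows "- 2 * \<theta> * h * X \<le> q * \<theta> / 2 * n\<^sup>2 + 2 * \<theta> / q * Z\<^sup>2 * h\<^sup>2"
proof -
  have "- (h * X) \<le> \<bar>h\<bar> * \<bar>X\<bar>" by (metis abs_ge_minus_self abs_mult)
  also have "\<dots> \<le> \<bar>h\<bar> * (n * Z)" using X by (intro mult_left_mono) auto
  finally have "- 2 * h * X \<le> 2 * n * (Z * \<bar>h\<bar>)" by (simp add: mult_ac)
  also have "\<dots> \<le> q / 2 * n\<^sup>2 + (Z * \<bar>h\<bar>)\<^sup>2 / (q / 2)" using q by (intro young) simp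
  also have "\<dots> = q / 2 * n\<^sup>2 + 2 / q * Z\<^sup>2 * h\<^sup>2" by (simp add: power_mult_distrib)
  finally have "\<theta> * (- 2 * h * X) \<le> \<theta> * (q / 2 * n\<^sup>2 + 2 / q * Z\<^sup>2 * h\<^sup>2)"
    using \<theta> by (intro mult_left_mono) auto
  then show ?thesis by (simp add: algebra_simps)
qed

text \<open>Passes from quadratic Lyapunov bounds to linear gains. The coefficient of each summand
  is exactly the square root of its quadratic coefficient, as the gain conditions demand.\<close>

lemma sqrt_sum_squares_bound:
  fixes X Y Z :: real
  assumes "Z\<^sup>2 \<le> X\<^sup>2 + Y\<^sup>2" "X \<ge> 0" "Y \<ge> 0"
  shows "Z \<le> X + Y"
proof (rule power2_le_imp_le)
  have "X\<^sup>2 + Y\<^sup>2 \<le> (X + Y)\<^sup>2" using assms by (simp add: power2_eq_square algebra_simps)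
  then show "Z\<^sup>2 \<le> (X + Y)\<^sup>2" using assms by linarith
qed (use assms in simp)

lemma symmetric_inner:
  fixes M :: "real ^ 'm ^ 'm"
  assumes "transpose M = M"
  shows "x \<bullet> (M *v y) = (M *v x) \<bullet> y"
  by (metis assms dot_lmul_matrix transpose_matrix_vector)

lemma norm_matrix_mult: "norm (M *v x) \<le> matnorm M * norm x" for M :: "real ^ 'n ^ 'm"
  unfolding matnorm_def by (rule onorm) simp

lemma bounded_bilinear_matrix: "bounded_bilinear (\<lambda>x y. x \<bullet> (M *v y))" for M :: "real ^ 'm ^ 'm"
  by (rule bounded_bilinear.comp[OF bounded_bilinear_inner bounded_linear_ident matrix_vector_mul_bounded_linear])

lemma ac_solves_quadratic:
  fixes M :: "real ^ 'm ^ 'm"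
  assumes M: "transpose M = M" and e: "ac_solves {\<alpha>..\<beta>} e E"
  shows "ac_solves {\<alpha>..\<beta>} (\<lambda>t. e t \<bullet> (M *v e t)) (\<lambda>t. 2 * (e t \<bullet> (M *v E t)))"
proof -
  have "E t \<bullet> (M *v e t) = e t \<bullet> (M *v E t)" for t
    by (metis M inner_commute symmetric_inner)
  then show ?thesis
    using ac_solves_bilinear[OF bounded_bilinear_matrix[of M] e e] by simp
qed

section \<open>Lyapunov function of the scaled observer error\<close>

context predictor_feedback
begin

lemma Q_sym: "transpose Q = Q" and P_sym: "transpose P = P"
  using B by (auto simp: assumption_B_def sym_pos_def_def)

lemma Q_lower: "a * (norm x)\<^sup>2 \<le> x \<bullet> (Q *v x)" and P_lower: "K\<^sub>1 * (norm x)\<^sup>2 \<le> x \<bullet> (P *v x)"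
  using B by (auto simp: assumption_B_def)

lemma matrix_upper: "x \<bullet> (M *v x) \<le> matnorm M * (norm x)\<^sup>2" for M :: "'n rmat"
proof -
  have "x \<bullet> (M *v x) \<le> norm x * norm (M *v x)" by (rule norm_cauchy_schwarz)
  also have "\<dots> \<le> norm x * (matnorm M * norm x)" by (intro mult_left_mono norm_matrix_mult) simp
  finally show ?thesis by (simp add: power2_eq_square mult_ac)
qed

lemma matnorm_Q_pos: "matnorm Q > 0"
proof -
  have "a * (norm (evec :: 'n rvec))\<^sup>2 \<le> matnorm Q * (norm (evec :: 'n rvec))\<^sup>2"
    using Q_lower matrix_upper order_trans by blast
  then show ?thesis using pos_consts by (simp add: norm_evec)
qed

text \<open>The quadratic form of the matrix inequality for Q: by symmetry of Q the two mixed terms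
  coincide, which accounts for the factor 2.\<close>

lemma observer_lmi: "2 * (e \<bullet> (Q *v (shiftA *v e + e $ fst_idx *\<^sub>R p))) \<le> - 2 * q * (norm e)\<^sup>2"
proof -
  define F :: "'n rmat" where "F = shiftA + outer p cvec"
  have Fe: "F *v e = shiftA *v e + e $ fst_idx *\<^sub>R p"
    by (simp add: F_def vec_eq_iff matrix_vector_mult_def outer_def algebra_simps sum.distrib cvec_def axis_def
        if_distrib[of "\<lambda>x. x * _"] if_distrib[of "\<lambda>x. _ * x"] cong: if_cong)
  have tF: "transpose F = transpose shiftA + outer cvec p"
    by (simp add: F_def vec_eq_iff transpose_def outer_def mult.commute)
  have "e \<bullet> ((Q ** F + (transpose shiftA + outer cvec p) ** Q + mat (2 * q)) *v e) \<le> 0"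
    using B by (simp add: F_def assumption_B_def neg_semidef_def)
  then have "e \<bullet> (Q *v (F *v e)) + e \<bullet> (transpose F *v (Q *v e)) + e \<bullet> (mat (2 * q) *v e) \<le> 0"
    unfolding tF[symmetric]
    by (simp add: matrix_vector_mult_add_rdistrib inner_add_right matrix_vector_mul_assoc)
  moreover have "e \<bullet> (transpose F *v (Q *v e)) = e \<bullet> (Q *v (F *v e))"
    by (metis Q_sym dot_lmul_matrix inner_commute transpose_matrix_vector)
  moreover have "mat (2 * q) *v e = (2 * q) *\<^sub>R e"
    by (simp add: vec_eq_iff matrix_vector_mult_def mat_def if_distrib[of "\<lambda>x. x * _"] cong: if_cong)
  ultimately show ?thesis
    unfolding Fe by (simp add: power2_norm_eq_inner)
qed

definition obs_rate :: real where "obs_rate = q * \<theta> / (8 * matnorm Q)"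

lemma obs_rate_pos: "obs_rate > 0"
  using pos_consts theta matnorm_Q_pos by (simp add: obs_rate_def)

text \<open>The matrix inequality supplies the decay 2 q \<theta> |e|^2. The nonlinearity F uses up
  q \<theta> |e|^2 of it, by the lower bound on \<theta>; Young's inequality spends half of q
  \<theta> |e|^2 on the intersample error \<eta> and a quarter on D. The last quarter dominates 2
  \<open>obs_rate\<close> e'Qe.\<close>

lemma observer_lyapunov:
  assumes F: "norm F \<le> L * sqrt (real CARD('n)) * norm e"
  shows "2 * (e \<bullet> (Q *v (F + \<theta> *\<^sub>R (shiftA *v e + e $ fst_idx *\<^sub>R p) - (\<theta> * \<eta>) *\<^sub>R p - D)))
    \<le> - 2 * obs_rate * (e \<bullet> (Q *v e)) + 2 * \<theta> / q * (norm (Q *v p))\<^sup>2 * \<eta>\<^sup>2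
       + 4 * (matnorm Q)\<^sup>2 / (q * \<theta>) * (norm D)\<^sup>2"
proof -
  let ?b = "matnorm Q" and ?n = "norm e" and ?Qp = "norm (Q *v p)"
  have q: "q > 0" "\<theta> > 0" "q * \<theta> > 0" using pos_consts theta by auto
  have 1: "2 * \<theta> * (e \<bullet> (Q *v (shiftA *v e + e $ fst_idx *\<^sub>R p))) \<le> - 2 * (q * \<theta>) * ?n\<^sup>2"
    using mult_left_mono[OF observer_lmi[of e], of \<theta>] q by (simp add: algebra_simps)
  have cs: "\<bar>e \<bullet> (Q *v v)\<bar> \<le> ?n * (?b * norm v)" for v
    using Cauchy_Schwarz_ineq2[of e "Q *v v"] mult_left_mono[OF norm_matrix_mult[of Q v], of ?n] by simp
  have 2: "2 * (e \<bullet> (Q *v F)) \<le> q * \<theta> * ?n\<^sup>2"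
  proof -
    have "2 * (e \<bullet> (Q *v F)) \<le> 2 * (?n * (?b * norm F))" using cs[of F] by simp
    also have "\<dots> \<le> 2 * (?n * (?b * (L * sqrt (real CARD('n)) * ?n)))"
      using F matnorm_Q_pos by (intro mult_left_mono) auto
    also have "\<dots> = (2 * ?b * L * sqrt (real CARD('n))) * ?n\<^sup>2" by (simp add: power2_eq_square)
    also have "\<dots> \<le> (q * \<theta>) * ?n\<^sup>2"
      using gain q by (intro mult_right_mono) (auto simp: field_simps)
    finally show ?thesis .
  qed
  have 3: "- 2 * \<theta> * \<eta> * (e \<bullet> (Q *v p)) \<le> q * \<theta> / 2 * ?n\<^sup>2 + 2 * \<theta> / q * ?Qp\<^sup>2 * \<eta>\<^sup>2"
    using q Cauchy_Schwarz_ineq2 by (intro young_gain)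
  have 4: "- 2 * (e \<bullet> (Q *v D)) \<le> q * \<theta> / 4 * ?n\<^sup>2 + 4 * ?b\<^sup>2 / (q * \<theta>) * (norm D)\<^sup>2"
  proof -
    have "- 2 * (e \<bullet> (Q *v D)) \<le> 2 * (?n * (?b * norm D))" using abs_le_D2[OF cs[of D]] by linarith
    also have "\<dots> = 2 * ?n * (?b * norm D)" by (rule mult.assoc[symmetric])
    also have "\<dots> \<le> q * \<theta> / 4 * ?n\<^sup>2 + (?b * norm D)\<^sup>2 / (q * \<theta> / 4)"
      using q by (intro young) auto
    finally show ?thesis by (simp add: power_mult_distrib)
  qed
  have 5: "q * \<theta> / 4 * ?n\<^sup>2 \<ge> 2 * obs_rate * (e \<bullet> (Q *v e))"
  proof -
    have "2 * obs_rate * (e \<bullet> (Q *v e)) \<le> 2 * obs_rate * (?b * ?n\<^sup>2)"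
      using obs_rate_pos matrix_upper by (intro mult_left_mono) auto
    also have "\<dots> = q * \<theta> / 4 * ?n\<^sup>2" using matnorm_Q_pos by (simp add: obs_rate_def)
    finally show ?thesis .
  qed
  have eq: "2 * (e \<bullet> (Q *v (F + \<theta> *\<^sub>R (shiftA *v e + e $ fst_idx *\<^sub>R p) - (\<theta> * \<eta>) *\<^sub>R p - D)))
    = 2 * (e \<bullet> (Q *v F)) + 2 * \<theta> * (e \<bullet> (Q *v (shiftA *v e + e $ fst_idx *\<^sub>R p)))
      + - 2 * \<theta> * \<eta> * (e \<bullet> (Q *v p)) + - 2 * (e \<bullet> (Q *v D))"
    by (simp add: matrix_vector_mult_diff_distrib matrix_vector_right_distrib matrix_vector_mult_scaleR
        inner_diff_right inner_add_right algebra_simps)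
  define Y where "Y = q * \<theta> * ?n\<^sup>2"
  have Y: "- 2 * (q * \<theta>) * ?n\<^sup>2 = - 2 * Y" "q * \<theta> / 2 * ?n\<^sup>2 = Y / 2" "q * \<theta> / 4 * ?n\<^sup>2 = Y / 4"
    by (simp_all add: Y_def)
  have "- 2 * obs_rate * (e \<bullet> (Q *v e)) = - (2 * obs_rate * (e \<bullet> (Q *v e)))" by simp
  then show ?thesis
    unfolding eq using 1[unfolded Y] 2[folded Y_def] 3[unfolded Y] 4[unfolded Y] 5[unfolded Y] by linarith
qed

lemma hgscale_linear: "hgscale \<theta> (x + y) = hgscale \<theta> x + hgscale \<theta> y"
  "hgscale \<theta> (x - y) = hgscale \<theta> x - hgscale \<theta> y" "hgscale \<theta> (c *\<^sub>R x) = c *\<^sub>R hgscale \<theta> x"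
  by (simp_all add: hgscale_def vec_eq_iff algebra_simps)

text \<open>In the application y is the delayed plant state. The output injection compares z with w
  instead of the true output, so it splits into the stabilising term in e and a perturbation by the
  intersample error w - y_1.\<close>

lemma observer_error_rhs:
  fixes z y :: "'n rvec"
  defines "e \<equiv> hgscale \<theta> (z - y)"
  shows "hgscale \<theta> (drift f z v + (z $ fst_idx - w) *\<^sub>R inj_gain - (drift f y v + D))
     = hgscale \<theta> (fvec f z - fvec f y) + \<theta> *\<^sub>R (shiftA *v e + e $ fst_idx *\<^sub>R p)
       - (\<theta> * (w - y $ fst_idx)) *\<^sub>R p - hgscale \<theta> D"
proof -
  have e1: "e $ fst_idx = z $ fst_idx - y $ fst_idx"
    unfolding e_def hgscale_fst[OF theta] by simp
  have "drift f z v + (z $ fst_idx - w) *\<^sub>R inj_gain - (drift f y v + D)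
     = (fvec f z - fvec f y) + shiftA *v (z - y) + (e $ fst_idx - (w - y $ fst_idx)) *\<^sub>R inj_gain - D"
    by (simp add: drift_def matrix_vector_mult_diff_distrib e1)
  then have "hgscale \<theta> (drift f z v + (z $ fst_idx - w) *\<^sub>R inj_gain - (drift f y v + D))
     = hgscale \<theta> (fvec f z - fvec f y) + \<theta> *\<^sub>R (shiftA *v e)
      + (e $ fst_idx - (w - y $ fst_idx)) *\<^sub>R (\<theta> *\<^sub>R p) - hgscale \<theta> D"
    by (simp only: hgscale_linear hgscale_shiftA[OF theta] hgscale_gain[OF theta] e_def inj_gain_def)
  then show ?thesis by (simp add: algebra_simps)
qed

text \<open>Origin of the factor L + \<theta> in the sampling condition: the first drift component
  involves the first error component, of weight 1, through f_1, and the second one, of weight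
  1/\<theta>, through the shift matrix.\<close>

lemma output_error_rhs:
  fixes z y :: "'n rvec"
  shows "\<bar>drift f z v $ fst_idx - (drift f y v + D) $ fst_idx\<bar> \<le> (L + \<theta>) * norm (hgscale \<theta> (z - y)) + norm D"
proof -
  let ?e = "hgscale \<theta> (z - y)"
  have 1: "\<bar>f fst_idx z - f fst_idx y\<bar> \<le> L * norm ?e"
  proof -
    have "{..fst_idx} = {fst_idx :: 'n}" using fst_idx_le antisym by auto
    then have "\<bar>f fst_idx z - f fst_idx y\<bar> \<le> L * \<bar>(z - y) $ fst_idx\<bar>"
      using f_lipschitz[OF A, of fst_idx z y] by simp
    also have "\<dots> = L * \<bar>?e $ fst_idx\<bar>" by (simp only: hgscale_fst[OF theta])
    also have "\<dots> \<le> L * norm ?e" using norm_nth_le L_nonneg[OF A] by (intro mult_left_mono)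
    finally show ?thesis .
  qed
  have 2: "\<bar>(shiftA *v (z - y)) $ fst_idx\<bar> \<le> \<theta> * norm ?e"
  proof -
    have "(shiftA *v (z - y)) $ fst_idx = \<theta> * (shiftA *v ?e) $ fst_idx"
      using arg_cong[OF hgscale_shiftA[OF theta, of "z - y"], of "\<lambda>v. v $ fst_idx"]
      unfolding hgscale_fst[OF theta] by simp
    moreover have "\<bar>(shiftA *v ?e) $ fst_idx\<bar> \<le> norm ?e"
      using norm_nth_le norm_shiftA_mult order_trans by blast
    ultimately show ?thesis using theta by (simp add: abs_mult mult_left_mono)
  qed
  have "drift f z v $ fst_idx - (drift f y v + D) $ fst_idx
      = (f fst_idx z - f fst_idx y) + (shiftA *v (z - y)) $ fst_idx - D $ fst_idx"
    by (simp add: drift_def fvec_def matrix_vector_mult_diff_distrib)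
  then show ?thesis using 1 2 norm_nth_le[of D fst_idx] by (simp add: algebra_simps)
qed

section \<open>The loop between observer error and intersample error\<close>

definition jj :: nat where "jj = (LEAST i. real i * T\<^sub>2 \<ge> r + T\<^sub>1)"

text \<open>By the time r + \<open>T\<^sub>1\<close> a sample has been taken at or after time r, so
  from holding instant \<open>jj\<close> on the estimate of the observer error is in force.\<close>

lemma jj: "real jj * T\<^sub>2 \<ge> r + T\<^sub>1"
proof -
  obtain i :: nat where "(r + T\<^sub>1) / T\<^sub>2 \<le> real i" using real_arch_simple by blast
  then have "real i * T\<^sub>2 \<ge> r + T\<^sub>1" using pos_consts by (simp add: field_simps)
  then show ?thesis unfolding jj_def by (rule LeastI)
qed

lemma observer_error_ac:
  assumes tr: "trajectory H J \<sigma> x u z w \<xi> d D ts" and t0: "r \<le> t0"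
  shows "ac_solves {t0..H} (\<lambda>t. hgscale \<theta> (z t - x (t - r)))
    (\<lambda>t. hgscale \<theta> (drift f (z t) (u (t - r - \<tau>)) + (z t $ fst_idx - w t) *\<^sub>R inj_gain
       - (drift f (x (t - r)) (u (t - r - \<tau>)) + D (t - r))))"
proof -
  have "ac_solves {t0..H} z (\<lambda>t. drift f (z t) (u (t - r - \<tau>)) + (z t $ fst_idx - w t) *\<^sub>R inj_gain)"
    using trajectoryD(7)[OF tr] by (rule ac_solves_subset) (use t0 delays in auto)
  moreover have "ac_solves {t0..H} (\<lambda>t. x (t - r)) (\<lambda>t. drift f (x (t - r)) (u (t - r - \<tau>)) + D (t - r))"
    using ac_solves_shift[OF trajectoryD(3)[OF tr], of r] by (rule ac_solves_subset) (use t0 delays in auto)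
  ultimately show ?thesis
    by (intro ac_solves_linear[OF bounded_linear_hgscale] ac_solves_diff)
qed

lemma disturbance_bound:
  assumes tr: "trajectory H J \<sigma> x u z w \<xi> d D ts" and t: "t \<in> {0..H + \<tau>}"
  shows "norm (D t) \<le> G * (exp (- \<sigma> * t) * J)"
  using trajectoryD(4)[OF tr t] mult_left_mono[OF trajectoryD(6)[OF tr t] G_nonneg[OF A]] by linarith

text \<open>The error w(s) - x_1(s - r) equals \<xi> at a sample and then evolves for at most
  \<open>T\<^sub>1\<close> with the speed bounded in \<open>output_error_rhs\<close>. The hypothesis
  \<open>i0 > 0\<close> makes the value at \<open>ts i0\<close> a genuine sample and not the
  arbitrary \<open>w 0\<close>. Moving the weight from the sample to s costs e^(\<sigma>
  \<open>T\<^sub>1\<close>).\<close>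

lemma output_error_bound:
  assumes tr: "trajectory H J \<sigma> x u z w \<xi> d D ts" and \<sigma>: "\<sigma> \<ge> 0" and t0: "r \<le> ts i0"
    and M: "\<And>t. t \<in> {ts i0..H} \<Longrightarrow> norm (hgscale \<theta> (z t - x (t - r))) \<le> M * exp (- \<sigma> * t)" "M \<ge> 0"
    and i0: "i0 > 0" and s: "s \<in> {ts i0..H}"
  shows "\<bar>w s - x (s - r) $ fst_idx\<bar>
    \<le> exp (\<sigma> * T\<^sub>1) * ((1 + T\<^sub>1 * G * exp (\<sigma> * r)) * J + T\<^sub>1 * (L + \<theta>) * M) * exp (- \<sigma> * s)"
proof -
  have J0: "J \<ge> 0" using trajectoryD(2)[OF tr] .
  have L0: "L \<ge> 0" "G \<ge> 0" using L_nonneg[OF A] G_nonneg[OF A] by auto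
  obtain i where i: "ts i \<le> s" "s < ts (Suc i)"
    using sampling_interval[of ts s] trajectoryD(8,11)[OF tr] s t0 delays by auto
  have "i0 \<le> i"
  proof (rule ccontr)
    assume "\<not> i0 \<le> i"
    then have "ts (Suc i) \<le> ts i0" by (intro ts_mono(1)[OF tr]) simp
    then show False using i s by simp
  qed
  then have ti: "ts i0 \<le> ts i" by (rule ts_mono(1)[OF tr])
  obtain i' where i': "i = Suc i'" using \<open>i0 \<le> i\<close> i0 by (cases i) auto
  have iH: "ts i \<le> H" "r \<le> ts i" using i s ti t0 by auto
  let ?W = "((L + \<theta>) * M + G * exp (\<sigma> * r) * J) * exp (- \<sigma> * ts i)"
  have W0: "?W \<ge> 0" using L0 J0 M(2) theta by simp
  have "w (ts i) - x (ts i - r) $ fst_idx = \<xi> (ts i)"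
    using trajectoryD(13)[OF tr, of i'] i' iH by simp
  then have 1: "\<bar>w (ts i) - x (ts i - r) $ fst_idx\<bar> \<le> exp (- \<sigma> * ts i) * J"
    using trajectoryD(14)[OF tr, of "ts i"] iH delays by simp
  have "norm ((w s - x (s - r) $ fst_idx) - (w (ts i) - x (ts i - r) $ fst_idx)) \<le> ?W * (s - ts i)"
  proof (rule ac_solves_const_bound)
    have "ac_solves {ts i..s} w (\<lambda>t. drift f (z t) (u (t - r - \<tau>)) $ fst_idx)"
      using trajectoryD(12)[OF tr, of i] by (rule ac_solves_subset) (use i in auto)
    moreover have "ac_solves {ts i..s} (\<lambda>t. x (t - r) $ fst_idx) (\<lambda>t. (drift f (x (t - r)) (u (t - r - \<tau>)) + D (t - r)) $ fst_idx)"
    proof (rule ac_solves_linear[OF bounded_linear_vec_nth])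
      show "ac_solves {ts i..s} (\<lambda>t. x (t - r)) (\<lambda>t. drift f (x (t - r)) (u (t - r - \<tau>)) + D (t - r))"
        using ac_solves_shift[OF trajectoryD(3)[OF tr], of r] by (rule ac_solves_subset) (use iH s delays in auto)
    qed
    ultimately show "ac_solves {ts i..s} (\<lambda>t. w t - x (t - r) $ fst_idx)
       (\<lambda>t. drift f (z t) (u (t - r - \<tau>)) $ fst_idx - (drift f (x (t - r)) (u (t - r - \<tau>)) + D (t - r)) $ fst_idx)"
      by (rule ac_solves_diff)
    fix \<rho> assume \<rho>: "\<rho> \<in> {ts i..<s}"
    have e: "exp (- \<sigma> * \<rho>) \<le> exp (- \<sigma> * ts i)" using \<rho> \<sigma> by (simp add: mult_left_mono)
    have "norm (D (\<rho> - r)) \<le> G * (exp (- \<sigma> * (\<rho> - r)) * J)"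
      using \<rho> iH s delays by (intro disturbance_bound[OF tr]) auto
    also have "\<dots> = G * exp (\<sigma> * r) * J * exp (- \<sigma> * \<rho>)"
      by (simp add: algebra_simps flip: exp_add)
    also have "\<dots> \<le> G * exp (\<sigma> * r) * J * exp (- \<sigma> * ts i)"
      using e L0 J0 by (intro mult_left_mono) auto
    finally have d: "norm (D (\<rho> - r)) \<le> G * exp (\<sigma> * r) * J * exp (- \<sigma> * ts i)" .
    have "norm (hgscale \<theta> (z \<rho> - x (\<rho> - r))) \<le> M * exp (- \<sigma> * \<rho>)"
      using \<rho> ti s by (intro M(1)) auto
    also have "\<dots> \<le> M * exp (- \<sigma> * ts i)" using e M(2) by (intro mult_left_mono) auto
    finally have "(L + \<theta>) * norm (hgscale \<theta> (z \<rho> - x (\<rho> - r))) \<le> (L + \<theta>) * (M * exp (- \<sigma> * ts i))"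
      using L0 theta by (intro mult_left_mono) auto
    then show "norm (drift f (z \<rho>) (u (\<rho> - r - \<tau>)) $ fst_idx - (drift f (x (\<rho> - r)) (u (\<rho> - r - \<tau>)) + D (\<rho> - r)) $ fst_idx) \<le> ?W"
      using output_error_rhs[of "z \<rho>" "u (\<rho> - r - \<tau>)" "x (\<rho> - r)" "D (\<rho> - r)"] d
      by (simp add: algebra_simps)
  qed (use i in auto)
  also have "\<dots> \<le> ?W * T\<^sub>1"
    using i trajectoryD(10)[OF tr, of i] W0 by (intro mult_left_mono) auto
  finally have 2: "\<bar>w s - x (s - r) $ fst_idx\<bar> \<le> exp (- \<sigma> * ts i) * J + ?W * T\<^sub>1"
    using 1 by (simp add: abs_le_iff)
  also have "\<dots> = ((1 + T\<^sub>1 * G * exp (\<sigma> * r)) * J + T\<^sub>1 * (L + \<theta>) * M) * exp (- \<sigma> * ts i)"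
    by (simp add: algebra_simps)
  also have "\<dots> \<le> ((1 + T\<^sub>1 * G * exp (\<sigma> * r)) * J + T\<^sub>1 * (L + \<theta>) * M) * exp (- \<sigma> * (s - T\<^sub>1))"
  proof (rule mult_left_mono)
    have "s - T\<^sub>1 \<le> ts i" using i trajectoryD(10)[OF tr, of i] by simp
    then show "exp (- \<sigma> * ts i) \<le> exp (- \<sigma> * (s - T\<^sub>1))" using \<sigma> by (simp add: mult_left_mono)
  qed (use L0 J0 M(2) theta pos_consts in auto)
  also have "\<dots> = exp (\<sigma> * T\<^sub>1) * ((1 + T\<^sub>1 * G * exp (\<sigma> * r)) * J + T\<^sub>1 * (L + \<theta>) * M) * exp (- \<sigma> * s)"
    by (simp add: algebra_simps flip: exp_add)
  finally show ?thesis .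
qed

text \<open>The maximum is attained at some t, so a single pointwise Lyapunov estimate at t bounds
  the whole weighted norm.\<close>

lemma weighted_maximum:
  fixes h :: "real \<Rightarrow> 'b::real_normed_vector"
  assumes "continuous_on {\<alpha>..\<beta>} h" "\<alpha> \<le> \<beta>"
  obtains t where "t \<in> {\<alpha>..\<beta>}"
    "\<And>s. s \<in> {\<alpha>..\<beta>} \<Longrightarrow> norm (h s) \<le> (exp (\<sigma> * t) * norm (h t)) * exp (- \<sigma> * s)"
proof -
  have "continuous_on {\<alpha>..\<beta>} (\<lambda>s. exp (\<sigma> * s) * norm (h s))"
    using assms(1) by (intro continuous_intros)
  then obtain t where t: "t \<in> {\<alpha>..\<beta>}" "\<And>s. s \<in> {\<alpha>..\<beta>} \<Longrightarrow> exp (\<sigma> * s) * norm (h s) \<le> exp (\<sigma> * t) * norm (h t)"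
    using continuous_attains_sup[of "{\<alpha>..\<beta>}" "\<lambda>s. exp (\<sigma> * s) * norm (h s)"] assms(2) by auto
  have "norm (h s) \<le> (exp (\<sigma> * t) * norm (h t)) * exp (- \<sigma> * s)" if "s \<in> {\<alpha>..\<beta>}" for s
    using mult_right_mono[OF t(2)[OF that], of "exp (- \<sigma> * s)"] by (simp add: algebra_simps flip: exp_add)
  with t(1) show thesis by (rule that)
qed

text \<open>From \<open>\<sigma> \<le> obs_rate / 2\<close> the forcing is divided by at least
  \<open>obs_rate\<close>. In the coefficient of \<eta>^2 this cancels \<theta> and leaves 16 |Q|
  |Qp|^2 / q^2, the source of the factor 4 in the sampling condition.\<close>

lemma observer_error_decay:
  assumes tr: "trajectory H J \<sigma> x u z w \<xi> d D ts" and \<sigma>: "\<sigma> \<ge> 0" "\<sigma> \<le> obs_rate / 2"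
    and i0: "r \<le> ts i0" "i0 > 0" and Y: "\<eta> \<ge> 0"
      "\<And>s. s \<in> {ts i0..H} \<Longrightarrow> \<bar>w s - x (s - r) $ fst_idx\<bar> \<le> \<eta> * exp (- \<sigma> * s)"
    and t: "t \<in> {ts i0..H}"
  shows "a * (norm (hgscale \<theta> (z t - x (t - r))))\<^sup>2 \<le> exp (- 2 * \<sigma> * t) *
     (exp (2 * \<sigma> * ts i0) * matnorm Q * (norm (z (ts i0) - x (ts i0 - r)))\<^sup>2
      + (16 * matnorm Q * (norm (Q *v p))\<^sup>2 / q\<^sup>2 * \<eta>\<^sup>2
      + 4 * (matnorm Q)\<^sup>2 / (q * \<theta>) * (G * exp (\<sigma> * r) * J)\<^sup>2 / obs_rate))"
proof -
  let ?b = "matnorm Q"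
  define e where "e t = hgscale \<theta> (z t - x (t - r))" for t
  define E where "E t = hgscale \<theta> (drift f (z t) (u (t - r - \<tau>)) + (z t $ fst_idx - w t) *\<^sub>R inj_gain
       - (drift f (x (t - r)) (u (t - r - \<tau>)) + D (t - r)))" for t
  have J0: "J \<ge> 0" using trajectoryD(2)[OF tr] .
  have q: "q > 0" "\<theta> > 0" "q * \<theta> > 0" using pos_consts theta by auto
  have G0: "G \<ge> 0" using G_nonneg[OF A] .
  define V where "V t = e t \<bullet> (Q *v e t)" for t
  define c where "c = 2 * \<theta> / q * (norm (Q *v p))\<^sup>2 * \<eta>\<^sup>2 + 4 * ?b\<^sup>2 / (q * \<theta>) * (G * exp (\<sigma> * r) * J)\<^sup>2"
  have c0: "c \<ge> 0" using q by (simp add: c_def)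
  have V0: "V s \<ge> 0" for s
    using Q_lower[of "e s"] pos_consts by (metis V_def mult_nonneg_nonneg less_imp_le order_trans zero_le_power2)
  have "ac_solves {ts i0..H} e E"
    unfolding e_def E_def by (rule observer_error_ac[OF tr i0(1)])
  then have "ac_solves {ts i0..t} e E" by (rule ac_solves_subset) (use t in auto)
  then have Vac: "ac_solves {ts i0..t} V (\<lambda>t. 2 * (e t \<bullet> (Q *v E t)))"
    unfolding V_def by (rule ac_solves_quadratic[OF Q_sym])
  have "V t \<le> exp (- 2 * \<sigma> * t) * (exp (2 * \<sigma> * ts i0) * V (ts i0) + c / (2 * obs_rate - 2 * \<sigma>))"
  proof (rule exponential_comparison[OF Vac _ V0 c0, where \<omega> = obs_rate and \<sigma> = \<sigma>])
    fix s assume s: "s \<in> {ts i0..<t}"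
    let ?e = "hgscale \<theta> (z s - x (s - r))" and ?F = "hgscale \<theta> (fvec f (z s) - fvec f (x (s - r)))"
    have "E s = ?F + \<theta> *\<^sub>R (shiftA *v e s + e s $ fst_idx *\<^sub>R p)
       - (\<theta> * (w s - x (s - r) $ fst_idx)) *\<^sub>R p - hgscale \<theta> (D (s - r))"
      unfolding E_def e_def by (rule observer_error_rhs)
    then have "2 * (e s \<bullet> (Q *v E s)) \<le> - 2 * obs_rate * V s + 2 * \<theta> / q * (norm (Q *v p))\<^sup>2 * (w s - x (s - r) $ fst_idx)\<^sup>2
       + 4 * ?b\<^sup>2 / (q * \<theta>) * (norm (hgscale \<theta> (D (s - r))))\<^sup>2"
      unfolding V_def using observer_lyapunov[OF hgscale_fvec[OF theta A]] by (simp add: e_def)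
    also have "\<dots> \<le> - 2 * obs_rate * V s + 2 * \<theta> / q * (norm (Q *v p))\<^sup>2 * (\<eta> * exp (- \<sigma> * s))\<^sup>2
       + 4 * ?b\<^sup>2 / (q * \<theta>) * (G * exp (\<sigma> * r) * J * exp (- \<sigma> * s))\<^sup>2"
    proof (rule add_mono[OF add_mono[OF order_refl mult_left_mono] mult_left_mono])
      have "\<bar>w s - x (s - r) $ fst_idx\<bar> \<le> \<eta> * exp (- \<sigma> * s)" using s t by (intro Y(2)) auto
      then show "(w s - x (s - r) $ fst_idx)\<^sup>2 \<le> (\<eta> * exp (- \<sigma> * s))\<^sup>2"
        using power_mono[of "\<bar>w s - x (s - r) $ fst_idx\<bar>" "\<eta> * exp (- \<sigma> * s)" 2] by simp
      have "norm (hgscale \<theta> (D (s - r))) \<le> norm (D (s - r))" by (rule norm_hgscale_le[OF theta])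
      also have "\<dots> \<le> G * (exp (- \<sigma> * (s - r)) * J)"
        using s t i0 delays by (intro disturbance_bound[OF tr]) auto
      also have "\<dots> = G * exp (\<sigma> * r) * J * exp (- \<sigma> * s)" by (simp add: algebra_simps flip: exp_add)
      finally show "(norm (hgscale \<theta> (D (s - r))))\<^sup>2 \<le> (G * exp (\<sigma> * r) * J * exp (- \<sigma> * s))\<^sup>2"
        by (intro power_mono) auto
    qed (use q in auto)
    also have "\<dots> = - 2 * obs_rate * V s + c * exp (- 2 * \<sigma> * s)"
      by (simp add: c_def power_mult_distrib power2_eq_square[of "exp _"] algebra_simps flip: exp_add)
    finally show "2 * (e s \<bullet> (Q *v E s)) \<le> - 2 * obs_rate * V s + c * exp (- 2 * \<sigma> * s)" .
  qed (use t \<sigma> obs_rate_pos in auto)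
  also have "\<dots> \<le> exp (- 2 * \<sigma> * t) * (exp (2 * \<sigma> * ts i0) * ?b * (norm (z (ts i0) - x (ts i0 - r)))\<^sup>2 + c / obs_rate)"
  proof (intro mult_left_mono add_mono)
    have "V (ts i0) \<le> ?b * (norm (e (ts i0)))\<^sup>2" unfolding V_def by (rule matrix_upper)
    also have "\<dots> \<le> ?b * (norm (z (ts i0) - x (ts i0 - r)))\<^sup>2"
      unfolding e_def using matnorm_Q_pos norm_hgscale_le[OF theta] by (intro mult_left_mono power_mono) auto
    finally show "exp (2 * \<sigma> * ts i0) * V (ts i0) \<le> exp (2 * \<sigma> * ts i0) * ?b * (norm (z (ts i0) - x (ts i0 - r)))\<^sup>2"
      by simp
    show "c / (2 * obs_rate - 2 * \<sigma>) \<le> c / obs_rate"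
      using c0 \<sigma> obs_rate_pos by (intro divide_left_mono) auto
  qed auto
  also have "c / obs_rate = 16 * ?b * (norm (Q *v p))\<^sup>2 / q\<^sup>2 * \<eta>\<^sup>2
      + 4 * ?b\<^sup>2 / (q * \<theta>) * (G * exp (\<sigma> * r) * J)\<^sup>2 / obs_rate"
    using q matnorm_Q_pos unfolding c_def add_divide_distrib
    by (simp add: obs_rate_def power2_eq_square)
  finally show ?thesis using Q_lower[of "e t"] by (simp add: V_def e_def)
qed

end

context predictor_feedback
begin

lemma first_sample_after_delay:
  assumes tr: "trajectory H J \<sigma> x u z w \<xi> d D ts"
  obtains i0 where "i0 > 0" "r \<le> ts i0" "ts i0 \<le> r + T\<^sub>1"
proof -
  obtain i where i: "ts i \<le> r" "r < ts (Suc i)"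
    using sampling_interval[of ts r] trajectoryD(8,11)[OF tr] delays by auto
  then show thesis using that[of "Suc i"] trajectoryD(10)[OF tr, of i] by simp
qed

text \<open>Let M be the weighted maximum of the scaled error. The intersample error is bounded by
  \<eta>, which is affine in M, and \<open>observer_error_decay\<close> bounds M by
  \<open>A1 * J + Bq * \<eta>\<close>. The resulting coefficient of M is \<epsilon> \<kappa> < 1, so
  M is bounded by a multiple of J. The multiple depends on \<sigma>, but on neither the horizon nor
  the trajectory.\<close>

lemma observer_convergence:
  "\<exists>\<sigma>0>0. \<forall>\<sigma>. 0 \<le> \<sigma> \<longrightarrow> \<sigma> \<le> \<sigma>0 \<longrightarrow> (\<exists>C\<ge>0. \<forall>H J x u z w \<xi> d D ts t. trajectory H J \<sigma> x u z w \<xi> d D ts \<longrightarrow>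
     t \<in> {r + T\<^sub>1..H} \<longrightarrow> norm (z t - x (t - r)) \<le> C * exp (- \<sigma> * t) * J
       \<and> \<bar>w t - x (t - r) $ fst_idx\<bar> \<le> C * exp (- \<sigma> * t) * J)"
proof -
  let ?b = "matnorm Q"
  have q: "q > 0" "\<theta> > 0" "q * \<theta> > 0" "a > 0" "T\<^sub>1 > 0" using pos_consts theta by auto
  have L0: "L \<ge> 0" "G \<ge> 0" using L_nonneg[OF A] G_nonneg[OF A] by auto
  have b0: "?b > 0" by (rule matnorm_Q_pos)
  \<comment> \<open>Square root of the coefficient of \<eta>^2 in
    \<open>observer_error_decay\<close>, after division by a. Then \<kappa> is the loop gain at
    \<sigma> = 0, and the sampling hypothesis is \<kappa> < 1.\<close>
  define Bq where "Bq = 4 * norm (Q *v p) * sqrt (?b / a) / q"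
  have Bq0: "Bq \<ge> 0" using q b0 by (simp add: Bq_def)
  define \<kappa> where "\<kappa> = Bq * (T\<^sub>1 * (L + \<theta>))"
  have \<kappa>: "\<kappa> < 1"
    using sampling q by (simp add: \<kappa>_def Bq_def field_simps)
  obtain s where s: "s > 0" "\<And>\<sigma>. \<sigma> \<le> s \<Longrightarrow> exp (\<sigma> * T\<^sub>1) * \<kappa> < 1"
    using exp_slack[OF \<kappa>, of T\<^sub>1] q by auto
  have "\<exists>C\<ge>0. \<forall>H J x u z w \<xi> d D ts t. trajectory H J \<sigma> x u z w \<xi> d D ts \<longrightarrow>
     t \<in> {r + T\<^sub>1..H} \<longrightarrow> norm (z t - x (t - r)) \<le> C * exp (- \<sigma> * t) * J
       \<and> \<bar>w t - x (t - r) $ fst_idx\<bar> \<le> C * exp (- \<sigma> * t) * J"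
    if \<sigma>: "0 \<le> \<sigma>" "\<sigma> \<le> min s (obs_rate / 2)" for \<sigma>
  proof -
    obtain C4 where C40: "C4 \<ge> 0" and C4: "\<And>H J x u z w \<xi> d D ts t. \<lbrakk>trajectory H J \<sigma> x u z w \<xi> d D ts;
        t \<in> {0..H}; t \<le> real jj * T\<^sub>2\<rbrakk> \<Longrightarrow> norm (z t) \<le> C4 * J \<and> \<bar>w t\<bar> \<le> C4 * J \<and> norm (x t) \<le> C4 * J"
      using crude_bound[OF \<sigma>(1), of jj] by metis
    define \<epsilon> where "\<epsilon> = exp (\<sigma> * T\<^sub>1)"
    define h1 where "h1 = 1 + T\<^sub>1 * G * exp (\<sigma> * r)"
    \<comment> \<open>Collects the disturbance and the error at the first sample past r, where z and
      x are each bounded by \<open>C4 * J\<close>.\<close>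
    define A1 where "A1 = sqrt ((exp (2 * \<sigma> * (r + T\<^sub>1)) * ?b * (2 * C4)\<^sup>2
       + 4 * ?b\<^sup>2 / (q * \<theta>) * (G * exp (\<sigma> * r))\<^sup>2 / obs_rate) / a)"
    \<comment> \<open>Solves \<open>M \<le> A1 * J + Bq * \<epsilon> * (h1 * J + T\<^sub>1 * (L +
      \<theta>) * M)\<close> for M; \<open>A4\<close> is the resulting bound for \<eta>.\<close>
    define A3 where "A3 = (A1 + Bq * \<epsilon> * h1) / (1 - \<epsilon> * \<kappa>)"
    define A4 where "A4 = \<epsilon> * (h1 + T\<^sub>1 * (L + \<theta>) * A3)"
    define C where "C = \<theta> ^ CARD('n) * A3 + A4"
    have \<epsilon>\<kappa>: "\<epsilon> * \<kappa> < 1" using s(2)[of \<sigma>] \<sigma> by (simp add: \<epsilon>_def)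
    have \<epsilon>0: "\<epsilon> > 0" by (simp add: \<epsilon>_def)
    have h10: "h1 \<ge> 0" using q L0 by (simp add: h1_def)
    have A1sq0: "(exp (2 * \<sigma> * (r + T\<^sub>1)) * ?b * (2 * C4)\<^sup>2
       + 4 * ?b\<^sup>2 / (q * \<theta>) * (G * exp (\<sigma> * r))\<^sup>2 / obs_rate) / a \<ge> 0"
      using b0 q obs_rate_pos by (intro divide_nonneg_pos add_nonneg_nonneg) auto
    have A10: "A1 \<ge> 0" unfolding A1_def using A1sq0 by (rule real_sqrt_ge_zero)
    have A30: "A3 \<ge> 0" unfolding A3_def using A10 Bq0 \<epsilon>0 h10 \<epsilon>\<kappa> by (intro divide_nonneg_pos add_nonneg_nonneg mult_nonneg_nonneg) auto
    have A40: "A4 \<ge> 0" unfolding A4_def using A30 \<epsilon>0 h10 q L0 by (intro mult_nonneg_nonneg add_nonneg_nonneg) auto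
    have C0: "C \<ge> 0" using A30 A40 q by (simp add: C_def)
    have main: "norm (z t - x (t - r)) \<le> \<theta> ^ CARD('n) * A3 * exp (- \<sigma> * t) * J \<and> \<bar>w t - x (t - r) $ fst_idx\<bar> \<le> A4 * exp (- \<sigma> * t) * J"
      if tr: "trajectory H J \<sigma> x u z w \<xi> d D ts" and t: "t \<in> {r + T\<^sub>1..H}" for H J x u z w \<xi> d D ts t
    proof -
      have J0: "J \<ge> 0" using trajectoryD(2)[OF tr] .
      obtain i0 where i0: "i0 > 0" "r \<le> ts i0" "ts i0 \<le> r + T\<^sub>1"
        using first_sample_after_delay[OF tr] by blast
      have t0H: "ts i0 \<le> H" "t \<in> {ts i0..H}" using t i0 by auto
      define e where "e t = hgscale \<theta> (z t - x (t - r))" for t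
      have ec: "continuous_on {ts i0..H} e"
        unfolding e_def using ac_solves_continuous_on[OF observer_error_ac[OF tr i0(2)]] .
      obtain t' where t': "t' \<in> {ts i0..H}" and
        et: "\<And>s. s \<in> {ts i0..H} \<Longrightarrow> norm (e s) \<le> (exp (\<sigma> * t') * norm (e t')) * exp (- \<sigma> * s)"
        using weighted_maximum[OF ec t0H(1)] by metis
      define M where "M = exp (\<sigma> * t') * norm (e t')"
      have M0: "M \<ge> 0" by (simp add: M_def)
      define \<eta> where "\<eta> = \<epsilon> * (h1 * J + T\<^sub>1 * (L + \<theta>) * M)"
      have \<eta>0: "\<eta> \<ge> 0" unfolding \<eta>_def using \<epsilon>0 h10 J0 M0 q L0 by (intro mult_nonneg_nonneg add_nonneg_nonneg) auto
      have eM: "norm (hgscale \<theta> (z t - x (t - r))) \<le> M * exp (- \<sigma> * t)" if "t \<in> {ts i0..H}" for t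
        using et[OF that] by (simp add: e_def M_def)
      have out: "\<bar>w s - x (s - r) $ fst_idx\<bar> \<le> \<eta> * exp (- \<sigma> * s)" if "s \<in> {ts i0..H}" for s
        using output_error_bound[OF tr \<sigma>(1) i0(2) eM M0 i0(1) that] by (simp add: \<eta>_def \<epsilon>_def h1_def)
      have "a * (norm (e t'))\<^sup>2 \<le> exp (- 2 * \<sigma> * t') *
        (exp (2 * \<sigma> * ts i0) * ?b * (norm (z (ts i0) - x (ts i0 - r)))\<^sup>2
        + (16 * ?b * (norm (Q *v p))\<^sup>2 / q\<^sup>2 * \<eta>\<^sup>2
        + 4 * ?b\<^sup>2 / (q * \<theta>) * (G * exp (\<sigma> * r) * J)\<^sup>2 / obs_rate))"
        unfolding e_def using \<sigma> by (intro observer_error_decay[OF tr \<sigma>(1) _ i0(2,1) \<eta>0 out t']) auto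
      then have "exp (2 * \<sigma> * t') * (a * (norm (e t'))\<^sup>2) \<le> exp (2 * \<sigma> * t') * (exp (- 2 * \<sigma> * t') *
        (exp (2 * \<sigma> * ts i0) * ?b * (norm (z (ts i0) - x (ts i0 - r)))\<^sup>2
        + (16 * ?b * (norm (Q *v p))\<^sup>2 / q\<^sup>2 * \<eta>\<^sup>2
        + 4 * ?b\<^sup>2 / (q * \<theta>) * (G * exp (\<sigma> * r) * J)\<^sup>2 / obs_rate)))"
        by (intro mult_left_mono) auto
      also have "\<dots> = exp (2 * \<sigma> * ts i0) * ?b * (norm (z (ts i0) - x (ts i0 - r)))\<^sup>2
        + (16 * ?b * (norm (Q *v p))\<^sup>2 / q\<^sup>2 * \<eta>\<^sup>2
        + 4 * ?b\<^sup>2 / (q * \<theta>) * (G * exp (\<sigma> * r) * J)\<^sup>2 / obs_rate)"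
        unfolding mult.assoc[symmetric] exp_add[symmetric] by simp
      also have "exp (2 * \<sigma> * ts i0) * ?b * (norm (z (ts i0) - x (ts i0 - r)))\<^sup>2 \<le> exp (2 * \<sigma> * (r + T\<^sub>1)) * ?b * (2 * C4 * J)\<^sup>2"
      proof (intro mult_mono power_mono)
        have "norm (z (ts i0)) \<le> C4 * J" using C4[OF tr, of "ts i0"] i0 jj t0H delays by auto
        moreover have "norm (x (ts i0 - r)) \<le> C4 * J" using C4[OF tr, of "ts i0 - r"] i0 jj t0H delays by auto
        ultimately show "norm (z (ts i0) - x (ts i0 - r)) \<le> 2 * C4 * J"
          using norm_triangle_ineq4[of "z (ts i0)" "x (ts i0 - r)"] by linarith
        show "exp (2 * \<sigma> * ts i0) \<le> exp (2 * \<sigma> * (r + T\<^sub>1))"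
          using i0 \<sigma> by (simp add: mult_left_mono)
      qed (use b0 in auto)
      also have "exp (2 * \<sigma> * (r + T\<^sub>1)) * ?b * (2 * C4 * J)\<^sup>2
        + (16 * ?b * (norm (Q *v p))\<^sup>2 / q\<^sup>2 * \<eta>\<^sup>2 + 4 * ?b\<^sup>2 / (q * \<theta>) * (G * exp (\<sigma> * r) * J)\<^sup>2 / obs_rate)
        = (exp (2 * \<sigma> * (r + T\<^sub>1)) * ?b * (2 * C4)\<^sup>2 + 4 * ?b\<^sup>2 / (q * \<theta>) * (G * exp (\<sigma> * r))\<^sup>2 / obs_rate) * J\<^sup>2
        + 16 * ?b * (norm (Q *v p))\<^sup>2 / q\<^sup>2 * \<eta>\<^sup>2"
        unfolding power_mult_distrib by (simp add: distrib_right)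
      also have "\<dots> = a * ((A1 * J)\<^sup>2 + (Bq * \<eta>)\<^sup>2)"
      proof -
        have 1: "A1\<^sup>2 = (exp (2 * \<sigma> * (r + T\<^sub>1)) * ?b * (2 * C4)\<^sup>2
           + 4 * ?b\<^sup>2 / (q * \<theta>) * (G * exp (\<sigma> * r))\<^sup>2 / obs_rate) / a"
          unfolding A1_def using A1sq0 by (rule real_sqrt_pow2)
        have 2: "Bq\<^sup>2 = 16 * (norm (Q *v p))\<^sup>2 * (?b / a) / q\<^sup>2"
          using b0 q by (simp add: Bq_def power_mult_distrib power_divide)
        show ?thesis unfolding power_mult_distrib 1 2 using q by (simp add: field_simps)
      qed
      also have "exp (2 * \<sigma> * t') * (a * (norm (e t'))\<^sup>2) = a * M\<^sup>2"
        by (simp add: M_def power_mult_distrib power2_eq_square mult_ac flip: exp_add)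
      finally have "M\<^sup>2 \<le> (A1 * J)\<^sup>2 + (Bq * \<eta>)\<^sup>2" using q by simp
      then have "M \<le> A1 * J + Bq * \<eta>"
        by (rule sqrt_sum_squares_bound) (use A10 J0 Bq0 \<eta>0 in auto)
      also have "\<dots> = (A1 + Bq * \<epsilon> * h1) * J + \<epsilon> * \<kappa> * M"
        by (simp add: \<eta>_def \<kappa>_def algebra_simps)
      finally have "(1 - \<epsilon> * \<kappa>) * M \<le> (A1 + Bq * \<epsilon> * h1) * J" by (simp add: algebra_simps)
      then have MA3: "M \<le> A3 * J"
        using \<epsilon>\<kappa> by (simp add: A3_def field_simps)
      have "norm (z t - x (t - r)) \<le> \<theta> ^ CARD('n) * norm (e t)"
        unfolding e_def by (rule norm_le_hgscale[OF theta])
      also have "\<dots> \<le> \<theta> ^ CARD('n) * (A3 * J * exp (- \<sigma> * t))"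
      proof (intro mult_left_mono)
        have "norm (e t) \<le> M * exp (- \<sigma> * t)" using et[OF t0H(2)] by (simp add: M_def)
        also have "\<dots> \<le> A3 * J * exp (- \<sigma> * t)" using MA3 by (intro mult_right_mono) auto
        finally show "norm (e t) \<le> A3 * J * exp (- \<sigma> * t)" .
      qed (use q in auto)
      finally have res1: "norm (z t - x (t - r)) \<le> \<theta> ^ CARD('n) * A3 * exp (- \<sigma> * t) * J" by (simp add: mult_ac)
      have "\<eta> \<le> \<epsilon> * (h1 * J + T\<^sub>1 * (L + \<theta>) * (A3 * J))"
        unfolding \<eta>_def using MA3 \<epsilon>0 q L0 by (intro mult_left_mono add_left_mono) auto
      also have "\<dots> = A4 * J" by (simp add: A4_def algebra_simps)
      finally have "\<eta> * exp (- \<sigma> * t) \<le> A4 * J * exp (- \<sigma> * t)" by (intro mult_right_mono) auto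
      then have "\<bar>w t - x (t - r) $ fst_idx\<bar> \<le> A4 * exp (- \<sigma> * t) * J"
        using order_trans[OF out[OF t0H(2)]] by (simp only: mult_ac)
      with res1 show ?thesis ..
    qed
    have le: "\<theta> ^ CARD('n) * A3 * exp (- \<sigma> * t) * J \<le> C * exp (- \<sigma> * t) * J" "A4 * exp (- \<sigma> * t) * J \<le> C * exp (- \<sigma> * t) * J"
      if "J \<ge> 0" for t J
      unfolding C_def by (intro mult_right_mono; use that A30 A40 q in simp)+
    show ?thesis
      using C0 main le trajectoryD(2) by (intro exI[of _ C]) (meson order_trans)
  qed
  moreover have "min s (obs_rate / 2) > 0" using s obs_rate_pos by simp
  ultimately show ?thesis by blast
qed

section \<open>Lyapunov function of the plant and deviation from the nominal feedback\<close>

definition \<kappa> :: real where "\<kappa> = norm k * (T\<^sub>2 + pe)"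
definition PS :: real where "PS = evec \<bullet> (P *v evec)"

lemma PS_nonneg: "PS \<ge> 0"
  using P_lower[of evec] pos_consts by (simp add: PS_def norm_evec)

lemma \<kappa>_nonneg: "\<kappa> \<ge> 0"
  using pe_nonneg pos_consts by (simp add: \<kappa>_def)

lemma P_nonneg: "0 \<le> x \<bullet> (P *v x)"
  by (rule order_trans[OF _ P_lower]) (use pos_consts in simp)

text \<open>The deviation v - k'x enters through a cross term with P e_n. Cauchy-Schwarz in the
  inner product of P, instead of the Euclidean one, bounds it with the constant e_n'P e_n of the
  holding condition and costs half of the decay 4 \<mu> x'Px.\<close>

lemma plant_lyapunov:
  assumes "x \<bullet> (P *v (drift f x (k \<bullet> x) + D)) \<le> - 2 * \<mu> * (x \<bullet> (P *v x)) + \<gamma> * (norm d)\<^sup>2"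
  shows "2 * (x \<bullet> (P *v (drift f x v + D))) \<le> - 2 * \<mu> * (x \<bullet> (P *v x)) + 2 * \<gamma> * (norm d)\<^sup>2
     + PS / (2 * \<mu>) * (v - k \<bullet> x)\<^sup>2"
proof -
  define \<delta> where "\<delta> = v - k \<bullet> x"
  define V where "V = x \<bullet> (P *v x)"
  define X where "X = x \<bullet> (P *v evec)"
  have \<mu>: "\<mu> > 0" using pos_consts by simp
  have "drift f x v + D = (drift f x (k \<bullet> x) + D) + \<delta> *\<^sub>R evec"
    by (simp add: drift_def \<delta>_def algebra_simps)
  then have 1: "2 * (x \<bullet> (P *v (drift f x v + D))) = 2 * (x \<bullet> (P *v (drift f x (k \<bullet> x) + D))) + 2 * \<delta> * X"
    by (simp add: matrix_vector_right_distrib matrix_vector_mult_scaleR inner_add_right X_def)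
  have Xs: "evec \<bullet> (P *v x) = X" unfolding X_def by (metis P_sym inner_commute symmetric_inner)
  \<comment> \<open>Nonnegativity of the form of P at this vector is the weighted Cauchy-Schwarz
    inequality; the weight \<open>2 * \<mu>\<close> leaves a decay rate of
    \<open>2 * \<mu>\<close>.\<close>
  let ?y = "(2 * \<mu>) *\<^sub>R x - \<delta> *\<^sub>R evec"
  have "0 \<le> ?y \<bullet> (P *v ?y)"
    by (rule P_nonneg)
  also have "?y \<bullet> (P *v ?y) = 2 * \<mu> * (2 * \<mu> * V - \<delta> * X) - \<delta> * (2 * \<mu> * X - \<delta> * PS)"
    by (simp only: matrix_vector_mult_diff_distrib matrix_vector_mult_scaleR inner_diff_left inner_diff_right
        inner_scaleR_left inner_scaleR_right Xs X_def[symmetric] PS_def[symmetric] V_def[symmetric])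
  also have "\<dots> = 2 * \<mu> * (2 * \<mu>) * V - 2 * (2 * \<mu>) * \<delta> * X + \<delta>\<^sup>2 * PS"
    by (simp add: power2_eq_square algebra_simps)
  finally have "2 * (2 * \<mu>) * \<delta> * X \<le> 2 * \<mu> * (2 * \<mu>) * V + \<delta>\<^sup>2 * PS" by simp
  then have "2 * \<delta> * X \<le> 2 * \<mu> * V + PS / (2 * \<mu>) * \<delta>\<^sup>2"
    using \<mu> by (simp add: field_simps)
  then show ?thesis using assms 1 unfolding \<delta>_def[symmetric] V_def[symmetric] by linarith
qed

text \<open>Comparison with \<omega> = \<mu>; since \<sigma> \<le> \<mu>/2, the forcing is divided
  by at least \<mu>. The coefficient of \<open>m\<delta>\<close> squared becomes PS / (2 \<mu>^2),
  which gives the gain \<open>Sx\<close>.\<close>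

lemma plant_decay:
  assumes tr: "trajectory H J \<sigma> x u z w \<xi> d D ts" and \<sigma>: "\<sigma> \<ge> 0" "\<sigma> \<le> \<mu> / 2"
    and t1: "0 \<le> t1" and \<delta>: "\<And>s. s \<in> {t1..H + \<tau>} \<Longrightarrow> \<bar>u (s - \<tau>) - k \<bullet> x s\<bar> \<le> m\<delta> * exp (- \<sigma> * s)"
    and m0: "m\<delta> \<ge> 0" and t: "t \<in> {t1..H + \<tau>}"
  shows "K\<^sub>1 * (norm (x t))\<^sup>2 \<le> exp (- 2 * \<sigma> * t) * (exp (2 * \<sigma> * t1) * matnorm P * (norm (x t1))\<^sup>2
     + (2 * \<gamma> * J\<^sup>2 + PS / (2 * \<mu>) * m\<delta>\<^sup>2) / \<mu>)"
proof -
  define V where "V t = x t \<bullet> (P *v x t)" for t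
  define c where "c = 2 * \<gamma> * J\<^sup>2 + PS / (2 * \<mu>) * m\<delta>\<^sup>2"
  have \<mu>: "\<mu> > 0" "\<gamma> > 0" using pos_consts by auto
  have J0: "J \<ge> 0" using trajectoryD(2)[OF tr] .
  have c0: "c \<ge> 0" using \<mu> PS_nonneg by (simp add: c_def)
  have V0: "V s \<ge> 0" for s
    unfolding V_def by (rule P_nonneg)
  have "ac_solves {t1..t} x (\<lambda>t. drift f (x t) (u (t - \<tau>)) + D t)"
    using trajectoryD(3)[OF tr] by (rule ac_solves_subset) (use t t1 in auto)
  then have Vac: "ac_solves {t1..t} V (\<lambda>t. 2 * (x t \<bullet> (P *v (drift f (x t) (u (t - \<tau>)) + D t))))"
    unfolding V_def by (rule ac_solves_quadratic[OF P_sym])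
  have "V t \<le> exp (- 2 * \<sigma> * t) * (exp (2 * \<sigma> * t1) * V t1 + c / (2 * \<mu> - 2 * \<sigma>))"
  proof (rule exponential_comparison[OF Vac _ V0 c0, where \<omega> = \<mu> and \<sigma> = \<sigma>])
    fix s assume s: "s \<in> {t1..<t}"
    have sH: "s \<in> {0..H + \<tau>}" "s \<in> {t1..H + \<tau>}" using s t t1 by auto
    have "2 * (x s \<bullet> (P *v (drift f (x s) (u (s - \<tau>)) + D s)))
       \<le> - 2 * \<mu> * V s + 2 * \<gamma> * (norm (d s))\<^sup>2 + PS / (2 * \<mu>) * (u (s - \<tau>) - k \<bullet> x s)\<^sup>2"
      unfolding V_def by (rule plant_lyapunov[OF trajectoryD(5)[OF tr sH(1)]])
    also have "\<dots> \<le> - 2 * \<mu> * V s + 2 * \<gamma> * (exp (- \<sigma> * s) * J)\<^sup>2 + PS / (2 * \<mu>) * (m\<delta> * exp (- \<sigma> * s))\<^sup>2"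
    proof (rule add_mono[OF add_mono[OF order_refl mult_left_mono] mult_left_mono])
      show "(norm (d s))\<^sup>2 \<le> (exp (- \<sigma> * s) * J)\<^sup>2"
        using trajectoryD(6)[OF tr sH(1)] by (intro power_mono) auto
      show "(u (s - \<tau>) - k \<bullet> x s)\<^sup>2 \<le> (m\<delta> * exp (- \<sigma> * s))\<^sup>2"
        using power_mono[OF \<delta>[OF sH(2)], of 2] by simp
    qed (use \<mu> PS_nonneg in auto)
    also have "\<dots> = - 2 * \<mu> * V s + c * exp (- 2 * \<sigma> * s)"
      by (simp add: c_def power_mult_distrib power2_eq_square[of "exp _"] algebra_simps flip: exp_add)
    finally show "2 * (x s \<bullet> (P *v (drift f (x s) (u (s - \<tau>)) + D s))) \<le> - 2 * \<mu> * V s + c * exp (- 2 * \<sigma> * s)" .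
  qed (use t \<sigma> \<mu> in auto)
  also have "\<dots> \<le> exp (- 2 * \<sigma> * t) * (exp (2 * \<sigma> * t1) * matnorm P * (norm (x t1))\<^sup>2 + c / \<mu>)"
  proof (intro mult_left_mono add_mono)
    show "exp (2 * \<sigma> * t1) * V t1 \<le> exp (2 * \<sigma> * t1) * matnorm P * (norm (x t1))\<^sup>2"
      using matrix_upper[of "x t1" P] by (simp add: V_def)
    show "c / (2 * \<mu> - 2 * \<sigma>) \<le> c / \<mu>"
      using c0 \<sigma> \<mu> by (intro divide_left_mono) auto
  qed auto
  finally show ?thesis using P_lower[of "x t"] by (simp add: V_def c_def)
qed

lemma exp_decay_shift:
  assumes "\<sigma> \<ge> 0" "t - c \<le> s"
  shows "exp (- \<sigma> * s) \<le> exp (\<sigma> * c) * exp (- \<sigma> * t :: real)"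
proof -
  have "\<sigma> * (t - c) \<le> \<sigma> * s" using assms by (intro mult_left_mono)
  then show ?thesis by (simp add: algebra_simps flip: exp_add)
qed

text \<open>The input acting at time t was computed at the holding instant t0 = i
  \<open>T\<^sub>2\<close> as k times a prediction of x(t0 + \<tau>). Hence it misses k'x(t) by the
  motion of x from t0 + \<tau> to t, of duration at most \<open>T\<^sub>2\<close>, and by the
  prediction error, which starts from z(t0) in place of x(t0 - r). All weights are moved to t at the
  cost e^(\<sigma> (T2 + 2R)), because no time before t0 - R is involved.\<close>

lemma prediction_mismatch:
  assumes tr: "trajectory H J \<sigma> x u z w \<xi> d D ts" and \<sigma>: "\<sigma> \<ge> 0"
    and i: "r \<le> real i * T\<^sub>2" "real i * T\<^sub>2 \<le> t - \<tau>" "t - \<tau> < real (Suc i) * T\<^sub>2" and t: "t \<le> H + \<tau>"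
    and X: "\<And>s. s \<in> {0..H + \<tau>} \<Longrightarrow> norm (x s) \<le> X * exp (- \<sigma> * s)" "X \<ge> 0"
    and U: "\<And>s. s \<in> {-r-\<tau>..H} \<Longrightarrow> \<bar>u s\<bar> \<le> U * exp (- \<sigma> * s)" "U \<ge> 0"
    and Co: "norm (z (real i * T\<^sub>2) - x (real i * T\<^sub>2 - r)) \<le> Co * exp (- \<sigma> * (real i * T\<^sub>2)) * J" "Co \<ge> 0"
  shows "\<bar>u (t - \<tau>) - k \<bullet> x t\<bar> \<le> norm k * exp (\<sigma> * (T\<^sub>2 + 2 * R)) * exp (- \<sigma> * t) *
     (T\<^sub>2 * (N * X + U + G * J) + (pe * (X + Co * J + U) + 2 * exp (2 * N * R) * (Co * J + G * J * R)))"
proof -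
  define t0 where "t0 = real i * T\<^sub>2"
  have i: "r \<le> t0" "t0 \<le> t - \<tau>" "t - \<tau> < t0 + T\<^sub>2" and t0: "0 \<le> t0"
    using i delays by (auto simp: t0_def algebra_simps)
  note Co = Co[folded t0_def]
  let ?s = "t0 + \<tau>"
  let ?E = "exp (\<sigma> * (T\<^sub>2 + 2 * R)) * exp (- \<sigma> * t)"
  have J0: "J \<ge> 0" using trajectoryD(2)[OF tr] .
  have G0: "G \<ge> 0" using G_nonneg[OF A] .
  have N0: "N \<ge> 0" using N_ge_1 by simp
  have ti: "0 \<le> t0" "t0 \<le> H" "?s \<le> t" "t - T\<^sub>2 \<le> ?s"
    using i t delays t0 by auto
  define \<Phi> where "\<Phi> = Ppred f r \<tau> l m (\<lambda>s. u (t0 + (s - r - \<tau>))) (z t0)"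
  have u: "u (t - \<tau>) = k \<bullet> \<Phi>"
    unfolding \<Phi>_def t0_def using i by (intro feedback_value[OF trajectoryD(15)[OF tr]]) (auto simp: t0_def algebra_simps)
  \<comment> \<open>Contribution of the hold: length of the holding period times a bound on the
    speed of x.\<close>
  have a: "norm (x t - x ?s) \<le> ?E * (T\<^sub>2 * (N * X + U + G * J))"
  proof -
    let ?W = "exp (\<sigma> * \<tau>) * (N * X + U + G * J) * exp (- \<sigma> * ?s)"
    have W0: "?W \<ge> 0" using N0 X U G0 J0 by simp
    have e1: "1 \<le> exp (\<sigma> * \<tau>)" using \<sigma> delays by simp
    have "norm (x t - x ?s) \<le> ?W * (t - ?s)"
    proof (rule ac_solves_const_bound)
      show "ac_solves {?s..t} x (\<lambda>t. drift f (x t) (u (t - \<tau>)) + D t)"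
        using trajectoryD(3)[OF tr] by (rule ac_solves_subset) (use ti t delays in auto)
      fix s assume s: "s \<in> {?s..<t}"
      have sH: "s \<in> {0..H + \<tau>}" using s ti t delays by auto
      have "N * norm (x s) \<le> N * (X * exp (- \<sigma> * s))" using X(1)[OF sH] N0 by (rule mult_left_mono)
      also have "\<dots> \<le> exp (\<sigma> * \<tau>) * (N * (X * exp (- \<sigma> * s)))"
        using mult_right_mono[OF e1, of "N * (X * exp (- \<sigma> * s))"] N0 X(2) by simp
      finally have 1: "N * norm (x s) \<le> exp (\<sigma> * \<tau>) * (N * (X * exp (- \<sigma> * s)))" .
      have "\<bar>u (s - \<tau>)\<bar> \<le> U * exp (- \<sigma> * (s - \<tau>))" using s ti t delays by (intro U(1)) auto
      also have "\<dots> = exp (\<sigma> * \<tau>) * (U * exp (- \<sigma> * s))" by (simp add: algebra_simps flip: exp_add)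
      finally have 2: "\<bar>u (s - \<tau>)\<bar> \<le> exp (\<sigma> * \<tau>) * (U * exp (- \<sigma> * s))" .
      have "norm (D s) \<le> G * (exp (- \<sigma> * s) * J)" by (rule disturbance_bound[OF tr sH])
      also have "\<dots> \<le> exp (\<sigma> * \<tau>) * (G * (exp (- \<sigma> * s) * J))"
        using mult_right_mono[OF e1, of "G * (exp (- \<sigma> * s) * J)"] G0 J0 by simp
      finally have 3: "norm (D s) \<le> exp (\<sigma> * \<tau>) * (G * (exp (- \<sigma> * s) * J))" .
      have "norm (drift f (x s) (u (s - \<tau>)) + D s) \<le> N * norm (x s) + \<bar>u (s - \<tau>)\<bar> + norm (D s)"
        using norm_drift norm_triangle_ineq by (smt (verit))
      also have "\<dots> \<le> exp (\<sigma> * \<tau>) * (N * (X * exp (- \<sigma> * s))) + exp (\<sigma> * \<tau>) * (U * exp (- \<sigma> * s))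
          + exp (\<sigma> * \<tau>) * (G * (exp (- \<sigma> * s) * J))"
        using 1 2 3 by linarith
      also have "\<dots> = exp (\<sigma> * \<tau>) * (N * X + U + G * J) * exp (- \<sigma> * s)" by (simp add: algebra_simps)
      also have "\<dots> \<le> ?W"
        using s \<sigma> N0 X U G0 J0 by (intro mult_left_mono) (auto intro: mult_left_mono)
      finally show "norm (drift f (x s) (u (s - \<tau>)) + D s) \<le> ?W" .
    qed (use ti in auto)
    also have "\<dots> \<le> ?W * T\<^sub>2" using ti W0 by (intro mult_left_mono) auto
    also have "\<dots> = (T\<^sub>2 * (N * X + U + G * J)) * (exp (\<sigma> * \<tau>) * exp (- \<sigma> * ?s))" by (simp only: mult_ac)
    also have "\<dots> \<le> (T\<^sub>2 * (N * X + U + G * J)) * ?E"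
    proof (rule mult_left_mono)
      have "t - (T\<^sub>2 + 2 * R) \<le> ?s - \<tau>" using ti delays by auto
      from exp_decay_shift[OF \<sigma> this] show "exp (\<sigma> * \<tau>) * exp (- \<sigma> * ?s) \<le> ?E"
        by (simp add: algebra_simps flip: exp_add)
    qed (use N0 X U G0 J0 pos_consts in auto)
    finally show ?thesis by (simp only: mult_ac)
  qed
  \<comment> \<open>Contribution of the predictor, run over the window from t0 - r to t0 + \<tau> of
    the actual plant motion.\<close>
  have b: "norm (\<Phi> - x ?s) \<le> ?E * (pe * (X + Co * J + U) + 2 * exp (2 * N * R) * (Co * J + G * J * R))"
  proof -
    \<comment> \<open>The weight at the earliest time t0 - R of the window of past input dominates
      all other weights that occur.\<close>
    define e where "e = exp (- \<sigma> * (t0 - R))"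
    have e0: "e \<ge> 0" by (simp add: e_def)
    have ee: "exp (- \<sigma> * s) \<le> e" if "t0 - R \<le> s" for s
      using that \<sigma> by (auto simp: e_def intro: mult_left_mono)
    have "ac_solves {t0 - r..?s} x (\<lambda>t. drift f (x t) (u (t - \<tau>)) + D t)"
      using trajectoryD(3)[OF tr] by (rule ac_solves_subset) (use i ti t in auto)
    from ac_solves_shift[OF this, of "r - t0"]
    have X': "ac_solves {0..R} (\<lambda>s. x (s - (r - t0)))
        (\<lambda>s. drift f (x (s - (r - t0))) (u (t0 + (s - r - \<tau>))) + D (s - (r - t0)))"
      by (simp add: algebra_simps)
    have "norm (\<Phi> - x (R - (r - t0))) \<le> pe * (norm (z t0) + U * e) + 2 * exp (2 * N * R) * (norm (z t0 - x (0 - (r - t0))) + (G * J * e) * R)"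
      unfolding \<Phi>_def
    proof (rule predictor_error[OF trajectoryD(20)[OF tr, of i, folded t0_def] _ X'])
      fix s assume s: "s \<in> {0..<R}"
      have "\<bar>u (t0 + (s - r - \<tau>))\<bar> \<le> U * exp (- \<sigma> * (t0 + (s - r - \<tau>)))" using s ti by (intro U(1)) auto
      also have "\<dots> \<le> U * e" using s U(2) by (intro mult_left_mono ee) auto
      finally show "\<bar>u (t0 + (s - r - \<tau>))\<bar> \<le> U * e" .
      have "norm (D (s - (r - t0))) \<le> G * (exp (- \<sigma> * (s - (r - t0))) * J)"
        using s i ti t by (intro disturbance_bound[OF tr]) auto
      also have "\<dots> \<le> G * (e * J)" using s delays G0 J0 by (intro mult_left_mono mult_right_mono ee) auto
      finally show "norm (D (s - (r - t0))) \<le> G * J * e" by (simp only: mult_ac)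
    qed (use G0 J0 e0 in auto)
    also have "\<dots> \<le> pe * ((X * e + Co * e * J) + U * e) + 2 * exp (2 * N * R) * (Co * e * J + (G * J * e) * R)"
    proof -
      have "norm (z t0 - x (t0 - r)) \<le> Co * exp (- \<sigma> * t0) * J" by (rule Co(1))
      also have "\<dots> \<le> Co * e * J" using Co(2) J0 delays by (intro mult_right_mono mult_left_mono ee) auto
      finally have 1: "norm (z t0 - x (t0 - r)) \<le> Co * e * J" .
      have "norm (x (t0 - r)) \<le> X * exp (- \<sigma> * (t0 - r))" using i ti delays by (intro X(1)) auto
      also have "\<dots> \<le> X * e" using X(2) delays by (intro mult_left_mono ee) auto
      finally have 2: "norm (z t0) \<le> X * e + Co * e * J"
        using 1 norm_triangle_sub[of "z t0" "x (t0 - r)"] by linarith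
      show ?thesis using 1 2 pe_nonneg U(2) G0 J0 e0 delays by (intro add_mono mult_left_mono) auto
    qed
    also have "\<dots> = e * (pe * (X + Co * J + U) + 2 * exp (2 * N * R) * (Co * J + G * J * R))"
      by (simp add: algebra_simps)
    also have "\<dots> \<le> ?E * (pe * (X + Co * J + U) + 2 * exp (2 * N * R) * (Co * J + G * J * R))"
    proof (rule mult_right_mono)
      have "t - (T\<^sub>2 + 2 * R) \<le> t0 - R" using ti delays by auto
      from exp_decay_shift[OF \<sigma> this] show "e \<le> ?E" by (simp add: e_def)
    qed (use pe_nonneg X U Co J0 G0 delays in auto)
    finally show ?thesis by (simp add: add.commute)
  qed
  have "u (t - \<tau>) - k \<bullet> x t = k \<bullet> (\<Phi> - x ?s) - k \<bullet> (x t - x ?s)"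
    by (simp add: u inner_diff_right)
  then have "\<bar>u (t - \<tau>) - k \<bullet> x t\<bar> \<le> norm k * norm (\<Phi> - x ?s) + norm k * norm (x t - x ?s)"
    using Cauchy_Schwarz_ineq2[of k "\<Phi> - x ?s"] Cauchy_Schwarz_ineq2[of k "x t - x ?s"] by linarith
  also have "\<dots> \<le> norm k * (?E * (pe * (X + Co * J + U) + 2 * exp (2 * N * R) * (Co * J + G * J * R)))
     + norm k * (?E * (T\<^sub>2 * (N * X + U + G * J)))"
    using a b by (intro add_mono mult_left_mono) auto
  finally show ?thesis by (simp add: algebra_simps)
qed

end

section \<open>The small-gain argument for the plant\<close>

lemma gain_identity:
  fixes K c g h y S v :: real
  assumes "K \<noteq> 0" "h \<noteq> 0"
  shows "K * ((c + 2 * g / h) / K * y + S / (2 * K) / h\<^sup>2 * v) = c * y + (2 * g * y + S / (2 * h) * v) / h"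
proof -
  have 1: "K * ((c + 2 * g / h) / K * y) = (c + 2 * g / h) * y" using assms by simp
  have 2: "K * (S / (2 * K) / h\<^sup>2 * v) = S / (2 * h) * v / h" using assms by (simp add: power2_eq_square)
  show ?thesis unfolding distrib_left 1 2 by (simp add: distrib_right add_divide_distrib)
qed

context predictor_feedback
begin

text \<open>Gain from the weighted deviation u(t - \<tau>) - k'x(t) to the weighted state: the
  square root of PS / (2 \<mu>^2), the coefficient in \<open>plant_decay\<close>, over
  \<open>K\<^sub>1\<close>.\<close>

definition Sx :: real where "Sx = sqrt (PS / (2 * K\<^sub>1)) / \<mu>"

text \<open>The holding hypothesis read as a loop gain. Since the delayed input is k'x plus the
  deviation, the hold and the predictor reproduce the deviation with gain \<kappa>, and x with gain
  \<kappa> (N + |k|); x in turn is bounded by \<open>Sx\<close> times the deviation.\<close>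

lemma small_gain: "\<kappa> * ((N + norm k) * Sx + 1) < 1"
proof -
  have "((N + norm k) * sqrt (PS / (2 * K\<^sub>1)) + \<mu>) * norm k * (T\<^sub>2 + pe) < \<mu>"
    using holding by (simp add: N_def PS_def pe_def)
  then have "((N + norm k) * sqrt (PS / (2 * K\<^sub>1)) + \<mu>) * norm k * (T\<^sub>2 + pe) / \<mu> < 1"
    using pos_consts by simp
  moreover have "\<kappa> * ((N + norm k) * Sx + 1) = ((N + norm k) * sqrt (PS / (2 * K\<^sub>1)) + \<mu>) * norm k * (T\<^sub>2 + pe) / \<mu>"
    using pos_consts by (simp add: \<kappa>_def Sx_def field_simps)
  ultimately show ?thesis by simp
qed

text \<open>On a bounded initial interval any constant bound is a decaying one with a larger
  constant.\<close>

lemma crude_le_decaying: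
  assumes "\<sigma> \<ge> 0" "s \<le> t1" "c \<ge> 0"
  shows "c \<le> c * exp (\<sigma> * t1) * exp (- \<sigma> * s :: real)"
proof -
  have "1 \<le> exp (\<sigma> * t1) * exp (- \<sigma> * s)"
    using mult_left_mono[OF assms(2,1)] by (simp flip: exp_add)
  from mult_left_mono[OF this assms(3)] show ?thesis by (simp add: mult.assoc)
qed

text \<open>With \<open>mx\<close> and \<open>md\<close> the weighted suprema of x and of the
  deviation after \<open>t1\<close>, the Lyapunov estimate gives
  \<open>mx \<le> Aw * J + Sx * md\<close>, and \<open>prediction_mismatch\<close> gives
  \<open>md \<le> E * \<kappa> * ((N + norm k) * mx + md) + C9 * J\<close>. Substituting the first
  into the second leaves a coefficient of \<open>md\<close> below 1 by \<open>slack\<close>. The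
  constants are tied by equations in \<open>Cm\<close> to make plain that they do not depend on the
  trajectory.\<close>

lemma closed_loop_gain:
  assumes tr: "trajectory H J \<sigma> x u z w \<xi> d D ts"
    and \<sigma>: "\<sigma> \<ge> 0" "\<sigma> \<le> \<mu> / 2" and slack: "exp (\<sigma> * (T\<^sub>2 + 2 * R)) * (\<kappa> * ((N + norm k) * Sx + 1)) < 1"
    and t1: "t1 = real jj * T\<^sub>2 + \<tau>" "t1 \<le> H + \<tau>"
    and c3: "c3 \<ge> 0" "\<And>s. s \<in> {0..H + \<tau>} \<Longrightarrow> s \<le> t1 \<Longrightarrow> norm (x s) \<le> c3 * J * exp (- \<sigma> * s)"
      "\<And>s. s \<in> {-r-\<tau>..H} \<Longrightarrow> s < real jj * T\<^sub>2 \<Longrightarrow> \<bar>u s\<bar> \<le> c3 * J * exp (- \<sigma> * s)"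
    and Co: "Co \<ge> 0" "\<And>t. t \<in> {r + T\<^sub>1..H} \<Longrightarrow> norm (z t - x (t - r)) \<le> Co * exp (- \<sigma> * t) * J"
    and Cm: "Aw = sqrt ((matnorm P * c3\<^sup>2 + 2 * \<gamma> / \<mu>) / K\<^sub>1)"
      "C9 = exp (\<sigma> * (T\<^sub>2 + 2 * R)) * norm k * (T\<^sub>2 * (N * c3 + c3 + G) + (pe * (2 * c3 + Co) + 2 * exp (2 * N * R) * (Co + G * R)))"
      "Cd = (exp (\<sigma> * (T\<^sub>2 + 2 * R)) * \<kappa> * (N + norm k) * Aw + C9)
         / (1 - exp (\<sigma> * (T\<^sub>2 + 2 * R)) * (\<kappa> * ((N + norm k) * Sx + 1)))"
  shows "\<exists>mx md. mx \<ge> 0 \<and> md \<ge> 0 \<and> mx \<le> (Aw + Sx * Cd) * J \<and> md \<le> Cd * J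
    \<and> (\<forall>s\<in>{t1..H + \<tau>}. norm (x s) \<le> mx * exp (- \<sigma> * s) \<and> \<bar>u (s - \<tau>) - k \<bullet> x s\<bar> \<le> md * exp (- \<sigma> * s))"
proof -
  have J0: "J \<ge> 0" using trajectoryD(2)[OF tr] .
  have G0: "G \<ge> 0" using G_nonneg[OF A] .
  have N0: "N \<ge> 1" using N_ge_1 by simp
  have pos: "\<mu> > 0" "\<gamma> > 0" "K\<^sub>1 > 0" "T\<^sub>2 > 0" "T\<^sub>1 > 0" using pos_consts by auto
  have Sx0: "Sx \<ge> 0" using pos PS_nonneg by (simp add: Sx_def)
  have P0: "matnorm P \<ge> 0" unfolding matnorm_def by (rule onorm_pos_le) simp
  have jT: "real jj * T\<^sub>2 \<ge> 0" using pos by simp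
  have t10: "0 \<le> t1" "\<tau> \<le> t1" using t1 jT delays by auto
  define E where "E = exp (\<sigma> * (T\<^sub>2 + 2 * R))"
  have E0: "E > 0" by (simp add: E_def)
  have "ac_solves {t1..H + \<tau>} x (\<lambda>t. drift f (x t) (u (t - \<tau>)) + D t)"
    using trajectoryD(3)[OF tr] by (rule ac_solves_subset) (use t10 in auto)
  then have xc: "continuous_on {t1..H + \<tau>} x" by (rule ac_solves_continuous_on)
  obtain t' where t': "t' \<in> {t1..H + \<tau>}" and
    xt: "\<And>s. s \<in> {t1..H + \<tau>} \<Longrightarrow> norm (x s) \<le> (exp (\<sigma> * t') * norm (x t')) * exp (- \<sigma> * s)"
    using weighted_maximum[OF xc t1(2)] by metis
  define mx where "mx = exp (\<sigma> * t') * norm (x t')"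
  have mx0: "mx \<ge> 0" by (simp add: mx_def)
  have xm: "norm (x s) \<le> mx * exp (- \<sigma> * s)" if "s \<in> {t1..H + \<tau>}" for s using xt[OF that] by (simp add: mx_def)
  define \<delta> where "\<delta> s = exp (\<sigma> * s) * \<bar>u (s - \<tau>) - k \<bullet> x s\<bar>" for s
  \<comment> \<open>The held input jumps, so unlike for the continuous x a maximum need not be
    attained and a supremum is taken.\<close>
  define md where "md = (SUP s\<in>{t1..H + \<tau>}. \<delta> s)"
  have bdd: "bdd_above (\<delta> ` {t1..H + \<tau>})"
  proof -
    \<comment> \<open>Crude bounds up to a holding instant beyond H. The constant \<open>Ci\<close>
      grows with H, but serves only to show that the supremum is finite.\<close>
    obtain i :: nat where i: "H / T\<^sub>2 < real i" using reals_Archimedean2 by blast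
    obtain Ci where Ci: "Ci \<ge> 0" "\<And>s. s \<in> {-r-\<tau>..H} \<Longrightarrow> s < real i * T\<^sub>2 \<Longrightarrow> \<bar>u s\<bar> \<le> Ci * J"
      using crude_bound[OF \<sigma>(1), of i] tr by metis
    have "\<delta> s \<le> exp (\<sigma> * (H + \<tau>)) * (Ci * J + norm k * mx)" if s: "s \<in> {t1..H + \<tau>}" for s
      unfolding \<delta>_def
    proof (intro mult_mono)
      have "H < real i * T\<^sub>2" using i pos by (simp add: field_simps)
      then have 1: "\<bar>u (s - \<tau>)\<bar> \<le> Ci * J" using s t10 delays by (intro Ci(2)) auto
      have "\<bar>k \<bullet> x s\<bar> \<le> norm k * norm (x s)" by (rule Cauchy_Schwarz_ineq2)
      also have "\<dots> \<le> norm k * (mx * exp (- \<sigma> * s))" by (intro mult_left_mono xm s) simp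
      also have "\<dots> \<le> norm k * (mx * 1)" using s t10 \<sigma> mx0 by (intro mult_left_mono) auto
      finally show "\<bar>u (s - \<tau>) - k \<bullet> x s\<bar> \<le> Ci * J + norm k * mx" using 1 by simp
      show "exp (\<sigma> * s) \<le> exp (\<sigma> * (H + \<tau>))" using s \<sigma> by (simp add: mult_left_mono)
    qed auto
    then show ?thesis by (rule bdd_aboveI2)
  qed
  have dm: "\<bar>u (s - \<tau>) - k \<bullet> x s\<bar> \<le> md * exp (- \<sigma> * s)" if "s \<in> {t1..H + \<tau>}" for s
  proof -
    have "\<delta> s \<le> md" unfolding md_def using bdd that by (rule cSUP_upper2) simp
    then have 1: "\<delta> s * exp (- \<sigma> * s) \<le> md * exp (- \<sigma> * s)" by (intro mult_right_mono) auto
    have 2: "\<delta> s * exp (- \<sigma> * s) = \<bar>u (s - \<tau>) - k \<bullet> x s\<bar>"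
      by (simp add: \<delta>_def algebra_simps flip: exp_add)
    show ?thesis using 1 unfolding 2 .
  qed
  have md0: "md \<ge> 0"
  proof -
    have "0 \<le> \<delta> t1" by (simp add: \<delta>_def)
    also have "\<dots> \<le> md" unfolding md_def by (rule cSUP_upper[OF _ bdd]) (use t1 in auto)
    finally show ?thesis .
  qed
  have "K\<^sub>1 * (norm (x t'))\<^sup>2 \<le> exp (- 2 * \<sigma> * t') * (exp (2 * \<sigma> * t1) * matnorm P * (norm (x t1))\<^sup>2
     + (2 * \<gamma> * J\<^sup>2 + PS / (2 * \<mu>) * md\<^sup>2) / \<mu>)"
    by (rule plant_decay[OF tr \<sigma> t10(1) dm md0 t'])
  also have "\<dots> \<le> exp (- 2 * \<sigma> * t') * (matnorm P * (c3 * J)\<^sup>2 + (2 * \<gamma> * J\<^sup>2 + PS / (2 * \<mu>) * md\<^sup>2) / \<mu>)"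
  proof (intro mult_left_mono add_right_mono)
    have "norm (x t1) \<le> c3 * J * exp (- \<sigma> * t1)" using t1 t10 by (intro c3(2)) auto
    then have "exp (\<sigma> * t1) * norm (x t1) \<le> exp (\<sigma> * t1) * (c3 * J * exp (- \<sigma> * t1))" by (intro mult_left_mono) auto
    also have "\<dots> = c3 * J" by (simp add: algebra_simps flip: exp_add)
    finally have "(exp (\<sigma> * t1) * norm (x t1))\<^sup>2 \<le> (c3 * J)\<^sup>2" by (intro power_mono) auto
    then have "matnorm P * (exp (\<sigma> * t1) * norm (x t1))\<^sup>2 \<le> matnorm P * (c3 * J)\<^sup>2" using P0 by (rule mult_left_mono)
    moreover have "exp (2 * \<sigma> * t1) = (exp (\<sigma> * t1))\<^sup>2" by (simp add: power2_eq_square flip: exp_add)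
    ultimately show "exp (2 * \<sigma> * t1) * matnorm P * (norm (x t1))\<^sup>2 \<le> matnorm P * (c3 * J)\<^sup>2"
      by (simp add: power_mult_distrib mult_ac)
  qed auto
  finally have "exp (2 * \<sigma> * t') * (K\<^sub>1 * (norm (x t'))\<^sup>2) \<le> exp (2 * \<sigma> * t') * (exp (- 2 * \<sigma> * t')
     * (matnorm P * (c3 * J)\<^sup>2 + (2 * \<gamma> * J\<^sup>2 + PS / (2 * \<mu>) * md\<^sup>2) / \<mu>))"
    by (intro mult_left_mono) auto
  also have "\<dots> = matnorm P * (c3 * J)\<^sup>2 + (2 * \<gamma> * J\<^sup>2 + PS / (2 * \<mu>) * md\<^sup>2) / \<mu>"
    unfolding mult.assoc[symmetric] exp_add[symmetric] by simp
  also have "\<dots> = K\<^sub>1 * ((Aw * J)\<^sup>2 + (Sx * md)\<^sup>2)"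
  proof -
    have 1: "Aw\<^sup>2 = (matnorm P * c3\<^sup>2 + 2 * \<gamma> / \<mu>) / K\<^sub>1"
      unfolding Cm(1) using P0 pos by (intro real_sqrt_pow2 divide_nonneg_pos add_nonneg_nonneg) auto
    have 2: "Sx\<^sup>2 = PS / (2 * K\<^sub>1) / \<mu>\<^sup>2"
      using PS_nonneg pos by (simp add: Sx_def power_divide)
    have "K\<^sub>1 \<noteq> 0" "\<mu> \<noteq> 0" using pos by auto
    from gain_identity[OF this] show ?thesis unfolding power_mult_distrib 1 2 by (simp only: mult.assoc)
  qed
  also have "exp (2 * \<sigma> * t') * (K\<^sub>1 * (norm (x t'))\<^sup>2) = K\<^sub>1 * mx\<^sup>2"
    by (simp add: mx_def power_mult_distrib power2_eq_square mult_ac flip: exp_add)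
  finally have sq: "mx\<^sup>2 \<le> (Aw * J)\<^sup>2 + (Sx * md)\<^sup>2" using pos by simp
  have Aw0: "Aw \<ge> 0" unfolding Cm(1) using P0 pos by (intro real_sqrt_ge_zero divide_nonneg_pos add_nonneg_nonneg) auto
  have mx: "mx \<le> Aw * J + Sx * md"
    by (rule sqrt_sum_squares_bound[OF sq]) (use Aw0 J0 Sx0 md0 in auto)
  define X where "X = mx + c3 * J"
  \<comment> \<open>An input value u(s) issued from holding instant \<open>jj\<close> on is the
    deviation plus k'x at time s + \<tau>; earlier ones are covered by the term
    \<open>c3 * J\<close>.\<close>
  define U where "U = md + norm k * mx + c3 * J"
  have X0: "X \<ge> 0" "U \<ge> 0" using mx0 md0 c3 J0 by (auto simp: X_def U_def)
  have Xb: "norm (x s) \<le> X * exp (- \<sigma> * s)" if s: "s \<in> {0..H + \<tau>}" for s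
  proof (cases "s \<le> t1")
    case True
    have "norm (x s) \<le> c3 * J * exp (- \<sigma> * s)" by (rule c3(2)[OF s True])
    also have "\<dots> \<le> X * exp (- \<sigma> * s)" using mx0 by (intro mult_right_mono) (auto simp: X_def)
    finally show ?thesis .
  next
    case False
    then have "norm (x s) \<le> mx * exp (- \<sigma> * s)" using s by (intro xm) auto
    also have "\<dots> \<le> X * exp (- \<sigma> * s)" using c3(1) J0 by (intro mult_right_mono) (auto simp: X_def)
    finally show ?thesis .
  qed
  have Ub: "\<bar>u s\<bar> \<le> U * exp (- \<sigma> * s)" if s: "s \<in> {-r-\<tau>..H}" for s
  proof (cases "s < real jj * T\<^sub>2")
    case True
    have "\<bar>u s\<bar> \<le> c3 * J * exp (- \<sigma> * s)" by (rule c3(3)[OF s True])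
    also have "\<dots> \<le> U * exp (- \<sigma> * s)" using mx0 md0 by (intro mult_right_mono) (auto simp: U_def)
    finally show ?thesis .
  next
    case False
    then have s': "s + \<tau> \<in> {t1..H + \<tau>}" using s t1 by auto
    have "\<bar>u s\<bar> \<le> \<bar>u (s + \<tau> - \<tau>) - k \<bullet> x (s + \<tau>)\<bar> + \<bar>k \<bullet> x (s + \<tau>)\<bar>" by simp
    also have "\<dots> \<le> md * exp (- \<sigma> * (s + \<tau>)) + norm k * (mx * exp (- \<sigma> * (s + \<tau>)))"
      using dm[OF s'] Cauchy_Schwarz_ineq2[of k "x (s + \<tau>)"] mult_left_mono[OF xm[OF s'], of "norm k"]
      by (intro add_mono) auto
    also have "\<dots> = (md + norm k * mx) * exp (- \<sigma> * (s + \<tau>))" by (simp add: algebra_simps)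
    also have "\<dots> \<le> U * exp (- \<sigma> * s)"
      using md0 mx0 c3(1) J0 \<sigma> delays by (intro mult_mono) (auto simp: U_def mult_left_mono)
    finally show ?thesis .
  qed
  have key: "\<delta> t \<le> E * \<kappa> * ((N + norm k) * mx + md) + C9 * J" if t: "t \<in> {t1..H + \<tau>}" for t
  proof -
    define i where "i = nat \<lfloor>(t - \<tau>) / T\<^sub>2\<rfloor>"
    have tq: "(t - \<tau>) / T\<^sub>2 \<ge> real jj" using t t1 pos by (simp add: field_simps)
    then have fl: "real i = of_int \<lfloor>(t - \<tau>) / T\<^sub>2\<rfloor>" by (simp add: i_def)
    have i1: "real i \<le> (t - \<tau>) / T\<^sub>2" "(t - \<tau>) / T\<^sub>2 < real i + 1" unfolding fl by linarith+
    have i2: "real i * T\<^sub>2 \<le> t - \<tau>" "t - \<tau> < real (Suc i) * T\<^sub>2" using i1 pos by (auto simp: field_simps)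
    have "real jj < real (Suc i)" using tq i1(2) by simp
    then have "real jj \<le> real i" by simp
    then have "real jj * T\<^sub>2 \<le> real i * T\<^sub>2" using pos by (intro mult_right_mono) auto
    then have ir: "r + T\<^sub>1 \<le> real i * T\<^sub>2" using jj by linarith
    have Coi: "norm (z (real i * T\<^sub>2) - x (real i * T\<^sub>2 - r)) \<le> Co * exp (- \<sigma> * (real i * T\<^sub>2)) * J"
      using ir i2 t by (intro Co(2)) auto
    have "\<bar>u (t - \<tau>) - k \<bullet> x t\<bar> \<le> norm k * exp (\<sigma> * (T\<^sub>2 + 2 * R)) * exp (- \<sigma> * t) *
       (T\<^sub>2 * (N * X + U + G * J) + (pe * (X + Co * J + U) + 2 * exp (2 * N * R) * (Co * J + G * J * R)))"
      using ir pos t by (intro prediction_mismatch[OF tr \<sigma>(1) _ i2 _ Xb X0(1) Ub X0(2) Coi Co(1)]) auto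
    then have "\<delta> t \<le> exp (\<sigma> * t) * (norm k * E * exp (- \<sigma> * t) *
       (T\<^sub>2 * (N * X + U + G * J) + (pe * (X + Co * J + U) + 2 * exp (2 * N * R) * (Co * J + G * J * R))))"
      unfolding \<delta>_def E_def by (intro mult_left_mono) auto
    also have "\<dots> = (exp (\<sigma> * t) * exp (- \<sigma> * t)) * (norm k * E *
       (T\<^sub>2 * (N * X + U + G * J) + (pe * (X + Co * J + U) + 2 * exp (2 * N * R) * (Co * J + G * J * R))))"
      by (simp only: mult_ac)
    also have "exp (\<sigma> * t) * exp (- \<sigma> * t) = 1" by (simp flip: exp_add)
    also have "1 * (norm k * E *
       (T\<^sub>2 * (N * X + U + G * J) + (pe * (X + Co * J + U) + 2 * exp (2 * N * R) * (Co * J + G * J * R))))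
      = norm k * E * (T\<^sub>2 * ((N + norm k) * mx + md) + pe * ((1 + norm k) * mx + md)) + C9 * J"
      unfolding Cm(2) X_def U_def E_def[symmetric] by (simp add: algebra_simps)
    also have "\<dots> \<le> norm k * E * (T\<^sub>2 * ((N + norm k) * mx + md) + pe * ((N + norm k) * mx + md)) + C9 * J"
      \<comment> \<open>From N \<ge> 1: the predictor term gets the same factor N + |k| as the hold,
        so that \<open>T\<^sub>2\<close> and \<open>pe\<close> combine into \<kappa>.\<close>
      using N0 pe_nonneg mx0 E0 by (intro add_right_mono mult_left_mono add_left_mono mult_right_mono) auto
    also have "\<dots> = E * \<kappa> * ((N + norm k) * mx + md) + C9 * J" by (simp add: \<kappa>_def algebra_simps)
    finally show ?thesis .
  qed
  have "md \<le> E * \<kappa> * ((N + norm k) * mx + md) + C9 * J"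
    unfolding md_def by (rule cSUP_least) (use t1 key in \<open>auto simp: md_def\<close>)
  also have "\<dots> \<le> E * \<kappa> * ((N + norm k) * (Aw * J + Sx * md) + md) + C9 * J"
    using E0 \<kappa>_nonneg N0 mx by (intro add_right_mono mult_left_mono) auto
  also have "\<dots> = E * (\<kappa> * ((N + norm k) * Sx + 1)) * md + (E * \<kappa> * (N + norm k) * Aw + C9) * J"
    by (simp add: algebra_simps)
  finally have "(1 - E * (\<kappa> * ((N + norm k) * Sx + 1))) * md \<le> (E * \<kappa> * (N + norm k) * Aw + C9) * J"
    unfolding left_diff_distrib by linarith
  moreover have sl: "1 - E * (\<kappa> * ((N + norm k) * Sx + 1)) > 0" using slack by (simp add: E_def)
  ultimately have "md \<le> (E * \<kappa> * (N + norm k) * Aw + C9) * J / (1 - E * (\<kappa> * ((N + norm k) * Sx + 1)))"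
    by (simp add: pos_le_divide_eq mult.commute)
  then have mdC: "md \<le> Cd * J" unfolding Cm(3) E_def by simp
  have "mx \<le> Aw * J + Sx * (Cd * J)"
    using mx mult_left_mono[OF mdC Sx0] by linarith
  then have "mx \<le> (Aw + Sx * Cd) * J" by (simp add: algebra_simps)
  with mx0 md0 mdC xm dm show ?thesis by blast
qed

text \<open>Before \<open>t1\<close> the crude bounds are recast as decaying ones. After it
  \<open>closed_loop_gain\<close> bounds x and the deviation, the input follows from both, and z and
  w follow from the delayed x and the observer errors. The rate \<sigma> is fixed before any
  constant, because all constants depend on it.\<close>

lemma closed_loop_decay:
  "\<exists>\<sigma>>0. \<exists>C\<ge>0. \<forall>H J x u z w \<xi> d D ts. trajectory H J \<sigma> x u z w \<xi> d D ts \<longrightarrow>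
     (\<forall>t\<in>{0..H}. norm (z t) \<le> C * exp (- \<sigma> * t) * J \<and> \<bar>w t\<bar> \<le> C * exp (- \<sigma> * t) * J)
     \<and> (\<forall>s\<in>{-r..H}. norm (x s) \<le> C * exp (- \<sigma> * s) * J)
     \<and> (\<forall>s\<in>{-r-\<tau>..H}. \<bar>u s\<bar> \<le> C * exp (- \<sigma> * s) * J)"
proof -
  obtain \<sigma>1 where \<sigma>1: "\<sigma>1 > 0" and obs: "\<And>\<sigma>. 0 \<le> \<sigma> \<Longrightarrow> \<sigma> \<le> \<sigma>1 \<Longrightarrow> (\<exists>C\<ge>0. \<forall>H J x u z w \<xi> d D ts t. trajectory H J \<sigma> x u z w \<xi> d D ts \<longrightarrow>
     t \<in> {r + T\<^sub>1..H} \<longrightarrow> norm (z t - x (t - r)) \<le> C * exp (- \<sigma> * t) * J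
       \<and> \<bar>w t - x (t - r) $ fst_idx\<bar> \<le> C * exp (- \<sigma> * t) * J)"
    using observer_convergence by blast
  obtain s2 where s2: "s2 > 0" "\<And>\<sigma>. \<sigma> \<le> s2 \<Longrightarrow> exp (\<sigma> * (T\<^sub>2 + 2 * R)) * (\<kappa> * ((N + norm k) * Sx + 1)) < 1"
    using exp_slack[OF small_gain, of "T\<^sub>2 + 2 * R"] pos_consts delays by auto
  define \<sigma> where "\<sigma> = min (min \<sigma>1 s2) (\<mu> / 2)"
  have \<sigma>: "\<sigma> > 0" "\<sigma> \<le> \<sigma>1" "\<sigma> \<le> s2" "\<sigma> \<le> \<mu> / 2" using \<sigma>1 s2 pos_consts by (auto simp: \<sigma>_def)
  have \<sigma>0: "0 \<le> \<sigma>" using \<sigma> by simp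
  obtain Co where Co0: "Co \<ge> 0" and Co: "\<And>H J x u z w \<xi> d D ts t. \<lbrakk>trajectory H J \<sigma> x u z w \<xi> d D ts; t \<in> {r + T\<^sub>1..H}\<rbrakk>
      \<Longrightarrow> norm (z t - x (t - r)) \<le> Co * exp (- \<sigma> * t) * J \<and> \<bar>w t - x (t - r) $ fst_idx\<bar> \<le> Co * exp (- \<sigma> * t) * J"
    using obs[OF \<sigma>0 \<sigma>(2)] by metis
  obtain C4 where C40: "C4 \<ge> 0" and C4: "\<And>H J x u z w \<xi> d D ts. trajectory H J \<sigma> x u z w \<xi> d D ts \<Longrightarrow>
     (\<forall>t\<in>{0..H}. t \<le> real jj * T\<^sub>2 \<longrightarrow> norm (z t) \<le> C4 * J \<and> \<bar>w t\<bar> \<le> C4 * J \<and> norm (x t) \<le> C4 * J)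
     \<and> (\<forall>s\<in>{-r-\<tau>..H}. s < real jj * T\<^sub>2 \<longrightarrow> \<bar>u s\<bar> \<le> C4 * J)"
    using crude_bound[OF \<sigma>0, of jj] by metis
  have G0: "G \<ge> 0" using G_nonneg[OF A] .
  have P0: "matnorm P \<ge> 0" unfolding matnorm_def by (rule onorm_pos_le) simp
  have Sx0: "Sx \<ge> 0" using pos_consts PS_nonneg by (simp add: Sx_def)
  define t1 where "t1 = real jj * T\<^sub>2 + \<tau>"
  have t10: "t1 \<ge> 0" using pos_consts delays by (simp add: t1_def)
  \<comment> \<open>The crude bound on x reaches up to \<open>t1\<close>, that is \<tau> past
    holding instant \<open>jj\<close>: until then the plant is driven by input issued before that
    instant.\<close>
  define Cx where "Cx = 2 * exp (2 * N * t1) * (1 + (C4 + G) * t1)"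
  have Cx0: "Cx \<ge> 0" using C40 G0 t10 by (simp add: Cx_def)
  define c3 where "c3 = (Cx + C4) * exp (\<sigma> * t1)"
  have c30: "c3 \<ge> 0" using Cx0 C40 by (simp add: c3_def)
  define Aw where "Aw = sqrt ((matnorm P * c3\<^sup>2 + 2 * \<gamma> / \<mu>) / K\<^sub>1)"
  define C9 where "C9 = exp (\<sigma> * (T\<^sub>2 + 2 * R)) * norm k * (T\<^sub>2 * (N * c3 + c3 + G) + (pe * (2 * c3 + Co) + 2 * exp (2 * N * R) * (Co + G * R)))"
  define Cd where "Cd = (exp (\<sigma> * (T\<^sub>2 + 2 * R)) * \<kappa> * (N + norm k) * Aw + C9)
         / (1 - exp (\<sigma> * (T\<^sub>2 + 2 * R)) * (\<kappa> * ((N + norm k) * Sx + 1)))"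
  have Aw0: "Aw \<ge> 0" unfolding Aw_def using P0 pos_consts by (intro real_sqrt_ge_zero divide_nonneg_pos add_nonneg_nonneg) auto
  have C90: "C9 \<ge> 0" unfolding C9_def using pos_consts N_ge_1 c30 G0 pe_nonneg Co0 delays
    by (intro mult_nonneg_nonneg add_nonneg_nonneg) auto
  have Cd0: "Cd \<ge> 0" unfolding Cd_def using s2(2)[OF \<sigma>(3)] \<kappa>_nonneg N_ge_1 Aw0 C90
    by (intro divide_nonneg_pos add_nonneg_nonneg mult_nonneg_nonneg) auto
  \<comment> \<open>The summand 1 accounts for the prescribed history of x at negative
    times.\<close>
  define CX where "CX = (Aw + Sx * Cd) + c3 + 1"
  define CU where "CU = Cd + norm k * (Aw + Sx * Cd) + c3"
  define Cz where "Cz = C4 * exp (\<sigma> * (r + T\<^sub>1)) + Co + CX * exp (\<sigma> * r)"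
  define C where "C = CX + CU + Cz"
  have CX0: "CX \<ge> 0" using Aw0 Sx0 Cd0 c30 by (simp add: CX_def)
  have CU0: "CU \<ge> 0" using Aw0 Sx0 Cd0 c30 by (simp add: CU_def)
  have Cz0: "Cz \<ge> 0" using C40 Co0 CX0 by (simp add: Cz_def)
  have C0: "C \<ge> 0" using CX0 CU0 Cz0 by (simp add: C_def)
  have main: "(\<forall>t\<in>{0..H}. norm (z t) \<le> Cz * exp (- \<sigma> * t) * J \<and> \<bar>w t\<bar> \<le> Cz * exp (- \<sigma> * t) * J)
     \<and> (\<forall>s\<in>{-r..H}. norm (x s) \<le> CX * exp (- \<sigma> * s) * J)
     \<and> (\<forall>s\<in>{-r-\<tau>..H}. \<bar>u s\<bar> \<le> CU * exp (- \<sigma> * s) * J)"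
    if tr: "trajectory H J \<sigma> x u z w \<xi> d D ts" for H J x u z w \<xi> d D ts
  proof -
    have J0: "J \<ge> 0" "H \<ge> 0" using trajectoryD(1,2)[OF tr] by auto
    have xcr: "norm (x s) \<le> c3 * J * exp (- \<sigma> * s)" if s: "s \<in> {0..H + \<tau>}" "s \<le> t1" for s
    proof -
      have "norm (x s) \<le> Cx * J" unfolding Cx_def
      proof (rule crude_plant_bound[OF tr \<sigma>0 _ _ _ _ C40])
        show "\<bar>u (\<rho> - \<tau>)\<bar> \<le> C4 * J" if "\<rho> \<in> {0..<s}" for \<rho>
          using C4[OF tr] that s delays by (auto simp: t1_def)
      qed (use s in auto)
      also have "\<dots> \<le> (Cx * J) * exp (\<sigma> * t1) * exp (- \<sigma> * s)"
        using s J0 Cx0 \<sigma>0 by (intro crude_le_decaying) auto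
      also have "\<dots> \<le> c3 * J * exp (- \<sigma> * s)"
        using C40 J0 by (auto simp: c3_def algebra_simps)
      finally show ?thesis .
    qed
    have ucr: "\<bar>u s\<bar> \<le> c3 * J * exp (- \<sigma> * s)" if s: "s \<in> {-r-\<tau>..H}" "s < real jj * T\<^sub>2" for s
    proof -
      have "\<bar>u s\<bar> \<le> C4 * J" using C4[OF tr] s by blast
      also have "\<dots> \<le> (C4 * J) * exp (\<sigma> * t1) * exp (- \<sigma> * s)"
        using s J0 C40 \<sigma>0 delays by (intro crude_le_decaying) (auto simp: t1_def)
      also have "\<dots> \<le> c3 * J * exp (- \<sigma> * s)"
        using Cx0 J0 by (auto simp: c3_def algebra_simps)
      finally show ?thesis .
    qed
    have "\<exists>mx md. mx \<ge> 0 \<and> md \<ge> 0 \<and> mx \<le> (Aw + Sx * Cd) * J \<and> md \<le> Cd * J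
      \<and> (\<forall>s\<in>{t1..H + \<tau>}. norm (x s) \<le> mx * exp (- \<sigma> * s) \<and> \<bar>u (s - \<tau>) - k \<bullet> x s\<bar> \<le> md * exp (- \<sigma> * s))"
    proof (cases "t1 \<le> H + \<tau>")
      case True
      show ?thesis
        using Co[OF tr] by (intro closed_loop_gain[OF tr \<sigma>0 \<sigma>(4) s2(2)[OF \<sigma>(3)] t1_def True c30 xcr ucr Co0 _ Aw_def C9_def Cd_def]) auto
    next
      case False
      then show ?thesis
        using Aw0 Sx0 Cd0 J0 by (intro exI[of _ 0]) auto
    qed
    then obtain mx md where m: "mx \<ge> 0" "md \<ge> 0" "mx \<le> (Aw + Sx * Cd) * J" "md \<le> Cd * J"
      and xm: "\<And>s. s \<in> {t1..H + \<tau>} \<Longrightarrow> norm (x s) \<le> mx * exp (- \<sigma> * s)"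
      and dm: "\<And>s. s \<in> {t1..H + \<tau>} \<Longrightarrow> \<bar>u (s - \<tau>) - k \<bullet> x s\<bar> \<le> md * exp (- \<sigma> * s)" by blast
    have xb: "norm (x s) \<le> CX * exp (- \<sigma> * s) * J" if s: "s \<in> {-r..H}" for s
    proof -
      consider "s < 0" | "0 \<le> s" "s \<le> t1" | "0 \<le> s" "t1 < s" by linarith
      then show ?thesis
      proof cases
        case 1
        then have "norm (x s) \<le> J" using trajectoryD(16)[OF tr, of s] s by auto
        also have "\<dots> \<le> J * exp (\<sigma> * 0) * exp (- \<sigma> * s)" using 1 J0 \<sigma>0 by (intro crude_le_decaying) auto
        also have "\<dots> \<le> CX * J * exp (- \<sigma> * s)"
          using J0 Aw0 Sx0 Cd0 c30 by (intro mult_right_mono) (auto simp: CX_def algebra_simps)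
        finally show ?thesis by (simp only: mult_ac)
      next
        case 2
        then have "norm (x s) \<le> c3 * J * exp (- \<sigma> * s)" using s delays by (intro xcr) auto
        also have "\<dots> \<le> CX * J * exp (- \<sigma> * s)"
          using J0 Aw0 Sx0 Cd0 by (intro mult_right_mono) (auto simp: CX_def)
        finally show ?thesis by (simp only: mult_ac)
      next
        case 3
        then have "norm (x s) \<le> mx * exp (- \<sigma> * s)" using s delays by (intro xm) auto
        also have "mx \<le> CX * J"
          using m(3) mult_nonneg_nonneg[OF c30 J0(1)] J0 by (simp add: CX_def algebra_simps)
        finally show ?thesis by (simp add: mult_ac)
      qed
    qed
    have ub: "\<bar>u s\<bar> \<le> CU * exp (- \<sigma> * s) * J" if s: "s \<in> {-r-\<tau>..H}" for s
    proof (cases "s < real jj * T\<^sub>2")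
      case True
      have "\<bar>u s\<bar> \<le> c3 * J * exp (- \<sigma> * s)" by (rule ucr[OF s True])
      also have "\<dots> \<le> CU * J * exp (- \<sigma> * s)"
        using J0 Aw0 Sx0 Cd0 by (intro mult_right_mono) (auto simp: CU_def)
      finally show ?thesis by (simp only: mult_ac)
    next
      case False
      then have s': "s + \<tau> \<in> {t1..H + \<tau>}" using s by (auto simp: t1_def)
      have "\<bar>u s\<bar> \<le> \<bar>u (s + \<tau> - \<tau>) - k \<bullet> x (s + \<tau>)\<bar> + \<bar>k \<bullet> x (s + \<tau>)\<bar>" by simp
      also have "\<dots> \<le> md * exp (- \<sigma> * (s + \<tau>)) + norm k * (mx * exp (- \<sigma> * (s + \<tau>)))"
        using dm[OF s'] Cauchy_Schwarz_ineq2[of k "x (s + \<tau>)"] mult_left_mono[OF xm[OF s'], of "norm k"]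
        by (intro add_mono) auto
      also have "\<dots> = (md + norm k * mx) * exp (- \<sigma> * (s + \<tau>))" by (simp add: algebra_simps)
      also have "\<dots> \<le> (CU * J) * exp (- \<sigma> * s)"
      proof (rule mult_mono)
        have "md + norm k * mx \<le> Cd * J + norm k * ((Aw + Sx * Cd) * J)" using m by (intro add_mono mult_left_mono) auto
        also have "\<dots> \<le> CU * J" using c30 J0 by (simp add: CU_def algebra_simps)
        finally show "md + norm k * mx \<le> CU * J" .
      qed (use CU0 J0 \<sigma>0 delays in \<open>auto simp: mult_left_mono\<close>)
      finally show ?thesis by (simp only: mult_ac)
    qed
    have zb: "norm (z t) \<le> Cz * exp (- \<sigma> * t) * J \<and> \<bar>w t\<bar> \<le> Cz * exp (- \<sigma> * t) * J" if t: "t \<in> {0..H}" for t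
    proof (cases "t \<le> r + T\<^sub>1")
      case True
      have "C4 * J \<le> (C4 * J) * exp (\<sigma> * (r + T\<^sub>1)) * exp (- \<sigma> * t)"
        using True C40 J0 \<sigma>0 by (intro crude_le_decaying) auto
      also have "\<dots> = (C4 * exp (\<sigma> * (r + T\<^sub>1))) * exp (- \<sigma> * t) * J" by (simp only: mult_ac)
      also have "\<dots> \<le> Cz * exp (- \<sigma> * t) * J"
        using Co0 CX0 J0 by (intro mult_right_mono) (auto simp: Cz_def)
      finally have le: "C4 * J \<le> Cz * exp (- \<sigma> * t) * J" .
      have "norm (z t) \<le> C4 * J \<and> \<bar>w t\<bar> \<le> C4 * J" using C4[OF tr] t True jj by force
      then show ?thesis using le by linarith
    next
      case False
      then have Cot: "norm (z t - x (t - r)) \<le> Co * exp (- \<sigma> * t) * J" "\<bar>w t - x (t - r) $ fst_idx\<bar> \<le> Co * exp (- \<sigma> * t) * J"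
        using Co[OF tr, of t] t by auto
      have "norm (x (t - r)) \<le> CX * exp (- \<sigma> * (t - r)) * J"
        using t delays False pos_consts by (intro xb) auto
      also have "\<dots> = CX * exp (\<sigma> * r) * exp (- \<sigma> * t) * J" by (simp add: algebra_simps flip: exp_add)
      finally have x: "norm (x (t - r)) \<le> CX * exp (\<sigma> * r) * exp (- \<sigma> * t) * J" .
      have le: "Co * exp (- \<sigma> * t) * J + CX * exp (\<sigma> * r) * exp (- \<sigma> * t) * J \<le> Cz * exp (- \<sigma> * t) * J"
        using C40 J0 by (simp add: Cz_def algebra_simps)
      have "norm (z t) \<le> norm (z t - x (t - r)) + norm (x (t - r))"
        using norm_triangle_sub[of "z t" "x (t - r)"] by simp
      moreover have "\<bar>w t\<bar> \<le> \<bar>w t - x (t - r) $ fst_idx\<bar> + norm (x (t - r))"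
        using norm_nth_le[of "x (t - r)" fst_idx] by linarith
      ultimately show ?thesis using Cot x le by linarith
    qed
    show ?thesis using xb ub zb by blast
  qed
  have le: "c * exp (- \<sigma> * t) * J \<le> C * exp (- \<sigma> * t) * J" if "J \<ge> 0" "c \<le> C" for c t J
    using that by (intro mult_right_mono) auto
  have les: "CX \<le> C" "CU \<le> C" "Cz \<le> C" using CX0 CU0 Cz0 by (auto simp: C_def)
  show ?thesis
  proof (rule exI[of _ \<sigma>], intro conjI exI[of _ C] allI impI)
    fix H J x u z w \<xi> d D ts
    assume tr: "trajectory H J \<sigma> x u z w \<xi> d D ts"
    note J0 = trajectoryD(2)[OF tr]
    show "\<forall>t\<in>{0..H}. norm (z t) \<le> C * exp (- \<sigma> * t) * J \<and> \<bar>w t\<bar> \<le> C * exp (- \<sigma> * t) * J"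
      "\<forall>s\<in>{-r..H}. norm (x s) \<le> C * exp (- \<sigma> * s) * J"
      "\<forall>s\<in>{-r-\<tau>..H}. \<bar>u s\<bar> \<le> C * exp (- \<sigma> * s) * J"
      using main[OF tr] le[OF J0 les(1)] le[OF J0 les(2)] le[OF J0 les(3)] by (meson order_trans)+
  qed (use \<sigma> C0 in auto)
qed

end

section \<open>Existence of solutions\<close>

lemma lebesgue_measurable_shift:
  fixes h :: "real \<Rightarrow> 'a::euclidean_space"
  assumes "h \<in> borel_measurable lebesgue"
  shows "(\<lambda>s. h (s + c)) \<in> borel_measurable lebesgue"
proof -
  have "(\<lambda>s::real. c + (\<Sum>j\<in>Basis. (1 * (s \<bullet> j)) *\<^sub>R j)) \<in> lebesgue \<rightarrow>\<^sub>M lebesgue"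
    by (rule lebesgue_affine_measurable) simp
  then have "(\<lambda>s::real. s + c) \<in> lebesgue \<rightarrow>\<^sub>M lebesgue"
    by (simp add: add.commute)
  from measurable_compose[OF this assms] show ?thesis .
qed

lemma measurable_vec_lambda:
  fixes h :: "'a \<Rightarrow> 'n::finite \<Rightarrow> real"
  assumes "\<And>i. (\<lambda>s. h s i) \<in> borel_measurable M"
  shows "(\<lambda>s. \<chi> i. h s i) \<in> borel_measurable M"
  unfolding borel_measurable_euclidean_space[where 'c = "real ^ 'n"]
  using assms by (auto simp: Basis_vec_def inner_axis)

lemma loc_lipschitz_continuous_on: "loc_lipschitz h \<Longrightarrow> continuous_on S h"
proof (rule continuous_at_imp_continuous_on, rule ballI)
  fix x assume "loc_lipschitz h"
  then obtain e C where e: "e > 0" "C-lipschitz_on (cball x e) h" unfolding loc_lipschitz_def by blast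
  then have "continuous_on (ball x e) h"
    by (meson ball_subset_cball continuous_on_subset lipschitz_on_continuous_on)
  then show "isCont h x" using e(1) by (simp add: continuous_on_eq_continuous_at)
qed

text \<open>The property is time-independent; the dummy time set {0} brings it into the form of the
  uniform Lipschitz result for time-dependent maps on compact sets.\<close>

lemma loc_lipschitz_compact:
  assumes h: "loc_lipschitz h" and S: "compact S"
  shows "\<exists>C\<ge>0. \<forall>x\<in>S. \<forall>y\<in>S. dist (h x) (h y) \<le> C * dist x y"
proof -
  have "local_lipschitz {0::real} S (\<lambda>_. h)"
    unfolding local_lipschitz_def
  proof (intro ballI)
    fix x and t :: real
    obtain e C where e: "e > 0" "C-lipschitz_on (cball x e) h" using h unfolding loc_lipschitz_def by blast
    then have "C-lipschitz_on (cball x e \<inter> S) h" by (meson inf_le1 lipschitz_on_subset)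
    then show "\<exists>u>0. \<exists>L. \<forall>t\<in>cball t u \<inter> {0}. L-lipschitz_on (cball x u \<inter> S) h"
      using e(1) by blast
  qed
  from local_lipschitz_compact_implies_lipschitz[OF this S]
  obtain C where "C-lipschitz_on S h" by auto
  then show ?thesis
    using lipschitz_on_nonneg lipschitz_onD by blast
qed

section \<open>Plant and observer under a prescribed input\<close>

context predictor_feedback
begin

text \<open>Inputs are total functions whose values before -R are arbitrary, so measurability is
  required of the function masked there by 0.\<close>

definition regular_input :: "(real \<Rightarrow> real) \<Rightarrow> bool" where
  "regular_input u \<longleftrightarrow> (\<lambda>s. if - R \<le> s then u s else 0) \<in> borel_measurable lebesgue
     \<and> (\<forall>c. \<exists>U. \<forall>s\<in>{-R..c}. \<bar>u s\<bar> \<le> U)"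

lemma regular_input_measurable:
  assumes "regular_input u" "\<And>s. s \<in> S \<Longrightarrow> - R \<le> s + c" "S \<in> sets lebesgue"
  shows "(\<lambda>s. u (s + c)) \<in> borel_measurable (lebesgue_on S)"
proof -
  have "(\<lambda>s. if - R \<le> s then u s else 0) \<in> borel_measurable lebesgue" using assms(1) by (simp add: regular_input_def)
  from measurable_restrict_space1[OF lebesgue_measurable_shift[OF this]]
  have "(\<lambda>s. if - R \<le> s + c then u (s + c) else 0) \<in> borel_measurable (lebesgue_on S)" .
  then show ?thesis
    by (rule measurable_cong[THEN iffD1, rotated]) (use assms(2) in \<open>auto simp: space_restrict_space\<close>)
qed

lemma regular_input_bounded:
  assumes "regular_input u"
  obtains U where "U \<ge> 0" "\<And>s. s \<in> {-R..c} \<Longrightarrow> \<bar>u s\<bar> \<le> U"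
proof -
  obtain U where U: "\<forall>s\<in>{-R..c}. \<bar>u s\<bar> \<le> U" using assms unfolding regular_input_def by blast
  show thesis by (rule that[of "max U 0"]) (use U in \<open>auto simp: le_max_iff_disj\<close>)
qed

lemma g_continuous: "continuous_on UNIV (\<lambda>(x, v). g i x v)"
  using plant_fg loc_lipschitz_continuous_on unfolding plant_functions_def by blast

text \<open>Bounded states and inputs form a compact set, on which each locally Lipschitz component
  of g is uniformly Lipschitz; summing the finitely many constants yields a common one.\<close>

lemma g_lipschitz_bounded:
  "\<exists>C\<ge>0. \<forall>i x x' v. norm x \<le> \<rho> \<longrightarrow> norm x' \<le> \<rho> \<longrightarrow> \<bar>v\<bar> \<le> U \<longrightarrow> \<bar>g i x v - g i x' v\<bar> \<le> C * norm (x - x')"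
proof -
  have "\<exists>C\<ge>0. \<forall>x x' v. norm x \<le> \<rho> \<longrightarrow> norm x' \<le> \<rho> \<longrightarrow> \<bar>v\<bar> \<le> U \<longrightarrow> \<bar>g i x v - g i x' v\<bar> \<le> C * norm (x - x')" for i
  proof -
    have "loc_lipschitz (\<lambda>(x, v). g i x v)" using plant_fg by (simp add: plant_functions_def)
    then obtain C where C: "C \<ge> 0" "\<forall>y\<in>cball 0 \<rho> \<times> {-U..U}. \<forall>y'\<in>cball 0 \<rho> \<times> {-U..U}.
        dist (case y of (x, v) \<Rightarrow> g i x v) (case y' of (x, v) \<Rightarrow> g i x v) \<le> C * dist y y'"
      using loc_lipschitz_compact[of _ "cball 0 \<rho> \<times> {-U..U}"] by (metis compact_Times compact_cball compact_Icc)
    have "\<bar>g i x v - g i x' v\<bar> \<le> C * norm (x - x')" if "norm x \<le> \<rho>" "norm x' \<le> \<rho>" "\<bar>v\<bar> \<le> U" for x x' v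
    proof -
      have "(x, v) \<in> cball 0 \<rho> \<times> {-U..U}" "(x', v) \<in> cball 0 \<rho> \<times> {-U..U}" using that by auto
      from bspec[OF bspec[OF C(2) this(1)] this(2)] show ?thesis
        by (simp add: dist_Pair_Pair dist_norm)
    qed
    with C(1) show ?thesis by blast
  qed
  then obtain C where C: "\<And>i. C i \<ge> 0" "\<And>i x x' v. \<lbrakk>norm x \<le> \<rho>; norm x' \<le> \<rho>; \<bar>v\<bar> \<le> U\<rbrakk> \<Longrightarrow> \<bar>g i x v - g i x' v\<bar> \<le> C i * norm (x - x')"
    by metis
  have "C i \<le> (\<Sum>i\<in>UNIV. C i)" for i using C(1) by (intro member_le_sum) auto
  then have "\<bar>g i x v - g i x' v\<bar> \<le> (\<Sum>i\<in>UNIV. C i) * norm (x - x')" if "norm x \<le> \<rho>" "norm x' \<le> \<rho>" "\<bar>v\<bar> \<le> U" for i x x' v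
    using C(2)[OF that, of i] mult_right_mono[of "C i" _ "norm (x - x')"] by (meson norm_ge_zero order_trans)
  moreover have "(\<Sum>i\<in>UNIV. C i) \<ge> 0" using C(1) by (simp add: sum_nonneg)
  ultimately show ?thesis by blast
qed

lemma diag_diff_bound:
  assumes "\<And>i. \<bar>g i x v - g i x' v\<bar> \<le> c" "c \<ge> 0"
  shows "norm (diag (\<chi> i. g i x v) *v d - diag (\<chi> i. g i x' v) *v d) \<le> c * norm d"
proof (rule norm_vec_le_comp[OF _ assms(2)])
  fix i
  have "(diag (\<chi> i. g i x v) *v d - diag (\<chi> i. g i x' v) *v d) $ i = (g i x v - g i x' v) * d $ i"
    by (simp add: diag_mult left_diff_distrib)
  then show "\<bar>(diag (\<chi> i. g i x v) *v d - diag (\<chi> i. g i x' v) *v d) $ i\<bar> \<le> c * \<bar>d $ i\<bar>"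
    using assms(1)[of i] by (simp add: abs_mult mult_right_mono)
qed

definition plant_rhs :: "(real \<Rightarrow> 'n rvec) \<Rightarrow> (real \<Rightarrow> real) \<Rightarrow> (real \<Rightarrow> 'n rvec) \<Rightarrow> real \<Rightarrow> 'n rvec" where
  "plant_rhs d u x t = drift f (x t) (u (t - \<tau>)) + diag (\<chi> i. g i (x t) (u t)) *v d t"

text \<open>As g is only locally Lipschitz, the state in its argument is projected onto a ball,
  which makes the right-hand side globally Lipschitz. The bound G on g persists under the
  projection, so \<rho> can be fixed beforehand as the Gronwall bound. The solution then stays in
  the ball, the projection has no effect on it, and it solves the original equation.\<close>

lemma plant_solution_exists:
  assumes u: "regular_input u" and dm: "d \<in> borel_measurable (lebesgue_on {0..H})"
    and db: "\<And>s. s \<in> {0..H} \<Longrightarrow> norm (d s) \<le> W" and H: "0 \<le> H"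
  obtains x where "ac_solves {0..H} x (plant_rhs d u x)" "x 0 = x0"
proof -
  obtain U where U: "U \<ge> 0" "\<And>s. s \<in> {-R..H} \<Longrightarrow> \<bar>u s\<bar> \<le> U"
    using regular_input_bounded[OF u] by blast
  have W0: "W \<ge> 0" using db[of 0] H norm_ge_zero order_trans by (metis atLeastAtMost_iff order_refl)
  have G0: "G \<ge> 0" using G_nonneg[OF A] .
  define \<rho> where "\<rho> = 2 * exp (2 * N * (H - 0)) * (norm x0 + (U + G * W) * (H - 0))"
  have \<rho>0: "\<rho> \<ge> 0" using U W0 G0 H by (simp add: \<rho>_def)
  obtain C where C: "C \<ge> 0" "\<And>i x x' v. \<lbrakk>norm x \<le> \<rho>; norm x' \<le> \<rho>; \<bar>v\<bar> \<le> U\<rbrakk> \<Longrightarrow> \<bar>g i x v - g i x' v\<bar> \<le> C * norm (x - x')"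
    using g_lipschitz_bounded[of \<rho> U] by metis
  define cl where "cl = closest_point (cball (0 :: 'n rvec) \<rho>)"
  have cl_in: "norm (cl y) \<le> \<rho>" for y
    using closest_point_in_set[of "cball (0 :: 'n rvec) \<rho>" y] \<rho>0 by (simp add: cl_def)
  have cl_lip: "norm (cl y - cl y') \<le> norm (y - y')" for y y'
    using closest_point_lipschitz[of "cball (0 :: 'n rvec) \<rho>" y y'] \<rho>0 by (simp add: cl_def dist_norm)
  have cl_id: "cl y = y" if "norm y \<le> \<rho>" for y
    using that by (simp add: cl_def closest_point_self)
  have cl_cont: "continuous_on UNIV cl"
    using cl_lip by (intro lipschitz_on_continuous_on[of 1] lipschitz_onI) (auto simp: dist_norm)
  define D where "D y s = diag (\<chi> i. g i (cl (y s)) (u s)) *v d s" for y s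
  have um: "(\<lambda>s. u (s - \<tau>)) \<in> borel_measurable (lebesgue_on {0..H})"
    using regular_input_measurable[OF u, of "{0..H}" "- \<tau>"] delays by simp
  have um0: "u \<in> borel_measurable (lebesgue_on {0..H})"
    using regular_input_measurable[OF u, of "{0..H}" 0] delays by simp
  have Dm: "D y \<in> borel_measurable (lebesgue_on {0..H})" if y: "continuous_on {0..H} y" for y
  proof -
    have "continuous_on {0..H} (\<lambda>s. cl (y s))"
      using continuous_on_compose2[OF cl_cont y] by simp
    then have clm: "(\<lambda>s. cl (y s)) \<in> borel_measurable (lebesgue_on {0..H})"
      by (rule continuous_imp_measurable_on_sets_lebesgue) simp
    have gm: "(\<lambda>s. g i (cl (y s)) (u s)) \<in> borel_measurable (lebesgue_on {0..H})" for i
      using borel_measurable_continuous_on[OF g_continuous[of i] borel_measurable_Pair[OF clm um0]] by simp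
    have dim: "(\<lambda>s. d s $ i) \<in> borel_measurable (lebesgue_on {0..H})" for i
      using borel_measurable_continuous_on[OF _ dm, of "\<lambda>v. v $ i"] by (simp add: continuous_on_component continuous_on_id)
    have "D y = (\<lambda>s. \<chi> i. g i (cl (y s)) (u s) * d s $ i)"
      by (simp add: D_def fun_eq_iff vec_eq_iff diag_mult)
    then show ?thesis
      using measurable_vec_lambda[OF borel_measurable_times[OF gm dim]] by simp
  qed
  have Db: "norm (D y s) \<le> G * W" if "s \<in> {0..H}" for y s
    unfolding D_def using diag_bound[OF A] mult_left_mono[OF db[OF that] G0] order_trans by blast
  obtain x where x: "ac_solves {0..H} x (\<lambda>t. drift f (x t) (u (t - \<tau>)) + D x t)" "x 0 = x0"
  proof (rule volterra_exists[of 0 H "N + C * W" "\<lambda>x t. drift f (x t) (u (t - \<tau>)) + D x t" x0 "N * norm x0 + U + G * W"])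
    show "(\<lambda>t. drift f (y t) (u (t - \<tau>)) + D y t) \<in> borel_measurable (lebesgue_on {0..H})" if "continuous_on {0..H} y" for y
      using that by (intro borel_measurable_add drift_measurable um Dm)
    show "norm (drift f (y s) (u (s - \<tau>)) + D y s - (drift f (y' s) (u (s - \<tau>)) + D y' s)) \<le> (N + C * W) * M"
      if s: "s \<in> {0..H}" and M: "\<And>\<sigma>. \<sigma> \<in> {0..s} \<Longrightarrow> norm (y \<sigma> - y' \<sigma>) \<le> M" for y y' s M
    proof -
      have yM: "norm (y s - y' s) \<le> M" using M s by simp
      have M0: "M \<ge> 0" using order_trans[OF norm_ge_zero yM] .
      have "\<bar>u s\<bar> \<le> U" using U(2)[of s] s delays by simp
      then have "\<bar>g i (cl (y s)) (u s) - g i (cl (y' s)) (u s)\<bar> \<le> C * M" for i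
        using C(2)[OF cl_in cl_in, of "u s" i "y s" "y' s"] mult_left_mono[OF order_trans[OF cl_lip yM] C(1)] by linarith
      then have "norm (D y s - D y' s) \<le> (C * M) * norm (d s)"
        unfolding D_def using C(1) M0 by (intro diag_diff_bound) auto
      also have "\<dots> \<le> (C * M) * W" using db[OF s] C(1) M0 by (intro mult_left_mono) auto
      finally have 1: "norm (D y s - D y' s) \<le> (C * M) * W" .
      have 2: "norm (drift f (y s) (u (s - \<tau>)) - drift f (y' s) (u (s - \<tau>))) \<le> N * M"
        by (rule order_trans[OF norm_drift_diff mult_left_mono[OF yM]]) (use N_ge_1 in simp)
      have "drift f (y s) (u (s - \<tau>)) + D y s - (drift f (y' s) (u (s - \<tau>)) + D y' s)
          = (drift f (y s) (u (s - \<tau>)) - drift f (y' s) (u (s - \<tau>))) + (D y s - D y' s)" by simp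
      also have "norm \<dots> \<le> N * M + (C * M) * W" using 1 2 by (intro norm_triangle_le) linarith
      finally show ?thesis by (simp add: algebra_simps)
    qed
    show "norm (drift f x0 (u (s - \<tau>)) + D (\<lambda>_. x0) s) \<le> N * norm x0 + U + G * W" if s: "s \<in> {0..H}" for s
      using norm_drift[of x0 "u (s - \<tau>)"] Db[OF s, of "\<lambda>_. x0"] U(2)[of "s - \<tau>"] s delays
        norm_triangle_ineq[of "drift f x0 (u (s - \<tau>))" "D (\<lambda>_. x0) s"] by simp
  qed (use H N_ge_1 C(1) W0 in \<open>auto intro: add_pos_nonneg\<close>)
  have "norm (x t) \<le> \<rho>" if "t \<in> {0..H}" for t
    unfolding \<rho>_def x(2)[symmetric]
    by (rule flow_bound[OF x(1) H _ _ U(1) _ that]) (use U(2) Db delays G0 W0 in auto)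
  then have "ac_solves {0..H} x (plant_rhs d u x)"
    by (intro ac_solves_cong[OF x(1)]) (auto simp: plant_rhs_def D_def cl_id)
  then show thesis using x(2) by (rule that)
qed

text \<open>Two given solutions stay in some ball on the horizon, where g is Lipschitz. The inputs
  are compared before H only, because the input at a holding instant belongs to the next
  interval.\<close>

lemma plant_solution_unique:
  assumes x: "ac_solves {0..H} x (plant_rhs d u x)" and x': "ac_solves {0..H} x' (plant_rhs d u' x')"
    and u: "regular_input u" and uu': "\<And>s. s \<in> {-R..<H} \<Longrightarrow> u s = u' s"
    and db: "\<And>s. s \<in> {0..H} \<Longrightarrow> norm (d s) \<le> W" and H: "0 \<le> H"
    and eq: "x 0 = x' 0" and t: "t \<in> {0..H}"
  shows "x t = x' t"
proof -
  obtain U where U: "U \<ge> 0" "\<And>s. s \<in> {-R..H} \<Longrightarrow> \<bar>u s\<bar> \<le> U"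
    using regular_input_bounded[OF u] by blast
  have W0: "W \<ge> 0" using db[of 0] H norm_ge_zero order_trans by (metis atLeastAtMost_iff order_refl)
  have "bounded (x ` {0..H} \<union> x' ` {0..H})"
    using ac_solves_continuous_on[OF x] ac_solves_continuous_on[OF x']
    by (simp add: compact_imp_bounded compact_continuous_image)
  then obtain \<rho> where "\<forall>y\<in>x ` {0..H} \<union> x' ` {0..H}. norm y \<le> \<rho>" unfolding bounded_iff by blast
  then have \<rho>: "\<And>s. s \<in> {0..H} \<Longrightarrow> norm (x s) \<le> \<rho>" "\<And>s. s \<in> {0..H} \<Longrightarrow> norm (x' s) \<le> \<rho>" by auto
  obtain C where C: "C \<ge> 0" "\<And>i x x' v. \<lbrakk>norm x \<le> \<rho>; norm x' \<le> \<rho>; \<bar>v\<bar> \<le> U\<rbrakk> \<Longrightarrow> \<bar>g i x v - g i x' v\<bar> \<le> C * norm (x - x')"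
    using g_lipschitz_bounded[of \<rho> U] by metis
  show ?thesis
  proof (rule volterra_unique[OF x x' H _ eq _ t, of "N + C * W"])
    show "0 < N + C * W" using N_ge_1 C(1) W0 by (auto intro: add_pos_nonneg)
    fix s M assume s: "s \<in> {0..<H}" and M: "\<And>\<sigma>. \<sigma> \<in> {0..s} \<Longrightarrow> norm (x \<sigma> - x' \<sigma>) \<le> M"
    have sH: "s \<in> {0..H}" using s by simp
    have xM: "norm (x s - x' s) \<le> M" using M s by simp
    have M0: "M \<ge> 0" using order_trans[OF norm_ge_zero xM] .
    have us: "u s = u' s" "u (s - \<tau>) = u' (s - \<tau>)" using uu'[of s] uu'[of "s - \<tau>"] s delays by auto
    have "\<bar>u s\<bar> \<le> U" using U(2)[of s] s delays by simp
    then have "\<bar>g i (x s) (u s) - g i (x' s) (u s)\<bar> \<le> C * M" for i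
      using C(2)[OF \<rho>(1)[OF sH] \<rho>(2)[OF sH], of "u s" i] mult_left_mono[OF xM C(1)] by linarith
    then have "norm (diag (\<chi> i. g i (x s) (u s)) *v d s - diag (\<chi> i. g i (x' s) (u s)) *v d s) \<le> (C * M) * norm (d s)"
      using C(1) M0 by (intro diag_diff_bound) auto
    also have "\<dots> \<le> (C * M) * W" using db[OF sH] C(1) M0 by (intro mult_left_mono) auto
    finally have 1: "norm (diag (\<chi> i. g i (x s) (u s)) *v d s - diag (\<chi> i. g i (x' s) (u s)) *v d s) \<le> (C * M) * W" .
    have 2: "norm (drift f (x s) (u (s - \<tau>)) - drift f (x' s) (u (s - \<tau>))) \<le> N * M"
      by (rule order_trans[OF norm_drift_diff mult_left_mono[OF xM]]) (use N_ge_1 in simp)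
    have "plant_rhs d u x s - plant_rhs d u' x' s = (drift f (x s) (u (s - \<tau>)) - drift f (x' s) (u (s - \<tau>)))
       + (diag (\<chi> i. g i (x s) (u s)) *v d s - diag (\<chi> i. g i (x' s) (u s)) *v d s)"
      by (simp add: plant_rhs_def us)
    also have "norm \<dots> \<le> N * M + (C * M) * W" using 1 2 by (intro norm_triangle_le) linarith
    finally show "norm (plant_rhs d u x s - plant_rhs d u' x' s) \<le> (N + C * W) * M" by (simp add: algebra_simps)
  qed
qed

definition sampling_schedule :: "(nat \<Rightarrow> real) \<Rightarrow> bool" where
  "sampling_schedule ts \<longleftrightarrow> ts 0 = 0 \<and> (\<forall>i. ts i < ts (Suc i)) \<and> (\<forall>t. \<exists>i. t < ts i)"

text \<open>The values of w at the sampling times are prescribed by a sequence y, with index 0 for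
  the initial value. This separates the observer from the origin of the samples; only those up to H
  matter.\<close>

definition observer_solution ::
  "real \<Rightarrow> (nat \<Rightarrow> real) \<Rightarrow> (nat \<Rightarrow> real) \<Rightarrow> (real \<Rightarrow> real) \<Rightarrow> (real \<Rightarrow> 'n rvec) \<Rightarrow> (real \<Rightarrow> real) \<Rightarrow> bool" where
  "observer_solution H ts y u z w \<longleftrightarrow>
     ac_solves {0..H} z (\<lambda>t. drift f (z t) (u (t - r - \<tau>)) + (z t $ fst_idx - w t) *\<^sub>R inj_gain)
     \<and> (\<forall>i. ts i \<le> H \<longrightarrow> ac_solves ({ts i..<ts (Suc i)} \<inter> {0..H}) w (\<lambda>t. drift f (z t) (u (t - r - \<tau>)) $ fst_idx))
     \<and> (\<forall>i. ts i \<le> H \<longrightarrow> w (ts i) = y i)"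

lemma schedule_mono:
  assumes "sampling_schedule ts"
  shows "i \<le> j \<Longrightarrow> ts i \<le> ts j" "0 \<le> ts i"
proof -
  show 1: "i \<le> j \<Longrightarrow> ts i \<le> ts j" for i j
    using lift_Suc_mono_le[of ts] assms less_imp_le unfolding sampling_schedule_def by blast
  show "0 \<le> ts i" using 1[of 0 i] assms by (simp add: sampling_schedule_def)
qed

lemma schedule_unique:
  assumes ts: "sampling_schedule ts" and "ts i \<le> s" "s < ts (Suc i)" "ts j \<le> s" "s < ts (Suc j)"
  shows "i = j"
proof (rule ccontr)
  assume "i \<noteq> j"
  then consider "Suc i \<le> j" | "Suc j \<le> i" by linarith
  then show False using schedule_mono(1)[OF ts] assms by cases force+
qed

text \<open>At each sampling time the two w coincide, so between samples they differ by an integral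
  of drift differences, of size at most \<open>N * H\<close> times the running distance of the z.
  This is again a Lipschitz condition with memory.\<close>

lemma observer_solution_unique:
  assumes o: "observer_solution H ts y u z w" and o': "observer_solution H ts y' u' z' w'"
    and ts: "sampling_schedule ts"
    and y: "\<And>i. ts i \<le> H \<Longrightarrow> y i = y' i"
    and uu': "\<And>s. s \<in> {-R..<H - R} \<Longrightarrow> u s = u' s" and H: "0 \<le> H" and eq: "z 0 = z' 0" and t: "t \<in> {0..H}"
  shows "z t = z' t \<and> w t = w' t"
proof -
  have N0: "N \<ge> 0" using N_ge_1 by simp
  have wdiff: "\<bar>w s - w' s\<bar> \<le> N * H * M"
    if s: "s \<in> {0..H}" and M: "\<And>\<rho>. \<rho> \<in> {0..s} \<Longrightarrow> norm (z \<rho> - z' \<rho>) \<le> M" for s M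
  proof -
    have M0: "M \<ge> 0" using order_trans[OF norm_ge_zero M, of 0] s by simp
    obtain i where i: "ts i \<le> s" "s < ts (Suc i)"
      using sampling_interval[of ts s] ts s unfolding sampling_schedule_def by auto
    have iH: "ts i \<le> H" "0 \<le> ts i" using i s schedule_mono(2)[OF ts] by auto
    have "norm ((w s - w' s) - (w (ts i) - w' (ts i))) \<le> N * M * (s - ts i)"
    proof (rule ac_solves_const_bound)
      have sub: "{ts i..s} \<subseteq> {ts i..<ts (Suc i)} \<inter> {0..H}" using i s iH by auto
      have "ac_solves {ts i..s} w (\<lambda>t. drift f (z t) (u (t - r - \<tau>)) $ fst_idx)"
        using o iH ac_solves_subset[OF _ sub] unfolding observer_solution_def by blast
      moreover have "ac_solves {ts i..s} w' (\<lambda>t. drift f (z' t) (u' (t - r - \<tau>)) $ fst_idx)"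
        using o' iH ac_solves_subset[OF _ sub] unfolding observer_solution_def by blast
      ultimately show "ac_solves {ts i..s} (\<lambda>t. w t - w' t) (\<lambda>t. drift f (z t) (u (t - r - \<tau>)) $ fst_idx - drift f (z' t) (u' (t - r - \<tau>)) $ fst_idx)"
        by (rule ac_solves_diff)
      fix \<rho> assume \<rho>: "\<rho> \<in> {ts i..<s}"
      have "u (\<rho> - r - \<tau>) = u' (\<rho> - r - \<tau>)" using \<rho> s iH by (intro uu') auto
      then have "norm (drift f (z \<rho>) (u (\<rho> - r - \<tau>)) $ fst_idx - drift f (z' \<rho>) (u' (\<rho> - r - \<tau>)) $ fst_idx)
         = \<bar>(drift f (z \<rho>) (u (\<rho> - r - \<tau>)) - drift f (z' \<rho>) (u (\<rho> - r - \<tau>))) $ fst_idx\<bar>" by simp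
      also have "\<dots> \<le> N * norm (z \<rho> - z' \<rho>)" using norm_nth_le norm_drift_diff order_trans by blast
      also have "\<dots> \<le> N * M" using \<rho> iH N0 by (intro mult_left_mono M) auto
      finally show "norm (drift f (z \<rho>) (u (\<rho> - r - \<tau>)) $ fst_idx - drift f (z' \<rho>) (u' (\<rho> - r - \<tau>)) $ fst_idx) \<le> N * M" .
    qed (use i in auto)
    moreover have "w (ts i) = w' (ts i)" using o o' y iH unfolding observer_solution_def by simp
    moreover have "N * M * (s - ts i) \<le> N * M * H" using s iH N0 M0 by (intro mult_left_mono) auto
    ultimately show ?thesis by (simp add: mult_ac)
  qed
  have zac: "ac_solves {0..H} z (\<lambda>t. drift f (z t) (u (t - r - \<tau>)) + (z t $ fst_idx - w t) *\<^sub>R inj_gain)"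
    "ac_solves {0..H} z' (\<lambda>t. drift f (z' t) (u' (t - r - \<tau>)) + (z' t $ fst_idx - w' t) *\<^sub>R inj_gain)"
    using o o' by (auto simp: observer_solution_def)
  have zz: "z t = z' t" if t: "t \<in> {0..H}" for t
  proof (rule volterra_unique[OF zac H _ eq _ t, of "N + (1 + N * H) * norm inj_gain"])
    show "0 < N + (1 + N * H) * norm inj_gain" using N_ge_1 H by (simp add: add_pos_nonneg)
    fix s M assume s: "s \<in> {0..<H}" and M: "\<And>\<sigma>. \<sigma> \<in> {0..s} \<Longrightarrow> norm (z \<sigma> - z' \<sigma>) \<le> M"
    have zM: "norm (z s - z' s) \<le> M" using M s by simp
    have us: "u (s - r - \<tau>) = u' (s - r - \<tau>)" using s by (intro uu') auto
    have 1: "norm (drift f (z s) (u (s - r - \<tau>)) - drift f (z' s) (u (s - r - \<tau>))) \<le> N * M"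
      using norm_drift_diff mult_left_mono[OF zM N0] order_trans by blast
    have "\<bar>(z s - z' s) $ fst_idx - (w s - w' s)\<bar> \<le> M + N * H * M"
      using norm_nth_le[of "z s - z' s" fst_idx] zM wdiff[OF _ M] s by fastforce
    then have 2: "norm (((z s - z' s) $ fst_idx - (w s - w' s)) *\<^sub>R inj_gain) \<le> (M + N * H * M) * norm inj_gain"
      by (simp add: mult_right_mono)
    have "drift f (z s) (u (s - r - \<tau>)) + (z s $ fst_idx - w s) *\<^sub>R inj_gain - (drift f (z' s) (u' (s - r - \<tau>)) + (z' s $ fst_idx - w' s) *\<^sub>R inj_gain)
       = (drift f (z s) (u (s - r - \<tau>)) - drift f (z' s) (u (s - r - \<tau>))) + ((z s - z' s) $ fst_idx - (w s - w' s)) *\<^sub>R inj_gain"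
      unfolding us by (simp add: algebra_simps)
    also have "norm \<dots> \<le> N * M + (M + N * H * M) * norm inj_gain" using 1 2 by (intro norm_triangle_le) linarith
    finally show "norm (drift f (z s) (u (s - r - \<tau>)) + (z s $ fst_idx - w s) *\<^sub>R inj_gain - (drift f (z' s) (u' (s - r - \<tau>)) + (z' s $ fst_idx - w' s) *\<^sub>R inj_gain))
        \<le> (N + (1 + N * H) * norm inj_gain) * M" by (simp add: algebra_simps)
  qed
  have "\<bar>w t - w' t\<bar> \<le> N * H * 0" using zz t by (intro wdiff) auto
  then show ?thesis using zz[OF t] by simp
qed

text \<open>Eliminating w removes the jumps: w is the causal functional \<open>Wf z\<close>, the
  latest sample plus the integral of the drift since then. What remains is one equation for the
  continuous z with memory, solved by \<open>volterra_exists\<close>.\<close>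

lemma observer_solution_exists:
  assumes ts: "sampling_schedule ts" and u: "regular_input u" and H: "0 \<le> H"
  obtains z w where "observer_solution H ts y u z w" "z 0 = z0"
proof -
  have N0: "N \<ge> 0" using N_ge_1 by simp
  obtain U where U: "U \<ge> 0" "\<And>s. s \<in> {-R..H} \<Longrightarrow> \<bar>u s\<bar> \<le> U"
    using regular_input_bounded[OF u] by blast
  define v where "v s = u (s - r - \<tau>)" for s
  have vm: "v \<in> borel_measurable (lebesgue_on {0..H})"
    using regular_input_measurable[OF u, of "{0..H}" "- R"] by (simp add: v_def[abs_def] algebra_simps)
  have vb: "\<bar>v s\<bar> \<le> U" if "s \<in> {0..H}" for s unfolding v_def using that delays by (intro U(2)) auto
  have "\<exists>i. s < ts (Suc i) \<and> ts i \<le> s" if "s \<ge> 0" for s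
    using sampling_interval[of ts s] ts that unfolding sampling_schedule_def by metis
  then obtain idx where idx: "\<And>s. s \<ge> 0 \<Longrightarrow> ts (idx s) \<le> s" "\<And>s. s \<ge> 0 \<Longrightarrow> s < ts (Suc (idx s))"
    by metis
  have idxm: "idx \<in> measurable (lebesgue_on {0..H}) (count_space UNIV)"
    unfolding measurable_count_space_eq2_countable
  proof (intro conjI ballI)
    fix i
    have "idx -` {i} \<inter> space (lebesgue_on {0..H}) = {ts i..<ts (Suc i)} \<inter> {0..H}"
    proof (rule set_eqI)
      fix s
      show "s \<in> idx -` {i} \<inter> space (lebesgue_on {0..H}) \<longleftrightarrow> s \<in> {ts i..<ts (Suc i)} \<inter> {0..H}"
        using idx[of s] schedule_unique[OF ts, of i s "idx s"] by (auto simp: space_restrict_space)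
    qed
    moreover have "{ts i..<ts (Suc i)} \<inter> {0..H} \<in> sets (lebesgue_on {0..H})"
      by (simp add: sets_restrict_space_iff)
    ultimately show "idx -` {i} \<inter> space (lebesgue_on {0..H}) \<in> sets (lebesgue_on {0..H})" by simp
  qed auto
  have im: "(\<lambda>s. drift f (z s) (v s) $ fst_idx) \<in> borel_measurable (lebesgue_on {0..H})" if "continuous_on {0..H} z" for z
    using borel_measurable_continuous_on[OF _ drift_measurable[OF that vm], of "\<lambda>v. v $ fst_idx"]
    by (simp add: continuous_on_component continuous_on_id)
  have ib: "\<exists>B. \<forall>s\<in>{0..H}. norm (drift f (z s) (v s) $ fst_idx) \<le> B" if z: "continuous_on {0..H} z" for z
  proof -
    have "bounded (z ` {0..H})" using z by (simp add: compact_imp_bounded compact_continuous_image)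
    then obtain M where M: "\<And>s. s \<in> {0..H} \<Longrightarrow> norm (z s) \<le> M" unfolding bounded_iff by blast
    have "norm (drift f (z s) (v s) $ fst_idx) \<le> N * M + U" if "s \<in> {0..H}" for s
      using norm_nth_le[of "drift f (z s) (v s)" fst_idx] norm_drift[of "z s" "v s"] vb[OF that] mult_left_mono[OF M[OF that] N0] by simp
    then show ?thesis by blast
  qed
  have int: "(\<lambda>s. drift f (z s) (v s) $ fst_idx) integrable_on {\<alpha>..\<beta>}"
    if "continuous_on {0..H} z" "{\<alpha>..\<beta>} \<subseteq> {0..H}" for z \<alpha> \<beta>
    using ib[OF that(1)] bounded_measurable_integrable[OF im[OF that(1)] _ that(2)] by metis
  define Wf where "Wf z s = y (idx s) + integral {ts (idx s)..s} (\<lambda>\<rho>. drift f (z \<rho>) (v \<rho>) $ fst_idx)" for z s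
  have Wm: "Wf z \<in> borel_measurable (lebesgue_on {0..H})" if z: "continuous_on {0..H} z" for z
  proof -
    define I where "I s = integral {0..s} (\<lambda>\<rho>. drift f (z \<rho>) (v \<rho>) $ fst_idx)" for s
    have "continuous_on {0..H} I"
      unfolding I_def by (intro indefinite_integral_continuous_1 int z) simp
    then have 1: "I \<in> borel_measurable (lebesgue_on {0..H})"
      by (rule continuous_imp_measurable_on_sets_lebesgue) simp
    \<comment> \<open>Writing \<open>Wf z\<close> as a function of the sample index plus the
      continuous primitive I reduces its measurability to that of \<open>idx\<close>, whose level
      sets are intervals within the horizon.\<close>
    have 2: "(\<lambda>s. y (idx s) - I (ts (idx s))) \<in> borel_measurable (lebesgue_on {0..H})"
      using measurable_compose[OF idxm, of "\<lambda>i. y i - I (ts i)"] by simp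
    have "Wf z s = (y (idx s) - I (ts (idx s))) + I s" if s: "s \<in> {0..H}" for s
    proof -
      have "integral {0..ts (idx s)} (\<lambda>\<rho>. drift f (z \<rho>) (v \<rho>) $ fst_idx) + integral {ts (idx s)..s} (\<lambda>\<rho>. drift f (z \<rho>) (v \<rho>) $ fst_idx)
         = integral {0..s} (\<lambda>\<rho>. drift f (z \<rho>) (v \<rho>) $ fst_idx)"
        using s idx(1)[of s] schedule_mono(2)[OF ts] by (intro Henstock_Kurzweil_Integration.integral_combine int z) auto
      then show ?thesis by (simp add: Wf_def I_def)
    qed
    then show ?thesis
      by (intro measurable_cong[THEN iffD2, OF _ borel_measurable_add[OF 2 1]]) (auto simp: space_restrict_space)
  qed
  have Wlip: "\<bar>Wf z s - Wf z' s\<bar> \<le> N * H * M"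
    if z: "continuous_on {0..H} z" "continuous_on {0..H} z'" and s: "s \<in> {0..H}"
      and M: "\<And>\<sigma>. \<sigma> \<in> {0..s} \<Longrightarrow> norm (z \<sigma> - z' \<sigma>) \<le> M" for z z' s M
  proof -
    have M0: "M \<ge> 0" using order_trans[OF norm_ge_zero M, of 0] s by simp
    let ?a = "ts (idx s)"
    have a: "0 \<le> ?a" "?a \<le> s" using idx(1)[of s] s schedule_mono(2)[OF ts] by auto
    have i: "(\<lambda>\<rho>. drift f (z \<rho>) (v \<rho>) $ fst_idx) integrable_on {?a..s}" "(\<lambda>\<rho>. drift f (z' \<rho>) (v \<rho>) $ fst_idx) integrable_on {?a..s}"
      using a s by (auto intro!: int z)
    have "Wf z s - Wf z' s = integral {?a..s} (\<lambda>\<rho>. drift f (z \<rho>) (v \<rho>) $ fst_idx - drift f (z' \<rho>) (v \<rho>) $ fst_idx)"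
      using i by (simp add: Wf_def Henstock_Kurzweil_Integration.integral_diff)
    also have "norm \<dots> \<le> integral {?a..s} (\<lambda>_. N * M)"
    proof (rule Henstock_Kurzweil_Integration.integral_norm_bound_integral)
      fix \<rho> assume \<rho>: "\<rho> \<in> {?a..s}"
      have "norm (drift f (z \<rho>) (v \<rho>) $ fst_idx - drift f (z' \<rho>) (v \<rho>) $ fst_idx) = \<bar>(drift f (z \<rho>) (v \<rho>) - drift f (z' \<rho>) (v \<rho>)) $ fst_idx\<bar>"
        by simp
      also have "\<dots> \<le> N * norm (z \<rho> - z' \<rho>)" using norm_nth_le norm_drift_diff order_trans by blast
      also have "\<dots> \<le> N * M" using \<rho> a N0 by (intro mult_left_mono M) auto
      finally show "norm (drift f (z \<rho>) (v \<rho>) $ fst_idx - drift f (z' \<rho>) (v \<rho>) $ fst_idx) \<le> N * M" .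
    qed (use i in \<open>auto intro: integrable_diff\<close>)
    also have "\<dots> = (s - ?a) * (N * M)" using a by simp
    also have "\<dots> \<le> H * (N * M)" using a s N0 M0 by (intro mult_right_mono) auto
    finally show ?thesis by (simp add: mult_ac)
  qed
  have Wb: "\<exists>B. \<forall>s\<in>{0..H}. \<bar>Wf (\<lambda>_. z0) s\<bar> \<le> B"
  proof -
    \<comment> \<open>Only the samples with index up to \<open>idx H\<close> occur on the horizon,
      so a finite sum bounds them all.\<close>
    let ?B = "(\<Sum>i\<le>idx H. \<bar>y i\<bar>) + H * (N * norm z0 + U)"
    have "\<bar>Wf (\<lambda>_. z0) s\<bar> \<le> ?B" if s: "s \<in> {0..H}" for s
    proof -
      let ?a = "ts (idx s)"
      have a: "0 \<le> ?a" "?a \<le> s" using idx(1)[of s] s schedule_mono(2)[OF ts] by auto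
      have "idx s \<le> idx H"
      proof (rule ccontr)
        assume "\<not> idx s \<le> idx H"
        then have "ts (Suc (idx H)) \<le> ts (idx s)" by (intro schedule_mono(1)[OF ts]) simp
        then show False using idx(2)[OF H] a s by simp
      qed
      then have h1: "\<bar>y (idx s)\<bar> \<le> (\<Sum>i\<le>idx H. \<bar>y i\<bar>)" by (intro member_le_sum) auto
      have h2: "norm (integral {?a..s} (\<lambda>\<rho>. drift f z0 (v \<rho>) $ fst_idx)) \<le> integral {?a..s} (\<lambda>_. N * norm z0 + U)"
      proof (rule Henstock_Kurzweil_Integration.integral_norm_bound_integral)
        show "(\<lambda>\<rho>. drift f z0 (v \<rho>) $ fst_idx) integrable_on {?a..s}" using a s by (intro int) auto
        fix \<rho> assume "\<rho> \<in> {?a..s}"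
        then have "\<bar>v \<rho>\<bar> \<le> U" using a s by (intro vb) auto
        then show "norm (drift f z0 (v \<rho>) $ fst_idx) \<le> N * norm z0 + U"
          using norm_nth_le[of "drift f z0 (v \<rho>)" fst_idx] norm_drift[of z0 "v \<rho>"] by simp
      qed auto
      have h3: "integral {?a..s} (\<lambda>_. N * norm z0 + U) = (s - ?a) * (N * norm z0 + U)" using a by simp
      have h4: "(s - ?a) * (N * norm z0 + U) \<le> H * (N * norm z0 + U)"
        using a s N0 U by (intro mult_right_mono) auto
      show ?thesis unfolding Wf_def using h1 h2[unfolded h3 real_norm_def] h4 by linarith
    qed
    then show ?thesis by blast
  qed
  then obtain Bw where Bw: "\<And>s. s \<in> {0..H} \<Longrightarrow> \<bar>Wf (\<lambda>_. z0) s\<bar> \<le> Bw" by blast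
  obtain z where z: "ac_solves {0..H} z (\<lambda>t. drift f (z t) (v t) + (z t $ fst_idx - Wf z t) *\<^sub>R inj_gain)" "z 0 = z0"
  proof (rule volterra_exists[of 0 H "N + (1 + N * H) * norm inj_gain"
        "\<lambda>z t. drift f (z t) (v t) + (z t $ fst_idx - Wf z t) *\<^sub>R inj_gain" z0 "N * norm z0 + U + (norm z0 + Bw) * norm inj_gain"])
    show "(\<lambda>t. drift f (z t) (v t) + (z t $ fst_idx - Wf z t) *\<^sub>R inj_gain) \<in> borel_measurable (lebesgue_on {0..H})"
      if z: "continuous_on {0..H} z" for z
    proof -
      have "(\<lambda>t. z t $ fst_idx) \<in> borel_measurable (lebesgue_on {0..H})"
        using z by (intro continuous_imp_measurable_on_sets_lebesgue continuous_on_component) auto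
      then show ?thesis
        using drift_measurable[OF z vm] Wm[OF z]
        by (intro borel_measurable_add borel_measurable_scaleR borel_measurable_diff) auto
    qed
    show "norm (drift f (y s) (v s) + (y s $ fst_idx - Wf y s) *\<^sub>R inj_gain - (drift f (y' s) (v s) + (y' s $ fst_idx - Wf y' s) *\<^sub>R inj_gain))
        \<le> (N + (1 + N * H) * norm inj_gain) * M"
      if y: "continuous_on {0..H} y" "continuous_on {0..H} y'" and s: "s \<in> {0..H}"
        and M: "\<And>\<sigma>. \<sigma> \<in> {0..s} \<Longrightarrow> norm (y \<sigma> - y' \<sigma>) \<le> M" for y y' s M
    proof -
      have zM: "norm (y s - y' s) \<le> M" using M s by simp
      have 1: "norm (drift f (y s) (v s) - drift f (y' s) (v s)) \<le> N * M"
        using norm_drift_diff mult_left_mono[OF zM N0] order_trans by blast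
      have "\<bar>(y s - y' s) $ fst_idx - (Wf y s - Wf y' s)\<bar> \<le> M + N * H * M"
        using norm_nth_le[of "y s - y' s" fst_idx] zM Wlip[OF y s M] by fastforce
      then have 2: "norm (((y s - y' s) $ fst_idx - (Wf y s - Wf y' s)) *\<^sub>R inj_gain) \<le> (M + N * H * M) * norm inj_gain"
        by (simp add: mult_right_mono)
      have "drift f (y s) (v s) + (y s $ fst_idx - Wf y s) *\<^sub>R inj_gain - (drift f (y' s) (v s) + (y' s $ fst_idx - Wf y' s) *\<^sub>R inj_gain)
         = (drift f (y s) (v s) - drift f (y' s) (v s)) + ((y s - y' s) $ fst_idx - (Wf y s - Wf y' s)) *\<^sub>R inj_gain"
        by (simp add: algebra_simps)
      also have "norm \<dots> \<le> N * M + (M + N * H * M) * norm inj_gain" using 1 2 by (intro norm_triangle_le) linarith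
      finally show ?thesis by (simp add: algebra_simps)
    qed
    show "norm (drift f z0 (v s) + (z0 $ fst_idx - Wf (\<lambda>_. z0) s) *\<^sub>R inj_gain) \<le> N * norm z0 + U + (norm z0 + Bw) * norm inj_gain"
      if s: "s \<in> {0..H}" for s
    proof -
      have "\<bar>z0 $ fst_idx - Wf (\<lambda>_. z0) s\<bar> \<le> norm z0 + Bw" using norm_nth_le[of z0 fst_idx] Bw[OF s] by linarith
      then have "norm ((z0 $ fst_idx - Wf (\<lambda>_. z0) s) *\<^sub>R inj_gain) \<le> (norm z0 + Bw) * norm inj_gain"
        by (simp add: mult_right_mono)
      then show ?thesis using norm_drift[of z0 "v s"] vb[OF s] by (intro norm_triangle_le) linarith
    qed
  qed (use H N_ge_1 in \<open>auto intro: add_pos_nonneg\<close>)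
  have zc: "continuous_on {0..H} z" by (rule ac_solves_continuous_on[OF z(1)])
  have "observer_solution H ts y u z (Wf z)"
    unfolding observer_solution_def
  proof (intro conjI allI impI)
    show "ac_solves {0..H} z (\<lambda>t. drift f (z t) (u (t - r - \<tau>)) + (z t $ fst_idx - Wf z t) *\<^sub>R inj_gain)"
      using z(1) by (simp add: v_def)
    fix i assume iH: "ts i \<le> H"
    have i0: "0 \<le> ts i" using schedule_mono(2)[OF ts] .
    have tsS: "ts i < ts (Suc i)" using ts by (simp add: sampling_schedule_def)
    have idi: "idx s = i" if "s \<in> {ts i..<ts (Suc i)}" for s
      using schedule_unique[OF ts, of "idx s" s i] idx[of s] that i0 by auto
    show "Wf z (ts i) = y i" using idi[of "ts i"] tsS by (simp add: Wf_def)
    define \<beta> where "\<beta> = min (ts (Suc i)) H"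
    define h where "h s = y i + integral {ts i..s} (\<lambda>\<rho>. drift f (z \<rho>) (v \<rho>) $ fst_idx)" for s
    obtain B where B: "\<forall>s\<in>{0..H}. norm (drift f (z s) (v s) $ fst_idx) \<le> B" using ib[OF zc] by blast
    have "ac_solves {ts i..\<beta>} h (\<lambda>t. drift f (z t) (v t) $ fst_idx)"
    proof (rule ac_solvesI_integral[where a = "ts i" and b = \<beta>])
      show "(\<lambda>t. drift f (z t) (v t) $ fst_idx) \<in> borel_measurable (lebesgue_on {ts i..\<beta>})"
        using i0 by (intro measurable_restrict_mono[OF im[OF zc]]) (auto simp: \<beta>_def)
      show "\<exists>B. \<forall>t\<in>{ts i..c}. norm (drift f (z t) (v t) $ fst_idx) \<le> B" if "c \<in> {ts i..\<beta>}" for c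
        using B that i0 by (intro exI[of _ B]) (auto simp: \<beta>_def)
      show "\<exists>B. \<forall>t\<in>{ts i..\<beta>}. norm (drift f (z t) (v t) $ fst_idx) \<le> B"
        using B i0 by (intro exI[of _ B]) (auto simp: \<beta>_def)
    qed (simp_all add: h_def)
    then have "ac_solves ({ts i..<ts (Suc i)} \<inter> {0..H}) h (\<lambda>t. drift f (z t) (v t) $ fst_idx)"
      by (rule ac_solves_subset) (auto simp: \<beta>_def)
    then show "ac_solves ({ts i..<ts (Suc i)} \<inter> {0..H}) (Wf z) (\<lambda>t. drift f (z t) (u (t - r - \<tau>)) $ fst_idx)"
      by (rule ac_solves_cong) (auto simp: idi h_def Wf_def v_def)
  qed
  then show thesis using z(2) by (rule that)
qed

end

text \<open>Iterates up to time S see v under an integral only, so its value at the endpoint S, a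
  null set, has no influence.\<close>

lemma picard_iterate_cong:
  assumes v: "\<And>s. 0 \<le> s \<Longrightarrow> s < S \<Longrightarrow> v s = v' s" and S: "0 \<le> S" and t: "t \<le> S"
  shows "(picard f v ^^ l) y t = (picard f v' ^^ l) y t"
  using t
proof (induction l arbitrary: t)
  case 0
  then show ?case by simp
next
  case (Suc l)
  let ?Y = "(picard f v ^^ l) y" and ?Y' = "(picard f v' ^^ l) y"
  have "integral {0..t} (\<lambda>s. drift f (?Y s) (v s)) = integral {0..t} (\<lambda>s. drift f (?Y' s) (v' s))"
  proof (rule integral_spike)
    show "negligible {S}" by simp
    show "drift f (?Y' s) (v' s) = drift f (?Y s) (v s)" if "s \<in> {0..t} - {S}" for s
      using that Suc.IH[of s] v[of s] Suc.prems by auto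
  qed
  moreover have "?Y 0 = ?Y' 0" using Suc.IH[of 0] S by simp
  ultimately show ?case
    by (simp only: funpow.simps o_apply picard_def[of f v ?Y] picard_def[of f v' ?Y'])
qed

section \<open>Dependence of the predictor on past input, and regularity of held inputs\<close>

context predictor_feedback
begin

lemma Ppred_cong:
  assumes "\<And>s. s \<in> {0..<R} \<Longrightarrow> v s = v' s"
  shows "Ppred f r \<tau> l m v x = Ppred f r \<tau> l m v' x"
proof -
  let ?T = "R / real m"
  have T0: "?T > 0" using delays lm by simp
  have "Qpred f l ?T (\<lambda>s. v (s + (real i - 1) * ?T)) = Qpred f l ?T (\<lambda>s. v' (s + (real i - 1) * ?T))"
    if i: "i \<in> set [1..<Suc m]" for i
  proof
    fix x
    have "v (s + (real i - 1) * ?T) = v' (s + (real i - 1) * ?T)" if s: "0 \<le> s" "s < ?T" for s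
    proof (rule assms)
      have i1: "1 \<le> real i" "real i \<le> real m" using i by auto
      have "0 \<le> (real i - 1) * ?T" using i1 T0 by (intro mult_nonneg_nonneg) auto
      moreover have "(real i - 1) * ?T = real i * ?T - ?T" by (simp only: left_diff_distrib mult_1)
      moreover have "real i * ?T \<le> real m * ?T" using i1 T0 by (intro mult_right_mono) auto
      moreover have "real m * ?T = R" using lm by simp
      ultimately show "s + (real i - 1) * ?T \<in> {0..<R}" using s unfolding atLeastLessThan_iff by linarith
    qed
    then show "Qpred f l ?T (\<lambda>s. v (s + (real i - 1) * ?T)) x = Qpred f l ?T (\<lambda>s. v' (s + (real i - 1) * ?T)) x"
      unfolding Qpred_def using T0 by (intro picard_iterate_cong) auto
  qed
  then show ?thesis unfolding Ppred_def Let_def by (intro fold_cong) auto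
qed

lemma regular_input_initial:
  assumes u0: "Linf {-r - \<tau>..<0} UNIV u\<^sub>0" and u: "\<And>s. s \<in> {-r - \<tau>..<0} \<Longrightarrow> u s = u\<^sub>0 s"
  shows "regular_input (\<lambda>s. if s < 0 then u s else 0)"
  unfolding regular_input_def
proof (intro conjI allI)
  have "(\<lambda>s. if s \<in> {-r - \<tau>..<0} then u\<^sub>0 s else 0) \<in> borel_measurable lebesgue"
    using u0 unfolding Linf_def by (simp add: borel_measurable_if del: atLeastLessThan_iff)
  moreover have "(\<lambda>s. if s \<in> {-r - \<tau>..<0} then u\<^sub>0 s else 0) = (\<lambda>s. if - R \<le> s then if s < 0 then u s else 0 else 0)"
    using u by auto
  ultimately show "(\<lambda>s. if - R \<le> s then if s < 0 then u s else 0 else 0) \<in> borel_measurable lebesgue" by simp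
  have "bounded (u\<^sub>0 ` {-r - \<tau>..<0})" using u0 by (simp add: Linf_def)
  then obtain U where U: "\<And>s. s \<in> {-r - \<tau>..<0} \<Longrightarrow> \<bar>u\<^sub>0 s\<bar> \<le> U" unfolding bounded_iff real_norm_def by blast
  show "\<exists>U. \<forall>s\<in>{-R..c}. \<bar>if s < 0 then u s else 0\<bar> \<le> U" for c
    using U u by (intro exI[of _ "max U 0"]) (auto simp: le_max_iff_disj)
qed

lemma regular_input_extend:
  assumes u: "regular_input u" and h: "- R \<le> h"
  shows "regular_input (\<lambda>s. if s < h then u s else c)"
  unfolding regular_input_def
proof (intro conjI allI)
  have um: "(\<lambda>s. if - R \<le> s then u s else 0) \<in> borel_measurable lebesgue" using u by (simp add: regular_input_def)
  have "(\<lambda>s. if s \<in> {..<h} then (if - R \<le> s then u s else 0) else c) \<in> borel_measurable lebesgue"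
    by (rule measurable_If_set[OF um]) auto
  moreover have "(\<lambda>s. if - R \<le> s then if s < h then u s else c else 0) = (\<lambda>s. if s \<in> {..<h} then (if - R \<le> s then u s else 0) else c)"
    using h by auto
  ultimately show "(\<lambda>s. if - R \<le> s then if s < h then u s else c else 0) \<in> borel_measurable lebesgue" by simp
  fix b
  obtain U where "U \<ge> 0" "\<And>s. s \<in> {-R..b} \<Longrightarrow> \<bar>u s\<bar> \<le> U" using regular_input_bounded[OF u] by blast
  then show "\<exists>U. \<forall>s\<in>{-R..b}. \<bar>if s < h then u s else c\<bar> \<le> U"
    by (intro exI[of _ "max U \<bar>c\<bar>"]) (auto simp: le_max_iff_disj)
qed

text \<open>Whatever z is, the feedback holds the input constant over each holding interval. Up to
  any holding instant it thus arises from the initial input by finitely many constant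
  extensions.\<close>

lemma feedback_regular_input:
  assumes u0: "Linf {-r - \<tau>..<0} UNIV u\<^sub>0" and u: "\<And>s. s \<in> {-r - \<tau>..<0} \<Longrightarrow> u s = u\<^sub>0 s"
    and fb: "feedback f r \<tau> k T\<^sub>2 l m u z"
  shows "regular_input (\<lambda>s. if s < real i * T\<^sub>2 then u s else 0)"
proof (induction i)
  case 0
  show ?case using regular_input_initial[OF u0 u] by simp
next
  case (Suc i)
  define c where "c = k \<bullet> Phi f r \<tau> l m (z (real i * T\<^sub>2)) (history (real i * T\<^sub>2) u)"
  have c: "u s = c" if "real i * T\<^sub>2 \<le> s" "s < real (Suc i) * T\<^sub>2" for s
    using fb that unfolding feedback_def c_def by simp
  have h: "- R \<le> real i * T\<^sub>2" "real i * T\<^sub>2 \<le> real (Suc i) * T\<^sub>2"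
  proof -
    have "0 \<le> real i * T\<^sub>2" using pos_consts by simp
    then show "- R \<le> real i * T\<^sub>2" using delays by linarith
  qed (use pos_consts in \<open>simp add: algebra_simps\<close>)
  then have h': "- R \<le> real (Suc i) * T\<^sub>2" by linarith
  have "regular_input (\<lambda>s. if s < real (Suc i) * T\<^sub>2 then
      (if s < real i * T\<^sub>2 then (if s < real i * T\<^sub>2 then u s else 0) else c) else 0)"
    by (intro regular_input_extend Suc.IH h h')
  moreover have "(\<lambda>s. if s < real (Suc i) * T\<^sub>2 then
      (if s < real i * T\<^sub>2 then (if s < real i * T\<^sub>2 then u s else 0) else c) else 0)
    = (\<lambda>s. if s < real (Suc i) * T\<^sub>2 then u s else 0)"
    using c by (auto simp del: of_nat_Suc)
  ultimately show ?case by simp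
qed

lemma horizon_index:
  obtains i :: nat where "t < real i * T\<^sub>2"
proof -
  obtain i :: nat where "t / T\<^sub>2 < real i" using reals_Archimedean2 by blast
  then show thesis using that pos_consts by (simp add: field_simps)
qed

section \<open>Construction of the closed loop over successive holding intervals\<close>

context
  fixes x\<^sub>0 :: "real \<Rightarrow> 'n rvec" and u\<^sub>0 :: "real \<Rightarrow> real" and z\<^sub>0 :: "'n rvec" and w\<^sub>0 :: real
    and \<xi> :: "real \<Rightarrow> real" and d :: "real \<Rightarrow> 'n rvec" and ts :: "nat \<Rightarrow> real"
  assumes u0: "Linf {-r - \<tau>..<0} UNIV u\<^sub>0" and d: "Linf_loc {0..} UNIV d" and ts: "sampling_schedule ts"
begin

lemma disturbance_measurable: "d \<in> borel_measurable (lebesgue_on {0..H})"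
proof (rule measurable_restrict_mono)
  show "d \<in> borel_measurable (lebesgue_on {0..})" using d by (simp add: Linf_loc_def)
qed auto

lemma disturbance_bounded:
  obtains W where "\<And>s. s \<in> {0..H} \<Longrightarrow> norm (d s) \<le> W"
proof -
  have "bounded (d ` {0..H})" using d by (simp add: Linf_loc_def)
  then show thesis using that unfolding bounded_iff by blast
qed

definition sampled_output :: "(real \<Rightarrow> 'n rvec) \<Rightarrow> nat \<Rightarrow> real" where
  "sampled_output x i = (if i = 0 then w\<^sub>0 else x (ts i - r) $ fst_idx + \<xi> (ts i))"

definition open_loop :: "real \<Rightarrow> (real \<Rightarrow> 'n rvec) \<Rightarrow> (real \<Rightarrow> real) \<Rightarrow> (real \<Rightarrow> 'n rvec) \<Rightarrow> (real \<Rightarrow> real) \<Rightarrow> bool" where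
  "open_loop H x u z w \<longleftrightarrow> (\<forall>s\<in>{-r..0}. x s = x\<^sub>0 s) \<and> ac_solves {0..H} x (plant_rhs d u x)
     \<and> observer_solution H ts (sampled_output x) u z w \<and> z 0 = z\<^sub>0"

lemma open_loop_exists:
  assumes u: "regular_input u" and H: "0 \<le> H"
  obtains x z w where "open_loop H x u z w"
proof -
  obtain W where W: "\<And>s. s \<in> {0..H} \<Longrightarrow> norm (d s) \<le> W" using disturbance_bounded by blast
  obtain x' where x': "ac_solves {0..H} x' (plant_rhs d u x')" "x' 0 = x\<^sub>0 0"
    using plant_solution_exists[OF u disturbance_measurable W H] by metis
  define x where "x s = (if s \<le> 0 then x\<^sub>0 s else x' s)" for s
  have eq: "x' t = x t" if "t \<in> {0..H}" for t using that x'(2) by (auto simp: x_def)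
  have "ac_solves {0..H} x (plant_rhs d u x)"
    by (rule ac_solves_cong[OF x'(1) eq]) (auto simp: plant_rhs_def eq)
  moreover obtain z w where "observer_solution H ts (sampled_output x) u z w" "z 0 = z\<^sub>0"
    using observer_solution_exists[OF ts u H] by metis
  ultimately show thesis
    by (intro that[of x z w]) (auto simp: open_loop_def x_def)
qed

lemma open_loop_unique:
  assumes o: "open_loop H x u z w" and o': "open_loop H x' u' z' w'" and u: "regular_input u"
    and uu': "\<And>s. s \<in> {-R..<H} \<Longrightarrow> u s = u' s" and H: "0 \<le> H"
  shows "t \<in> {-r..H} \<Longrightarrow> x t = x' t" "t \<in> {0..H} \<Longrightarrow> z t = z' t \<and> w t = w' t"
proof -
  obtain W where W: "\<And>s. s \<in> {0..H} \<Longrightarrow> norm (d s) \<le> W" using disturbance_bounded by blast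
  have x00: "x 0 = x' 0" using o o' delays by (auto simp: open_loop_def)
  show xx: "x t = x' t" if "t \<in> {-r..H}" for t
  proof (cases "t \<le> 0")
    case True
    then show ?thesis using o o' that by (auto simp: open_loop_def)
  next
    case False
    show ?thesis
      by (rule plant_solution_unique[of H x d u x' u' W])
         (use o o' u uu' W H x00 that False in \<open>auto simp: open_loop_def\<close>)
  qed
  show "z t = z' t \<and> w t = w' t" if "t \<in> {0..H}"
  proof (rule observer_solution_unique[OF _ _ ts _ _ H _ that])
    show "observer_solution H ts (sampled_output x) u z w" "observer_solution H ts (sampled_output x') u' z' w'" "z 0 = z' 0"
      using o o' by (auto simp: open_loop_def)
    show "sampled_output x i = sampled_output x' i" if "ts i \<le> H" for i
      using xx[of "ts i - r"] that schedule_mono(2)[OF ts, of i] delays by (simp add: sampled_output_def)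
    show "u s = u' s" if "s \<in> {-R..<H - R}" for s using that delays by (intro uu') auto
  qed
qed

text \<open>A solution up to holding instant i whose input obeys the feedback on the first i holding
  intervals; past that instant the input is any regular one.\<close>

definition horizon_solution ::
  "nat \<Rightarrow> (real \<Rightarrow> 'n rvec) \<times> (real \<Rightarrow> real) \<times> (real \<Rightarrow> 'n rvec) \<times> (real \<Rightarrow> real) \<Rightarrow> bool" where
  "horizon_solution i = (\<lambda>(x, u, z, w). regular_input u \<and> (\<forall>s\<in>{-R..<0}. u s = u\<^sub>0 s)
     \<and> open_loop (real i * T\<^sub>2) x u z w
     \<and> (\<forall>i'<i. \<forall>t\<in>{real i' * T\<^sub>2..<real (Suc i') * T\<^sub>2}.
         u t = k \<bullet> Ppred f r \<tau> l m (\<lambda>s. u (real i' * T\<^sub>2 + (s - r - \<tau>))) (z (real i' * T\<^sub>2))))"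

text \<open>Inputs are compared strictly before H: the value at a holding instant is fixed only by
  the following step of the construction.\<close>

definition agree ::
  "real \<Rightarrow> (real \<Rightarrow> 'n rvec) \<times> (real \<Rightarrow> real) \<times> (real \<Rightarrow> 'n rvec) \<times> (real \<Rightarrow> real)
     \<Rightarrow> (real \<Rightarrow> 'n rvec) \<times> (real \<Rightarrow> real) \<times> (real \<Rightarrow> 'n rvec) \<times> (real \<Rightarrow> real) \<Rightarrow> bool" where
  "agree H = (\<lambda>(x, u, z, w) (x', u', z', w'). (\<forall>t\<in>{-r..H}. x t = x' t) \<and> (\<forall>t\<in>{-R..<H}. u t = u' t)
     \<and> (\<forall>t\<in>{0..H}. z t = z' t \<and> w t = w' t))"

lemma agree_trans: "agree H s s' \<Longrightarrow> agree H' s' s'' \<Longrightarrow> H \<le> H' \<Longrightarrow> agree H s s''"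
  by (auto simp: agree_def split: prod.splits)

lemma horizon_solution_0: "\<exists>s. horizon_solution 0 s"
proof -
  define u where "u s = (if s < 0 then u\<^sub>0 s else 0)" for s
  have ur: "regular_input u" unfolding u_def by (rule regular_input_initial[OF u0]) simp
  obtain x z w where "open_loop 0 x u z w" using open_loop_exists[OF ur, of 0] by auto
  then have "horizon_solution 0 (x, u, z, w)" using ur by (auto simp: horizon_solution_def u_def)
  then show ?thesis ..
qed

text \<open>The next held value c uses z and past input at the current holding instant, both known.
  Plant and observer are solved afresh on the longer horizon with the input extended by c;
  uniqueness makes the result agree with the old solution, so the earlier feedback equations remain
  valid.\<close>

lemma horizon_solution_Suc:
  assumes s: "horizon_solution i s"
  shows "\<exists>s'. horizon_solution (Suc i) s' \<and> agree (real i * T\<^sub>2) s s'"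
proof -
  let ?H = "real i * T\<^sub>2"
  obtain x u z w where sx: "s = (x, u, z, w)" by (cases s)
  have ur: "regular_input u" and ui: "\<And>s. s \<in> {-R..<0} \<Longrightarrow> u s = u\<^sub>0 s" and o: "open_loop ?H x u z w"
    and fb: "\<And>i' t. i' < i \<Longrightarrow> t \<in> {real i' * T\<^sub>2..<real (Suc i') * T\<^sub>2} \<Longrightarrow>
         u t = k \<bullet> Ppred f r \<tau> l m (\<lambda>s. u (real i' * T\<^sub>2 + (s - r - \<tau>))) (z (real i' * T\<^sub>2))"
    using s unfolding sx horizon_solution_def by auto
  have H0: "0 \<le> ?H" "?H \<le> real (Suc i) * T\<^sub>2" using pos_consts by (auto simp: algebra_simps)
  define c where "c = k \<bullet> Ppred f r \<tau> l m (\<lambda>s. u (?H + (s - r - \<tau>))) (z ?H)"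
  define u' where "u' s = (if s < ?H then u s else c)" for s
  have ur': "regular_input u'"
    unfolding u'_def using H0 delays by (intro regular_input_extend[OF ur]) linarith
  obtain x' z' w' where o': "open_loop (real (Suc i) * T\<^sub>2) x' u' z' w'"
    using open_loop_exists[OF ur'] H0 by (metis order_trans)
  have o'': "open_loop ?H x' u' z' w'"
    unfolding open_loop_def observer_solution_def
  proof (intro conjI allI impI)
    let ?H' = "real (Suc i) * T\<^sub>2"
    have sub: "{0..?H} \<subseteq> {0..?H'}" using H0 by auto
    have o1: "\<forall>s\<in>{-r..0}. x' s = x\<^sub>0 s" "ac_solves {0..?H'} x' (plant_rhs d u' x')" "z' 0 = z\<^sub>0"
      "observer_solution ?H' ts (sampled_output x') u' z' w'"
      using o' by (auto simp only: open_loop_def)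
    note o2 = o1(4)[unfolded observer_solution_def]
    show "\<forall>s\<in>{-r..0}. x' s = x\<^sub>0 s" "z' 0 = z\<^sub>0" by fact+
    show "ac_solves {0..?H} x' (plant_rhs d u' x')" by (rule ac_solves_subset[OF o1(2) sub])
    show "ac_solves {0..?H} z' (\<lambda>t. drift f (z' t) (u' (t - r - \<tau>)) + (z' t $ fst_idx - w' t) *\<^sub>R inj_gain)"
      using o2 by (intro ac_solves_subset[OF _ sub]) blast
    fix j assume "ts j \<le> ?H"
    then have j: "ts j \<le> ?H'" using H0 by simp
    show "w' (ts j) = sampled_output x' j" using o2 j by blast
    have "ac_solves ({ts j..<ts (Suc j)} \<inter> {0..?H'}) w' (\<lambda>t. drift f (z' t) (u' (t - r - \<tau>)) $ fst_idx)"
      using o2 j by blast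
    then show "ac_solves ({ts j..<ts (Suc j)} \<inter> {0..?H}) w' (\<lambda>t. drift f (z' t) (u' (t - r - \<tau>)) $ fst_idx)"
      by (rule ac_solves_subset) (use sub in blast)
  qed
  have uu': "u s = u' s" if "s \<in> {-R..<?H}" for s using that by (simp add: u'_def)
  note un = open_loop_unique[OF o o'' ur uu' H0(1)]
  have ag: "agree ?H s (x', u', z', w')"
    unfolding sx agree_def using un uu' by auto
  have "horizon_solution (Suc i) (x', u', z', w')"
    unfolding horizon_solution_def prod.case
  proof (intro conjI allI impI ballI ur' o')
    show "u' s = u\<^sub>0 s" if "s \<in> {-R..<0}" for s using that ui[OF that] H0 by (simp add: u'_def)
    fix i' t assume i': "i' < Suc i" and t: "t \<in> {real i' * T\<^sub>2..<real (Suc i') * T\<^sub>2}"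
    have le: "real i' * T\<^sub>2 \<le> ?H" using i' pos_consts by (intro mult_right_mono) auto
    have P1: "Ppred f r \<tau> l m (\<lambda>s. u' (real i' * T\<^sub>2 + (s - r - \<tau>))) y
       = Ppred f r \<tau> l m (\<lambda>s. u (real i' * T\<^sub>2 + (s - r - \<tau>))) y" for y
      using le by (intro Ppred_cong) (auto simp: u'_def)
    have zi: "z' (real i' * T\<^sub>2) = z (real i' * T\<^sub>2)"
      using un(2)[of "real i' * T\<^sub>2"] le pos_consts by simp
    have P: "Ppred f r \<tau> l m (\<lambda>s. u' (real i' * T\<^sub>2 + (s - r - \<tau>))) (z' (real i' * T\<^sub>2))
      = Ppred f r \<tau> l m (\<lambda>s. u (real i' * T\<^sub>2 + (s - r - \<tau>))) (z (real i' * T\<^sub>2))"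
      unfolding zi P1 ..
    show "u' t = k \<bullet> Ppred f r \<tau> l m (\<lambda>s. u' (real i' * T\<^sub>2 + (s - r - \<tau>))) (z' (real i' * T\<^sub>2))"
    proof (cases "i' = i")
      case True
      then show ?thesis unfolding P using t by (simp add: u'_def c_def)
    next
      case False
      then have "i' < i" using i' by simp
      then have "real (Suc i') * T\<^sub>2 \<le> ?H" using pos_consts by (intro mult_right_mono) auto
      then show ?thesis unfolding P using fb[OF \<open>i' < i\<close> t] t by (simp add: u'_def)
    qed
  qed
  with ag show ?thesis by blast
qed

text \<open>Dependent choice yields a chain of horizon solutions, each extending its predecessor,
  and every function is read off at t from a member whose horizon exceeds t. Each defining relation
  concerns a bounded time range, hence is inherited from one member of the chain.\<close>

lemma closed_loop_exists:
  "\<exists>x u z w. (\<forall>s\<in>{-r..0}. x s = x\<^sub>0 s) \<and> (\<forall>s\<in>{-R..<0}. u s = u\<^sub>0 s) \<and> z 0 = z\<^sub>0 \<and> w 0 = w\<^sub>0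
     \<and> ac_solves {0..} x (plant_rhs d u x)
     \<and> ac_solves {0..} z (\<lambda>t. drift f (z t) (u (t - r - \<tau>)) + (z t $ fst_idx - w t) *\<^sub>R inj_gain)
     \<and> (\<forall>i. ac_solves {ts i..<ts (Suc i)} w (\<lambda>t. drift f (z t) (u (t - r - \<tau>)) $ fst_idx))
     \<and> (\<forall>i. w (ts (Suc i)) = x (ts (Suc i) - r) $ fst_idx + \<xi> (ts (Suc i)))
     \<and> feedback f r \<tau> k T\<^sub>2 l m u z"
proof -
  obtain S where S: "\<And>i. horizon_solution i (S i)" "\<And>i. agree (real i * T\<^sub>2) (S i) (S (Suc i))"
    using dependent_nat_choice[of horizon_solution "\<lambda>i s s'. agree (real i * T\<^sub>2) s s'"]
      horizon_solution_0 horizon_solution_Suc by metis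
  have ag: "agree (real i * T\<^sub>2) (S i) (S j)" if "i \<le> j" for i j
    using that
  proof (induction j rule: dec_induct)
    case base
    show ?case by (auto simp: agree_def split: prod.splits)
  next
    case (step j)
    show ?case using agree_trans[OF step(3) S(2)[of j]] step pos_consts by (simp add: mult_right_mono)
  qed
  define X U Z W where "X i = fst (S i)" and "U i = fst (snd (S i))" and "Z i = fst (snd (snd (S i)))"
    and "W i = snd (snd (snd (S i)))" for i
  have Sd: "S i = (X i, U i, Z i, W i)" for i by (simp add: X_def U_def Z_def W_def)
  \<comment> \<open>The added 1 makes the horizon exceed t strictly, so that the input at time t is
    already determined.\<close>
  define n where "n t = nat \<lfloor>t / T\<^sub>2\<rfloor> + 1" for t
  have nt: "t < real (n t) * T\<^sub>2" for t
  proof -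
    have "t / T\<^sub>2 < real (n t)" unfolding n_def by linarith
    then show ?thesis using pos_consts by (simp add: field_simps)
  qed
  define x u z w where "x t = X (n t) t" and "u t = U (n t) t" and "z t = Z (n t) t" and "w t = W (n t) t" for t
  have agt: "t \<ge> -r \<longrightarrow> X i t = x t" "t \<ge> -R \<longrightarrow> U i t = u t" "t \<ge> 0 \<longrightarrow> Z i t = z t" "t \<ge> 0 \<longrightarrow> W i t = w t"
    if t: "t < real i * T\<^sub>2" for t i
  proof -
    have "(t \<ge> -r \<longrightarrow> X i t = x t) \<and> (t \<ge> -R \<longrightarrow> U i t = u t) \<and> (t \<ge> 0 \<longrightarrow> Z i t = z t) \<and> (t \<ge> 0 \<longrightarrow> W i t = w t)"
    proof (cases "i \<le> n t")
      case True
      then show ?thesis using ag[OF True] t by (auto simp: agree_def Sd x_def u_def z_def w_def)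
    next
      case False
      then have "n t \<le> i" by simp
      from ag[OF this] show ?thesis using nt[of t] by (auto simp: agree_def Sd x_def u_def z_def w_def)
    qed
    then show "t \<ge> -r \<longrightarrow> X i t = x t" "t \<ge> -R \<longrightarrow> U i t = u t" "t \<ge> 0 \<longrightarrow> Z i t = z t" "t \<ge> 0 \<longrightarrow> W i t = w t" by auto
  qed
  have HS: "regular_input (U i)" "\<And>s. s \<in> {-R..<0} \<Longrightarrow> U i s = u\<^sub>0 s" "\<And>s. s \<in> {-r..0} \<Longrightarrow> X i s = x\<^sub>0 s"
    "ac_solves {0..real i * T\<^sub>2} (X i) (plant_rhs d (U i) (X i))" "Z i 0 = z\<^sub>0"
    "observer_solution (real i * T\<^sub>2) ts (sampled_output (X i)) (U i) (Z i) (W i)"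
    "\<And>i' t. i' < i \<Longrightarrow> t \<in> {real i' * T\<^sub>2..<real (Suc i') * T\<^sub>2} \<Longrightarrow>
         U i t = k \<bullet> Ppred f r \<tau> l m (\<lambda>s. U i (real i' * T\<^sub>2 + (s - r - \<tau>))) (Z i (real i' * T\<^sub>2))" for i
    using S(1)[of i] unfolding Sd horizon_solution_def open_loop_def by auto
  have T2: "0 < T\<^sub>2" using pos_consts by simp
  show ?thesis
  proof (rule exI[of _ x], rule exI[of _ u], rule exI[of _ z], rule exI[of _ w], intro conjI ballI allI)
    show "x s = x\<^sub>0 s" if "s \<in> {-r..0}" for s using HS(3)[OF that] by (simp add: x_def)
    show "u s = u\<^sub>0 s" if "s \<in> {-R..<0}" for s using HS(2)[OF that] by (simp add: u_def)
    show "z 0 = z\<^sub>0" using HS(5) by (simp add: z_def)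
    have "ts 0 = 0" using ts by (simp add: sampling_schedule_def)
    have "W (n 0) (ts 0) = sampled_output (X (n 0)) 0"
    proof -
      have "\<forall>i. ts i \<le> real (n 0) * T\<^sub>2 \<longrightarrow> W (n 0) (ts i) = sampled_output (X (n 0)) i"
        using HS(6)[of "n 0"] unfolding observer_solution_def by blast
      moreover have "ts 0 \<le> real (n 0) * T\<^sub>2" using \<open>ts 0 = 0\<close> T2 by simp
      ultimately show ?thesis by blast
    qed
    then show "w 0 = w\<^sub>0" using \<open>ts 0 = 0\<close> by (simp add: w_def sampled_output_def)
    show "ac_solves {0..} x (plant_rhs d u x)"
    proof (rule ac_solves_atLeast)
      fix j :: nat
      obtain i where i: "real j < real i * T\<^sub>2" using horizon_index by blast
      have "ac_solves {0..0 + real j} (X i) (plant_rhs d (U i) (X i))"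
        using HS(4)[of i] by (rule ac_solves_subset) (use i in auto)
      then show "ac_solves {0..0 + real j} x (plant_rhs d u x)"
        by (rule ac_solves_cong) (use agt(1,2)[of _ i] i delays in \<open>auto simp: plant_rhs_def\<close>)
    qed
    show "ac_solves {0..} z (\<lambda>t. drift f (z t) (u (t - r - \<tau>)) + (z t $ fst_idx - w t) *\<^sub>R inj_gain)"
    proof (rule ac_solves_atLeast)
      fix j :: nat
      obtain i where i: "real j < real i * T\<^sub>2" using horizon_index by blast
      have "ac_solves {0..real i * T\<^sub>2} (Z i) (\<lambda>t. drift f (Z i t) (U i (t - r - \<tau>)) + (Z i t $ fst_idx - W i t) *\<^sub>R inj_gain)"
        using HS(6)[of i] by (simp add: observer_solution_def)
      then have "ac_solves {0..0 + real j} (Z i) (\<lambda>t. drift f (Z i t) (U i (t - r - \<tau>)) + (Z i t $ fst_idx - W i t) *\<^sub>R inj_gain)"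
        by (rule ac_solves_subset) (use i in auto)
      then show "ac_solves {0..0 + real j} z (\<lambda>t. drift f (z t) (u (t - r - \<tau>)) + (z t $ fst_idx - w t) *\<^sub>R inj_gain)"
        by (rule ac_solves_cong) (use agt(2,3,4)[of _ i] i delays in auto)
    qed
    fix i
    obtain j where j: "ts (Suc i) < real j * T\<^sub>2" using horizon_index by blast
    have tsi: "0 \<le> ts i" "ts i < ts (Suc i)" using schedule_mono(2)[OF ts] ts by (auto simp: sampling_schedule_def)
    have "ac_solves ({ts i..<ts (Suc i)} \<inter> {0..real j * T\<^sub>2}) (W j) (\<lambda>t. drift f (Z j t) (U j (t - r - \<tau>)) $ fst_idx)"
      using HS(6)[of j] tsi j unfolding observer_solution_def by auto
    then have "ac_solves {ts i..<ts (Suc i)} (W j) (\<lambda>t. drift f (Z j t) (U j (t - r - \<tau>)) $ fst_idx)"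
      by (rule ac_solves_subset) (use tsi j in auto)
    then show "ac_solves {ts i..<ts (Suc i)} w (\<lambda>t. drift f (z t) (u (t - r - \<tau>)) $ fst_idx)"
      by (rule ac_solves_cong) (use agt(2,3,4)[of _ j] tsi j delays in auto)
    have "W j (ts (Suc i)) = X j (ts (Suc i) - r) $ fst_idx + \<xi> (ts (Suc i))"
      using HS(6)[of j] j unfolding observer_solution_def sampled_output_def by auto
    then show "w (ts (Suc i)) = x (ts (Suc i) - r) $ fst_idx + \<xi> (ts (Suc i))"
      using agt(4)[of "ts (Suc i)" j] agt(1)[of "ts (Suc i) - r" j] tsi j delays by auto
  next
    show "feedback f r \<tau> k T\<^sub>2 l m u z"
      unfolding feedback_def Phi_def history_def
    proof (intro allI ballI)
      fix i t assume t: "t \<in> {real i * T\<^sub>2..<real (i + 1) * T\<^sub>2}"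
      have i0: "0 \<le> real i * T\<^sub>2" "real i * T\<^sub>2 < real (Suc i) * T\<^sub>2" using T2 by auto
      have "u t = U (Suc i) t" using agt(2)[of t "Suc i"] t i0 delays by auto
      also have "\<dots> = k \<bullet> Ppred f r \<tau> l m (\<lambda>s. U (Suc i) (real i * T\<^sub>2 + (s - r - \<tau>))) (Z (Suc i) (real i * T\<^sub>2))"
        using t by (intro HS(7)) auto
      also have "Z (Suc i) (real i * T\<^sub>2) = z (real i * T\<^sub>2)" using agt(3)[OF i0(2)] i0 by simp
      also have "Ppred f r \<tau> l m (\<lambda>s. U (Suc i) (real i * T\<^sub>2 + (s - r - \<tau>))) (z (real i * T\<^sub>2))
         = Ppred f r \<tau> l m (\<lambda>s. u (real i * T\<^sub>2 + (s - r - \<tau>))) (z (real i * T\<^sub>2))"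
        using agt(2)[of _ "Suc i"] i0 by (intro Ppred_cong) auto
      finally show "u t = k \<bullet> Ppred f r \<tau> l m (\<lambda>s. u (real i * T\<^sub>2 + (s - r - \<tau>))) (z (real i * T\<^sub>2))" .
    qed
  qed
qed

end

end

section \<open>Estimates for solutions\<close>

text \<open>Local boundedness of b prevents the sampling times from accumulating: if all of them
  stayed below t, every step would be at least \<open>T\<^sub>1 * exp (- \<beta>)\<close>, with
  \<beta> a bound of b on {0..t}.\<close>

lemma sampling_time_schedule:
  assumes T1: "T\<^sub>1 > 0" and b: "Linf_loc {0..} {0..} b"
  shows "sampling_time T\<^sub>1 b i < sampling_time T\<^sub>1 b (Suc i)"
    and "sampling_time T\<^sub>1 b (Suc i) \<le> sampling_time T\<^sub>1 b i + T\<^sub>1"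
    and "\<exists>i. t < sampling_time T\<^sub>1 b i"
proof -
  let ?t = "sampling_time T\<^sub>1 b"
  show inc: "?t i < ?t (Suc i)" for i using T1 by simp
  have nonneg: "0 \<le> ?t i" for i using T1 by (induction i) (auto intro: add_nonneg_nonneg)
  have b0: "b s \<ge> 0" if "s \<ge> 0" for s using b that unfolding Linf_loc_def by auto
  show "?t (Suc i) \<le> ?t i + T\<^sub>1" using b0[OF nonneg] T1 by simp
  show "\<exists>i. t < ?t i"
  proof (rule ccontr)
    assume "\<not> (\<exists>i. t < ?t i)"
    then have le: "?t i \<le> t" for i by (simp add: not_less)
    have "bounded (b ` {0..t})" using b by (simp add: Linf_loc_def)
    then obtain \<beta> where \<beta>: "\<And>s. s \<in> {0..t} \<Longrightarrow> \<bar>b s\<bar> \<le> \<beta>" unfolding bounded_iff real_norm_def by blast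
    have step: "T\<^sub>1 * exp (- \<beta>) \<le> ?t (Suc i) - ?t i" for i
      using \<beta>[of "?t i"] nonneg[of i] le[of i] T1 by (auto intro!: mult_left_mono)
    have lower: "real i * (T\<^sub>1 * exp (- \<beta>)) \<le> ?t i" for i
    proof (induction i)
      case (Suc i)
      have "real (Suc i) * (T\<^sub>1 * exp (- \<beta>)) = real i * (T\<^sub>1 * exp (- \<beta>)) + T\<^sub>1 * exp (- \<beta>)"
        by (simp add: algebra_simps)
      then show ?case using Suc step[of i] by linarith
    qed simp
    have "0 < T\<^sub>1 * exp (- \<beta>)" using T1 by simp
    then obtain i where "t < real i * (T\<^sub>1 * exp (- \<beta>))"
      using reals_Archimedean3 by blast
    then show False using lower[of i] le[of i] by linarith
  qed
qed

lemma supnorm_upper: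
  assumes "bounded (h ` S)" "s \<in> S"
  shows "norm (h s) \<le> supnorm S h"
proof -
  obtain B where "\<And>s. s \<in> S \<Longrightarrow> norm (h s) \<le> B" using assms(1) unfolding bounded_iff by blast
  then have "bdd_above ((\<lambda>s. norm (h s)) ` S)" by (rule bdd_aboveI2)
  then show ?thesis unfolding supnorm_def using assms(2) by (rule cSUP_upper[rotated])
qed

text \<open>Puts the fading suprema of the claim into the form J e^(-\<sigma> s) that
  \<open>trajectory\<close> demands of inputs; the factor e^(\<sigma> t) is undone at the end by the
  decay at time t.\<close>

lemma fading_supremum:
  fixes h :: "real \<Rightarrow> 'a::real_normed_vector"
  assumes h: "bounded (h ` {0..t})" and \<sigma>: "\<sigma> \<ge> 0" and s: "s \<in> {0..t}"
  shows "norm (h s) \<le> exp (- \<sigma> * s) * (exp (\<sigma> * t) * (SUP s\<in>{0..t}. exp (- \<sigma> * (t - s)) * norm (h s)))"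
proof -
  obtain B where B: "\<And>s. s \<in> {0..t} \<Longrightarrow> norm (h s) \<le> B" using h unfolding bounded_iff by blast
  have "exp (- \<sigma> * (t - s)) * norm (h s) \<le> 1 * B" if "s \<in> {0..t}" for s
    using B[OF that] that \<sigma> by (intro mult_mono) auto
  then have "bdd_above ((\<lambda>s. exp (- \<sigma> * (t - s)) * norm (h s)) ` {0..t})" by (rule bdd_aboveI2)
  then have "exp (- \<sigma> * (t - s)) * norm (h s) \<le> (SUP s\<in>{0..t}. exp (- \<sigma> * (t - s)) * norm (h s))"
    using s by (rule cSUP_upper[rotated])
  then have "exp (\<sigma> * (t - s)) * (exp (- \<sigma> * (t - s)) * norm (h s))
      \<le> exp (\<sigma> * (t - s)) * (SUP s\<in>{0..t}. exp (- \<sigma> * (t - s)) * norm (h s))"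
    by (intro mult_left_mono) auto
  moreover have "exp (\<sigma> * (t - s)) * (exp (- \<sigma> * (t - s)) * norm (h s)) = norm (h s)"
    unfolding mult.assoc[symmetric] exp_add[symmetric] by simp
  moreover have "exp (\<sigma> * (t - s)) = exp (- \<sigma> * s) * exp (\<sigma> * t)"
    unfolding exp_add[symmetric] by (simp add: algebra_simps)
  ultimately show ?thesis by (simp only: mult.assoc)
qed

section \<open>From closed-loop solutions to the estimate\<close>

context predictor_feedback
begin

lemma lyapunov_inequality:
  "x \<bullet> (P *v (drift f x (k \<bullet> x) + diag (\<chi> i. g i x v) *v d)) \<le> - 2 * \<mu> * (x \<bullet> (P *v x)) + \<gamma> * (norm d)\<^sup>2"
proof -
  have ek: "(shiftA + outer evec k) *v x = shiftA *v x + (k \<bullet> x) *\<^sub>R evec"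
    by (simp add: vec_eq_iff matrix_vector_mult_def outer_def algebra_simps sum.distrib inner_vec_def
        sum_distrib_left)
  have "x \<bullet> (P *v ((shiftA + outer evec k) *v x)) + x \<bullet> (P *v fvec f x) + x \<bullet> (P *v (diag (\<chi> i. g i x v) *v d))
      \<le> - 2 * \<mu> * (x \<bullet> (P *v x)) + \<gamma> * (norm d)\<^sup>2"
    using B unfolding assumption_B_def by blast
  moreover have "drift f x (k \<bullet> x) + diag (\<chi> i. g i x v) *v d
     = (shiftA + outer evec k) *v x + fvec f x + diag (\<chi> i. g i x v) *v d"
    by (simp add: drift_def ek)
  ultimately show ?thesis by (simp only: matrix_vector_right_distrib inner_add_right)
qed

lemma plant_iff: "plant f g \<tau> d x u \<longleftrightarrow> ac_solves {0..} x (plant_rhs d u x)"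
  unfolding plant_def plant_rhs_eq by (simp add: plant_rhs_def[abs_def])

lemma observer_iff:
  "observer f r \<tau> p \<theta> T\<^sub>1 \<xi> b x u z w \<longleftrightarrow>
     ac_solves {0..} z (\<lambda>t. drift f (z t) (u (t - r - \<tau>)) + (z t $ fst_idx - w t) *\<^sub>R inj_gain)
     \<and> (\<forall>i. ac_solves {sampling_time T\<^sub>1 b i..<sampling_time T\<^sub>1 b (Suc i)} w (\<lambda>t. drift f (z t) (u (t - r - \<tau>)) $ fst_idx))
     \<and> (\<forall>i. w (sampling_time T\<^sub>1 b (Suc i)) = x (sampling_time T\<^sub>1 b (Suc i) - r) $ fst_idx + \<xi> (sampling_time T\<^sub>1 b (Suc i)))"
  unfolding observer_def Let_def observer_rhs_eq inner_cvec inj_gain_def[symmetric]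
  by (auto simp: drift_eq simp del: sampling_time.simps)

text \<open>Since \<open>d'\<close> and \<open>D\<close> vanish after H, the Lyapunov inequality and
  the exponential bound on the disturbance extend to H + \<tau>. Measurability and local boundedness
  of the input, needed for the continuation and for the predictor, come from the feedback law via
  \<open>feedback_regular_input\<close>.\<close>

lemma solution_trajectory:
  assumes data: "Linf {-r - \<tau>..<0} UNIV u\<^sub>0" "Linf_loc {0..} {0..} b" "Linf_loc {0..} UNIV d"
    and ic: "initial_cond r \<tau> x\<^sub>0 u\<^sub>0 z\<^sub>0 w\<^sub>0 x u z w" and pl: "plant f g \<tau> d x u"
    and ob: "observer f r \<tau> p \<theta> T\<^sub>1 \<xi> b x u z w" and fb: "feedback f r \<tau> k T\<^sub>2 l m u z"
    and H: "0 \<le> H" and J: "0 \<le> J"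
    and bounds: "\<And>s. s \<in> {-r..0} \<Longrightarrow> norm (x\<^sub>0 s) \<le> J" "\<And>s. s \<in> {-r - \<tau>..<0} \<Longrightarrow> \<bar>u\<^sub>0 s\<bar> \<le> J"
      "norm z\<^sub>0 \<le> J" "\<bar>w\<^sub>0\<bar> \<le> J" "\<And>s. s \<in> {0..H} \<Longrightarrow> \<bar>\<xi> s\<bar> \<le> exp (- \<sigma> * s) * J"
      "\<And>s. s \<in> {0..H} \<Longrightarrow> norm (d s) \<le> exp (- \<sigma> * s) * J"
  obtains x' d' D where "trajectory H J \<sigma> x' u z w \<xi> d' D (sampling_time T\<^sub>1 b)" "\<And>s. s \<le> H \<Longrightarrow> x' s = x s"
proof -
  have xi: "\<And>s. s \<in> {-r..0} \<Longrightarrow> x s = x\<^sub>0 s" and ui: "\<And>s. s \<in> {-r - \<tau>..<0} \<Longrightarrow> u s = u\<^sub>0 s"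
    and zi: "z 0 = z\<^sub>0" and wi: "w 0 = w\<^sub>0"
    using ic by (auto simp: initial_cond_def history_def)
  note reg = feedback_regular_input[OF data(1) ui fb]
  have xac: "ac_solves {0..H} x (plant_rhs d u x)"
    using pl[unfolded plant_iff] by (rule ac_solves_subset) auto
  obtain i where i: "H < real i * T\<^sub>2" using horizon_index by blast
  obtain U where U: "U \<ge> 0" "\<And>s. s \<in> {-R..H} \<Longrightarrow> \<bar>u s\<bar> \<le> U"
  proof -
    obtain U where U: "U \<ge> 0" "\<And>s. s \<in> {-R..H} \<Longrightarrow> \<bar>if s < real i * T\<^sub>2 then u s else 0\<bar> \<le> U"
      using regular_input_bounded[OF reg[of i]] by blast
    show thesis by (rule that[OF U(1)]) (use U(2) i in fastforce)
  qed
  have um: "(\<lambda>s. u (s - \<tau>)) \<in> borel_measurable (lebesgue_on {H..<H + \<tau>})"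
  proof -
    have "(\<lambda>s. (if s + - \<tau> < real i * T\<^sub>2 then u (s + - \<tau>) else 0)) \<in> borel_measurable (lebesgue_on {H..<H + \<tau>})"
      by (rule regular_input_measurable[OF reg[of i]]) (use H delays in auto)
    then show ?thesis
      by (rule measurable_cong[THEN iffD1, rotated]) (use i in \<open>auto simp: space_restrict_space\<close>)
  qed
  have ub: "\<bar>u (s - \<tau>)\<bar> \<le> U" if "s \<in> {0..H + \<tau>}" for s using that delays by (intro U(2)) auto
  obtain y where y: "ac_solves {H..H + \<tau>} y (\<lambda>t. drift f (y t) (u (t - \<tau>)))" "y H = x H"
    using flow_exists[OF _ um, of U "x H"] ub H delays by auto
  obtain W where W: "\<And>s. s \<in> {0..H} \<Longrightarrow> norm (d s) \<le> W"
  proof -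
    have "bounded (d ` {0..H})" using data(3) by (simp add: Linf_loc_def)
    then show thesis using that unfolding bounded_iff by blast
  qed
  have "bounded (x ` {0..H} \<union> y ` {H..H + \<tau>})"
    using ac_solves_continuous_on[OF xac] ac_solves_continuous_on[OF y(1)]
    by (simp add: compact_imp_bounded compact_continuous_image)
  then obtain M where "\<forall>v\<in>x ` {0..H} \<union> y ` {H..H + \<tau>}. norm v \<le> M" unfolding bounded_iff by blast
  then have M: "\<And>s. s \<in> {0..H} \<Longrightarrow> norm (x s) \<le> M" "\<And>s. s \<in> {H..H + \<tau>} \<Longrightarrow> norm (y s) \<le> M" by auto
  define x' where "x' s = (if s \<le> H then x s else y s)" for s
  define d' where "d' s = (if s \<le> H then d s else 0)" for s
  define D where "D s = (if s \<le> H then diag (\<chi> i. g i (x s) (u s)) *v d s else 0)" for s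
  have G0: "G \<ge> 0" using G_nonneg[OF A] .
  have W0: "0 \<le> W" using W[of 0] H norm_ge_zero order_trans by (metis atLeastAtMost_iff order_refl)
  have N0: "N \<ge> 0" using N_ge_1 by simp
  have "ac_solves {0..H + \<tau>} (\<lambda>t. if t \<le> H then x t else y t)
     (\<lambda>t. if t \<le> H then plant_rhs d u x t else drift f (y t) (u (t - \<tau>)))"
  proof (rule ac_solves_concat[OF xac y(1) H _ y(2)[symmetric], of "N * M + U + G * W"])
    show "norm (plant_rhs d u x t) \<le> N * M + U + G * W" if t: "t \<in> {0..H}" for t
    proof -
      have "norm (drift f (x t) (u (t - \<tau>))) \<le> N * M + U"
        using norm_drift[of "x t" "u (t - \<tau>)"] mult_left_mono[OF M(1)[OF t] N0] ub[of t] t delays by simp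
      moreover have "norm (diag (\<chi> i. g i (x t) (u t)) *v d t) \<le> G * W"
        using diag_bound[OF A, of "x t" "u t" "d t"] mult_left_mono[OF W[OF t] G0] by linarith
      ultimately show ?thesis unfolding plant_rhs_def by (intro norm_triangle_le) linarith
    qed
    show "norm (drift f (y t) (u (t - \<tau>))) \<le> N * M + U + G * W" if t: "t \<in> {H..H + \<tau>}" for t
      using norm_drift[of "y t" "u (t - \<tau>)"] mult_left_mono[OF M(2)[OF t] N0] ub[of t] t H mult_nonneg_nonneg[OF G0 W0] by simp
  qed (use delays in auto)
  then have x'ac: "ac_solves {0..H + \<tau>} x' (\<lambda>t. drift f (x' t) (u (t - \<tau>)) + D t)"
    by (rule ac_solves_cong) (auto simp: x'_def D_def plant_rhs_def)
  have D0: "D t = diag (\<chi> i. g i (x' t) (u t)) *v d' t" for t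
    by (auto simp: D_def x'_def d'_def)
  let ?ts = "sampling_time T\<^sub>1 b"
  note ts = sampling_time_schedule[OF pos_consts(6) data(2)]
  have "trajectory H J \<sigma> x' u z w \<xi> d' D ?ts"
    unfolding trajectory_def
  proof (intro conjI ballI allI impI H J x'ac ts fb)
    show "norm (D t) \<le> G * norm (d' t)" for t unfolding D0 by (rule diag_bound[OF A])
    show "x' t \<bullet> (P *v (drift f (x' t) (k \<bullet> x' t) + D t)) \<le> - 2 * \<mu> * (x' t \<bullet> (P *v x' t)) + \<gamma> * (norm (d' t))\<^sup>2" for t
      unfolding D0 by (rule lyapunov_inequality)
    show "norm (d' t) \<le> exp (- \<sigma> * t) * J" if "t \<in> {0..H + \<tau>}" for t
    proof (cases "t \<le> H")
      case True
      then show ?thesis using bounds(6)[of t] that by (simp add: d'_def)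
    next
      case False
      then show ?thesis using J by (simp add: d'_def)
    qed
    show "ac_solves {0..H} z (\<lambda>t. drift f (z t) (u (t - r - \<tau>)) + (z t $ fst_idx - w t) *\<^sub>R inj_gain)"
    proof (rule ac_solves_subset)
      show "ac_solves {0..} z (\<lambda>t. drift f (z t) (u (t - r - \<tau>)) + (z t $ fst_idx - w t) *\<^sub>R inj_gain)"
        using ob[unfolded observer_iff] by blast
    qed simp
    show "?ts 0 = 0" by simp
    show "ac_solves {?ts i..<?ts (Suc i)} w (\<lambda>t. drift f (z t) (u (t - r - \<tau>)) $ fst_idx)" for i
      using ob[unfolded observer_iff] by blast
    show "w (?ts (Suc i)) = x' (?ts (Suc i) - r) $ fst_idx + \<xi> (?ts (Suc i))" if "?ts (Suc i) \<le> H" for i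
      using ob[unfolded observer_iff] that delays by (simp add: x'_def del: sampling_time.simps)
    show "\<bar>\<xi> t\<bar> \<le> exp (- \<sigma> * t) * J" if "t \<in> {0..H}" for t using bounds(5)[OF that] .
    show "norm (x' t) \<le> J" if "t \<in> {-r..0}" for t using bounds(1)[OF that] xi[OF that] that H by (simp add: x'_def)
    show "\<bar>u t\<bar> \<le> J" if "t \<in> {-r - \<tau>..<0}" for t using bounds(2)[OF that] ui[OF that] by simp
    show "norm (z 0) \<le> J" "\<bar>w 0\<bar> \<le> J" using bounds zi wi by auto
    fix i :: nat
    have i0: "0 \<le> real i * T\<^sub>2" using pos_consts by simp
    have "(\<lambda>s. if s + (real i * T\<^sub>2 - R) < real i * T\<^sub>2 then u (s + (real i * T\<^sub>2 - R)) else 0)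
        \<in> borel_measurable (lebesgue_on {0..<R})"
      by (rule regular_input_measurable[OF reg[of i]]) (use i0 in auto)
    then have "(\<lambda>s. u (real i * T\<^sub>2 + (s - r - \<tau>))) \<in> borel_measurable (lebesgue_on {0..<R})"
      by (rule measurable_cong[THEN iffD1, rotated]) (auto simp: space_restrict_space algebra_simps)
    moreover have "bounded ((\<lambda>s. u (real i * T\<^sub>2 + (s - r - \<tau>))) ` {0..<R})"
    proof -
      obtain V where V: "V \<ge> 0" "\<And>s. s \<in> {-R..real i * T\<^sub>2} \<Longrightarrow> \<bar>if s < real i * T\<^sub>2 then u s else 0\<bar> \<le> V"
        using regular_input_bounded[OF reg[of i]] by blast
      have "\<bar>u (real i * T\<^sub>2 + (s - r - \<tau>))\<bar> \<le> V" if "s \<in> {0..<R}" for s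
        using V(2)[of "real i * T\<^sub>2 + (s - r - \<tau>)"] that i0 by auto
      then show ?thesis unfolding bounded_iff by (intro exI[of _ V]) auto
    qed
    ultimately show "Linf {0..<R} UNIV (\<lambda>s. u (real i * T\<^sub>2 + (s - r - \<tau>)))" by (simp add: Linf_def)
  qed
  then show thesis by (rule that) (simp add: x'_def)
qed

lemma solution_exists:
  assumes "Linf {-r - \<tau>..<0} UNIV u\<^sub>0" "Linf_loc {0..} {0..} b" "Linf_loc {0..} UNIV d"
  shows "\<exists>x u z w. initial_cond r \<tau> x\<^sub>0 u\<^sub>0 z\<^sub>0 w\<^sub>0 x u z w \<and> plant f g \<tau> d x u
     \<and> observer f r \<tau> p \<theta> T\<^sub>1 \<xi> b x u z w \<and> feedback f r \<tau> k T\<^sub>2 l m u z"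
proof -
  have "sampling_schedule (sampling_time T\<^sub>1 b)"
    using sampling_time_schedule[OF pos_consts(6) assms(2)] by (simp add: sampling_schedule_def)
  from closed_loop_exists[OF assms(1,3) this, of x\<^sub>0 z\<^sub>0 w\<^sub>0 \<xi>] show ?thesis
    unfolding plant_iff observer_iff initial_cond_def history_def by (simp del: sampling_time.simps)
qed

lemma solution_bound:
  "\<exists>\<sigma>>0. \<exists>\<Theta>>0. \<forall>x\<^sub>0 u\<^sub>0 z\<^sub>0 w\<^sub>0 \<xi> b d x u z w t.
     continuous_on {-r..0} x\<^sub>0 \<longrightarrow> Linf {-r - \<tau>..<0} UNIV u\<^sub>0 \<longrightarrow> Linf_loc {0..} UNIV \<xi>
     \<longrightarrow> Linf_loc {0..} {0..} b \<longrightarrow> Linf_loc {0..} UNIV d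
     \<longrightarrow> initial_cond r \<tau> x\<^sub>0 u\<^sub>0 z\<^sub>0 w\<^sub>0 x u z w \<longrightarrow> plant f g \<tau> d x u
     \<longrightarrow> observer f r \<tau> p \<theta> T\<^sub>1 \<xi> b x u z w \<longrightarrow> feedback f r \<tau> k T\<^sub>2 l m u z \<longrightarrow> 0 \<le> t
     \<longrightarrow> norm (z t) + \<bar>w t\<bar> + supnorm {-r..0} (history t x) + supnorm {-r - \<tau>..<0} (history t u)
       \<le> exp (- \<sigma> * t) * (\<Theta> * norm z\<^sub>0 + \<Theta> * \<bar>w\<^sub>0\<bar> + \<Theta> * supnorm {-r..0} x\<^sub>0 + \<Theta> * supnorm {-r - \<tau>..<0} u\<^sub>0)
         + \<Theta> * (SUP s\<in>{0..t}. exp (- \<sigma> * (t - s)) * \<bar>\<xi> s\<bar>)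
         + \<Theta> * (SUP s\<in>{0..t}. exp (- \<sigma> * (t - s)) * norm (d s))"
proof -
  obtain \<sigma> C where \<sigma>: "\<sigma> > 0" and C: "C \<ge> 0" and dec: "\<And>H J x u z w \<xi> d D ts. trajectory H J \<sigma> x u z w \<xi> d D ts \<Longrightarrow>
     (\<forall>t\<in>{0..H}. norm (z t) \<le> C * exp (- \<sigma> * t) * J \<and> \<bar>w t\<bar> \<le> C * exp (- \<sigma> * t) * J)
     \<and> (\<forall>s\<in>{-r..H}. norm (x s) \<le> C * exp (- \<sigma> * s) * J)
     \<and> (\<forall>s\<in>{-r-\<tau>..H}. \<bar>u s\<bar> \<le> C * exp (- \<sigma> * s) * J)"
    using closed_loop_decay by metis
  \<comment> \<open>The 2 stands for z and w, the exponentials for the largest loss of decay over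
    the histories of x and u; the last 1 ensures positivity.\<close>
  define \<Theta> where "\<Theta> = C * (2 + exp (\<sigma> * r) + exp (\<sigma> * R)) + 1"
  have \<Theta>0: "\<Theta> > 0" using C by (simp add: \<Theta>_def add_nonneg_pos)
  have main: "norm (z t) + \<bar>w t\<bar> + supnorm {-r..0} (history t x) + supnorm {-r - \<tau>..<0} (history t u)
       \<le> exp (- \<sigma> * t) * (\<Theta> * norm z\<^sub>0 + \<Theta> * \<bar>w\<^sub>0\<bar> + \<Theta> * supnorm {-r..0} x\<^sub>0 + \<Theta> * supnorm {-r - \<tau>..<0} u\<^sub>0)
         + \<Theta> * (SUP s\<in>{0..t}. exp (- \<sigma> * (t - s)) * \<bar>\<xi> s\<bar>)
         + \<Theta> * (SUP s\<in>{0..t}. exp (- \<sigma> * (t - s)) * norm (d s))"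
    if data: "continuous_on {-r..0} x\<^sub>0" "Linf {-r - \<tau>..<0} UNIV u\<^sub>0" "Linf_loc {0..} UNIV \<xi>"
       "Linf_loc {0..} {0..} b" "Linf_loc {0..} UNIV d"
      and sol: "initial_cond r \<tau> x\<^sub>0 u\<^sub>0 z\<^sub>0 w\<^sub>0 x u z w" "plant f g \<tau> d x u"
        "observer f r \<tau> p \<theta> T\<^sub>1 \<xi> b x u z w" "feedback f r \<tau> k T\<^sub>2 l m u z" and t: "0 \<le> t"
    for x\<^sub>0 u\<^sub>0 z\<^sub>0 w\<^sub>0 \<xi> b d x u z w t
  proof -
    define B1 where "B1 = (SUP s\<in>{0..t}. exp (- \<sigma> * (t - s)) * norm (\<xi> s))"
    define B2 where "B2 = (SUP s\<in>{0..t}. exp (- \<sigma> * (t - s)) * norm (d s))"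
    define I0 where "I0 = norm z\<^sub>0 + \<bar>w\<^sub>0\<bar> + supnorm {-r..0} x\<^sub>0 + supnorm {-r - \<tau>..<0} u\<^sub>0"
    \<comment> \<open>Chosen so that e^(-\<sigma> t) J is e^(-\<sigma> t) times the initial size
      plus the two fading suprema at time t.\<close>
    define J where "J = I0 + exp (\<sigma> * t) * B1 + exp (\<sigma> * t) * B2"
    have bx: "bounded (x\<^sub>0 ` {-r..0})" using data(1) by (simp add: compact_imp_bounded compact_continuous_image)
    have bu: "bounded (u\<^sub>0 ` {-r - \<tau>..<0})" using data(2) by (simp add: Linf_def)
    have bxi: "bounded (\<xi> ` {0..t})" using data(3) by (simp add: Linf_loc_def)
    have bd: "bounded (d ` {0..t})" using data(5) by (simp add: Linf_loc_def)
    note x0 = supnorm_upper[OF bx] and u0 = supnorm_upper[OF bu]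
    have sx: "supnorm {-r..0} x\<^sub>0 \<ge> 0" using order_trans[OF norm_ge_zero x0[of 0]] delays by simp
    have su: "supnorm {-r - \<tau>..<0} u\<^sub>0 \<ge> 0" using order_trans[OF norm_ge_zero u0[of "- r - \<tau>"]] delays by simp
    note xi = fading_supremum[OF bxi less_imp_le[OF \<sigma>], folded B1_def]
      and dd = fading_supremum[OF bd less_imp_le[OF \<sigma>], folded B2_def]
    have B10: "exp (\<sigma> * t) * B1 \<ge> 0" using order_trans[OF norm_ge_zero xi[of 0]] t by simp
    have B20: "exp (\<sigma> * t) * B2 \<ge> 0" using order_trans[OF norm_ge_zero dd[of 0]] t by simp
    have I00: "I0 \<ge> 0" using sx su by (simp add: I0_def)
    have J0: "J \<ge> 0" using I00 B10 B20 by (simp add: J_def)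
    have nz: "0 \<le> norm z\<^sub>0" "0 \<le> \<bar>w\<^sub>0\<bar>" by auto
    have px: "norm (x\<^sub>0 s) \<le> J" if "s \<in> {-r..0}" for s
      using x0[OF that] su B10 B20 nz unfolding J_def I0_def by linarith
    have pu: "\<bar>u\<^sub>0 s\<bar> \<le> J" if "s \<in> {-r - \<tau>..<0}" for s
      using u0[OF that, unfolded real_norm_def] sx B10 B20 nz unfolding J_def I0_def by linarith
    have pz: "norm z\<^sub>0 \<le> J" and pw: "\<bar>w\<^sub>0\<bar> \<le> J"
      using sx su B10 B20 nz unfolding J_def I0_def by linarith+
    have pxi: "\<bar>\<xi> s\<bar> \<le> exp (- \<sigma> * s) * J" if "s \<in> {0..t}" for s
    proof -
      have "exp (- \<sigma> * s) * (exp (\<sigma> * t) * B1) \<le> exp (- \<sigma> * s) * J"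
        using I00 B20 by (intro mult_left_mono) (auto simp: J_def)
      from order_trans[OF xi[OF that] this] show ?thesis by (simp only: real_norm_def)
    qed
    have pd: "norm (d s) \<le> exp (- \<sigma> * s) * J" if "s \<in> {0..t}" for s
    proof -
      have "exp (- \<sigma> * s) * (exp (\<sigma> * t) * B2) \<le> exp (- \<sigma> * s) * J"
        using I00 B10 by (intro mult_left_mono) (auto simp: J_def)
      from order_trans[OF dd[OF that] this] show ?thesis .
    qed
    obtain x' d' D where tr: "trajectory t J \<sigma> x' u z w \<xi> d' D (sampling_time T\<^sub>1 b)" and x': "\<And>s. s \<le> t \<Longrightarrow> x' s = x s"
      using solution_trajectory[OF data(2,4,5) sol t J0 px pu pz pw pxi pd] by blast
    define e where "e = exp (- \<sigma> * t) * J"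
    have e0: "e \<ge> 0" using J0 by (simp add: e_def)
    have zw: "norm (z t) \<le> C * e" "\<bar>w t\<bar> \<le> C * e" using dec[OF tr] t by (auto simp: e_def mult.assoc)
    have shift: "C * exp (- \<sigma> * (t + s)) * J \<le> C * exp (\<sigma> * c) * e" if "- c \<le> s" for s c
    proof -
      have "exp (- \<sigma> * (t + s)) \<le> exp (\<sigma> * c) * exp (- \<sigma> * t)"
        using that \<sigma> by (intro exp_decay_shift) auto
      then have "C * exp (- \<sigma> * (t + s)) * J \<le> C * (exp (\<sigma> * c) * exp (- \<sigma> * t)) * J"
        using C J0 by (intro mult_right_mono mult_left_mono)
      then show ?thesis by (simp add: e_def mult.assoc)
    qed
    have hx: "supnorm {-r..0} (history t x) \<le> C * exp (\<sigma> * r) * e"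
      unfolding supnorm_def
    proof (rule cSUP_least)
      fix s assume s: "s \<in> {-r..0}"
      have "norm (history t x s) = norm (x' (t + s))" using x'[of "t + s"] s by (simp add: history_def)
      also have "\<dots> \<le> C * exp (- \<sigma> * (t + s)) * J" using dec[OF tr] s t by auto
      also have "\<dots> \<le> C * exp (\<sigma> * r) * e" using s by (intro shift) auto
      finally show "norm (history t x s) \<le> C * exp (\<sigma> * r) * e" .
    qed (use delays in auto)
    have hu: "supnorm {-r - \<tau>..<0} (history t u) \<le> C * exp (\<sigma> * R) * e"
      unfolding supnorm_def
    proof (rule cSUP_least)
      fix s assume s: "s \<in> {-r - \<tau>..<0}"
      have "norm (history t u s) \<le> C * exp (- \<sigma> * (t + s)) * J" using dec[OF tr] s t by (auto simp: history_def)
      also have "\<dots> \<le> C * exp (\<sigma> * R) * e" using s by (intro shift) auto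
      finally show "norm (history t u s) \<le> C * exp (\<sigma> * R) * e" .
    qed (use delays in auto)
    have "norm (z t) + \<bar>w t\<bar> + supnorm {-r..0} (history t x) + supnorm {-r - \<tau>..<0} (history t u)
       \<le> C * (2 + exp (\<sigma> * r) + exp (\<sigma> * R)) * e"
      using zw hx hu by (simp add: algebra_simps)
    also have "\<dots> \<le> \<Theta> * e" using e0 by (intro mult_right_mono) (auto simp: \<Theta>_def)
    also have "\<dots> = \<Theta> * (exp (- \<sigma> * t) * I0) + \<Theta> * ((exp (- \<sigma> * t) * exp (\<sigma> * t)) * B1) + \<Theta> * ((exp (- \<sigma> * t) * exp (\<sigma> * t)) * B2)"
      by (simp add: e_def J_def distrib_left mult.assoc)
    also have "exp (- \<sigma> * t) * exp (\<sigma> * t) = 1" by (simp flip: exp_add)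
    finally show ?thesis by (simp add: I0_def B1_def B2_def algebra_simps)
  qed
  show ?thesis
    by (rule exI[of _ \<sigma>], rule conjI[OF \<sigma>], rule exI[of _ \<Theta>], rule conjI[OF \<Theta>0]) (use main in blast)
qed

end

theorem theorem2p2:
  fixes f :: "'n::{finite,linorder} \<Rightarrow> 'n rvec \<Rightarrow> real"
    and g :: "'n \<Rightarrow> 'n rvec \<Rightarrow> real \<Rightarrow> real"
    and P Q :: "'n rmat" and p k :: "'n rvec"
    and r \<tau> L G q \<mu> \<gamma> a K\<^sub>1 T\<^sub>1 T\<^sub>2 \<theta> T K :: real and l m :: nat
  assumes delays: "\<tau> \<ge> 0" "r \<ge> 0" "r + \<tau> > 0"
    and plant: "plant_functions f g"
    and A: "assumption_A f g L G"
    and B: "assumption_B f g L Q q p P \<mu> \<gamma> k a K\<^sub>1 T\<^sub>1 T\<^sub>2"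
    and theta: "\<theta> \<ge> 1"
    and lm: "l \<ge> 1" "m \<ge> 1" "real m > (real CARD('n) * L + 1) * (r + \<tau>)"
    and T: "T = (r + \<tau>) / real m"
    and K: "predictor_constant f L r \<tau> m K"
    and sampling: "4 * norm (Q *v p) * (L + \<theta>) * T\<^sub>1 * sqrt (matnorm Q / a) < q"
    and gain: "\<theta> \<ge> max 1 (2 * matnorm Q * L * sqrt (real CARD('n)) / q)"
    and holding: "((real CARD('n) * L + 1 + norm k) * sqrt (evec \<bullet> (P *v evec) / (2 * K\<^sub>1)) + \<mu>)
        * norm k * (T\<^sub>2 + K * pred_err (real CARD('n) * L + 1) T l) < \<mu>"
  shows "\<exists>\<sigma> \<Theta>\<^sub>1 \<Theta>\<^sub>2 \<Theta>\<^sub>3 \<Theta>\<^sub>4 \<Theta>\<^sub>5 \<Theta>\<^sub>6 :: real. \<exists>M :: real \<Rightarrow> real.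
    \<sigma> > 0 \<and> \<Theta>\<^sub>1 > 0 \<and> \<Theta>\<^sub>2 > 0 \<and> \<Theta>\<^sub>3 > 0 \<and> \<Theta>\<^sub>4 > 0 \<and> \<Theta>\<^sub>5 > 0 \<and> \<Theta>\<^sub>6 > 0
    \<and> continuous_on {0..} M \<and> mono_on {0..} M \<and> M ` {0..} \<subseteq> {0..}
    \<and> (\<forall>(x\<^sub>0 :: real \<Rightarrow> 'n rvec) (u\<^sub>0 :: real \<Rightarrow> real) (z\<^sub>0 :: 'n rvec) (w\<^sub>0 :: real)
         (\<xi> :: real \<Rightarrow> real) (b :: real \<Rightarrow> real) (d :: real \<Rightarrow> 'n rvec).
         continuous_on {-r..0} x\<^sub>0 \<and> Linf {-r - \<tau>..<0} UNIV u\<^sub>0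
         \<and> Linf_loc {0..} UNIV \<xi> \<and> Linf_loc {0..} {0..} b \<and> Linf_loc {0..} UNIV d \<longrightarrow>
         (let sol = (\<lambda>x u z w. initial_cond r \<tau> x\<^sub>0 u\<^sub>0 z\<^sub>0 w\<^sub>0 x u z w \<and> plant f g \<tau> d x u
                \<and> observer f r \<tau> p \<theta> T\<^sub>1 \<xi> b x u z w \<and> feedback f r \<tau> k T\<^sub>2 l m u z);
              j = (LEAST i::nat. real i * T\<^sub>2 \<ge> r + T\<^sub>1);
              Mb = M (SUP s\<in>{0..real j * T\<^sub>2 + \<tau>}. b s)
          in (\<exists>x u z w. sol x u z w)
           \<and> (\<forall>x u z w. sol x u z w \<longrightarrow> (\<forall>t\<ge>0.
                norm (z t) + \<bar>w t\<bar> + supnorm {-r..0} (history t x)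
                  + supnorm {-r - \<tau>..<0} (history t u)
                \<le> exp (- \<sigma> * t) * Mb
                    * (\<Theta>\<^sub>1 * norm z\<^sub>0 + \<Theta>\<^sub>2 * \<bar>w\<^sub>0\<bar> + \<Theta>\<^sub>3 * supnorm {-r..0} x\<^sub>0
                       + \<Theta>\<^sub>4 * supnorm {-r - \<tau>..<0} u\<^sub>0)
                  + Mb * \<Theta>\<^sub>5 * (SUP s\<in>{0..t}. exp (- \<sigma> * (t - s)) * \<bar>\<xi> s\<bar>)
                  + Mb * \<Theta>\<^sub>6 * (SUP s\<in>{0..t}. exp (- \<sigma> * (t - s)) * norm (d s))))))"
proof -
  interpret predictor_feedback f g P Q p k r \<tau> L G q \<mu> \<gamma> a K\<^sub>1 T\<^sub>1 T\<^sub>2 \<theta> T K l m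
    by unfold_locales (fact delays plant A B theta lm T K sampling gain holding)+
  obtain \<sigma> \<Theta> where \<sigma>: "\<sigma> > 0" and \<Theta>: "\<Theta> > 0" and
    bound: "\<And>x\<^sub>0 u\<^sub>0 z\<^sub>0 w\<^sub>0 \<xi> b d x u z w t.
     \<lbrakk>continuous_on {-r..0} x\<^sub>0; Linf {-r - \<tau>..<0} UNIV u\<^sub>0; Linf_loc {0..} UNIV \<xi>;
      Linf_loc {0..} {0..} b; Linf_loc {0..} UNIV d;
      initial_cond r \<tau> x\<^sub>0 u\<^sub>0 z\<^sub>0 w\<^sub>0 x u z w; plant f g \<tau> d x u;
      observer f r \<tau> p \<theta> T\<^sub>1 \<xi> b x u z w; feedback f r \<tau> k T\<^sub>2 l m u z; 0 \<le> t\<rbrakk>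
     \<Longrightarrow> norm (z t) + \<bar>w t\<bar> + supnorm {-r..0} (history t x) + supnorm {-r - \<tau>..<0} (history t u)
       \<le> exp (- \<sigma> * t) * (\<Theta> * norm z\<^sub>0 + \<Theta> * \<bar>w\<^sub>0\<bar> + \<Theta> * supnorm {-r..0} x\<^sub>0 + \<Theta> * supnorm {-r - \<tau>..<0} u\<^sub>0)
         + \<Theta> * (SUP s\<in>{0..t}. exp (- \<sigma> * (t - s)) * \<bar>\<xi> s\<bar>)
         + \<Theta> * (SUP s\<in>{0..t}. exp (- \<sigma> * (t - s)) * norm (d s))"
    using solution_bound by blast
  show ?thesis
    unfolding Let_def
    \<comment> \<open>The six constants coincide and M is the constant function 1, because
      \<open>solution_bound\<close> holds with a \<Theta> that does not depend on b.\<close>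
    apply (rule exI[of _ \<sigma>], (rule exI[of _ \<Theta>])+, rule exI[of _ "\<lambda>_. 1"])
    apply (intro conjI allI impI; (elim conjE)?)
    subgoal by (rule \<sigma>)
    subgoal by (rule \<Theta>)
    subgoal by (rule \<Theta>)
    subgoal by (rule \<Theta>)
    subgoal by (rule \<Theta>)
    subgoal by (rule \<Theta>)
    subgoal by (rule \<Theta>)
    subgoal by simp
    subgoal by (simp add: mono_on_def)
    subgoal by auto
    subgoal by (rule solution_exists)
    subgoal premises that for x\<^sub>0 u\<^sub>0 z\<^sub>0 w\<^sub>0 \<xi> b d x u z w t
      using bound[OF that(2,4,6,9,10,3,5,7,8,1)] by simp
    done
qed

end
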